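(* The shift operators of $S\!E_6(a,b,c,g,p,q,r)$ for the shifts $a\to a\pm1$, $b\to b\pm1$, $c\to c\pm1$, $g\to g\pm2$, $p\to p\pm1$, $q\to q\pm1$, $r\to r\pm1$ (suitably normalized, with polynomial dependence on the seven parameters) have the following S-values: $$\begin{array}{rcl} Sv_{a-}&=&-r^2(r-1)^2a(2a+g)(e_2-r-1)(a+b+c+g+1)(2a+2b+2c+g+2)(e_3-r-1)(e_3-r-2)e_8e_9(e_9+1),\\ Sv_{b-}&=&-r^2(r-1)^2b(2b+g)(e_5-r-1)(a+b+c+g+1)(2a+2b+2c+g+2)(e_6-r-1)(e_6-r-2)e_8e_9(e_9+1),\\ Sv_{c-}&=&r^2(r-1)^2c(2c+g)(e_2-r-1)(e_5-r-1)(a+b+c+g+1)(2a+2b+2c+g+2)\\ &&\times(e_3-r-1)(e_3-r-2)(e_6-r-1)(e_6-r-2)e_7(e_7+1)e_8(e_8+1)e_9(e_9+1),\\ Sv_{g-}&=&r^2(r-1)^2(g-1)(2a+g)(2b+g)(2c+g)(a+b+c+g)(a+b+c+g+1)(2a+2b+2c+g+2)\\ &&\times(e_3-1-r)(e_3-2-r)(e_6-1-r)(e_6-2-r)e_8(e_8+1)e_9(e_9+1),\\ Sv_{p-}&=&-r^2(r-1)^2p(e_2-r-1)(e_3-r-1)e_7e_8e_9,\\ Sv_{q-}&=&-r^2(r-1)^2q(e_5-r-1)(e_6-r-1)e_7e_8e_9,\\ Sv_{r-}&=&r(r-1)(r-2)e_7e_8e_9. \end{array}$$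
   Context: Notation: $\partial=d/dx$, $\theta=x\partial$; $a,b,c,g,p,q,r$ are complex parameters. The operator $E_6(e_1,\dots,e_9)$: put $s=(6-e_1-\cdots-e_9)/3$ and $s_{11}=e_1+e_2+e_3$, $s_{12}=e_4+e_5+e_6$, $s_{13}=e_7+e_8+e_9$, $s_{21}=e_1e_2+e_1e_3+e_2e_3$, $s_{22}=e_4e_5+e_4e_6+e_5e_6$, $s_{23}=e_7e_8+e_7e_9+e_8e_9$, $s_{31}=e_1e_2e_3$, $s_{32}=e_4e_5e_6$, $s_{33}=e_7e_8e_9$. Then $E_6=T_0+T_1\partial+T_2\partial^2+T_3\partial^3$ with $T_0=(\theta+s+2)(\theta+s+1)(\theta+s)(\theta+e_7)(\theta+e_8)(\theta+e_9)$, $T_1=(\theta+s+2)(\theta+s+1)B_1$, $B_1=T_{13}\theta^3+T_{12}\theta^2+T_{11}\theta+T_{10}$, $T_2=(\theta+s+2)B_2$, $B_2=T_{23}\theta^3+T_{22}\theta^2+T_{21}\theta+T_{20}$, $T_3=-(\theta+3-e_1)(\theta+3-e_2)(\theta+3-e_3)$, where $T_{13}=-3$, $T_{23}=3$, $T_{12}=-9+s_{11}-2s_{13}$, $T_{22}=18+s_{13}-2s_{11}$, $T_{11}=-8+(s_{11}^2+2s_{11}s_{13}-s_{12}^2+s_{13}^2)/3+s_{11}-5s_{13}-s_{21}+s_{22}-2s_{23}$, $T_{21}=35+(-s_{11}^2-2s_{11}s_{13}+s_{12}^2-s_{13}^2)/3-7s_{11}+5s_{13}+2s_{21}-s_{22}+s_{23}$,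 $T_{20}=-T_{10}+19+(s_{11}^2s_{13}-s_{11}s_{12}^2+s_{11}s_{13}^2-s_{12}^2s_{13})/9+(s_{13}^3+s_{11}^3-2s_{12}^3)/27+(-2s_{11}^2-4s_{11}s_{13}+s_{11}s_{22}+2s_{12}^2+s_{22}s_{12}-2s_{13}^2+s_{22}s_{13})/3-5s_{11}+4s_{13}+3s_{21}-2s_{22}-s_{31}-s_{32}-s_{33}$, $2T_{10}=(2s_{11}+s_{11}^2+2s_{11}s_{13}-s_{12}^2+s_{13}^2-s_{11}s_{21}+2s_{11}s_{23}+s_{12}s_{22}-2s_{13}s_{21}+2s_{13}s_{22}+s_{13}s_{23}-14s_{13})/3+2(s_{11}^2s_{13}-s_{12}^2s_{13})/9+2(s_{11}^3-s_{12}^3)/27-5-s_{21}+s_{31}+s_{22}-s_{32}-5s_{23}-3s_{33}$. The operator $S\!E_6(a,b,c,g,p,q,r)$ is $E_6(e_1,\dots,e_9)$ with (writing $\delta=a+b+c$) $e_1=p+r+1$, $e_2=a+c+p+r+2$, $e_3=2a+2c+g+p+r+3$, $e_4=q+r+1$, $e_5=b+c+q+r+2$, $e_6=2b+2c+g+q+r+3$, $e_7=-2c-(p+q+r)-1$, $e_8=-\delta-c-(p+q+r+g)-2$, $e_9=-2\delta-(p+q+r+g)-3$; then $s=-r$. Shift operators and S-values: for a parameter $e$ (with step $\epsilon=1$, or $\epsilon=2$ when $e=g$), a shift operator $P_{e\pm}$ is a non-zero operator in $\mathbb C(x)[\partial]$ of order lower than $6$ (depending on the parameters) sending the solution space of $S\!E_6$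 into that of $S\!E_6$ with $e$ replaced by $e\pm\epsilon$. For generic parameters it is unique up to a factor independent of $x$ and $\partial$. The S-value $Sv_{e-}$ is the constant congruent to $P_{e+}(e-\epsilon)\circ P_{e-}(e)$ modulo the left ideal $\mathbb C(x)[\partial]\circ S\!E_6$, where $P_{e+}(e-\epsilon)$ is $P_{e+}$ with $e$ replaced by $e-\epsilon$. *)

theory Defs
  imports
    "HOL-Complex_Analysis.Complex_Analysis"
    "HOL-Computational_Algebra.Computational_Algebra"
    "HOL-Computational_Algebra.Field_as_Ring"
begin

section \<open>The field \<open>\<complex>(x)\<close> and its derivation\<close>

type_synonym ratfun = "complex poly fract"

definition fract_deriv :: "ratfun \<Rightarrow> ratfun" where
  "fract_deriv f = (let (n, d) = quot_of_fract f in Fract (pderiv n * d - n * pderiv d) (d * d))"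

lemma fract_deriv_Fract:
  assumes "d \<noteq> 0"
  shows "fract_deriv (Fract n d) = Fract (pderiv n * d - n * pderiv d) (d * d)"
proof -
  obtain a b where ab: "quot_of_fract (Fract n d) = (a, b)"
    by fastforce
  have b: "b \<noteq> 0"
    using snd_quot_of_fract_nonzero[of "Fract n d"] ab by simp
  have "Fract a b = Fract n d"
    using Fract_quot_of_fract[of "Fract n d"] ab by simp
  with assms b have eq: "a * d = n * b"
    by (simp add: eq_fract)
  then have "pderiv (a * d) = pderiv (n * b)"
    by simp
  then have "a * pderiv d + d * pderiv a = n * pderiv b + b * pderiv n"
    by (simp add: pderiv_mult)
  with eq have "(pderiv a * b - a * pderiv b) * (d * d) = (pderiv n * d - n * pderiv d) * (b * b)"
    by algebra
  with assms b show ?thesis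
    by (simp add: fract_deriv_def ab eq_fract)
qed

lemma fract_deriv_0 [simp]: "fract_deriv 0 = 0"
  by (simp add: Zero_fract_def fract_deriv_Fract eq_fract)

lemma fract_deriv_1 [simp]: "fract_deriv 1 = 0"
  by (simp add: One_fract_def Zero_fract_def fract_deriv_Fract eq_fract pderiv_1)

lemma fract_deriv_add: "fract_deriv (p + q) = fract_deriv p + fract_deriv q"
  by (cases p, cases q)
    (simp add: fract_deriv_Fract eq_fract pderiv_add pderiv_mult algebra_simps)

lemma fract_deriv_mult: "fract_deriv (p * q) = fract_deriv p * q + p * fract_deriv q"
  by (cases p, cases q)
    (simp add: fract_deriv_Fract eq_fract pderiv_mult algebra_simps)

definition ratfun_eval :: "ratfun \<Rightarrow> complex \<Rightarrow> complex" where
  "ratfun_eval q z = poly (fst (quot_of_fract q)) z / poly (snd (quot_of_fract q)) z"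

definition ratfun_regular_at :: "ratfun \<Rightarrow> complex \<Rightarrow> bool" where
  "ratfun_regular_at q z \<longleftrightarrow> poly (snd (quot_of_fract q)) z \<noteq> 0"


section \<open>The ring \<open>\<complex>(x)[\<partial>]\<close>\<close>

text \<open>
  An operator \<open>a\<^sub>0 + a\<^sub>1 \<partial> + \<dots> + a\<^sub>n \<partial>\<^sup>n\<close> is stored as the polynomial with coefficients
  \<open>a\<^sub>0, \<dots>, a\<^sub>n\<close>.  The ring multiplication is composition, determined by
  \<open>\<partial> \<circ> a = a \<partial> + a'\<close> for \<open>a \<in> \<complex>(x)\<close>.
\<close>

typedef diffop = "UNIV :: ratfun poly set" morphisms symbol DiffOp
  by simp

setup_lifting type_definition_diffop

definition d_left :: "ratfun poly \<Rightarrow> ratfun poly" where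
  \<comment> \<open>the coefficients of \<open>\<partial> \<circ> Q\<close>\<close>
  "d_left Q = pCons 0 Q + map_poly fract_deriv Q"

definition symbol_mult :: "ratfun poly \<Rightarrow> ratfun poly \<Rightarrow> ratfun poly" where
  "symbol_mult P Q = (\<Sum>i\<le>degree P. smult (coeff P i) ((d_left ^^ i) Q))"

lemma coeff_map_fract_deriv [simp]:
  "coeff (map_poly fract_deriv Q) i = fract_deriv (coeff Q i)"
  by (simp add: coeff_map_poly)

lemma map_fract_deriv_pCons:
  "map_poly fract_deriv (pCons a Q) = pCons (fract_deriv a) (map_poly fract_deriv Q)"
  by (simp add: map_poly_pCons)

lemma d_left_0 [simp]: "d_left 0 = 0"
  by (simp add: d_left_def)

lemma d_left_add: "d_left (P + Q) = d_left P + d_left Q"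
  by (rule poly_eqI) (auto simp: d_left_def coeff_pCons fract_deriv_add split: nat.split)

lemma d_left_smult: "d_left (smult a Q) = smult (fract_deriv a) Q + smult a (d_left Q)"
  by (rule poly_eqI)
    (auto simp: d_left_def coeff_pCons fract_deriv_mult algebra_simps split: nat.split)

lemma d_left_pCons: "d_left (pCons b Q) = pCons (fract_deriv b) ([:b:] + d_left Q)"
  by (simp add: d_left_def map_fract_deriv_pCons)

lemma d_left_funpow_0 [simp]: "(d_left ^^ i) 0 = 0"
  by (induction i) auto

lemma d_left_funpow_add: "(d_left ^^ i) (P + Q) = (d_left ^^ i) P + (d_left ^^ i) Q"
  by (induction i) (auto simp: d_left_add)

lemma symbol_mult_le:
  assumes "degree P \<le> n"
  shows "symbol_mult P Q = (\<Sum>i\<le>n. smult (coeff P i) ((d_left ^^ i) Q))"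
  unfolding symbol_mult_def
  by (rule sum.mono_neutral_left) (use assms in \<open>auto simp: coeff_eq_0\<close>)

lemma symbol_mult_0_left [simp]: "symbol_mult 0 Q = 0"
  by (simp add: symbol_mult_def)

lemma symbol_mult_0_right [simp]: "symbol_mult P 0 = 0"
  by (simp add: symbol_mult_def)

lemma symbol_mult_pCons: "symbol_mult (pCons a P) Q = smult a Q + symbol_mult P (d_left Q)"
proof -
  have "symbol_mult (pCons a P) Q
      = (\<Sum>i\<le>Suc (degree P). smult (coeff (pCons a P) i) ((d_left ^^ i) Q))"
    by (rule symbol_mult_le) (simp add: degree_pCons_le)
  also have "\<dots> = smult a Q + (\<Sum>i\<le>degree P. smult (coeff P i) ((d_left ^^ Suc i) Q))"
    by (subst sum.atMost_Suc_shift) simp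
  also have "(\<Sum>i\<le>degree P. smult (coeff P i) ((d_left ^^ Suc i) Q)) = symbol_mult P (d_left Q)"
    by (simp add: symbol_mult_def funpow_swap1)
  finally show ?thesis .
qed

lemma symbol_mult_add_left: "symbol_mult (P + P') Q = symbol_mult P Q + symbol_mult P' Q"
proof -
  let ?n = "max (degree P) (degree P')"
  have "degree (P + P') \<le> ?n"
    by (rule degree_add_le) auto
  then show ?thesis
    by (simp add: symbol_mult_le[where n = ?n] smult_add_left sum.distrib)
qed

lemma symbol_mult_add_right: "symbol_mult P (Q + Q') = symbol_mult P Q + symbol_mult P Q'"
  by (simp add: symbol_mult_def d_left_funpow_add smult_add_right sum.distrib)

lemma symbol_mult_smult_left: "symbol_mult (smult a P) Q = smult a (symbol_mult P Q)"
  by (induction P arbitrary: Q) (simp_all add: symbol_mult_pCons smult_add_right)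

lemma symbol_mult_d_left: "symbol_mult (d_left Q) R = d_left (symbol_mult Q R)"
proof (induction Q arbitrary: R)
  case 0
  then show ?case by simp
next
  case (pCons b Q)
  then show ?case
    by (simp add: d_left_pCons symbol_mult_pCons symbol_mult_add_left d_left_add d_left_smult
        add.assoc)
qed

lemma symbol_mult_assoc: "symbol_mult (symbol_mult P Q) R = symbol_mult P (symbol_mult Q R)"
  by (induction P arbitrary: Q)
    (simp_all add: symbol_mult_pCons symbol_mult_add_left symbol_mult_smult_left
      symbol_mult_d_left)

lemma symbol_mult_1_left: "symbol_mult 1 Q = Q"
  by (simp add: one_pCons symbol_mult_pCons)

lemma symbol_mult_1_right: "symbol_mult P 1 = P"
proof (induction P)
  case (pCons a P)
  have "d_left (1 :: ratfun poly) = [:0, 1:]"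
    by (simp add: one_pCons d_left_pCons)
  moreover have "symbol_mult P [:0, 1:] = pCons 0 P" if "symbol_mult P 1 = P" for P
  proof -
    have "(d_left ^^ i) [:0, 1:] = pCons 0 ((d_left ^^ i) 1)" for i
    proof (induction i)
      case (Suc i)
      then show ?case by (simp add: d_left_pCons)
    qed (simp add: one_pCons)
    then have "symbol_mult P [:0, 1:] = (\<Sum>i\<le>degree P. pCons 0 (smult (coeff P i) ((d_left ^^ i) 1)))"
      by (simp add: symbol_mult_def)
    also have "\<dots> = pCons 0 (\<Sum>i\<le>degree P. smult (coeff P i) ((d_left ^^ i) 1))"
      by (rule poly_eqI) (simp add: coeff_sum coeff_pCons split: nat.split)
    finally show ?thesis
      using that by (simp add: symbol_mult_def)
  qed
  ultimately show ?case
    using pCons.IH by (simp add: symbol_mult_pCons)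
qed simp

instantiation diffop :: ring_1
begin

lift_definition zero_diffop :: diffop is 0 .
lift_definition one_diffop :: diffop is 1 .
lift_definition plus_diffop :: "diffop \<Rightarrow> diffop \<Rightarrow> diffop" is plus .
lift_definition minus_diffop :: "diffop \<Rightarrow> diffop \<Rightarrow> diffop" is minus .
lift_definition uminus_diffop :: "diffop \<Rightarrow> diffop" is uminus .
lift_definition times_diffop :: "diffop \<Rightarrow> diffop \<Rightarrow> diffop" is symbol_mult .

instance
  by standard
    (transfer; simp add: symbol_mult_assoc symbol_mult_1_left symbol_mult_1_right
      symbol_mult_add_left symbol_mult_add_right)+

end

definition op_coeff :: "diffop \<Rightarrow> nat \<Rightarrow> ratfun" where
  "op_coeff P i = coeff (symbol P) i"

text \<open>The zero operator gets order \<open>0\<close>.\<close>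

definition op_order :: "diffop \<Rightarrow> nat" where
  "op_order P = degree (symbol P)"

definition op_ratfun :: "ratfun \<Rightarrow> diffop" where
  "op_ratfun q = DiffOp [:q:]"

definition op_const :: "complex \<Rightarrow> diffop" where
  "op_const c = op_ratfun (to_fract [:c:])"

definition op_d :: diffop where
  "op_d = DiffOp [:0, 1:]"

definition op_theta :: diffop where
  "op_theta = op_ratfun (to_fract [:0, 1:]) * op_d"

lemma op_d_ratfun: "op_d * op_ratfun q = op_ratfun q * op_d + op_ratfun (fract_deriv q)"
  by (simp add: op_d_def op_ratfun_def symbol_inject[symmetric] plus_diffop.rep_eq
      times_diffop.rep_eq DiffOp_inverse symbol_mult_pCons d_left_pCons)

definition left_ideal :: "diffop \<Rightarrow> diffop set" where
  "left_ideal L = {Q * L | Q. True}"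


section \<open>Solution spaces\<close>

definition op_apply :: "diffop \<Rightarrow> (complex \<Rightarrow> complex) \<Rightarrow> complex \<Rightarrow> complex" where
  "op_apply P f z = (\<Sum>i\<le>op_order P. ratfun_eval (op_coeff P i) z * (deriv ^^ i) f z)"

definition op_regular_on :: "diffop \<Rightarrow> complex set \<Rightarrow> bool" where
  "op_regular_on P U \<longleftrightarrow> (\<forall>i. \<forall>z\<in>U. ratfun_regular_at (op_coeff P i) z)"

definition solutions :: "diffop \<Rightarrow> complex set \<Rightarrow> (complex \<Rightarrow> complex) set" where
  "solutions L U = {f. f holomorphic_on U \<and> (\<forall>z\<in>U. op_apply L f z = 0)}"

text \<open>
  Solutions are in general multivalued on the plane minus the singular points, so the solution
  space is the local system of holomorphic solutions on open sets that avoid the poles of the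
  coefficients.
\<close>

definition maps_solutions :: "diffop \<Rightarrow> diffop \<Rightarrow> diffop \<Rightarrow> bool" where
  "maps_solutions P L L' \<longleftrightarrow>
     (\<forall>U. open U \<and> op_regular_on P U \<and> op_regular_on L U \<and> op_regular_on L' U \<longrightarrow>
        op_apply P ` solutions L U \<subseteq> solutions L' U)"


section \<open>The operators \<open>E\<^sub>6\<close> and \<open>SE\<^sub>6\<close>\<close>

definition E6 :: "(nat \<Rightarrow> complex) \<Rightarrow> diffop" where
  "E6 e = (let
     s = (6 - (\<Sum>i=1..9. e i)) / 3;
     s11 = e 1 + e 2 + e 3;
     s12 = e 4 + e 5 + e 6;
     s13 = e 7 + e 8 + e 9;
     s21 = e 1 * e 2 + e 1 * e 3 + e 2 * e 3;
     s22 = e 4 * e 5 + e 4 * e 6 + e 5 * e 6;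
     s23 = e 7 * e 8 + e 7 * e 9 + e 8 * e 9;
     s31 = e 1 * e 2 * e 3;
     s32 = e 4 * e 5 * e 6;
     s33 = e 7 * e 8 * e 9;
     t13 = -3;
     t23 = 3;
     t12 = -9 + s11 - 2 * s13;
     t22 = 18 + s13 - 2 * s11;
     t11 = -8 + (s11^2 + 2 * s11 * s13 - s12^2 + s13^2) / 3
           + s11 - 5 * s13 - s21 + s22 - 2 * s23;
     t21 = 35 + (- (s11^2) - 2 * s11 * s13 + s12^2 - s13^2) / 3
           - 7 * s11 + 5 * s13 + 2 * s21 - s22 + s23;
     t10 = ((2 * s11 + s11^2 + 2 * s11 * s13 - s12^2 + s13^2 - s11 * s21 + 2 * s11 * s23
               + s12 * s22 - 2 * s13 * s21 + 2 * s13 * s22 + s13 * s23 - 14 * s13) / 3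
            + 2 * (s11^2 * s13 - s12^2 * s13) / 9
            + 2 * (s11^3 - s12^3) / 27
            - 5 - s21 + s31 + s22 - s32 - 5 * s23 - 3 * s33) / 2;
     t20 = - t10 + 19
           + (s11^2 * s13 - s11 * s12^2 + s11 * s13^2 - s12^2 * s13) / 9
           + (s13^3 + s11^3 - 2 * s12^3) / 27
           + (- 2 * s11^2 - 4 * s11 * s13 + s11 * s22 + 2 * s12^2 + s22 * s12
               - 2 * s13^2 + s22 * s13) / 3
           - 5 * s11 + 4 * s13 + 3 * s21 - 2 * s22 - s31 - s32 - s33;
     th = (\<lambda>c. op_theta + op_const c);
     B1 = op_const t13 * op_theta^3 + op_const t12 * op_theta^2 + op_const t11 * op_theta
          + op_const t10;
     B2 = op_const t23 * op_theta^3 + op_const t22 * op_theta^2 + op_const t21 * op_theta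
          + op_const t20;
     T0 = th (s + 2) * th (s + 1) * th s * th (e 7) * th (e 8) * th (e 9);
     T1 = th (s + 2) * th (s + 1) * B1;
     T2 = th (s + 2) * B2;
     T3 = - (th (3 - e 1) * th (3 - e 2) * th (3 - e 3))
   in T0 + T1 * op_d + T2 * op_d^2 + T3 * op_d^3)"

text \<open>A value of the parameters \<open>(a, b, c, g, p, q, r)\<close> is a function on the seven names.\<close>

datatype param = par_a | par_b | par_c | par_g | par_p | par_q | par_r

lemma UNIV_param: "UNIV = {par_a, par_b, par_c, par_g, par_p, par_q, par_r}"
  using param.exhaust by auto

instance param :: finite
  by standard (simp add: UNIV_param)

type_synonym params = "param \<Rightarrow> complex"

definition SE6_exponent :: "params \<Rightarrow> nat \<Rightarrow> complex" where
  "SE6_exponent v i = (let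
     a = v par_a; b = v par_b; c = v par_c; g = v par_g; p = v par_p; q = v par_q; r = v par_r;
     \<delta> = a + b + c
   in [p + r + 1,
       a + c + p + r + 2,
       2 * a + 2 * c + g + p + r + 3,
       q + r + 1,
       b + c + q + r + 2,
       2 * b + 2 * c + g + q + r + 3,
       - 2 * c - (p + q + r) - 1,
       - \<delta> - c - (p + q + r + g) - 2,
       - 2 * \<delta> - (p + q + r + g) - 3] ! (i - 1))"

definition SE6 :: "params \<Rightarrow> diffop" where
  "SE6 v = E6 (SE6_exponent v)"

fun shift_step :: "param \<Rightarrow> complex" where
  "shift_step par_g = 2"
| "shift_step _ = 1"

definition shift_up :: "param \<Rightarrow> params \<Rightarrow> params" where
  "shift_up e v = v(e := v e + shift_step e)"

definition shift_down :: "param \<Rightarrow> params \<Rightarrow> params" where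
  "shift_down e v = v(e := v e - shift_step e)"


section \<open>Polynomial dependence on the parameters\<close>

definition param_monomial :: "(param \<Rightarrow> nat) \<Rightarrow> params \<Rightarrow> complex" where
  "param_monomial m v = (\<Prod>i\<in>UNIV. v i ^ m i)"

definition polynomial_function :: "(params \<Rightarrow> complex) \<Rightarrow> bool" where
  "polynomial_function h \<longleftrightarrow>
     (\<exists>M k. finite M \<and> (\<forall>v. h v = (\<Sum>m\<in>M. param_monomial m v * k m)))"

definition polynomial_family :: "(params \<Rightarrow> diffop) \<Rightarrow> bool" where
  "polynomial_family P \<longleftrightarrow>
     (\<exists>M K. finite M \<and> (\<forall>v. P v = (\<Sum>m\<in>M. op_const (param_monomial m v) * K m)))"

definition for_generic_params :: "(params \<Rightarrow> bool) \<Rightarrow> bool" where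
  "for_generic_params \<phi> \<longleftrightarrow>
     (\<exists>h. polynomial_function h \<and> (\<exists>v. h v \<noteq> 0) \<and> (\<forall>v. h v \<noteq> 0 \<longrightarrow> \<phi> v))"


section \<open>Shift operators and S-values\<close>

definition is_shift_operator :: "diffop \<Rightarrow> params \<Rightarrow> params \<Rightarrow> bool" where
  "is_shift_operator P v w \<longleftrightarrow>
     P \<noteq> 0 \<and> op_order P < 6 \<and> maps_solutions P (SE6 v) (SE6 w)"

text \<open>
  A polynomially normalized shift operator may vanish identically for special parameter values;
  there it is not a shift operator.
\<close>

definition shift_operator_family :: "(params \<Rightarrow> params) \<Rightarrow> (params \<Rightarrow> diffop) \<Rightarrow> bool" where
  "shift_operator_family \<sigma> P \<longleftrightarrow>
     polynomial_family P \<and>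
     for_generic_params (\<lambda>v. P v \<noteq> 0) \<and>
     (\<forall>v. P v \<noteq> 0 \<longrightarrow> is_shift_operator (P v) v (\<sigma> v))"

definition is_S_value_down ::
    "param \<Rightarrow> (params \<Rightarrow> diffop) \<Rightarrow> (params \<Rightarrow> diffop) \<Rightarrow> params \<Rightarrow> complex \<Rightarrow> bool" where
  "is_S_value_down e Pup Pdown v k \<longleftrightarrow>
     Pup (shift_down e v) * Pdown v - op_const k \<in> left_ideal (SE6 v)"

end

theory Submission
  imports Defs
begin

text \<open>
  If \<open>L' P\<close> lies in the left ideal of \<open>L\<close>, then \<open>P\<close> maps solutions of \<open>L\<close> to solutions of \<open>L'\<close>, and since everything
  depends polynomially on the parameters, such membership only has to be shown for generic parameters.  There the
  operators \<open>\<partial>\<close>, \<open>\<theta> - r\<close> and the image of \<open>\<theta> - r\<close> under \<open>x \<mapsto> 1 - x\<close>, which intertwine \<open>SE\<^sub>6\<close> for the shifts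
  \<open>r \<mapsto> r - 1\<close>, \<open>(p, r) \<mapsto> (p + 1, r - 1)\<close> and \<open>(q, r) \<mapsto> (q + 1, r - 1)\<close>, can be cancelled on the left modulo \<open>SE\<^sub>6\<close>.

  The Riemann-Liouville transform reduces \<open>SE\<^sub>6\<close> to an operator of order \<open>3\<close>, for which there are explicit intertwining
  operators of order \<open>2\<close> shifting \<open>a\<close>, \<open>c\<close>, \<open>g\<close> or \<open>p\<close> together with \<open>p, q, r\<close>; composing two opposite ones gives a
  constant \<open>\<kappa>\<close> times a product of the elementary operators above.  A raising operator \<open>P\<close> is the solution of
  \<open>\<partial>\<^sup>2 P = \<sigma> M\<close> modulo \<open>SE\<^sub>6\<close>, where \<open>\<sigma>\<close> and the low order terms of the multiplier are chosen such that the
  division by \<open>\<partial>\<^sup>2\<close> is possible; a lowering operator is obtained similarly with \<open>(\<theta> - r + 1) (\<theta> - r)\<close>, and, for \<open>c\<close>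
  and \<open>g\<close>, its image under \<open>x \<mapsto> 1 - x\<close> in place of \<open>\<partial>\<^sup>2\<close>.  Cancelling yields the S-value \<open>\<sigma> \<sigma>' \<kappa>\<close>.  The reflection
  exchanges \<open>(a, p)\<close> and \<open>(b, q)\<close>, and the case of \<open>r\<close> is \<open>SE\<^sub>6 = C + R \<partial>\<close> with a constant \<open>C\<close>.
\<close>

section \<open>The algebra of operators\<close>

text \<open>For constant lists \<open>psi\<close> shows what the elementary operators are before the
  transform: \<partial> composed with multiplication by \<open>1\<close>, \<open>x\<close> and
  \<open>x - 1\<close> (lists \<open>[0, 1]\<close>, \<open>[1, 0]\<close>,
  \<open>[1, - 1]\<close>). Each of them lowers \<open>r\<close> by one. This shapes the proof: the
  intertwining operators of low order reach the wanted parameters only together with a drop of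
  \<open>r\<close>, which has to be undone by a division on the left. Modulo \<open>SE6\<close> that
  division is possible generically, at the price of denominators in the parameters, and \<sigma>
  clears them. For every shift but that of \<open>r\<close>, the factor \<kappa> of the S-value is
  free of \<open>p\<close>, \<open>q\<close>, \<open>r\<close>, and \<sigma> and \<sigma>'
  contribute the zeros of the outer coefficients \<open>be0\<close> and \<open>be3\<close>. An
  operator \<partial> - \<eta> can be cancelled if \<open>SE6\<close> acts injectively on the right
  module \<complex>(x)[\<partial>] / (\<partial> - \<eta>) \<complex>(x)[\<partial>]. Leading
  exponents at infinity or at 0 decide this, whence the non-integrality conditions in
  \<open>generic\<close>. The return to all parameters works because the leading coefficient
  \<open>x^3 (x - 1)^3\<close> of \<open>SE6\<close> is free of parameters, so that division with
  remainder stays polynomial in them.\<close>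

lemma DiffOp_plus: "DiffOp (P + Q) = DiffOp P + DiffOp Q"
  by (simp add: symbol_inject[symmetric] plus_diffop.rep_eq DiffOp_inverse)

lemma DiffOp_0: "DiffOp 0 = 0"
  by (simp add: symbol_inject[symmetric] zero_diffop.rep_eq DiffOp_inverse)

lemma DiffOp_times: "DiffOp P * DiffOp Q = DiffOp (symbol_mult P Q)"
  by (simp add: symbol_inject[symmetric] times_diffop.rep_eq DiffOp_inverse)

lemma symbol_mult_const_left: "symbol_mult [:a:] Q = smult a Q"
  by (simp add: symbol_mult_pCons)

lemma symbol_mult_pCons_0_1: "symbol_mult P [:0, 1:] = pCons 0 P"
proof -
  have "symbol_mult P [:0, 1:] = (\<Sum>i\<le>degree P. pCons 0 (smult (coeff P i) ((d_left ^^ i) 1)))"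
  proof -
    have "(d_left ^^ i) [:0, 1:] = pCons 0 ((d_left ^^ i) 1)" for i
      by (induction i) (simp_all add: one_pCons d_left_pCons)
    then show ?thesis by (simp add: symbol_mult_def)
  qed
  also have "\<dots> = pCons 0 (\<Sum>i\<le>degree P. smult (coeff P i) ((d_left ^^ i) 1))"
    by (rule poly_eqI) (simp add: coeff_sum coeff_pCons split: nat.split)
  also have "\<dots> = pCons 0 (symbol_mult P 1)"
    by (simp add: symbol_mult_def)
  finally show ?thesis by (simp add: symbol_mult_1_right)
qed

lemma op_ratfun_mult: "op_ratfun (p * q) = op_ratfun p * op_ratfun q"
  by (simp add: op_ratfun_def DiffOp_times symbol_mult_const_left)

lemma op_ratfun_add: "op_ratfun (p + q) = op_ratfun p + op_ratfun q"
  by (simp add: op_ratfun_def DiffOp_plus[symmetric])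

lemma op_ratfun_0 [simp]: "op_ratfun 0 = 0"
  by (simp add: op_ratfun_def DiffOp_0)

lemma op_ratfun_1 [simp]: "op_ratfun 1 = 1"
  by (simp add: op_ratfun_def symbol_inject[symmetric] one_diffop.rep_eq DiffOp_inverse one_pCons)

lemma op_ratfun_uminus: "op_ratfun (- p) = - op_ratfun p"
  using op_ratfun_add[of p "- p"] by (simp add: eq_neg_iff_add_eq_0 add.commute)

lemma op_ratfun_diff: "op_ratfun (p - q) = op_ratfun p - op_ratfun q"
  using op_ratfun_add[of p "- q"] by (simp add: op_ratfun_uminus)

lemma DiffOp_pCons: "DiffOp (pCons a P) = op_ratfun a + DiffOp P * op_d"
proof -
  have "pCons a P = [:a:] + symbol_mult P [:0, 1:]"
    by (simp add: symbol_mult_pCons_0_1)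
  then show ?thesis
    by (simp only: op_ratfun_def op_d_def DiffOp_plus DiffOp_times)
qed

text \<open>Horner form with \<open>op_d\<close> appended on the right. Unlike multiplication by
  \<open>op_d\<close> on the left, this creates no derivatives of coefficients.\<close>

lemma diffop_induct [case_names zero step]:
  assumes "Q 0" "\<And>a P. Q P \<Longrightarrow> Q (op_ratfun a + P * op_d)"
  shows "Q P"
proof -
  have "Q (DiffOp S)" for S
    by (induction S) (simp_all add: assms DiffOp_0 DiffOp_pCons)
  then show ?thesis by (metis symbol_inverse)
qed

lemma op_coeff_add: "op_coeff (P + Q) i = op_coeff P i + op_coeff Q i"
  by (simp add: op_coeff_def plus_diffop.rep_eq)

lemma op_coeff_0 [simp]: "op_coeff 0 i = 0"
  by (simp add: op_coeff_def zero_diffop.rep_eq)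

lemma op_coeff_diff: "op_coeff (P - Q) i = op_coeff P i - op_coeff Q i"
  by (simp add: op_coeff_def minus_diffop.rep_eq)

lemma op_coeff_sum: "op_coeff (sum f A) i = (\<Sum>a\<in>A. op_coeff (f a) i)"
  by (induction A rule: infinite_finite_induct) (simp_all add: op_coeff_add)

lemma op_coeff_ratfun_mult: "op_coeff (op_ratfun a * P) i = a * op_coeff P i"
  by (simp add: op_coeff_def op_ratfun_def times_diffop.rep_eq DiffOp_inverse symbol_mult_const_left)

lemma op_coeff_ratfun: "op_coeff (op_ratfun a) i = (if i = 0 then a else 0)"
  by (simp add: op_coeff_def op_ratfun_def DiffOp_inverse coeff_pCons split: nat.split)

lemma op_coeff_mult_d: "op_coeff (P * op_d) i = (case i of 0 \<Rightarrow> 0 | Suc j \<Rightarrow> op_coeff P j)"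
  by (simp add: op_coeff_def op_d_def times_diffop.rep_eq DiffOp_inverse symbol_mult_pCons_0_1
      coeff_pCons split: nat.split)

lemma op_eqI: "(\<And>i. op_coeff P i = op_coeff Q i) \<Longrightarrow> P = Q"
  by (metis op_coeff_def poly_eqI symbol_inject)

lemma op_coeff_eq_0: "op_order P < i \<Longrightarrow> op_coeff P i = 0"
  by (simp add: op_coeff_def op_order_def coeff_eq_0)

lemma op_order_le: "(\<And>i. n < i \<Longrightarrow> op_coeff P i = 0) \<Longrightarrow> op_order P \<le> n"
  by (simp add: op_coeff_def op_order_def degree_le)

lemma op_coeff_order_nz: "P \<noteq> 0 \<Longrightarrow> op_coeff P (op_order P) \<noteq> 0"
  by (metis op_coeff_def op_order_def leading_coeff_0_iff symbol_inject zero_diffop.rep_eq)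

lemma op_expand: assumes "op_order P \<le> n"
  shows "P = (\<Sum>i\<le>n. op_ratfun (op_coeff P i) * op_d ^ i)"
proof (rule op_eqI)
  fix j
  have cd: "op_coeff (op_d ^ k) i = (if i = k then 1 else 0)" for k i
  proof (induction k arbitrary: i)
    case 0
    then show ?case using op_coeff_ratfun[of 1 i] by simp
  next
    case (Suc k)
    have "op_d ^ Suc k = op_d ^ k * op_d" by (rule power_Suc2)
    then show ?case using Suc by (simp add: op_coeff_mult_d split: nat.split)
  qed
  show "op_coeff P j = op_coeff (\<Sum>i\<le>n. op_ratfun (op_coeff P i) * op_d ^ i) j"
    using assms op_coeff_eq_0[of P j]
    by (auto simp: op_coeff_sum op_coeff_ratfun_mult cd if_distrib sum.delta' cong: if_cong)
qed

lemma op_order_add_le: "op_order P \<le> n \<Longrightarrow> op_order Q \<le> n \<Longrightarrow> op_order (P + Q) \<le> n"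
  by (rule op_order_le) (simp add: op_coeff_add op_coeff_eq_0)

lemma op_order_diff_le: "op_order P \<le> n \<Longrightarrow> op_order Q \<le> n \<Longrightarrow> op_order (P - Q) \<le> n"
  by (rule op_order_le) (simp add: op_coeff_diff op_coeff_eq_0)

lemma op_order_ratfun [simp]: "op_order (op_ratfun a) = 0"
  by (simp add: op_order_def op_ratfun_def DiffOp_inverse)

lemma op_order_0 [simp]: "op_order 0 = 0"
  by (simp add: op_order_def zero_diffop.rep_eq)

lemma op_order_d [simp]: "op_order op_d = 1"
  by (simp add: op_order_def op_d_def DiffOp_inverse)

section \<open>Order and leading coefficient of a product\<close>

lemma d_left_funpow_coeff:
  assumes "degree Q \<le> n"
  shows "degree ((d_left ^^ i) Q) \<le> n + i \<and> coeff ((d_left ^^ i) Q) (n + i) = coeff Q n"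
proof (induction i)
  case (Suc i)
  let ?R = "(d_left ^^ i) Q"
  have z: "coeff ?R j = 0" if "j > n + i" for j using Suc that by (simp add: coeff_eq_0)
  have "coeff (d_left ?R) j = 0" if "j > Suc (n + i)" for j
    using that z by (auto simp: d_left_def coeff_pCons split: nat.split)
  moreover have "coeff (d_left ?R) (Suc (n + i)) = coeff ?R (n + i)"
    using z[of "Suc (n + i)"] by (simp add: d_left_def)
  ultimately show ?case using Suc by (simp add: degree_le)
qed (use assms in simp)

lemma symbol_mult_top:
  assumes "degree P \<le> m" "degree Q \<le> n"
  shows "degree (symbol_mult P Q) \<le> m + n \<and> coeff (symbol_mult P Q) (m + n) = coeff P m * coeff Q n"
proof -
  have e: "symbol_mult P Q = (\<Sum>i\<le>m. smult (coeff P i) ((d_left ^^ i) Q))"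
    by (rule symbol_mult_le[OF assms(1)])
  have z: "coeff ((d_left ^^ i) Q) j = 0" if "j > n + i" for i j
    using d_left_funpow_coeff[OF assms(2), of i] that by (intro coeff_eq_0) simp
  have "coeff (symbol_mult P Q) j = 0" if "j > m + n" for j
    unfolding e using that by (auto simp: coeff_sum intro!: sum.neutral z)
  moreover have "coeff (symbol_mult P Q) (m + n)
      = (\<Sum>i\<le>m. if i = m then coeff P m * coeff Q n else 0)"
    unfolding e coeff_sum
  proof (rule sum.cong[OF refl])
    fix i assume "i \<in> {..m}"
    then show "coeff (smult (coeff P i) ((d_left ^^ i) Q)) (m + n)
        = (if i = m then coeff P m * coeff Q n else 0)"
      using d_left_funpow_coeff[OF assms(2), of m] z[of i "m + n"] by (auto simp: add.commute)
  qed
  ultimately show ?thesis by (simp add: degree_le)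
qed

lemma op_order_mult_le: "op_order P \<le> m \<Longrightarrow> op_order Q \<le> n \<Longrightarrow> op_order (P * Q) \<le> m + n"
  using symbol_mult_top[of "symbol P" m "symbol Q" n]
  by (simp add: op_order_def times_diffop.rep_eq)

lemma op_coeff_mult_top:
  "op_order P \<le> m \<Longrightarrow> op_order Q \<le> n \<Longrightarrow>
   op_coeff (P * Q) (m + n) = op_coeff P m * op_coeff Q n"
  using symbol_mult_top[of "symbol P" m "symbol Q" n]
  by (simp add: op_order_def op_coeff_def times_diffop.rep_eq)

text \<open>Leading coefficients multiply in the field \<complex>(x). Cancelling a common factor in
  an equation of operators rests on this.\<close>

lemma diffop_mult_eq_0: "(P :: diffop) * Q = 0 \<Longrightarrow> P = 0 \<or> Q = 0"
  using op_coeff_mult_top[of P "op_order P" Q "op_order Q"] op_coeff_order_nz[of P] op_coeff_order_nz[of Q]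
  by auto

instance diffop :: ring_1_no_zero_divisors
  by standard (use diffop_mult_eq_0 in \<open>auto\<close>)

lemma op_order_mult:
  assumes "P \<noteq> 0" "Q \<noteq> 0"
  shows "op_order (P * Q) = op_order P + op_order Q"
proof -
  have "op_coeff (P * Q) (op_order P + op_order Q) \<noteq> 0"
    using op_coeff_mult_top[of P "op_order P" Q "op_order Q"] op_coeff_order_nz assms by simp
  then have "op_order P + op_order Q \<le> op_order (P * Q)"
    using op_coeff_eq_0[of "P * Q"] by (meson not_le_imp_less)
  then show ?thesis using op_order_mult_le[of P "op_order P" Q "op_order Q"] by simp
qed

subsection \<open>Constants are central\<close>

abbreviation rconst :: "complex \<Rightarrow> ratfun" where "rconst c \<equiv> to_fract [:c:]"

lemma to_fract_poly_simps:
  "to_fract (p + q) = to_fract p + to_fract (q :: complex poly)"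
  "to_fract (p * q) = to_fract p * to_fract (q :: complex poly)"
  "to_fract (p - q) = to_fract p - to_fract (q :: complex poly)"
  "to_fract (- p) = - to_fract (p :: complex poly)"
  by (simp_all add: to_fract_def)

lemma rconst_simps:
  "rconst (a + b) = rconst a + rconst b" "rconst (a * b) = rconst a * rconst b"
  "rconst (- a) = - rconst a" "rconst (a - b) = rconst a - rconst b"
  "rconst 0 = 0" "rconst 1 = 1"
proof -
  show "rconst (a + b) = rconst a + rconst b"
    by (simp add: to_fract_poly_simps(1)[symmetric])
  show "rconst (a * b) = rconst a * rconst b"
    by (simp add: to_fract_poly_simps(2)[symmetric] mult.commute)
  show "rconst (- a) = - rconst a"
    by (simp add: to_fract_poly_simps(4)[symmetric])
  show "rconst (a - b) = rconst a - rconst b"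
    by (simp add: to_fract_poly_simps(3)[symmetric])
  show "rconst 0 = 0" by simp
  show "rconst 1 = 1" by (simp add: one_pCons[symmetric])
qed

lemma fract_deriv_to_fract: "fract_deriv (to_fract p) = to_fract (pderiv p)"
  by (simp add: to_fract_def fract_deriv_Fract)

lemma fract_deriv_rconst [simp]: "fract_deriv (rconst c) = 0"
  by (simp add: fract_deriv_to_fract pderiv_pCons)

lemma op_const_simps:
  "op_const (a + b) = op_const a + op_const b" "op_const (a * b) = op_const a * op_const b"
  "op_const (- a) = - op_const a" "op_const (a - b) = op_const a - op_const b"
  "op_const 0 = 0" "op_const 1 = 1"
  by (simp_all add: op_const_def rconst_simps op_ratfun_add op_ratfun_mult op_ratfun_uminus
      op_ratfun_diff del: to_fract_eq_0_iff)

lemma op_const_eq_0_iff [simp]: "op_const c = 0 \<longleftrightarrow> c = 0"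
proof
  assume "op_const c = 0"
  then have "op_coeff (op_const c) 0 = 0" by simp
  then show "c = 0" by (simp add: op_const_def op_coeff_ratfun)
qed (simp add: op_const_simps)

lemma op_const_commute: "op_const c * P = P * op_const c"
proof (induction P rule: diffop_induct)
  case (step a P)
  have "op_d * op_const c = op_const c * op_d"
    by (simp add: op_const_def op_d_ratfun)
  then have "op_const c * (P * op_d) = P * op_d * op_const c"
    using step by (metis mult.assoc)
  moreover have "op_const c * op_ratfun a = op_ratfun a * op_const c"
    by (simp add: op_const_def op_ratfun_mult[symmetric] mult.commute)
  ultimately show ?case by (simp add: distrib_left distrib_right)
qed simp

lemma op_const_left_commute: "P * (op_const c * Q) = op_const c * (P * Q)"
  by (metis mult.assoc op_const_commute)

lemma op_coeff_const_mult: "op_coeff (op_const c * P) i = rconst c * op_coeff P i"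
  by (simp add: op_const_def op_coeff_ratfun_mult)

lemma left_ideal_iff: "P \<in> left_ideal L \<longleftrightarrow> (\<exists>Q. P = Q * L)"
  by (auto simp: left_ideal_def)

lemma left_ideal_add: "P \<in> left_ideal L \<Longrightarrow> Q \<in> left_ideal L \<Longrightarrow> P + Q \<in> left_ideal L"
  unfolding left_ideal_iff by (metis distrib_right)

lemma left_ideal_diff: "P \<in> left_ideal L \<Longrightarrow> Q \<in> left_ideal L \<Longrightarrow> P - Q \<in> left_ideal L"
  unfolding left_ideal_iff by (metis left_diff_distrib)

lemma left_ideal_mult: "P \<in> left_ideal L \<Longrightarrow> Q * P \<in> left_ideal L"
  unfolding left_ideal_iff by (metis mult.assoc)

lemma left_ideal_self [simp]: "Q * L \<in> left_ideal L"
  unfolding left_ideal_iff by blast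

section \<open>Operators acting on holomorphic functions\<close>

text \<open>\<open>quot_of_fract\<close> yields the reduced fraction, whose denominator divides
  every other denominator. Regularity and value can therefore be read off from any representation
  with a denominator that does not vanish at \<open>z\<close>.\<close>

lemma ratfun_regular_eval_Fract:
  assumes "poly d z \<noteq> 0"
  shows "ratfun_regular_at (Fract n d) z" "ratfun_eval (Fract n d) z = poly n z / poly d z"
proof -
  obtain a b where ab: "quot_of_fract (Fract n d) = (a, b)" by fastforce
  have d: "d \<noteq> 0" using assms by auto
  have b: "b \<noteq> 0" using snd_quot_of_fract_nonzero[of "Fract n d"] ab by simp
  have "Fract a b = Fract n d" using Fract_quot_of_fract[of "Fract n d"] ab by simp
  then have eq: "a * d = n * b" using b d by (simp add: eq_fract)
  have "coprime a b" using coprime_quot_of_fract[of "Fract n d"] ab by simp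
  moreover have "b dvd a * d" using eq by simp
  ultimately have "b dvd d" by (simp add: coprime_commute coprime_dvd_mult_right_iff)
  then have bz: "poly b z \<noteq> 0" using assms by auto
  then show "ratfun_regular_at (Fract n d) z" by (simp add: ratfun_regular_at_def ab)
  have "poly a z * poly d z = poly n z * poly b z" using eq by (metis poly_mult)
  then show "ratfun_eval (Fract n d) z = poly n z / poly d z"
    using bz assms by (simp add: ratfun_eval_def ab field_simps)
qed

lemma ratfun_regular_cases:
  assumes "ratfun_regular_at q z"
  obtains n d where "q = Fract n d" "poly d z \<noteq> 0"
  using assms Fract_quot_of_fract[of q] that[of "fst (quot_of_fract q)" "snd (quot_of_fract q)"]
  by (simp add: ratfun_regular_at_def)

lemma ratfun_regular_simps:
  assumes "ratfun_regular_at p z" "ratfun_regular_at q z"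
  shows "ratfun_regular_at (p + q) z" "ratfun_eval (p + q) z = ratfun_eval p z + ratfun_eval q z"
    "ratfun_regular_at (p * q) z" "ratfun_eval (p * q) z = ratfun_eval p z * ratfun_eval q z"
proof -
  obtain n d where p: "p = Fract n d" "poly d z \<noteq> 0" using assms(1) by (rule ratfun_regular_cases)
  obtain m e where q: "q = Fract m e" "poly e z \<noteq> 0" using assms(2) by (rule ratfun_regular_cases)
  have nz: "d \<noteq> 0" "e \<noteq> 0" "poly (d * e) z \<noteq> 0" using p q by auto
  show "ratfun_regular_at (p + q) z" "ratfun_regular_at (p * q) z"
    "ratfun_eval (p + q) z = ratfun_eval p z + ratfun_eval q z"
    "ratfun_eval (p * q) z = ratfun_eval p z * ratfun_eval q z"
    using p(2) q(2) nz(1,2)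
    by (simp_all add: p(1) q(1) ratfun_regular_eval_Fract[OF nz(3)] ratfun_regular_eval_Fract[OF p(2)]
        ratfun_regular_eval_Fract[OF q(2)] add_frac_eq)
qed

lemma ratfun_regular_eval_poly [simp]:
  "ratfun_regular_at (to_fract p) z" "ratfun_eval (to_fract p) z = poly p z"
  using ratfun_regular_eval_Fract[of 1 z p] by (simp_all add: to_fract_def)

lemma ratfun_regular_eval_0_1 [simp]:
  "ratfun_regular_at 0 z" "ratfun_eval 0 z = 0" "ratfun_regular_at 1 z" "ratfun_eval 1 z = 1"
  using ratfun_regular_eval_poly[of 0 z] ratfun_regular_eval_poly[of 1 z] by simp_all

lemma ratfun_regular_sum:
  "(\<And>i. i \<in> A \<Longrightarrow> ratfun_regular_at (f i) z) \<Longrightarrow> ratfun_regular_at (sum f A) z"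
  by (induction A rule: infinite_finite_induct) (auto intro: ratfun_regular_simps)

lemma ratfun_regular_deriv:
  assumes "ratfun_regular_at q z"
  shows "ratfun_regular_at (fract_deriv q) z"
    and "(ratfun_eval q has_field_derivative ratfun_eval (fract_deriv q) z) (at z)"
proof -
  obtain n d where q: "q = Fract n d" "poly d z \<noteq> 0" using assms by (rule ratfun_regular_cases)
  have nz: "poly (d * d) z \<noteq> 0" "d \<noteq> 0" using q by auto
  show "ratfun_regular_at (fract_deriv q) z"
    using ratfun_regular_eval_Fract[OF nz(1)] nz by (simp add: q(1) fract_deriv_Fract)
  have ev: "ratfun_eval (fract_deriv q) z
      = (poly (pderiv n) z * poly d z - poly n z * poly (pderiv d) z) / (poly d z * poly d z)"
    using ratfun_regular_eval_Fract[OF nz(1)] nz by (simp add: q(1) fract_deriv_Fract)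
  have "((\<lambda>z. poly n z / poly d z) has_field_derivative ratfun_eval (fract_deriv q) z) (at z)"
    unfolding ev by (rule DERIV_divide[OF poly_DERIV poly_DERIV q(2)])
  moreover have "\<forall>\<^sub>F w in nhds z. poly d w \<noteq> 0"
  proof -
    have "open {w. poly d w \<noteq> 0}"
      using poly_roots_finite[OF nz(2)] finite_imp_closed[of "{w. poly d w = 0}"]
      by (simp add: closed_def Compl_eq)
    then show ?thesis using q(2) by (auto simp: eventually_nhds)
  qed
  then have "\<forall>\<^sub>F w in nhds z. poly n w / poly d w = ratfun_eval q w"
    by eventually_elim (simp add: q(1) ratfun_regular_eval_Fract)
  ultimately show "(ratfun_eval q has_field_derivative ratfun_eval (fract_deriv q) z) (at z)"
    using DERIV_cong_ev[of z z "\<lambda>z. poly n z / poly d z" "ratfun_eval q",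
        OF refl _ refl[of "ratfun_eval (fract_deriv q) z"]] by blast
qed

lemma finite_not_regular: "finite {z. \<not> ratfun_regular_at q z}"
  using poly_roots_finite[OF snd_quot_of_fract_nonzero[of q]] by (simp add: ratfun_regular_at_def)

section \<open>The ring product as composition of maps on holomorphic functions\<close>

lemma op_coeff_d_mult:
  "op_coeff (op_d * P) i = (case i of 0 \<Rightarrow> 0 | Suc j \<Rightarrow> op_coeff P j) + fract_deriv (op_coeff P i)"
proof -
  have "symbol (op_d * P) = d_left (symbol P)"
    by (simp add: op_d_def times_diffop.rep_eq DiffOp_inverse symbol_mult_pCons)
  then show ?thesis
    by (simp add: op_coeff_def d_left_def coeff_pCons split: nat.split)
qed

lemma op_apply_le:
  assumes "op_order P \<le> n"
  shows "op_apply P f z = (\<Sum>i\<le>n. ratfun_eval (op_coeff P i) z * (deriv ^^ i) f z)"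
  unfolding op_apply_def
  by (rule sum.mono_neutral_left) (use assms op_coeff_eq_0[of P] in auto)

lemma finite_op_not_regular: "finite {z. \<exists>i. \<not> ratfun_regular_at (op_coeff P i) z}"
proof -
  have "{z. \<exists>i. \<not> ratfun_regular_at (op_coeff P i) z}
      \<subseteq> (\<Union>i\<le>op_order P. {z. \<not> ratfun_regular_at (op_coeff P i) z})"
    using op_coeff_eq_0[of P] by (force simp: not_less[symmetric])
  then show ?thesis by (rule finite_subset) (simp add: finite_not_regular)
qed

lemma op_apply_add:
  assumes "\<And>i. ratfun_regular_at (op_coeff P i) z" "\<And>i. ratfun_regular_at (op_coeff Q i) z"
  shows "op_apply (P + Q) f z = op_apply P f z + op_apply Q f z"
proof -
  let ?n = "max (op_order P) (op_order Q)"
  have "op_order (P + Q) \<le> ?n" by (rule op_order_add_le) auto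
  then show ?thesis
    using assms by (simp add: op_apply_le[where n = ?n] op_coeff_add ratfun_regular_simps
        distrib_right sum.distrib)
qed

lemma op_apply_ratfun_mult:
  assumes "\<And>i. ratfun_regular_at (op_coeff P i) z" "ratfun_regular_at a z"
  shows "op_apply (op_ratfun a * P) f z = ratfun_eval a z * op_apply P f z"
proof -
  have "op_order (op_ratfun a * P) \<le> op_order P"
    by (rule op_order_le) (simp add: op_coeff_ratfun_mult op_coeff_eq_0)
  then show ?thesis
    using assms by (simp add: op_apply_le[where n = "op_order P"] op_coeff_ratfun_mult
        ratfun_regular_simps sum_distrib_left mult.assoc)
qed

lemma op_regular_on_d: "op_regular_on P U \<Longrightarrow> op_regular_on (op_d * P) U"
  by (auto simp: op_regular_on_def op_coeff_d_mult intro!: ratfun_regular_simps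
      ratfun_regular_deriv split: nat.split)

lemma funpow_deriv_holomorphic:
  "f holomorphic_on U \<Longrightarrow> open U \<Longrightarrow> (deriv ^^ i) f holomorphic_on U"
  by (induction i) (auto intro: holomorphic_deriv)

lemma op_apply_d:
  assumes "open U" "op_regular_on P U" "f holomorphic_on U" "z \<in> U"
  shows "(op_apply P f has_field_derivative op_apply (op_d * P) f z) (at z)"
proof -
  have reg: "ratfun_regular_at (op_coeff P i) w" if "w \<in> U" for i w
    using assms that by (simp add: op_regular_on_def)
  let ?n = "op_order P"
  let ?c = "\<lambda>i. op_coeff P i" and ?f = "\<lambda>i. (deriv ^^ i) f"
  have D: "(?f i has_field_derivative ?f (Suc i) z) (at z)" for i
    using holomorphic_derivI[OF funpow_deriv_holomorphic[OF assms(3,1)] assms(1,4)] by simp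
  have "((\<lambda>w. \<Sum>i\<le>?n. ratfun_eval (?c i) w * ?f i w) has_field_derivative
     (\<Sum>i\<le>?n. ratfun_eval (fract_deriv (?c i)) z * ?f i z + ?f (Suc i) z * ratfun_eval (?c i) z)) (at z)"
    by (rule DERIV_sum) (rule DERIV_mult[OF ratfun_regular_deriv(2)[OF reg[OF assms(4)]] D])
  moreover have "op_apply (op_d * P) f z
      = (\<Sum>i\<le>?n. ratfun_eval (fract_deriv (?c i)) z * ?f i z + ?f (Suc i) z * ratfun_eval (?c i) z)"
  proof -
    have "op_order (op_d * P) \<le> Suc ?n"
      using op_order_mult_le[of op_d 1 P ?n] by simp
    then have "op_apply (op_d * P) f z
        = (\<Sum>i\<le>Suc ?n. ratfun_eval (op_coeff (op_d * P) i) z * ?f i z)"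
      by (rule op_apply_le)
    also have "\<dots> = (\<Sum>i\<le>Suc ?n. ratfun_eval (case i of 0 \<Rightarrow> 0 | Suc j \<Rightarrow> ?c j) z * ?f i z)
        + (\<Sum>i\<le>Suc ?n. ratfun_eval (fract_deriv (?c i)) z * ?f i z)"
    proof -
      have r: "ratfun_regular_at (case i of 0 \<Rightarrow> 0 | Suc j \<Rightarrow> ?c j) z" for i
        using reg[OF assms(4)] by (auto split: nat.split)
      show ?thesis
        by (simp only: op_coeff_d_mult sum.distrib[symmetric] distrib_right[symmetric]
            ratfun_regular_simps(2)[OF r ratfun_regular_deriv(1)[OF reg[OF assms(4)]]])
    qed
    also have "(\<Sum>i\<le>Suc ?n. ratfun_eval (case i of 0 \<Rightarrow> 0 | Suc j \<Rightarrow> ?c j) z * ?f i z)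
        = (\<Sum>i\<le>?n. ?f (Suc i) z * ratfun_eval (?c i) z)"
      by (subst sum.atMost_Suc_shift) (simp add: mult.commute)
    also have "(\<Sum>i\<le>Suc ?n. ratfun_eval (fract_deriv (?c i)) z * ?f i z)
        = (\<Sum>i\<le>?n. ratfun_eval (fract_deriv (?c i)) z * ?f i z)"
      by (simp add: op_coeff_eq_0)
    finally show ?thesis by (simp add: sum.distrib)
  qed
  moreover have "op_apply P f = (\<lambda>w. \<Sum>i\<le>?n. ratfun_eval (?c i) w * ?f i w)"
    by (rule ext) (simp add: op_apply_def)
  ultimately show ?thesis by simp
qed

lemma op_apply_holomorphic:
  "open U \<Longrightarrow> op_regular_on P U \<Longrightarrow> f holomorphic_on U \<Longrightarrow> op_apply P f holomorphic_on U"
  using op_apply_d by (metis holomorphic_on_open)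

lemma op_apply_d_funpow:
  assumes "open U" "op_regular_on P U" "f holomorphic_on U" "z \<in> U"
  shows "op_regular_on (op_d ^ i * P) U \<and> op_apply (op_d ^ i * P) f z = (deriv ^^ i) (op_apply P f) z"
  using assms(4)
proof (induction i arbitrary: z)
  case (Suc i)
  have reg: "op_regular_on (op_d ^ i * P) U" using Suc.IH[OF Suc.prems] by blast
  have "op_apply (op_d ^ Suc i * P) f z = deriv (op_apply (op_d ^ i * P) f) z"
    using DERIV_imp_deriv[OF op_apply_d[OF assms(1) reg assms(3) Suc.prems]] by (simp add: mult.assoc)
  also have "\<dots> = deriv ((deriv ^^ i) (op_apply P f)) z"
  proof (rule deriv_cong_ev[OF _ refl])
    show "\<forall>\<^sub>F x in nhds z. op_apply (op_d ^ i * P) f x = (deriv ^^ i) (op_apply P f) x"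
      using Suc.IH assms(1) Suc.prems by (auto simp: eventually_nhds)
  qed
  finally show ?case using op_regular_on_d[OF reg] by (simp add: mult.assoc)
qed (use assms in simp)

text \<open>Expanding \<open>Q\<close> in powers of \<partial> reduces this to the product rule in
  \<open>op_apply_d\<close>, iterated in \<open>op_apply_d_funpow\<close>. It is the link between
  identities in the ring and statements on solutions.\<close>

lemma op_apply_mult:
  assumes "open U" "op_regular_on P U" "op_regular_on Q U" "f holomorphic_on U" "z \<in> U"
  shows "op_regular_on (Q * P) U" "op_apply (Q * P) f z = op_apply Q (op_apply P f) z"
proof -
  let ?n = "op_order Q"
  let ?g = "\<lambda>i. op_ratfun (op_coeff Q i) * (op_d ^ i * P)"
  have "Q * P = (\<Sum>i\<le>?n. op_ratfun (op_coeff Q i) * op_d ^ i) * P"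
    using op_expand[of Q ?n] by simp
  then have e: "Q * P = (\<Sum>i\<le>?n. ?g i)" by (simp add: sum_distrib_right mult.assoc)
  have qr: "ratfun_regular_at (op_coeff Q i) w" if "w \<in> U" for i w
    using assms(3) that by (simp add: op_regular_on_def)
  have gr: "ratfun_regular_at (op_coeff (op_d ^ i * P) j) w" if "w \<in> U" for i j w
    using op_apply_d_funpow[OF assms(1,2,4) that, of i] that by (simp add: op_regular_on_def)
  have r: "ratfun_regular_at (op_coeff (?g i) j) w" if "w \<in> U" for i j w
    unfolding op_coeff_ratfun_mult by (rule ratfun_regular_simps) (use qr gr that in auto)
  show "op_regular_on (Q * P) U"
    unfolding op_regular_on_def e op_coeff_sum by (auto intro!: ratfun_regular_sum r)
  have "op_apply (sum ?g A) f z = (\<Sum>i\<in>A. op_apply (?g i) f z)" if "finite A" for A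
    using that
  proof (induction A)
    case empty
    then show ?case by (simp add: op_apply_def)
  next
    case (insert a A)
    then show ?case
      using op_apply_add[of "?g a" z "sum ?g A" f] r[OF assms(5)]
      by (simp add: op_coeff_sum ratfun_regular_sum)
  qed
  then have "op_apply (Q * P) f z = (\<Sum>i\<le>?n. op_apply (?g i) f z)" by (simp add: e)
  also have "\<dots> = (\<Sum>i\<le>?n. ratfun_eval (op_coeff Q i) z * (deriv ^^ i) (op_apply P f) z)"
    using op_apply_ratfun_mult[OF gr[OF assms(5)] qr[OF assms(5)]]
      op_apply_d_funpow[OF assms(1,2,4,5)] by simp
  finally show "op_apply (Q * P) f z = op_apply Q (op_apply P f) z" by (simp add: op_apply_def)
qed

text \<open>The quotient operator may have poles inside \<open>U\<close>; these are finitely many, and the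
  conclusion extends across them by continuity.\<close>

lemma maps_solutions_if_left_ideal:
  assumes "L' * P \<in> left_ideal L"
  shows "maps_solutions P L L'"
  unfolding maps_solutions_def
proof (intro allI impI image_subsetI)
  fix U f
  assume U: "open U \<and> op_regular_on P U \<and> op_regular_on L U \<and> op_regular_on L' U"
    and f: "f \<in> solutions L U"
  have hf: "f holomorphic_on U" using f by (simp add: solutions_def)
  obtain Q where Q: "L' * P = Q * L" using assms by (auto simp: left_ideal_iff)
  define S where "S = {z. \<exists>i. \<not> ratfun_regular_at (op_coeff Q i) z}"
  have fS: "finite S" unfolding S_def by (rule finite_op_not_regular)
  have hP: "op_apply P f holomorphic_on U" using U hf by (intro op_apply_holomorphic) auto
  have hL: "op_apply L' (op_apply P f) holomorphic_on U"
    using U hP op_apply_holomorphic[of U L' "op_apply P f"] by blast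
  have zero: "op_apply L' (op_apply P f) z = 0" if z: "z \<in> U - S" for z
  proof -
    let ?V = "U - S"
    have V: "open ?V" "f holomorphic_on ?V"
      using U fS hf by (auto intro: finite_imp_closed holomorphic_on_subset)
    have regs: "op_regular_on P ?V" "op_regular_on L ?V" "op_regular_on L' ?V" "op_regular_on Q ?V"
      using U by (auto simp: op_regular_on_def S_def)
    have "op_apply L' (op_apply P f) z = op_apply (L' * P) f z"
      using op_apply_mult(2)[OF V(1) regs(1) regs(3) V(2) z] by simp
    also have "\<dots> = op_apply Q (op_apply L f) z"
      using op_apply_mult(2)[OF V(1) regs(2) regs(4) V(2) z] Q by simp
    also have "\<dots> = 0"
    proof -
      \<comment> \<open>\<open>op_apply Q\<close> takes derivatives at \<open>z\<close>, so
        vanishing of \<open>op_apply L f\<close> at the single point \<open>z\<close> would not do;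
        it vanishes on a neighbourhood.\<close>
      have ev: "\<forall>\<^sub>F w in nhds z. op_apply L f w = 0"
        using U f z by (auto simp: eventually_nhds solutions_def)
      have "(deriv ^^ i) (op_apply L f) z = (deriv ^^ i) (\<lambda>_. 0) z" for i
        by (rule higher_deriv_cong_ev[OF ev refl])
      then show ?thesis by (simp add: op_apply_def)
    qed
    finally show ?thesis .
  qed
  have "op_apply L' (op_apply P f) z = 0" if z: "z \<in> U" for z
  proof -
    have cont: "isCont (op_apply L' (op_apply P f)) z"
      using hL U z by (meson continuous_on_eq_continuous_at holomorphic_on_imp_continuous_on)
    have "open (U - (S - {z}))" using U fS by (auto intro: finite_imp_closed)
    then have "\<forall>\<^sub>F w in at z. w \<in> U - (S - {z}) \<and> w \<noteq> z"
      using z by (auto simp: eventually_at_topological)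
    then have "\<forall>\<^sub>F w in at z. op_apply L' (op_apply P f) w = 0"
      by eventually_elim (use zero in blast)
    then have "(op_apply L' (op_apply P f) \<longlongrightarrow> 0) (at z)"
      by (rule tendsto_eventually)
    then show ?thesis
      using cont by (meson LIM_unique isCont_def)
  qed
  then show "op_apply P f \<in> solutions L' U" using hP by (simp add: solutions_def)
qed

section \<open>Polynomial dependence on the parameters\<close>

text \<open>\<open>pfam \<iota> F\<close>: \<open>F\<close> is polynomial in the parameters with values in a ring into which the scalars
  are embedded by \<open>\<iota>\<close>.\<close>

inductive pfam :: "(complex \<Rightarrow> 'a::ring_1) \<Rightarrow> (params \<Rightarrow> 'a) \<Rightarrow> bool" for \<iota> where
  pfam_const: "pfam \<iota> (\<lambda>v. K)"
| pfam_var: "pfam \<iota> (\<lambda>v. \<iota> (v i))"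
| pfam_add: "pfam \<iota> F \<Longrightarrow> pfam \<iota> G \<Longrightarrow> pfam \<iota> (\<lambda>v. F v + G v)"
| pfam_mult: "pfam \<iota> F \<Longrightarrow> pfam \<iota> G \<Longrightarrow> pfam \<iota> (\<lambda>v. F v * G v)"

lemma pfam_uminus: "pfam \<iota> F \<Longrightarrow> pfam \<iota> (\<lambda>v. - F v)"
  using pfam_mult[OF pfam_const[of \<iota> "- 1"], of F] by simp

lemma pfam_diff: "pfam \<iota> F \<Longrightarrow> pfam \<iota> G \<Longrightarrow> pfam \<iota> (\<lambda>v. F v - G v)"
  using pfam_add[OF _ pfam_uminus, of \<iota> F G] by simp

lemma pfam_power: "pfam \<iota> F \<Longrightarrow> pfam \<iota> (\<lambda>v. F v ^ n)"
  by (induction n) (auto intro: pfam_const pfam_mult)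

lemma pfam_sum: "(\<And>i. i \<in> A \<Longrightarrow> pfam \<iota> (F i)) \<Longrightarrow> pfam \<iota> (\<lambda>v. \<Sum>i\<in>A. F i v)"
  by (induction A rule: infinite_finite_induct) (auto intro: pfam_const pfam_add)

lemma pfam_prod:
  fixes F :: "'b \<Rightarrow> params \<Rightarrow> 'a::comm_ring_1"
  shows "(\<And>i. i \<in> A \<Longrightarrow> pfam \<iota> (F i)) \<Longrightarrow> pfam \<iota> (\<lambda>v. \<Prod>i\<in>A. F i v)"
  by (induction A rule: infinite_finite_induct) (auto intro: pfam_const pfam_mult)

lemma pfam_id_var: "pfam (\<lambda>c. c) (\<lambda>v. v i)"
  by (rule pfam_var)

lemmas pfam_intros = pfam_const pfam_id_var pfam_add pfam_mult pfam_diff pfam_uminus pfam_power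

definition ring_emb :: "(complex \<Rightarrow> 'a::ring_1) \<Rightarrow> bool" where
  "ring_emb \<iota> \<longleftrightarrow> \<iota> 1 = 1 \<and> (\<forall>a b. \<iota> (a + b) = \<iota> a + \<iota> b) \<and> (\<forall>a b. \<iota> (a * b) = \<iota> a * \<iota> b)"

lemma ring_emb_op_const: "ring_emb op_const"
  by (simp add: ring_emb_def op_const_simps)

lemma ring_emb_poly: "ring_emb (\<lambda>c. [:c:])"
  by (simp add: ring_emb_def one_pCons mult.commute)

lemma ring_emb_rconst: "ring_emb rconst"
  using rconst_simps by (simp add: ring_emb_def)

lemma pfam_emb:
  assumes "pfam (\<lambda>c. c) F" "ring_emb \<iota>"
  shows "pfam \<iota> (\<lambda>v. \<iota> (F v))"
  using assms(1)
proof induction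
  case (pfam_add F G)
  then show ?case using assms(2) pfam.pfam_add[of \<iota>] by (simp add: ring_emb_def)
next
  case (pfam_mult F G)
  then show ?case using assms(2) pfam.pfam_mult[of \<iota>] by (simp add: ring_emb_def)
qed (auto intro: pfam.intros)

lemma pfam_subst:
  assumes "pfam \<iota> F" "\<And>i. pfam (\<lambda>c. c) (\<lambda>v. s v i)" "ring_emb \<iota>"
  shows "pfam \<iota> (\<lambda>v. F (s v))"
  using assms(1)
proof induction
  case (pfam_var i)
  then show ?case using pfam_emb[OF assms(2,3)] by simp
qed (auto intro: pfam.intros)

lemma pfam_monomial: "pfam (\<lambda>c. c) (param_monomial m)"
proof -
  have "pfam (\<lambda>c. c) (\<lambda>v. \<Prod>i\<in>UNIV. v i ^ m i)"
    by (intro pfam_prod pfam_power pfam_id_var)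
  then show ?thesis by (simp add: param_monomial_def[abs_def])
qed

text \<open>Scalars are central, so in a product all monomials can be moved to the front; the
  coefficients \<open>K m\<close> may lie in a noncommutative ring such as that of
  operators.\<close>

lemma pfam_normal_form:
  assumes "pfam \<iota> F" "ring_emb \<iota>" and central: "\<And>c x. \<iota> c * x = x * \<iota> c"
  shows "\<exists>M K. finite M \<and> (\<forall>v. F v = (\<Sum>m\<in>M. \<iota> (param_monomial m v) * K m))"
  using assms(1)
proof induction
  case (pfam_const K)
  have "param_monomial (\<lambda>_. 0) v = 1" for v by (simp add: param_monomial_def)
  then show ?case using assms(2)
    by (intro exI[of _ "{\<lambda>_. 0}"] exI[of _ "\<lambda>_. K"]) (simp add: ring_emb_def)
next
  case (pfam_var i)
  have "param_monomial ((\<lambda>_. 0)(i := 1)) v = v i" for v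
    unfolding param_monomial_def by (subst prod.remove[of _ i]) auto
  then show ?case
    by (intro exI[of _ "{(\<lambda>_. 0)(i := 1)}"] exI[of _ "\<lambda>_. 1"]) (simp del: fun_upd_apply)
next
  case (pfam_add F G)
  obtain M K where F: "finite M" "\<And>v. F v = (\<Sum>m\<in>M. \<iota> (param_monomial m v) * K m)"
    using pfam_add.IH(1) by blast
  obtain N J where G: "finite N" "\<And>v. G v = (\<Sum>m\<in>N. \<iota> (param_monomial m v) * J m)"
    using pfam_add.IH(2) by blast
  let ?K = "\<lambda>m. (if m \<in> M then K m else 0) + (if m \<in> N then J m else 0)"
  have "F v + G v = (\<Sum>m\<in>M \<union> N. \<iota> (param_monomial m v) * ?K m)" for v
  proof -
    have "(\<Sum>m\<in>M. \<iota> (param_monomial m v) * K m)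
        = (\<Sum>m\<in>M \<union> N. \<iota> (param_monomial m v) * (if m \<in> M then K m else 0))"
      using F(1) G(1) by (intro sum.mono_neutral_cong_left) auto
    moreover have "(\<Sum>m\<in>N. \<iota> (param_monomial m v) * J m)
        = (\<Sum>m\<in>M \<union> N. \<iota> (param_monomial m v) * (if m \<in> N then J m else 0))"
      using F(1) G(1) by (intro sum.mono_neutral_cong_left) auto
    ultimately show ?thesis by (simp only: F(2) G(2) distrib_left sum.distrib)
  qed
  then show ?case using F(1) G(1)
    by (intro exI[of _ "M \<union> N"] exI[of _ ?K]) simp
next
  case (pfam_mult F G)
  obtain M K where F: "finite M" "\<And>v. F v = (\<Sum>m\<in>M. \<iota> (param_monomial m v) * K m)"
    using pfam_mult.IH(1) by blast
  obtain N J where G: "finite N" "\<And>v. G v = (\<Sum>m\<in>N. \<iota> (param_monomial m v) * J m)"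
    using pfam_mult.IH(2) by blast
  let ?s = "\<lambda>(m, n). (\<lambda>i. m i + n i :: nat)"
  let ?A = "?s ` (M \<times> N)"
  let ?K = "\<lambda>l. \<Sum>x\<in>{x \<in> M \<times> N. ?s x = l}. K (fst x) * J (snd x)"
  have mm: "param_monomial (\<lambda>i. m i + n i) v = param_monomial m v * param_monomial n v" for m n v
    by (simp add: param_monomial_def power_add prod.distrib)
  have "F v * G v = (\<Sum>l\<in>?A. \<iota> (param_monomial l v) * ?K l)" for v
  proof -
    have "F v * G v = (\<Sum>x\<in>M \<times> N. \<iota> (param_monomial (?s x) v) * (K (fst x) * J (snd x)))"
      unfolding F(2) G(2) sum_product sum.cartesian_product
    proof (rule sum.cong[OF refl])
      fix x assume "x \<in> M \<times> N"
      obtain m n where x: "x = (m, n)" by fastforce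
      have "\<iota> (param_monomial m v) * K m * (\<iota> (param_monomial n v) * J n)
        = \<iota> (param_monomial m v) * \<iota> (param_monomial n v) * (K m * J n)"
        by (metis central mult.assoc)
      then show "(case x of (i, j) \<Rightarrow> \<iota> (param_monomial i v) * K i * (\<iota> (param_monomial j v) * J j))
        = \<iota> (param_monomial (?s x) v) * (K (fst x) * J (snd x))"
        using assms(2) by (simp add: x mm ring_emb_def)
    qed
    \<comment> \<open>Pairs of monomials are grouped by their product.\<close>
    also have "\<dots> = (\<Sum>l\<in>?A. \<Sum>x\<in>{x \<in> M \<times> N. ?s x = l}.
        \<iota> (param_monomial (?s x) v) * (K (fst x) * J (snd x)))"
      by (rule sum.image_gen) (use F(1) G(1) in simp)
    also have "\<dots> = (\<Sum>l\<in>?A. \<iota> (param_monomial l v) * ?K l)"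
      by (simp add: sum_distrib_left)
    finally show ?thesis .
  qed
  then show ?case using F(1) G(1)
    by (intro exI[of _ ?A] exI[of _ ?K]) simp
qed

lemma polynomial_family_iff_pfam: "polynomial_family P \<longleftrightarrow> pfam op_const P"
proof
  assume "polynomial_family P"
  then obtain M K where "\<And>v. P v = (\<Sum>m\<in>M. op_const (param_monomial m v) * K m)"
    by (auto simp: polynomial_family_def)
  then have "P = (\<lambda>v. \<Sum>m\<in>M. op_const (param_monomial m v) * K m)" by auto
  then show "pfam op_const P"
    by (auto intro!: pfam_sum pfam_mult pfam_const pfam_emb pfam_monomial ring_emb_op_const)
next
  assume "pfam op_const P"
  then show "polynomial_family P"
    unfolding polynomial_family_def
    using pfam_normal_form[OF _ ring_emb_op_const op_const_commute] by blast
qed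

lemma pfam_imp_polynomial_function:
  assumes "pfam (\<lambda>c. c) h" shows "polynomial_function h"
  unfolding polynomial_function_def
  using pfam_normal_form[OF assms, of] by (simp add: ring_emb_def mult.commute)

text \<open>In the normal form the parameters occur only in central scalars, so a map linear over
  the constants acts on finitely many fixed coefficients. Used for the leading term of a quotient
  and for \<open>oflip\<close>.\<close>

lemma pfam_linear_image:
  assumes "pfam op_const F" "\<And>x y. \<phi> (x + y) = \<phi> x + (\<phi> y :: diffop)"
    "\<And>c x. \<phi> (op_const c * x) = op_const c * \<phi> x"
  shows "pfam op_const (\<lambda>v. \<phi> (F v))"
proof -
  obtain M K where F: "finite M" "\<And>v. F v = (\<Sum>m\<in>M. op_const (param_monomial m v) * K m)"
    using pfam_normal_form[OF assms(1) ring_emb_op_const op_const_commute] by blast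
  have \<phi>0: "\<phi> 0 = 0" using assms(2)[of 0 0] by simp
  have "\<phi> (\<Sum>m\<in>A. op_const (param_monomial m v) * K m)
      = (\<Sum>m\<in>A. op_const (param_monomial m v) * \<phi> (K m))" for A v
    by (induction A rule: infinite_finite_induct) (simp_all add: \<phi>0 assms)
  then have "(\<lambda>v. \<phi> (F v)) = (\<lambda>v. \<Sum>m\<in>M. op_const (param_monomial m v) * \<phi> (K m))"
    by (simp add: F(2))
  then show ?thesis
    by (auto intro!: pfam_sum pfam_mult pfam_const pfam_emb pfam_monomial ring_emb_op_const)
qed

lemma pfam_op_coeff:
  assumes "pfam op_const F" shows "pfam rconst (\<lambda>v. op_coeff (F v) i)"
proof -
  obtain M K where F: "finite M" "\<And>v. F v = (\<Sum>m\<in>M. op_const (param_monomial m v) * K m)"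
    using pfam_normal_form[OF assms(1) ring_emb_op_const op_const_commute] by blast
  have "(\<lambda>v. op_coeff (F v) i) = (\<lambda>v. \<Sum>m\<in>M. rconst (param_monomial m v) * op_coeff (K m) i)"
    by (simp add: F(2) op_coeff_sum op_coeff_const_mult)
  then show ?thesis
    by (auto intro!: pfam_sum pfam_mult pfam_const pfam_emb pfam_monomial ring_emb_rconst)
qed

subsection \<open>Identities that hold generically\<close>

lemma pfam_line:
  fixes \<iota> :: "complex \<Rightarrow> 'a::comm_ring_1"
  assumes "pfam \<iota> F" "ring_emb \<iota>"
  shows "\<exists>Q. \<forall>t. F (\<lambda>i. v i + t * w i) = poly Q (\<iota> t)"
  using assms(1)
proof induction
  case (pfam_const K)
  show ?case by (rule exI[of _ "[:K:]"]) simp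
next
  case (pfam_var i)
  show ?case using assms(2) by (intro exI[of _ "[:\<iota> (v i), \<iota> (w i):]"]) (simp add: ring_emb_def)
next
  case (pfam_add F G)
  then show ?case by (metis poly_add)
next
  case (pfam_mult F G)
  then show ?case by (metis poly_mult)
qed

text \<open>Polynomials in seven variables are handled through their restrictions to lines
  (\<open>pfam_line\<close>), and a nonzero polynomial in one variable has finitely many zeros.
  Hence density is asked along one suitable line through each point.\<close>

definition dense_params :: "params set \<Rightarrow> bool" where
  "dense_params G \<longleftrightarrow> (\<forall>v. \<exists>w. infinite {t. (\<lambda>i. v i + t * w i) \<in> G})"

lemma dense_params_zero:
  fixes \<iota> :: "complex \<Rightarrow> 'a::{comm_ring_1,ring_no_zero_divisors}"
  assumes "dense_params G" "pfam \<iota> F" "ring_emb \<iota>" "inj \<iota>" "\<And>v. v \<in> G \<Longrightarrow> F v = 0"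
  shows "F v = 0"
proof -
  obtain w where w: "infinite {t. (\<lambda>i. v i + t * w i) \<in> G}"
    using assms(1) by (auto simp: dense_params_def)
  obtain Q where Q: "\<And>t. F (\<lambda>i. v i + t * w i) = poly Q (\<iota> t)"
    using pfam_line[OF assms(2,3), of v w] by blast
  have "\<iota> ` {t. (\<lambda>i. v i + t * w i) \<in> G} \<subseteq> {x. poly Q x = 0}"
    using assms(5) by (auto simp flip: Q)
  then have "infinite {x. poly Q x = 0}"
    using w assms(4) by (meson finite_imageD infinite_super inj_on_subset subset_UNIV)
  then have "Q = 0" using poly_roots_finite by blast
  then show ?thesis using Q[of 0] by simp
qed

lemma dense_params_op_zero:
  assumes "dense_params G" "pfam op_const F" "\<And>v. v \<in> G \<Longrightarrow> F v = 0"
  shows "F v = 0"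
proof (rule op_eqI)
  fix i
  have "inj rconst" by (auto intro!: injI simp: to_fract_eq_iff)
  then show "op_coeff (F v) i = op_coeff 0 i"
    using dense_params_zero[OF assms(1) pfam_op_coeff[OF assms(2), of i] ring_emb_rconst] assms(3)
    by simp
qed

lemma op_const_ratfun_mult: "op_ratfun (rconst c * a) = op_const c * op_ratfun a"
  by (simp add: op_const_def op_ratfun_mult)

text \<open>The leading coefficient \<open>lc\<close> of the divisors is the same for all
  parameters, so dividing by it introduces no denominators in the parameters and the remainder
  \<open>B\<close> is again a polynomial family.\<close>

lemma right_division:
  assumes "pfam op_const F" "pfam op_const L" "\<And>v. op_order (F v) \<le> n"
    and L: "\<And>v. op_order (L v) \<le> m" "\<And>v. op_coeff (L v) m = lc" "lc \<noteq> 0" "0 < m"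
  shows "\<exists>Q B. pfam op_const B \<and> (\<forall>v. F v = Q v * L v + B v \<and> op_order (B v) < m)"
  using assms(1,3)
proof (induction n arbitrary: F rule: less_induct)
  case (less n)
  show ?case
  proof (cases "n < m")
    case True
    then show ?thesis using less.prems
      by (intro exI[of _ "\<lambda>v. 0"] exI[of _ F]) (auto intro: le_less_trans)
  next
    case False
    \<comment> \<open>The leading term of the quotient. It is linear in \<open>X\<close> over the
      constants, so \<open>pfam_linear_image\<close> applies.\<close>
    define \<phi> where "\<phi> X = op_ratfun (op_coeff X n / lc) * op_d ^ (n - m)" for X
    define F' where "F' v = F v - \<phi> (F v) * L v" for v
    have "pfam op_const (\<lambda>v. \<phi> (F v))"
      by (rule pfam_linear_image[OF less.prems(1)])
        (simp_all add: \<phi>_def op_coeff_add add_divide_distrib op_ratfun_add distrib_right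
          op_coeff_const_mult op_const_ratfun_mult[symmetric] mult.assoc[symmetric])
    then have pF': "pfam op_const F'"
      unfolding F'_def[abs_def] by (intro pfam_diff pfam_mult less.prems assms(2))
    have od: "op_order (op_d ^ k) \<le> k" for k
      using op_order_mult_le[of op_d 1] by (induction k) (use op_order_ratfun[of 1] in auto)
    have o\<phi>: "op_order (\<phi> X) \<le> n - m" for X
      using op_order_mult_le[of "op_ratfun (op_coeff X n / lc)" 0, OF _ od[of "n - m"]]
      by (simp add: \<phi>_def)
    have cd: "op_coeff (op_d ^ k) k = 1" for k
    proof (induction k)
      case 0
      show ?case using op_coeff_ratfun[of 1 0] by simp
    next
      case (Suc k)
      then show ?case by (subst power_Suc2) (simp add: op_coeff_mult_d)
    qed
    have c\<phi>: "op_coeff (\<phi> X) (n - m) = op_coeff X n / lc" for X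
      by (simp add: \<phi>_def op_coeff_ratfun_mult cd)
    have oF': "op_order (F' v) \<le> n" for v
      unfolding F'_def using op_order_mult_le[OF o\<phi> L(1)] False
      by (intro op_order_diff_le less.prems(2)) (simp add: le_trans)
    have "op_coeff (F' v) n = 0" for v
      using op_coeff_mult_top[OF o\<phi> L(1), of "F v" v] False L(2,3)
      by (simp add: F'_def op_coeff_diff c\<phi>)
    then have oF'': "op_order (F' v) < n" for v
      using oF'[of v] False L(4) op_coeff_order_nz[of "F' v"]
      by (metis le_neq_implies_less not_less op_order_0 le_zero_eq)
    have "n - 1 < n" using False L(4) by simp
    moreover have "op_order (F' v) \<le> n - 1" for v using oF''[of v] by simp
    ultimately obtain Q B where QB: "pfam op_const B" "\<And>v. F' v = Q v * L v + B v" "\<And>v. op_order (B v) < m"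
      using less.IH[of "n - 1", OF _ pF'] by (metis (no_types, lifting))
    have "F v = (\<phi> (F v) + Q v) * L v + B v" for v
      using QB(2)[of v] by (simp add: F'_def algebra_simps)
    then show ?thesis using QB(1,3)
      by (intro exI[of _ "\<lambda>v. \<phi> (F v) + Q v"] exI[of _ B]) simp
  qed
qed

lemma pfam_order_bounded:
  assumes "pfam op_const F" shows "\<exists>n. \<forall>v. op_order (F v) \<le> n"
proof -
  obtain M K where F: "finite M" "\<And>v. F v = (\<Sum>m\<in>M. op_const (param_monomial m v) * K m)"
    using pfam_normal_form[OF assms(1) ring_emb_op_const op_const_commute] by blast
  have "op_order (F v) \<le> Max (insert 0 ((\<lambda>m. op_order (K m)) ` M))" for v
  proof (rule op_order_le)
    fix i assume i: "Max (insert 0 ((\<lambda>m. op_order (K m)) ` M)) < i"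
    have "op_coeff (K m) i = 0" if "m \<in> M" for m
      using i F(1) that by (intro op_coeff_eq_0) simp
    then show "op_coeff (F v) i = 0" by (simp add: F(2) op_coeff_sum op_coeff_const_mult)
  qed
  then show ?thesis by blast
qed

lemma order_less_in_left_ideal:
  assumes "B \<in> left_ideal L" "op_order B < op_order L"
  shows "B = 0"
proof (rule ccontr)
  assume B: "B \<noteq> 0"
  obtain Q where Q: "B = Q * L" using assms(1) by (auto simp: left_ideal_iff)
  then have "op_order B = op_order Q + op_order L" using B by (intro op_order_mult[of Q L, folded Q]) auto
  then show False using assms(2) by simp
qed

text \<open>On \<open>G\<close> the remainder of right division lies in the ideal and has order
  below \<open>m\<close>, hence is 0. Being polynomial in the parameters it is 0 everywhere.\<close>

lemma left_ideal_dense: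
  assumes G: "dense_params G" and F: "pfam op_const F" and "pfam op_const L"
    and L: "\<And>v. op_order (L v) \<le> m" "\<And>v. op_coeff (L v) m = lc" "lc \<noteq> 0" "0 < m"
    and I: "\<And>v. v \<in> G \<Longrightarrow> F v \<in> left_ideal (L v)"
  shows "F v \<in> left_ideal (L v)"
proof -
  obtain n where "\<And>v. op_order (F v) \<le> n" using pfam_order_bounded[OF F] by blast
  then obtain Q B where QB: "pfam op_const B" "\<And>v. F v = Q v * L v + B v" "\<And>v. op_order (B v) < m"
    using right_division[OF F assms(3) _ L] by metis
  have oL: "op_order (L v) = m" for v
    using L(1)[of v] L(2)[of v] L(3) op_coeff_eq_0[of "L v" m] by (metis le_neq_implies_less)
  have "B v = 0" for v
  proof (rule dense_params_op_zero[OF G QB(1)])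
    fix v assume "v \<in> G"
    then have "F v - Q v * L v \<in> left_ideal (L v)" using I by (intro left_ideal_diff) auto
    then have "B v \<in> left_ideal (L v)" by (simp add: QB(2))
    then show "B v = 0" using order_less_in_left_ideal QB(3) oL by metis
  qed
  then show ?thesis by (simp add: QB(2))
qed

section \<open>Operators in \<open>\<theta>\<close> and \<open>\<partial>\<close>\<close>

definition op_x :: diffop where "op_x = op_ratfun (to_fract [:0, 1:])"

lemma op_theta_eq: "op_theta = op_x * op_d"
  by (simp add: op_theta_def op_x_def)

lemma op_d_x: "op_d * op_x = op_x * op_d + 1"
  by (simp add: op_x_def op_d_ratfun fract_deriv_to_fract pderiv_pCons flip: one_pCons)

definition thp :: "complex poly \<Rightarrow> diffop" where
  "thp p = fold_coeffs (\<lambda>c x. op_const c + x * op_theta) p 0"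

lemma thp_0 [simp]: "thp 0 = 0"
  by (simp add: thp_def)

lemma thp_pCons: "thp (pCons c p) = op_const c + thp p * op_theta"
  by (cases "p = 0 \<and> c = 0") (auto simp: thp_def op_const_simps)

lemma thp_const: "thp [:c:] = op_const c"
  by (simp add: thp_pCons)

lemma thp_1 [simp]: "thp 1 = 1"
  by (simp add: one_pCons thp_const op_const_simps)

lemma thp_linear: "thp [:c, 1:] = op_theta + op_const c"
  by (simp add: thp_pCons op_const_simps add.commute)

lemma thp_add: "thp (p + q) = thp p + thp q"
proof (induction p arbitrary: q)
  case (pCons a p)
  show ?case by (cases q) (simp add: thp_pCons pCons.IH op_const_simps distrib_right)
qed simp

lemma thp_smult: "thp (smult c p) = op_const c * thp p"
  by (induction p) (simp_all add: thp_pCons op_const_simps distrib_left mult.assoc)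

lemma thp_theta_commute: "thp p * op_theta = op_theta * thp p"
proof (induction p)
  case (pCons a p)
  have "thp p * op_theta * op_theta = op_theta * (thp p * op_theta)"
    by (simp only: pCons.IH mult.assoc)
  then show ?case by (simp add: thp_pCons distrib_left distrib_right op_const_commute)
qed simp

lemma thp_mult: "thp (p * q) = thp p * thp q"
proof (induction p)
  case (pCons a p)
  have "thp (pCons a p * q) = op_const a * thp q + thp p * thp q * op_theta"
    using pCons.IH by (simp add: thp_add thp_smult thp_pCons op_const_simps)
  moreover have "thp p * op_theta * thp q = thp p * thp q * op_theta"
    by (simp only: mult.assoc thp_theta_commute[of q])
  ultimately show ?case by (simp add: thp_pCons distrib_right)
qed simp

lemma thp_uminus: "thp (- p) = - thp p"
  using thp_add[of p "- p"] by (simp add: eq_neg_iff_add_eq_0 add.commute)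

definition shp :: "complex poly \<Rightarrow> complex poly" where
  "shp p = pcompose p [:1, 1:]"

lemma poly_shp [simp]: "poly (shp p) t = poly p (t + 1)"
  by (simp add: shp_def poly_pcompose add.commute)

lemma shp_simps [simp]: "shp 0 = 0" "shp (p + q) = shp p + shp q" "shp (p * q) = shp p * shp q"
  by (simp_all add: shp_def pcompose_add pcompose_mult)

lemma op_d_theta: "op_d * op_theta = (op_theta + 1) * op_d"
proof -
  have "op_d * op_theta = (op_d * op_x) * op_d" by (simp add: op_theta_eq mult.assoc)
  then show ?thesis by (simp add: op_d_x op_theta_eq)
qed

lemma op_d_thp: "op_d * thp p = thp (shp p) * op_d"
proof (induction p)
  case (pCons a p)
  have s: "shp (pCons a p) = [:a:] + shp p * [:1, 1:]"
    by (simp add: shp_def pcompose_pCons mult.commute)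
  have "op_d * thp (pCons a p) = op_const a * op_d + thp (shp p) * (op_d * op_theta)"
    by (simp add: thp_pCons distrib_left pCons.IH op_const_commute flip: mult.assoc)
  also have "\<dots> = thp (shp (pCons a p)) * op_d"
    unfolding s op_d_theta by (simp add: thp_add thp_mult thp_pCons op_const_simps algebra_simps)
  finally show ?case .
qed (simp add: shp_def)

section \<open>Orders and normal forms of polynomials in \<theta> and \<partial>\<close>

lemma thp_coeff_top:
  assumes "degree p \<le> n"
  shows "op_order (thp p) \<le> n \<and> op_coeff (thp p) n = to_fract (monom (coeff p n) n)"
  using assms
proof (induction n arbitrary: p)
  case 0
  then obtain c where "p = [:c:]" by (metis degree_0_id le_zero_eq)
  then show ?case by (simp add: thp_const op_const_def op_coeff_ratfun monom_0)
next
  case (Suc n)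
  obtain c q where p: "p = pCons c q" by (rule pCons_cases)
  have "degree q \<le> n" using Suc.prems by (cases "q = 0") (simp_all add: p)
  then have q: "op_order (thp q) \<le> n" "op_coeff (thp q) n = to_fract (monom (coeff q n) n)"
    using Suc.IH by auto
  have t: "op_order op_theta \<le> 1" "op_coeff op_theta 1 = to_fract [:0, 1:]"
    using op_order_mult_le[of op_x 0 op_d 1] op_coeff_ratfun[of "to_fract [:0,1:]" 0]
    by (simp_all add: op_theta_eq op_x_def op_coeff_mult_d)
  have o: "op_order (thp q * op_theta) \<le> Suc n"
    and c: "op_coeff (thp q * op_theta) (Suc n) = to_fract (monom (coeff q n) n) * to_fract [:0, 1:]"
    using op_order_mult_le[OF q(1) t(1)] op_coeff_mult_top[OF q(1) t(1)] q(2) t(2) by simp_all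
  have "monom (coeff q n) n * [:0, 1:] = monom (coeff q n) (Suc n)"
    by (simp add: monom_Suc mult.commute)
  then have "op_coeff (thp q * op_theta) (Suc n) = to_fract (monom (coeff p (Suc n)) (Suc n))"
    using c by (simp add: p flip: to_fract_poly_simps)
  moreover have "op_coeff (op_const c) (Suc n) = 0" by (simp add: op_const_def op_coeff_ratfun)
  moreover have "op_order (op_const c) \<le> Suc n" by (simp add: op_const_def)
  ultimately show ?case using o by (simp add: p thp_pCons op_order_add_le op_coeff_add)
qed

text \<open>Sums of \<open>A_i(\<theta>) \<partial>^i\<close>. As \<partial> moves past \<theta> by
  a shift of the argument, products stay in this form (\<open>lmult\<close>), and an identity of
  operators splits into polynomial identities in \<theta> and the parameters. Positive powers of
  \<open>x\<close> are outside this form; where they occur they are removed by a factor \<partial>^2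
  on the left.\<close>

fun lop :: "complex poly list \<Rightarrow> diffop" where
  "lop [] = 0"
| "lop (A # As) = thp A + lop As * op_d"

fun ladd :: "complex poly list \<Rightarrow> complex poly list \<Rightarrow> complex poly list" where
  "ladd [] B = B"
| "ladd (a # A) [] = a # A"
| "ladd (a # A) (b # B) = (a + b) # ladd A B"

fun lmult :: "complex poly list \<Rightarrow> complex poly list \<Rightarrow> complex poly list" where
  "lmult [] B = []"
| "lmult (a # A) B = ladd (map ((*) a) B) (0 # lmult A (map shp B))"

lemma lop_ladd: "lop (ladd A B) = lop A + lop B"
  by (induction A B rule: ladd.induct) (simp_all add: thp_add distrib_right add_ac)

lemma lop_map_mult: "lop (map ((*) a) B) = thp a * lop B"
  by (induction B) (simp_all add: thp_mult distrib_left mult.assoc)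

lemma op_d_lop: "op_d * lop B = lop (map shp B) * op_d"
  by (induction B) (simp_all add: distrib_left distrib_right op_d_thp flip: mult.assoc)

lemma lop_lmult: "lop (lmult A B) = lop A * lop B"
  by (induction A arbitrary: B)
    (simp_all add: lop_ladd lop_map_mult distrib_right mult.assoc op_d_lop)

lemma lop_coeff_order:
  assumes "\<And>i. i < length As \<Longrightarrow> degree (As ! i) + i \<le> n"
  shows "op_order (lop As) \<le> n \<and>
    op_coeff (lop As) n = to_fract (\<Sum>i<length As. monom (coeff (As ! i) (n - i)) (n - i))"
  using assms
proof (induction As arbitrary: n)
  case (Cons A As)
  have A: "op_order (thp A) \<le> n" "op_coeff (thp A) n = to_fract (monom (coeff A n) n)"
    using thp_coeff_top[of A n] Cons.prems[of 0] by auto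
  show ?case
  proof (cases "As = []")
    case True
    then show ?thesis using A by simp
  next
    case False
    then obtain m where n: "n = Suc m" using Cons.prems[of 1] by (cases n) auto
    have p: "degree (As ! i) + i \<le> m" if "i < length As" for i
      using Cons.prems[of "Suc i"] that n by simp
    have As: "op_order (lop As) \<le> m"
      "op_coeff (lop As) m = to_fract (\<Sum>i<length As. monom (coeff (As ! i) (m - i)) (m - i))"
      using Cons.IH[OF p] by auto
    have "op_order (lop As * op_d) \<le> n"
      using op_order_mult_le[OF As(1), of op_d 1] by (simp add: n)
    moreover have "op_coeff (lop As * op_d) n = op_coeff (lop As) m"
      by (simp add: op_coeff_mult_d n)
    moreover have "(\<Sum>i<length (A # As). monom (coeff ((A # As) ! i) (n - i)) (n - i))
        = monom (coeff A n) n + (\<Sum>i<length As. monom (coeff (As ! i) (m - i)) (m - i))"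
      unfolding n length_Cons by (subst sum.lessThan_Suc_shift) simp
    ultimately show ?thesis
      using A As(2) by (simp add: op_order_add_le op_coeff_add to_fract_poly_simps)
  qed
qed simp

section \<open>Families of polynomials in \<theta>, and division by a root depending on the
  parameters\<close>

lemma pfam_thp: "pfam (\<lambda>c. [:c:]) f \<Longrightarrow> pfam op_const (\<lambda>v. thp (f v))"
  by (induction rule: pfam.induct) (auto simp: thp_const thp_add thp_mult intro: pfam.intros)

lemma pfam_pcompose:
  "pfam (\<lambda>c. [:c:]) f \<Longrightarrow> pfam (\<lambda>c. [:c:]) q \<Longrightarrow> pfam (\<lambda>c. [:c:]) (\<lambda>v. pcompose (f v) (q v))"
proof (induction rule: pfam.induct)
  case (pfam_const K)
  show ?case
    by (induction K) (auto simp: pcompose_pCons intro!: pfam.intros pfam_const)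
qed (auto simp: pcompose_add pcompose_mult intro: pfam.intros)

lemma pfam_pCons:
  assumes "pfam (\<lambda>c. c) a" "pfam (\<lambda>c. [:c:]) p"
  shows "pfam (\<lambda>c. [:c:]) (\<lambda>v. pCons (a v) (p v))"
proof -
  have "pfam (\<lambda>c. [:c:]) (\<lambda>v. [:a v:] + [:0, 1:] * p v)"
    by (intro pfam_add pfam_mult pfam_const assms pfam_emb ring_emb_poly)
  moreover have "(\<lambda>v. [:a v:] + [:0, 1:] * p v) = (\<lambda>v. pCons (a v) (p v))" by auto
  ultimately show ?thesis by simp
qed

text \<open>The divisor \<open>[:- c v, 1:]\<close> is monic, so no denominators in the parameters
  appear. The induction follows the construction of \<open>f\<close>, since the quotient has to be
  one polynomial family and not a choice for each \<open>v\<close>.\<close>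

lemma pfam_synthetic_div:
  assumes "pfam (\<lambda>c. [:c:]) f" "pfam (\<lambda>c. c) c"
  shows "\<exists>g. pfam (\<lambda>c. [:c:]) g \<and> pfam (\<lambda>c. c) (\<lambda>v. poly (f v) (c v)) \<and>
    (\<forall>v. f v = [:poly (f v) (c v):] + [:- c v, 1:] * g v)"
  using assms(1)
proof induction
  case (pfam_const K)
  have "pfam (\<lambda>c. c) (\<lambda>v. poly K (c v)) \<and> pfam (\<lambda>c. [:c:]) (\<lambda>v. synthetic_div K (c v))"
    by (induction K) (auto intro!: pfam_pCons pfam_add pfam_mult assms(2) pfam.pfam_const)
  moreover have "K = [:poly K (c v):] + [:- c v, 1:] * synthetic_div K (c v)" for v
    using synthetic_div_correct'[of "c v" K] by (simp add: add.commute)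
  ultimately show ?case by blast
next
  case (pfam_var i)
  show ?case by (intro exI[of _ "\<lambda>_. 0"]) (auto intro: pfam.pfam_const pfam_id_var)
next
  case (pfam_add F G)
  obtain f where f: "pfam (\<lambda>c. [:c:]) f" "pfam (\<lambda>c. c) (\<lambda>v. poly (F v) (c v))"
    "\<And>v. F v = [:poly (F v) (c v):] + [:- c v, 1:] * f v"
    using pfam_add.IH(1) by blast
  obtain g where g: "pfam (\<lambda>c. [:c:]) g" "pfam (\<lambda>c. c) (\<lambda>v. poly (G v) (c v))"
    "\<And>v. G v = [:poly (G v) (c v):] + [:- c v, 1:] * g v"
    using pfam_add.IH(2) by blast
  have "F v + G v = [:poly (F v + G v) (c v):] + [:- c v, 1:] * (f v + g v)" for v
  proof -
    have "F v + G v = ([:poly (F v) (c v):] + [:poly (G v) (c v):]) + [:- c v, 1:] * (f v + g v)"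
      using f(3)[of v] g(3)[of v] by (simp only: distrib_left add_ac)
    then show ?thesis by simp
  qed
  moreover have "pfam (\<lambda>c. c) (\<lambda>v. poly (F v + G v) (c v))"
    using pfam.pfam_add[OF f(2) g(2)] by simp
  ultimately show ?case using pfam.pfam_add[OF f(1) g(1)] by blast
next
  case (pfam_mult F G)
  obtain f where f: "pfam (\<lambda>c. [:c:]) f" "pfam (\<lambda>c. c) (\<lambda>v. poly (F v) (c v))"
    "\<And>v. F v = [:poly (F v) (c v):] + [:- c v, 1:] * f v"
    using pfam_mult.IH(1) by blast
  obtain g where g: "pfam (\<lambda>c. [:c:]) g" "pfam (\<lambda>c. c) (\<lambda>v. poly (G v) (c v))"
    "\<And>v. G v = [:poly (G v) (c v):] + [:- c v, 1:] * g v"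
    using pfam_mult.IH(2) by blast
  let ?h = "\<lambda>v. [:poly (F v) (c v):] * g v + f v * G v"
  have alg: "A = x + l * u \<Longrightarrow> B = y + l * w \<Longrightarrow> A * B = x * y + l * (x * w + u * B)"
    for A B x y l u w :: "complex poly"
    by (simp add: algebra_simps)
  have "F v * G v = [:poly (F v * G v) (c v):] + [:- c v, 1:] * ?h v" for v
    using alg[OF f(3)[of v] g(3)[of v]] by (simp only: poly_mult) (simp add: mult.commute)
  moreover have "pfam (\<lambda>c. c) (\<lambda>v. poly (F v * G v) (c v))"
    using pfam.pfam_mult[OF f(2) g(2)] by simp
  moreover have "pfam (\<lambda>c. [:c:]) ?h"
    by (intro pfam.pfam_add pfam.pfam_mult f g pfam_mult.hyps pfam_emb ring_emb_poly)
  ultimately show ?case by blast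
qed

lemma pfam_root_factor:
  assumes "pfam (\<lambda>c. [:c:]) f" "pfam (\<lambda>c. c) c" "\<And>v. poly (f v) (c v) = 0"
  obtains g where "pfam (\<lambda>c. [:c:]) g" "\<And>v. f v = [:- c v, 1:] * g v"
  using pfam_synthetic_div[OF assms(1,2)] assms(3) that by auto

section \<open>Left divisibility by first-order operators\<close>

text \<open>The right module \<open>\<complex>(x)[\<partial>] / (\<partial> - \<eta>) \<complex>(x)[\<partial>]\<close> is \<open>\<complex>(x)\<close>, on which \<open>\<partial>\<close> acts by \<open>z \<mapsto> \<eta> z - z'\<close>.\<close>

definition ract1 :: "ratfun \<Rightarrow> ratfun \<Rightarrow> ratfun" where
  "ract1 \<eta> z = \<eta> * z - fract_deriv z"

definition ract :: "ratfun \<Rightarrow> ratfun \<Rightarrow> diffop \<Rightarrow> ratfun" where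
  "ract \<eta> z P = (\<Sum>i\<le>op_order P. (ract1 \<eta> ^^ i) (z * op_coeff P i))"

lemma ract1_add: "ract1 \<eta> (y + z) = ract1 \<eta> y + ract1 \<eta> z"
  by (simp add: ract1_def fract_deriv_add algebra_simps)

lemma ract1_0 [simp]: "ract1 \<eta> 0 = 0"
  by (simp add: ract1_def)

lemma ract1_sum: "ract1 \<eta> (sum f A) = (\<Sum>i\<in>A. ract1 \<eta> (f i))"
  by (induction A rule: infinite_finite_induct) (simp_all add: ract1_add)

lemma ract1_funpow_add: "(ract1 \<eta> ^^ i) (y + z) = (ract1 \<eta> ^^ i) y + (ract1 \<eta> ^^ i) z"
  by (induction i) (simp_all add: ract1_add)

lemma ract1_funpow_0: "(ract1 \<eta> ^^ i) 0 = 0"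
  by (induction i) simp_all

lemma ract_le: "op_order P \<le> n \<Longrightarrow> ract \<eta> z P = (\<Sum>i\<le>n. (ract1 \<eta> ^^ i) (z * op_coeff P i))"
  unfolding ract_def
  by (rule sum.mono_neutral_left) (auto simp: op_coeff_eq_0 ract1_funpow_0)

lemma ract_add: "ract \<eta> z (P + Q) = ract \<eta> z P + ract \<eta> z Q"
proof -
  let ?n = "max (op_order P) (op_order Q)"
  have "op_order (P + Q) \<le> ?n" by (rule op_order_add_le) auto
  then show ?thesis
    by (simp add: ract_le[where n = ?n] op_coeff_add distrib_left ract1_funpow_add sum.distrib)
qed

lemma ract_ratfun: "ract \<eta> z (op_ratfun a) = z * a"
  by (simp add: ract_def op_coeff_ratfun)

lemma ract_0_right [simp]: "ract \<eta> z 0 = 0"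
  using ract_ratfun[of \<eta> z 0] by simp

lemma ract_0_left [simp]: "ract \<eta> 0 P = 0"
  by (simp add: ract_def ract1_funpow_0)

lemma ract_ratfun_mult: "ract \<eta> z (op_ratfun a * P) = ract \<eta> (z * a) P"
proof -
  have "op_order (op_ratfun a * P) \<le> op_order P"
    using op_order_mult_le[of "op_ratfun a" 0 P "op_order P"] by simp
  then show ?thesis
    by (simp add: ract_le[where n = "op_order P"] op_coeff_ratfun_mult mult.assoc)
qed

lemma ract_mult_d: "ract \<eta> z (P * op_d) = ract1 \<eta> (ract \<eta> z P)"
proof -
  have "op_order (P * op_d) \<le> Suc (op_order P)"
    using op_order_mult_le[of P "op_order P" op_d 1] by simp
  then show ?thesis
    by (subst ract_le, assumption, subst sum.atMost_Suc_shift)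
      (simp add: op_coeff_mult_d ract_def ract1_sum)
qed

lemma ract_d_mult: "ract \<eta> z (op_d * P) = ract \<eta> (ract1 \<eta> z) P"
proof (induction P rule: diffop_induct)
  case (step a P)
  have "op_d * (op_ratfun a + P * op_d)
      = op_ratfun a * op_d + op_ratfun (fract_deriv a) + op_d * P * op_d"
    by (simp add: distrib_left op_d_ratfun mult.assoc)
  moreover have "ract1 \<eta> (z * a) + z * fract_deriv a = ract1 \<eta> z * a"
    by (simp add: ract1_def fract_deriv_mult algebra_simps)
  ultimately show ?case
    using step by (simp add: ract_add ract_mult_d ract_ratfun)
qed simp

lemma ract_mult: "ract \<eta> z (P * Q) = ract \<eta> (ract \<eta> z P) Q"
proof (induction P arbitrary: Q rule: diffop_induct)
  case (step a P)
  have "ract \<eta> (y + y') Q = ract \<eta> y Q + ract \<eta> y' Q" for y y'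
    by (simp add: ract_def distrib_right ract1_funpow_add sum.distrib)
  then show ?case
    using step[of "op_d * Q"]
    by (simp add: distrib_right mult.assoc ract_add ract_ratfun_mult ract_ratfun ract_mult_d ract_d_mult)
qed simp

text \<open>The remainder is the class of \<open>Z\<close> in the quotient module, that is, the
  image of 1 under the right action of \<open>Z\<close>.\<close>

lemma left_division_first_order:
  "\<exists>Z'. Z = op_ratfun (ract \<eta> 1 Z) + (op_d - op_ratfun \<eta>) * Z'"
proof (induction Z rule: diffop_induct)
  case zero
  show ?case by (rule exI[of _ 0]) simp
next
  case (step a P)
  then obtain P' where P': "P = op_ratfun (ract \<eta> 1 P) + (op_d - op_ratfun \<eta>) * P'" by blast
  let ?z = "ract \<eta> 1 P"
  have "P * op_d = op_ratfun ?z * op_d + (op_d - op_ratfun \<eta>) * (P' * op_d)"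
    by (subst P') (simp add: distrib_right mult.assoc)
  also have "op_ratfun ?z * op_d = (op_d - op_ratfun \<eta>) * op_ratfun ?z + op_ratfun (ract1 \<eta> ?z)"
    by (simp add: ract1_def op_d_ratfun op_ratfun_diff op_ratfun_mult left_diff_distrib)
  finally have "op_ratfun a + P * op_d = op_ratfun (a + ract1 \<eta> ?z)
      + (op_d - op_ratfun \<eta>) * (op_ratfun ?z + P' * op_d)"
    by (simp add: op_ratfun_add distrib_left)
  moreover have "ract \<eta> 1 (op_ratfun a + P * op_d) = a + ract1 \<eta> ?z"
    by (simp add: ract_add ract_ratfun ract_mult_d)
  ultimately show ?case by auto
qed

text \<open>Let \<open>(\<partial> - \<eta>) B = Z L\<close>. The left side sends 1 to 0, so
  \<open>L\<close> kills the image of 1 under \<open>Z\<close>. By injectivity of \<open>L\<close>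
  that image is 0, so \<partial> - \<eta> divides \<open>Z\<close> on the left and can be
  cancelled.\<close>

lemma left_cancel_first_order:
  assumes "(op_d - op_ratfun \<eta>) * B \<in> left_ideal L" "\<And>z. z \<noteq> 0 \<Longrightarrow> ract \<eta> z L \<noteq> 0"
  shows "B \<in> left_ideal L"
proof -
  obtain Z where Z: "(op_d - op_ratfun \<eta>) * B = Z * L"
    using assms(1) by (auto simp: left_ideal_iff)
  have "ract \<eta> 1 ((op_d - op_ratfun \<eta>) * B) = 0"
  proof -
    have "ract \<eta> 1 (op_d - op_ratfun \<eta>) = ract \<eta> 1 (1 * op_d + op_ratfun (- \<eta>))"
      by (simp add: op_ratfun_uminus)
    also have "\<dots> = 0"
    proof -
      have "ract \<eta> 1 1 = 1" using ract_ratfun[of \<eta> 1 1] by simp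
      then show ?thesis by (simp only: ract_add ract_mult_d ract_ratfun) (simp add: ract1_def)
    qed
    finally show ?thesis by (simp add: ract_mult)
  qed
  then have "ract \<eta> 1 Z = 0" using assms(2) by (auto simp: Z ract_mult)
  then obtain Z' where Z': "Z = (op_d - op_ratfun \<eta>) * Z'"
    using left_division_first_order[of Z \<eta>] by auto
  have "op_d - op_ratfun \<eta> \<noteq> 0"
  proof
    assume "op_d - op_ratfun \<eta> = 0"
    then have "op_order op_d = op_order (op_ratfun \<eta>)" by simp
    then show False by simp
  qed
  then have "B = Z' * L" using Z by (simp add: Z' mult.assoc)
  then show ?thesis by simp
qed

section \<open>Leading exponents at infinity and at 0\<close>

lemma ract_1 [simp]: "ract \<eta> z 1 = z"
  using ract_ratfun[of \<eta> z 1] by simp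

text \<open>With \<open>R = (<)\<close> no exponent of \<open>p\<close> exceeds \<open>m\<close>,
  with \<open>R = (>)\<close> none is below \<open>m\<close>; one relation serves both points. The
  coefficient at \<open>m\<close> itself may be 0.\<close>

definition extremal :: "(nat \<Rightarrow> nat \<Rightarrow> bool) \<Rightarrow> complex poly \<Rightarrow> nat \<Rightarrow> bool" where
  "extremal R p m \<longleftrightarrow> (\<forall>i. R m i \<longrightarrow> coeff p i = 0)"

text \<open>\<open>has_lead R z n c\<close>: \<open>z = c x\<^sup>n\<close> up to terms of lower order at \<open>\<infinity>\<close> (for \<open>R = (<)\<close>)
  or of higher order at \<open>0\<close> (for \<open>R = (>)\<close>).\<close>

definition has_lead :: "(nat \<Rightarrow> nat \<Rightarrow> bool) \<Rightarrow> ratfun \<Rightarrow> int \<Rightarrow> complex \<Rightarrow> bool" where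
  "has_lead R z n c \<longleftrightarrow> (\<exists>a b m k. z = Fract a b \<and> extremal R a m \<and> extremal R b k \<and>
     coeff b k \<noteq> 0 \<and> int m = int k + n \<and> coeff a m = c * coeff b k)"

lemma extremal_mult:
  assumes R: "R = (<) \<or> R = (>)" and "extremal R a m" "extremal R b k"
  shows "extremal R (a * b) (m + k) \<and> coeff (a * b) (m + k) = coeff a m * coeff b k"
proof -
  have z: "coeff a i * coeff b (j - i) = 0" if "i \<le> j" "R (m + k) j \<or> j = m + k \<and> i \<noteq> m" for i j
  proof -
    have "R m i \<or> R k (j - i)" using that R by auto
    then show ?thesis using assms(2,3) by (auto simp: extremal_def)
  qed
  have "extremal R (a * b) (m + k)"
    using z by (auto simp: extremal_def coeff_mult intro!: sum.neutral)
  moreover have "coeff (a * b) (m + k) = (\<Sum>i\<le>m + k. if i = m then coeff a m * coeff b k else 0)"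
    unfolding coeff_mult by (rule sum.cong[OF refl]) (use z in auto)
  ultimately show ?thesis by simp
qed

lemma extremal_add: "extremal R a m \<Longrightarrow> extremal R b m \<Longrightarrow> extremal R (a + b) m"
  by (simp add: extremal_def)

lemma extremal_x:
  assumes "R = (<) \<or> R = (>)" "extremal R a m"
  shows "extremal R (pCons 0 a) (Suc m)"
  using assms by (auto simp: extremal_def coeff_pCons split: nat.split)

lemma extremal_theta: "extremal R a m \<Longrightarrow> extremal R (pCons 0 (pderiv a)) m"
  by (auto simp: extremal_def coeff_pCons coeff_pderiv split: nat.split)

lemma coeff_theta: "coeff (pCons 0 (pderiv a)) m = of_nat m * coeff a m"
  by (auto simp: coeff_pCons coeff_pderiv split: nat.split)

context
  fixes R :: "nat \<Rightarrow> nat \<Rightarrow> bool"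
  assumes R: "R = (<) \<or> R = (>)"
begin

lemma has_lead_add:
  assumes "has_lead R y n c" "has_lead R z n d"
  shows "has_lead R (y + z) n (c + d)"
proof -
  obtain a b m k where y: "y = Fract a b" "extremal R a m" "extremal R b k"
     "coeff b k \<noteq> 0" "int m = int k + n" "coeff a m = c * coeff b k"
    using assms(1) by (auto simp: has_lead_def)
  obtain a' b' m' k' where z: "z = Fract a' b'" "extremal R a' m'" "extremal R b' k'"
     "coeff b' k' \<noteq> 0" "int m' = int k' + n" "coeff a' m' = d * coeff b' k'"
    using assms(2) by (auto simp: has_lead_def)
  have nz: "b \<noteq> 0" "b' \<noteq> 0" using y(4) z(4) by auto
  have e: "m' + k = m + k'" using y(5) z(5) by linarith
  note 1 = extremal_mult[OF R y(2) z(3)] and 2 = extremal_mult[OF R z(2) y(3), unfolded e]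
    and 3 = extremal_mult[OF R y(3) z(3)]
  have "y + z = Fract (a * b' + a' * b) (b * b')" using nz by (simp add: y(1) z(1))
  moreover have "extremal R (a * b' + a' * b) (m + k')"
    using 1 2 by (auto intro: extremal_add)
  moreover have "coeff (a * b' + a' * b) (m + k') = (c + d) * coeff (b * b') (k + k')"
    using 1 2 3 y(6) z(6) by (simp add: distrib_right)
  ultimately show ?thesis
    unfolding has_lead_def using 3 y(4,5) z(4)
    by (intro exI[of _ "a * b' + a' * b"] exI[of _ "b * b'"] exI[of _ "m + k'"] exI[of _ "k + k'"]) auto
qed

lemma has_lead_rconst:
  assumes "has_lead R z n c" shows "has_lead R (rconst d * z) n (d * c)"
proof -
  obtain a b m k where z: "z = Fract a b" "extremal R a m" "extremal R b k"
     "coeff b k \<noteq> 0" "int m = int k + n" "coeff a m = c * coeff b k"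
    using assms(1) by (auto simp: has_lead_def)
  have "rconst d * z = Fract (smult d a) b" using z(4) by (auto simp: z(1) to_fract_def)
  moreover have "extremal R (smult d a) m" using z(2) by (simp add: extremal_def)
  ultimately show ?thesis unfolding has_lead_def using z
    by (intro exI[of _ "smult d a"] exI[of _ b] exI[of _ m] exI[of _ k]) auto
qed

lemma has_lead_x:
  assumes "has_lead R z n c" shows "has_lead R (to_fract [:0, 1:] * z) (n + 1) c"
proof -
  obtain a b m k where z: "z = Fract a b" "extremal R a m" "extremal R b k"
     "coeff b k \<noteq> 0" "int m = int k + n" "coeff a m = c * coeff b k"
    using assms(1) by (auto simp: has_lead_def)
  have "to_fract [:0, 1:] * z = Fract (pCons 0 a) b" using z(4) by (auto simp: z(1) to_fract_def)
  then show ?thesis unfolding has_lead_def using z extremal_x[OF R z(2)]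
    by (intro exI[of _ "pCons 0 a"] exI[of _ b] exI[of _ "Suc m"] exI[of _ k]) auto
qed

lemma has_lead_x_inverse:
  assumes "has_lead R z n c" shows "has_lead R (inverse (to_fract [:0, 1:]) * z) (n - 1) c"
proof -
  obtain a b m k where z: "z = Fract a b" "extremal R a m" "extremal R b k"
     "coeff b k \<noteq> 0" "int m = int k + n" "coeff a m = c * coeff b k"
    using assms(1) by (auto simp: has_lead_def)
  have "inverse (to_fract [:0, 1:]) * z = Fract a (pCons 0 b)"
    using z(4) by (auto simp: z(1) to_fract_def)
  then show ?thesis unfolding has_lead_def using z extremal_x[OF R z(3)]
    by (intro exI[of _ a] exI[of _ "pCons 0 b"] exI[of _ m] exI[of _ "Suc k"]) auto
qed

lemma has_lead_theta:
  assumes "has_lead R z n c"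
  shows "has_lead R (to_fract [:0, 1:] * fract_deriv z) n (of_int n * c)"
proof -
  obtain a b m k where z: "z = Fract a b" "extremal R a m" "extremal R b k"
     "coeff b k \<noteq> 0" "int m = int k + n" "coeff a m = c * coeff b k"
    using assms(1) by (auto simp: has_lead_def)
  let ?a = "pCons 0 (pderiv a)" and ?b = "pCons 0 (pderiv b)"
  have b: "b \<noteq> 0" using z(4) by auto
  have e: "to_fract [:0, 1:] * fract_deriv z = Fract (?a * b + a * (- ?b)) (b * b)"
    using b by (simp add: z(1) to_fract_def fract_deriv_Fract eq_fract algebra_simps)
  have bm: "extremal R (- ?b) k" using extremal_theta[OF z(3)] by (simp only: extremal_def coeff_minus) simp
  note 1 = extremal_mult[OF R extremal_theta[OF z(2)] z(3)] and 2 = extremal_mult[OF R z(2) bm]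
    and 3 = extremal_mult[OF R z(3) z(3)]
  have mk: "(of_nat m :: complex) = of_nat k + of_int n"
    using arg_cong[OF z(5), of of_int] by simp
  have "coeff (?a * b + a * (- ?b)) (m + k) = of_int n * c * coeff (b * b) (k + k)"
    using 1 2 3 by (simp only: coeff_add coeff_theta coeff_minus z(6) mk) (simp add: algebra_simps)
  moreover have "extremal R (?a * b + a * (- ?b)) (m + k)"
    using 1 2 by (blast intro: extremal_add)
  moreover have "coeff (b * b) (k + k) \<noteq> 0" "int (m + k) = int (k + k) + n" using 3 z(4,5) by auto
  ultimately show ?thesis
    unfolding has_lead_def e using 3 by blast
qed

lemma has_lead_0:
  assumes "has_lead R 0 n c" shows "c = 0"
proof -
  obtain a b m k where z: "0 = Fract a b" "coeff b k \<noteq> 0" "coeff a m = c * coeff b k"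
    using assms by (auto simp: has_lead_def)
  then have "b \<noteq> 0" by auto
  then have "a = 0" using z(1) by (simp add: Zero_fract_def eq_fract)
  then show ?thesis using z(2,3) by simp
qed

text \<open>For \<eta> = \<open>d / x\<close> and \<open>z = x^n\<close> one has \<eta>
  \<open>z - z' = (d - n) x^(n - 1)\<close>.\<close>

lemma has_lead_ract_d:
  assumes "has_lead R z n c"
  shows "has_lead R (ract1 (rconst d * inverse (to_fract [:0, 1:])) z) (n - 1) ((d - of_int n) * c)"
proof -
  let ?X = "to_fract [:0, 1:] :: ratfun"
  have X: "?X \<noteq> 0" by simp
  have "ract1 (rconst d * inverse ?X) z
      = inverse ?X * (rconst d * z + rconst (- 1) * (?X * fract_deriv z))"
    using X by (simp add: ract1_def field_simps rconst_simps)
  moreover have "d * c + - 1 * (of_int n * c) = (d - of_int n) * c" by (simp add: algebra_simps)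
  ultimately show ?thesis
    using has_lead_x_inverse[OF has_lead_add[OF has_lead_rconst[OF assms, of d]
          has_lead_rconst[OF has_lead_theta[OF assms], of "- 1"]]]
    by simp
qed

text \<open>\<theta> acts from the right as multiplication by \<open>x\<close> followed by the
  action of \<partial>, hence on \<open>x^n\<close> as the scalar
  \<open>d - (n + 1)\<close>.\<close>

lemma has_lead_ract_thp:
  assumes "has_lead R z n c"
  shows "has_lead R (ract (rconst d * inverse (to_fract [:0, 1:])) z (thp p)) n (poly p (d - 1 - of_int n) * c)"
proof (induction p)
  case 0
  show ?case using has_lead_rconst[OF assms, of 0] by simp
next
  case (pCons a p)
  let ?\<eta> = "rconst d * inverse (to_fract [:0, 1:])"
  let ?y = "ract ?\<eta> z (thp p)"
  have "ract ?\<eta> z (thp (pCons a p)) = rconst a * z + ract1 ?\<eta> (to_fract [:0, 1:] * ?y)"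
    by (simp add: thp_pCons ract_add op_const_def ract_ratfun op_theta_eq op_x_def ract_mult ract_mult_d
        mult.commute ract_mult_d[of _ _ 1, simplified] flip: mult.assoc)
  moreover have "a * c + (d - of_int (n + 1)) * (poly p (d - 1 - of_int n) * c)
      = poly (pCons a p) (d - 1 - of_int n) * c"
    by (simp add: algebra_simps)
  ultimately show ?case
    using has_lead_add[OF has_lead_rconst[OF assms, of a] has_lead_ract_d[OF has_lead_x[OF pCons.IH], of d, simplified]]
    by simp
qed

end

lemma has_lead_exists:
  assumes "z \<noteq> 0" and R: "R = (<) \<or> R = (>)"
  shows "\<exists>n c. c \<noteq> 0 \<and> has_lead R z n c"
proof -
  have ex: "\<exists>m. extremal R p m \<and> coeff p m \<noteq> 0" if "p \<noteq> 0" for p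
    using R
  proof
    assume "R = (<)"
    then show ?thesis using that
      by (intro exI[of _ "degree p"]) (simp add: extremal_def coeff_eq_0)
  next
    assume "R = (>)"
    define m where "m = (LEAST m. coeff p m \<noteq> 0)"
    have "\<exists>m. coeff p m \<noteq> 0" using that by (meson leading_coeff_0_iff)
    then have "coeff p m \<noteq> 0" unfolding m_def by (rule LeastI_ex)
    moreover have "coeff p i = 0" if "i < m" for i
      using not_less_Least[of i "\<lambda>m. coeff p m \<noteq> 0"] that by (simp add: m_def)
    ultimately show ?thesis using \<open>R = (>)\<close> by (auto simp: extremal_def)
  qed
  obtain a b where z: "z = Fract a b" "b \<noteq> 0" by (cases z)
  then have "a \<noteq> 0" using assms(1) by (auto simp: Zero_fract_def eq_fract)
  then obtain m k where "extremal R a m" "coeff a m \<noteq> 0" "extremal R b k" "coeff b k \<noteq> 0"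
    using ex z(2) by metis
  then show ?thesis unfolding has_lead_def
    by (intro exI[of _ "int m - int k"] exI[of _ "coeff a m / coeff b k"] conjI exI[of _ a] exI[of _ b]
        exI[of _ m] exI[of _ k]) (auto simp: z)
qed

lemma has_lead_weaken:
  assumes "has_lead (<) z n c" "n < n'" shows "has_lead (<) z n' 0"
proof -
  obtain a b m k where z: "z = Fract a b" "extremal (<) a m" "extremal (<) b k"
     "coeff b k \<noteq> 0" "int m = int k + n" "coeff a m = c * coeff b k"
    using assms(1) by (auto simp: has_lead_def)
  then show ?thesis unfolding has_lead_def using assms(2)
    by (intro exI[of _ a] exI[of _ b] exI[of _ "nat (int k + n')"] exI[of _ k]) (auto simp: extremal_def)
qed

lemma has_lead_weaken_0:
  assumes "has_lead (>) z n c" "n' < n" shows "has_lead (>) z n' 0"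
proof -
  obtain a b m k where z: "z = Fract a b" "extremal (>) a m" "extremal (>) b k"
     "coeff b k \<noteq> 0" "int m = int k + n" "coeff a m = c * coeff b k"
    using assms(1) by (auto simp: has_lead_def)
  \<comment> \<open>Exponents in \<open>has_lead\<close> are natural numbers, while
    \<open>n'\<close> may be negative. Expanding the fraction by \<open>x^N\<close> leaves enough
    room.\<close>
  define N where "N = nat \<bar>n'\<bar>"
  have xN: "extremal (>) (monom 1 N) N" by (auto simp: extremal_def)
  have b': "extremal (>) (b * monom 1 N) (k + N)" "coeff (b * monom 1 N) (k + N) \<noteq> 0"
    using extremal_mult[OF _ z(3) xN] z(4) by auto
  have a': "extremal (>) (a * monom 1 N) (m + N)" using extremal_mult[OF _ z(2) xN] by auto
  have "b \<noteq> 0" "monom (1 :: complex) N \<noteq> 0" using z(4) by auto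
  then have "z = Fract (a * monom 1 N) (b * monom 1 N)" by (simp add: z(1) eq_fract)
  moreover have "nat (int (k + N) + n') < m + N" "int (k + N) + n' \<ge> 0"
    using assms(2) z(5) by (auto simp: N_def)
  ultimately show ?thesis unfolding has_lead_def using a' b'
    by (intro exI[of _ "a * monom 1 N"] exI[of _ "b * monom 1 N"] exI[of _ "nat (int (k + N) + n')"]
        exI[of _ "k + N"]) (auto simp: extremal_def)
qed

text \<open>Here \<eta> = 0. At infinity every \<partial> lowers the exponent, so \<open>T0\<close>
  alone decides the coefficient at the exponent \<open>n\<close> of \<open>z\<close>, and it
  contributes the factor \<open>T0(- 1 - n)\<close>.\<close>

lemma cancel_op_d:
  assumes "op_d * B \<in> left_ideal (lop [T0, T1, T2, T3])" "\<And>n. poly T0 (of_int n) \<noteq> 0"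
  shows "B \<in> left_ideal (lop [T0, T1, T2, T3])"
proof (rule left_cancel_first_order[of 0])
  show "(op_d - op_ratfun 0) * B \<in> left_ideal (lop [T0, T1, T2, T3])" using assms(1) by simp
next
  fix z :: ratfun assume "z \<noteq> 0"
  then obtain n c where nc: "c \<noteq> 0" "has_lead (<) z n c" using has_lead_exists by metis
  have R: "((<) :: nat \<Rightarrow> nat \<Rightarrow> bool) = (<) \<or> ((<) :: nat \<Rightarrow> nat \<Rightarrow> bool) = (>)" by simp
  note th = has_lead_ract_thp[OF R _, of _ _ _ 0, simplified] and dd = has_lead_ract_d[OF R _, of _ _ _ 0, simplified]
  have 1: "has_lead (<) (ract1 0 (ract 0 z (thp T1))) n 0"
    by (rule has_lead_weaken[OF dd[OF th[OF nc(2)]]]) simp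
  have 2: "has_lead (<) (ract1 0 (ract1 0 (ract 0 z (thp T2)))) n 0"
    by (rule has_lead_weaken[OF dd[OF dd[OF th[OF nc(2)]]]]) simp
  have 3: "has_lead (<) (ract1 0 (ract1 0 (ract1 0 (ract 0 z (thp T3))))) n 0"
    by (rule has_lead_weaken[OF dd[OF dd[OF dd[OF th[OF nc(2)]]]]]) simp
  have "ract 0 z (lop [T0, T1, T2, T3]) = ract 0 z (thp T0) + (ract1 0 (ract 0 z (thp T1))
      + (ract1 0 (ract1 0 (ract 0 z (thp T2))) + ract1 0 (ract1 0 (ract1 0 (ract 0 z (thp T3))))))"
    by (simp add: ract_add ract_mult_d ract1_add)
  then have "has_lead (<) (ract 0 z (lop [T0, T1, T2, T3])) n (poly T0 (- 1 - of_int n) * c)"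
    using has_lead_add[OF R th[OF nc(2)] has_lead_add[OF R 1 has_lead_add[OF R 2 3]]] by simp
  moreover have "poly T0 (- 1 - of_int n) \<noteq> 0" using assms(2)[of "- 1 - n"] by simp
  ultimately show "ract 0 z (lop [T0, T1, T2, T3]) \<noteq> 0"
    using has_lead_0[OF R] nc(1) by fastforce
qed

text \<open>The same argument at \<open>x = 0\<close>: only the term with \<partial>^3 reaches the
  exponent \<open>n - 3\<close>, with the factors \<open>c - n\<close>, \<open>c - n + 1\<close>,
  \<open>c - n + 2\<close> and \<open>T3(c - 1 - n)\<close>. The first three are the reason for
  \<open>c\<close> not being an integer.\<close>

lemma cancel_theta:
  assumes "(op_theta - op_const c) * B \<in> left_ideal (lop [T0, T1, T2, T3])"
    "\<And>n. poly T3 (c + of_int n) \<noteq> 0" "c \<notin> \<int>"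
  shows "B \<in> left_ideal (lop [T0, T1, T2, T3])"
proof (rule left_cancel_first_order[of "rconst c * inverse (to_fract [:0, 1:])"])
  let ?X = "to_fract [:0, 1:] :: ratfun" and ?\<eta> = "rconst c * inverse (to_fract [:0, 1:])"
  have X: "?X \<noteq> 0" by simp
  \<comment> \<open>\<theta> - \<open>c\<close> is \<open>x\<close> times \<partial> -
    \<open>c / x\<close>, so it can be treated by \<open>left_cancel_first_order\<close>.\<close>
  have "op_d - op_ratfun ?\<eta> = op_ratfun (inverse ?X) * (op_theta - op_const c)"
    using X by (simp add: op_theta_def op_const_def right_diff_distrib mult.commute
        flip: op_ratfun_mult mult.assoc)
  then show "(op_d - op_ratfun ?\<eta>) * B \<in> left_ideal (lop [T0, T1, T2, T3])"
    using left_ideal_mult[OF assms(1)] by (simp add: mult.assoc)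
next
  let ?\<eta> = "rconst c * inverse (to_fract [:0, 1:])"
  fix z :: ratfun assume "z \<noteq> 0"
  then obtain n \<zeta> where nc: "\<zeta> \<noteq> 0" "has_lead (>) z n \<zeta>" using has_lead_exists by metis
  have R: "((>) :: nat \<Rightarrow> nat \<Rightarrow> bool) = (<) \<or> ((>) :: nat \<Rightarrow> nat \<Rightarrow> bool) = (>)" by simp
  note th = has_lead_ract_thp[OF R _, of _ _ _ c] and dd = has_lead_ract_d[OF R _, of _ _ _ c]
  have 0: "has_lead (>) (ract ?\<eta> z (thp T0)) (n - 3) 0"
    by (rule has_lead_weaken_0[OF th[OF nc(2)]]) simp
  have 1: "has_lead (>) (ract1 ?\<eta> (ract ?\<eta> z (thp T1))) (n - 3) 0"
    by (rule has_lead_weaken_0[OF dd[OF th[OF nc(2)]]]) simp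
  have 2: "has_lead (>) (ract1 ?\<eta> (ract1 ?\<eta> (ract ?\<eta> z (thp T2)))) (n - 3) 0"
    by (rule has_lead_weaken_0[OF dd[OF dd[OF th[OF nc(2)]]]]) simp
  have 3: "has_lead (>) (ract1 ?\<eta> (ract1 ?\<eta> (ract1 ?\<eta> (ract ?\<eta> z (thp T3))))) (n - 3)
     ((c - of_int (n - 1 - 1)) * ((c - of_int (n - 1)) * ((c - of_int n) * (poly T3 (c - 1 - of_int n) * \<zeta>))))"
    using dd[OF dd[OF dd[OF th[OF nc(2)]]]] by simp
  have "ract ?\<eta> z (lop [T0, T1, T2, T3]) = ract ?\<eta> z (thp T0) + (ract1 ?\<eta> (ract ?\<eta> z (thp T1))
      + (ract1 ?\<eta> (ract1 ?\<eta> (ract ?\<eta> z (thp T2))) + ract1 ?\<eta> (ract1 ?\<eta> (ract1 ?\<eta> (ract ?\<eta> z (thp T3))))))"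
    by (simp add: ract_add ract_mult_d ract1_add)
  then have "has_lead (>) (ract ?\<eta> z (lop [T0, T1, T2, T3])) (n - 3)
     ((c - of_int (n - 1 - 1)) * ((c - of_int (n - 1)) * ((c - of_int n) * (poly T3 (c - 1 - of_int n) * \<zeta>))))"
    using has_lead_add[OF R 0 has_lead_add[OF R 1 has_lead_add[OF R 2 3]]] by simp
  moreover have "poly T3 (c - 1 - of_int n) \<noteq> 0" using assms(2)[of "- 1 - n"] by (simp add: algebra_simps)
  moreover have "c - of_int k \<noteq> 0" for k using assms(3) by auto
  ultimately show "ract ?\<eta> z (lop [T0, T1, T2, T3]) \<noteq> 0"
    using has_lead_0[OF R] nc(1) by (metis mult_eq_0_iff)
qed

section \<open>The reflection \<open>x \<mapsto> 1 - x\<close>\<close>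

definition rflip :: "ratfun \<Rightarrow> ratfun" where
  "rflip f = (let (n, d) = quot_of_fract f in Fract (pcompose n [:1, - 1:]) (pcompose d [:1, - 1:]))"

lemma pcompose_flip_nz: "d \<noteq> 0 \<Longrightarrow> pcompose d [:1, - 1 :: complex:] \<noteq> 0"
  using pcompose_eq_0[of d "[:1, - 1:]"] by auto

lemma rflip_Fract:
  assumes "d \<noteq> 0"
  shows "rflip (Fract n d) = Fract (pcompose n [:1, - 1:]) (pcompose d [:1, - 1:])"
proof -
  obtain a b where ab: "quot_of_fract (Fract n d) = (a, b)" by fastforce
  have b: "b \<noteq> 0" using snd_quot_of_fract_nonzero[of "Fract n d"] ab by simp
  have "Fract a b = Fract n d" using Fract_quot_of_fract[of "Fract n d"] ab by simp
  with assms b have "a * d = n * b" by (simp add: eq_fract)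
  then have "pcompose (a * d) [:1, - 1:] = pcompose (n * b) [:1, - 1:]" by simp
  with assms b show ?thesis
    by (simp add: rflip_def ab eq_fract pcompose_flip_nz pcompose_mult)
qed

lemma rflip_add: "rflip (p + q) = rflip p + rflip q"
  by (cases p, cases q) (simp add: rflip_Fract pcompose_flip_nz pcompose_add pcompose_mult)

lemma rflip_mult: "rflip (p * q) = rflip p * rflip q"
  by (cases p, cases q) (simp add: rflip_Fract pcompose_flip_nz pcompose_mult)

lemma rflip_to_fract: "rflip (to_fract p) = to_fract (pcompose p [:1, - 1:])"
proof -
  have "pcompose 1 [:1, - 1:] = (1 :: complex poly)" by (metis one_pCons pcompose_const)
  then show ?thesis by (simp add: to_fract_def rflip_Fract)
qed

lemma rflip_0 [simp]: "rflip 0 = 0"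
  using rflip_to_fract[of 0] by simp

lemma fract_deriv_rflip: "fract_deriv (rflip f) = - rflip (fract_deriv f)"
proof (cases f)
  case (Fract n d)
  then show ?thesis
    by (simp add: rflip_Fract pcompose_flip_nz fract_deriv_Fract pderiv_pcompose pderiv_pCons
        pcompose_mult pcompose_diff eq_fract algebra_simps)
qed

text \<open>The ring automorphism induced by \<open>x \<mapsto> 1 - x\<close>, under which
  \<partial> becomes - \<partial>. Multiplicativity is \<open>oflip_mult\<close>.\<close>

definition oflip :: "diffop \<Rightarrow> diffop" where
  "oflip P = (\<Sum>i\<le>op_order P. op_ratfun (rflip (op_coeff P i)) * (- op_d) ^ i)"

lemma oflip_le: "op_order P \<le> n \<Longrightarrow>
    oflip P = (\<Sum>i\<le>n. op_ratfun (rflip (op_coeff P i)) * (- op_d) ^ i)"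
  unfolding oflip_def by (rule sum.mono_neutral_left) (auto simp: op_coeff_eq_0)

lemma oflip_add: "oflip (P + Q) = oflip P + oflip Q"
proof -
  let ?n = "max (op_order P) (op_order Q)"
  have "op_order (P + Q) \<le> ?n" by (rule op_order_add_le) auto
  then show ?thesis
    by (simp add: oflip_le[where n = ?n] op_coeff_add rflip_add op_ratfun_add distrib_right sum.distrib)
qed

lemma oflip_ratfun: "oflip (op_ratfun a) = op_ratfun (rflip a)"
  by (simp add: oflip_def op_coeff_ratfun)

lemma oflip_0 [simp]: "oflip 0 = 0"
  using oflip_ratfun[of 0] by simp

lemma oflip_uminus: "oflip (- P) = - oflip P"
  using oflip_add[of P "- P"] by (simp add: eq_neg_iff_add_eq_0 add.commute)

lemma oflip_diff: "oflip (P - Q) = oflip P - oflip Q"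
  using oflip_add[of P "- Q"] by (simp add: oflip_uminus)

lemma oflip_ratfun_mult: "oflip (op_ratfun a * P) = op_ratfun (rflip a) * oflip P"
proof -
  have "op_order (op_ratfun a * P) \<le> op_order P"
    using op_order_mult_le[of "op_ratfun a" 0 P "op_order P"] by simp
  then show ?thesis
    by (simp add: oflip_le[where n = "op_order P"] op_coeff_ratfun_mult rflip_mult op_ratfun_mult
        sum_distrib_left mult.assoc)
qed

lemma oflip_mult_d: "oflip (P * op_d) = - (oflip P * op_d)"
proof -
  have "op_order (P * op_d) \<le> Suc (op_order P)"
    using op_order_mult_le[of P "op_order P" op_d 1] by simp
  then have "oflip (P * op_d)
      = (\<Sum>i\<le>Suc (op_order P). op_ratfun (rflip (op_coeff (P * op_d) i)) * (- op_d) ^ i)"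
    by (rule oflip_le)
  also have "\<dots> = (\<Sum>i\<le>op_order P. op_ratfun (rflip (op_coeff P i)) * ((- op_d) ^ i * (- op_d)))"
    by (subst sum.atMost_Suc_shift) (simp add: op_coeff_mult_d power_commutes del: mult_minus_left mult_minus_right)
  also have "\<dots> = oflip P * (- op_d)"
    by (simp add: oflip_def sum_distrib_right sum_negf mult.assoc)
  finally show ?thesis by simp
qed

lemma oflip_d_mult: "oflip (op_d * P) = - (op_d * oflip P)"
proof (induction P rule: diffop_induct)
  case (step a P)
  let ?r = "op_ratfun (rflip a)" and ?r' = "op_ratfun (rflip (fract_deriv a))"
  have 1: "op_d * (op_ratfun a + P * op_d)
      = op_ratfun a * op_d + op_ratfun (fract_deriv a) + (op_d * P) * op_d"
    by (simp add: distrib_left op_d_ratfun mult.assoc)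
  have 2: "oflip (op_d * (op_ratfun a + P * op_d)) = - (?r * op_d) + ?r' + op_d * oflip P * op_d"
    unfolding 1 oflip_add oflip_mult_d oflip_ratfun step by simp
  have 3: "oflip (op_ratfun a + P * op_d) = ?r - oflip P * op_d"
    by (simp add: oflip_add oflip_mult_d oflip_ratfun)
  have 4: "op_d * ?r = ?r * op_d - ?r'"
    by (simp add: op_d_ratfun fract_deriv_rflip op_ratfun_uminus)
  show ?case unfolding 2 3 right_diff_distrib 4 by (simp add: mult.assoc)
qed simp

lemma oflip_mult: "oflip (P * Q) = oflip P * oflip Q"
proof (induction P arbitrary: Q rule: diffop_induct)
  case (step a P)
  then show ?case
    using step[of "op_d * Q"]
    by (simp add: distrib_right left_diff_distrib mult.assoc oflip_add oflip_ratfun_mult oflip_ratfun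
        oflip_mult_d oflip_d_mult)
qed simp

lemma oflip_op_const [simp]: "oflip (op_const c) = op_const c"
  by (simp add: op_const_def oflip_ratfun rflip_to_fract pcompose_pCons)

lemma oflip_1 [simp]: "oflip 1 = 1"
  using oflip_op_const[of 1] by (simp add: op_const_simps del: oflip_op_const)

lemma oflip_d: "oflip op_d = - op_d"
  using oflip_mult_d[of 1] by simp

lemma oflip_theta: "oflip op_theta = op_theta - op_d"
proof -
  have "oflip op_x = 1 - op_x"
    by (simp add: op_x_def oflip_ratfun rflip_to_fract pcompose_pCons one_pCons
        flip: op_ratfun_1 op_ratfun_diff to_fract_1 to_fract_poly_simps)
  then have "oflip op_theta = (1 - op_x) * - op_d"
    by (simp only: op_theta_eq oflip_mult oflip_d)
  then show ?thesis by (simp add: op_theta_eq left_diff_distrib)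
qed

lemma op_order_oflip: "op_order (oflip P) \<le> op_order P"
proof -
  have d: "op_order ((- op_d) ^ i) \<le> i" for i
  proof (induction i)
    case 0
    then show ?case using op_order_ratfun[of 1] by simp
  next
    case (Suc i)
    have "op_order (- op_d) \<le> 1" using op_order_diff_le[of 0 1 op_d] by simp
    then show ?case using op_order_mult_le[OF _ Suc, of "- op_d" 1] by simp
  qed
  have "op_order (op_ratfun a * (- op_d) ^ i) \<le> n" if "i \<le> n" for a i n
    using op_order_mult_le[OF _ d[of i], of "op_ratfun a" 0] that by simp
  then have "op_order (\<Sum>i\<le>m. op_ratfun (rflip (op_coeff P i)) * (- op_d) ^ i) \<le> n" if "m \<le> n" for m n
    using that by (induction m) (auto intro!: op_order_add_le simp del: power_Suc)
  then show ?thesis by (simp add: oflip_def)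
qed

lemma oflip_left_ideal: "P \<in> left_ideal L \<Longrightarrow> oflip P \<in> left_ideal (oflip L)"
  by (auto simp: left_ideal_iff oflip_mult)

lemma pfam_oflip: "pfam op_const F \<Longrightarrow> pfam op_const (\<lambda>v. oflip (F v))"
  by (rule pfam_linear_image) (simp_all add: oflip_add oflip_mult)

section \<open>Intertwining operators\<close>

type_synonym dfpoly = "complex \<Rightarrow> complex \<Rightarrow> complex \<Rightarrow> complex \<Rightarrow> complex \<Rightarrow> complex poly"

text \<open>
  Polynomials in \<open>w = \<theta> - r - p\<close>; all but \<open>be\<close> were found by interpolation.  The coefficients of \<open>SE\<^sub>6\<close> are \<open>be\<close>, those
  of the operators intertwining it with the shifts up and down of \<open>a, c, g\<close> are \<open>ma, mc, mg\<close> and \<open>na, nc, ng\<close>.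
  With an additional \<open>k\<close> they denote the left factors on the other side of the intertwining relation, and
  \<open>ja, jc, jg\<close> are the quotients of the composites by \<open>SE\<^sub>6\<close>.
\<close>

definition be0 :: dfpoly where
  "be0 a b c g q = [:- 2*c - q - 1, 1:] * [:- a - b - 2*c - g - q - 2, 1:] * [:- 2*a - 2*b - 2*c - g - q - 3, 1:]"

definition be1 :: dfpoly where
"be1 a b c g q = [:8*a^2*c + 4*a^2*q + 12*a*b*c + 4*a*b*q + 20*a*c^2 + 10*a*c*g + 16*a*c*q +
    4*a*g*q + 3*a*q^2 + 4*b^2*c + 16*b*c^2 + 8*b*c*g + 8*b*c*q + 2*b*g*q + 12*c^3 + 12*c^2*g +
    12*c^2*q + 3*c*g^2 + 8*c*g*q + 3*c*q^2 + g^2*q + g*q^2 + 14*a*c + 5*a*q + 10*b*c + 18*c^2 +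
    9*c*g + 9*c*q + 2*g*q + 6*c, - 6*a^2 - 8*a*b - 28*a*c - 7*a*g - 12*a*q - 2*b^2 - 20*b*c -
    5*b*g - 6*b*q - 24*c^2 - 16*c*g - 18*c*q - 2*g^2 - 6*g*q - 3*q^2 - 12*a - 7*b - 27*c - 7*g -
    9*q - 6, 9*a + 6*b + 15*c + 5*g + 6*q + 9, - 3:]"

definition be2 :: dfpoly where
"be2 a b c g q = [:- 4*a^2*c - 2*a^2*q - 4*a*b*c - 8*a*c^2 - 4*a*c*g - 4*a*c*q - a*g*q - 4*b*c^2
    - 2*b*c*g - 4*c^3 - 4*c^2*g - 2*c^2*q - c*g^2 - c*g*q + 6*a^2 + 4*a*b + 14*a*c + 5*a*g +
    5*a*q + 6*b*c + 2*b*g + 8*c^2 + 6*c*g + 5*c*q + g^2 + 2*g*q + 3*a + 5*c + g, 6*a^2 + 4*a*b +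
    20*a*c + 5*a*g + 6*a*q + 8*b*c + 2*b*g + 14*c^2 + 9*c*g + 6*c*q + g^2 + 2*g*q - 6*a - 3*b -
    5*c - 3*g - 3*q - 3, - 9*a - 3*b - 12*c - 4*g - 3*q, 3:]"

definition be3 :: dfpoly where
  "be3 a b c g q = - ([:2, 1:] * [:1 - a - c, 1:] * [:- 2*a - 2*c - g, 1:])"

definition ma0 :: dfpoly where
"ma0 a b c g q = [:2*a*c + a*q + 2*b*c + b*q + 4*c^2 + 2*c*g + 4*c*q + g*q + q^2 + a + b + 6*c +
    g + 3*q + 2, - a - b - 4*c - g - 2*q - 3, 1:]"

definition ma1 :: dfpoly where
"ma1 a b c g q = [:- 6*a*c - 3*a*q - 2*b*c - 6*c^2 - 3*c*g - 3*c*q - g*q - 6*c - 2*q, 4*a + b +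
    7*c + 2*g + 2*q + 4, - 2:]"

definition ma2 :: dfpoly where
"ma2 a b c g q = [:2*a^2 + 4*a*c + a*g + 2*c^2 + c*g + a + c, - 3*a - 3*c - g - 1, 1:]"

definition mak0 :: dfpoly where
"mak0 a b c g q = [:2*a*c + a*q + 2*b*c + b*q + 4*c^2 + 2*c*g + 4*c*q + g*q + q^2 - a - b - g -
    1, - a - b - 4*c - g - 2*q, 1:]"

definition mak1 :: dfpoly where
"mak1 a b c g q = [:- 6*a*c - 3*a*q - 2*b*c - 6*c^2 - 3*c*g - 3*c*q - g*q + 7*a + 2*b + 5*c +
    4*g + q + 3, 4*a + b + 7*c + 2*g + 2*q - 2, - 2:]"

definition mak2 :: dfpoly where
"mak2 a b c g q = [:2*a^2 + 4*a*c + a*g + 2*c^2 + c*g - 4*a - 4*c - 2*g, - 3*a - 3*c - g + 2,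
    1:]"

definition mc0 :: dfpoly where
"mc0 a b c g q = [:2*a^2 + 4*a*b + 10*a*c + 3*a*g + 3*a*q + 2*b^2 + 10*b*c + 3*b*g + 3*b*q +
    10*c^2 + 7*c*g + 6*c*q + g^2 + 2*g*q + q^2 + 11*a + 11*b + 24*c + 8*g + 7*q + 14, - 3*a -
    3*b - 6*c - 2*g - 2*q - 7, 1:]"

definition mc1 :: dfpoly where
"mc1 a b c g q = [:- 4*a^2 - 4*a*b - 14*a*c - 4*a*g - 3*a*q - 6*b*c - 2*b*g - 10*c^2 - 7*c*g -
    3*c*q - g^2 - g*q - 12*a - 4*b - 18*c - 6*g - 2*q - 8, 6*a + 3*b + 9*c + 3*g + 2*q + 8, -
    2:]"

definition mc2 :: dfpoly where
"mc2 a b c g q = [:2*a^2 + 4*a*c + a*g + 2*c^2 + c*g + a + c, - 3*a - 3*c - g - 1, 1:]"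

definition mck0 :: dfpoly where
"mck0 a b c g q = [:2*a^2 + 4*a*b + 10*a*c + 3*a*g + 3*a*q + 2*b^2 + 10*b*c + 3*b*g + 3*b*q +
    10*c^2 + 7*c*g + 6*c*q + g^2 + 2*g*q + q^2 + 11*a + 11*b + 24*c + 8*g + 7*q + 14, - 3*a -
    3*b - 6*c - 2*g - 2*q - 7, 1:]"

definition mck1 :: dfpoly where
"mck1 a b c g q = [:- 4*a^2 - 4*a*b - 14*a*c - 4*a*g - 3*a*q - 6*b*c - 2*b*g - 10*c^2 - 7*c*g -
    3*c*q - g^2 - g*q - 7*a - 9*c - 3*g + q + 1, 6*a + 3*b + 9*c + 3*g + 2*q + 5, - 2:]"

definition mck2 :: dfpoly where
"mck2 a b c g q = [:2*a^2 + 4*a*c + a*g + 2*c^2 + c*g - 4*a - 4*c - 2*g, - 3*a - 3*c - g + 2,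
    1:]"

definition mg0 :: dfpoly where
"mg0 a b c g q = [:8*a^2*c + 4*a^2*q + 16*a*b*c + 8*a*b*q + 16*a*c^2 + 16*a*c*g + 12*a*c*q +
    8*a*g*q + 2*a*q^2 + 8*b^2*c + 4*b^2*q + 16*b*c^2 + 16*b*c*g + 12*b*c*q + 8*b*g*q + 2*b*q^2 +
    8*c^3 + 20*c^2*g + 8*c^2*q + 8*c*g^2 + 16*c*g*q + 2*c*q^2 + 4*g^2*q + 3*g*q^2 + 4*a^2 +
    8*a*b + 44*a*c + 8*a*g + 20*a*q + 4*b^2 + 44*b*c + 8*b*g + 20*b*q + 44*c^2 + 46*c*g + 34*c*q
    + 4*g^2 + 21*g*q + 6*q^2 + 18*a + 18*b + 60*c + 18*g + 26*q + 20, - 4*a^2 - 8*a*b - 12*a*c -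
    8*a*g - 4*a*q - 4*b^2 - 12*b*c - 8*b*g - 4*b*q - 8*c^2 - 16*c*g - 4*c*q - 4*g^2 - 6*g*q -
    20*a - 20*b - 34*c - 21*g - 12*q - 26, 2*a + 2*b + 2*c + 3*g + 6:]"

definition mg1 :: dfpoly where
"mg1 a b c g q = [:- 8*a^2*c - 4*a^2*q - 16*a*b*c - 4*a*b*q - 16*a*c^2 - 20*a*c*g - 8*a*c*q -
    8*a*g*q - 8*b^2*c - 16*b*c^2 - 12*b*c*g - 4*b*c*q - 8*c^3 - 20*c^2*g - 4*c^2*q - 8*c*g^2 -
    8*c*g*q - 2*g^2*q - 36*a*c - 14*a*q - 28*b*c - 36*c^2 - 30*c*g - 14*c*q - 6*g*q - 28*c -
    4*q, 8*a^2 + 12*a*b + 20*a*c + 16*a*g + 4*a*q + 4*b^2 + 16*b*c + 8*b*g + 4*b*q + 12*c^2 +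
    24*c*g + 4*c*q + 6*g^2 + 6*g*q + 32*a + 18*b + 46*c + 24*g + 12*q + 24, - 4*a - 4*b - 4*c -
    6*g - 12:]"

definition mg2 :: dfpoly where
"mg2 a b c g q = [:- 4*a*b*g - 2*a*g^2 - 4*b*c*g - 2*b*g^2 - 2*c*g^2 - g^3 - 4*a^2 - 8*a*b -
    8*a*c - 14*a*g - 8*b*c - 6*b*g - 4*c^2 - 14*c*g - 7*g^2 - 18*a - 4*b - 18*c - 14*g - 8, -
    4*a^2 - 4*a*b - 8*a*c - 8*a*g - 4*b*c - 4*c^2 - 8*c*g - 2*g^2 - 12*a + 2*b - 12*c - 3*g + 2,
    2*a + 2*b + 2*c + 3*g + 6:]"

definition mgk0 :: dfpoly where
"mgk0 a b c g q = [:8*a^2*c + 4*a^2*q + 16*a*b*c + 8*a*b*q + 16*a*c^2 + 16*a*c*g + 12*a*c*q +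
    8*a*g*q + 2*a*q^2 + 8*b^2*c + 4*b^2*q + 16*b*c^2 + 16*b*c*g + 12*b*c*q + 8*b*g*q + 2*b*q^2 +
    8*c^3 + 20*c^2*g + 8*c^2*q + 8*c*g^2 + 16*c*g*q + 2*c*q^2 + 4*g^2*q + 3*g*q^2 - 4*a^2 -
    8*a*b + 28*a*c - 8*a*g + 16*a*q - 4*b^2 + 28*b*c - 8*b*g + 16*b*q + 36*c^2 + 26*c*g + 30*c*q
    - 4*g^2 + 15*g*q + 6*q^2 - 18*a - 18*b + 20*c - 18*g + 14*q - 20, - 4*a^2 - 8*a*b - 12*a*c -
    8*a*g - 4*a*q - 4*b^2 - 12*b*c - 8*b*g - 4*b*q - 8*c^2 - 16*c*g - 4*c*q - 4*g^2 - 6*g*q -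
    16*a - 16*b - 30*c - 15*g - 12*q - 14, 2*a + 2*b + 2*c + 3*g + 6:]"

definition mgk1 :: dfpoly where
"mgk1 a b c g q = [:- 8*a^2*c - 4*a^2*q - 16*a*b*c - 4*a*b*q - 16*a*c^2 - 20*a*c*g - 8*a*c*q -
    8*a*g*q - 8*b^2*c - 16*b*c^2 - 12*b*c*g - 4*b*c*q - 8*c^3 - 20*c^2*g - 4*c^2*q - 8*c*g^2 -
    8*c*g*q - 2*g^2*q + 20*a^2 + 28*a*b + 4*a*c + 36*a*g - 6*a*q + 8*b^2 + 20*b*g + 8*b*q -
    16*c^2 + 14*c*g - 6*c*q + 14*g^2 + 6*g*q + 70*a + 36*b + 50*c + 48*g + 20*q + 40, 8*a^2 +
    12*a*b + 20*a*c + 16*a*g + 4*a*q + 4*b^2 + 16*b*c + 8*b*g + 4*b*q + 12*c^2 + 24*c*g + 4*c*q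
    + 6*g^2 + 6*g*q + 20*a + 6*b + 34*c + 6*g + 12*q - 12, - 4*a - 4*b - 4*c - 6*g - 12:]"

definition mgk2 :: dfpoly where
"mgk2 a b c g q = [:- 4*a*b*g - 2*a*g^2 - 4*b*c*g - 2*b*g^2 - 2*c*g^2 - g^3 - 16*a^2 - 20*a*b -
    32*a*c - 38*a*g - 20*b*c - 10*b*g - 16*c^2 - 38*c*g - 15*g^2 - 52*a - 52*c - 26*g, - 4*a^2 -
    4*a*b - 8*a*c - 8*a*g - 4*b*c - 4*c^2 - 8*c*g - 2*g^2 - 4*a + 10*b - 4*c + 9*g + 26, 2*a +
    2*b + 2*c + 3*g + 6:]"

definition na0 :: dfpoly where
"na0 a b c g q = [:2*a^2 + 4*a*b + 6*a*c + 3*a*g + 3*a*q + 2*b^2 + 6*b*c + 3*b*g + 3*b*q + 4*c^2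
    + 4*c*g + 4*c*q + g^2 + 2*g*q + q^2 + 7*a + 7*b + 10*c + 5*g + 5*q + 6, - 3*a - 3*b - 4*c -
    2*g - 2*q - 5, 1:]"

definition na1 :: dfpoly where
"na1 a b c g q = [:- 2*a*c - a*q - 2*b*c - 2*c^2 - c*g - c*q - 2*c, 4*a + 3*b + 5*c + 2*g + 2*q
    + 4, - 2:]"

definition na2 :: dfpoly where
"na2 a b c g q = [:- a - c, - a - c + 1, 1:]"

definition nak0 :: dfpoly where
"nak0 a b c g q = [:2*a^2 + 4*a*b + 6*a*c + 3*a*g + 3*a*q + 2*b^2 + 6*b*c + 3*b*g + 3*b*q +
    4*c^2 + 4*c*g + 4*c*q + g^2 + 2*g*q + q^2 + 3*a + 3*b + 4*c + 2*g + 2*q + 1, - 3*a - 3*b -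
    4*c - 2*g - 2*q - 2, 1:]"

definition nak1 :: dfpoly where
"nak1 a b c g q = [:- 2*a*c - a*q - 2*b*c - 2*c^2 - c*g - c*q + 5*a + 4*b + 5*c + 3*g + 3*q + 1,
    4*a + 3*b + 5*c + 2*g + 2*q - 2, - 2:]"

definition nak2 :: dfpoly where
"nak2 a b c g q = [:- 2*a - 2*c + 4, - a - c + 4, 1:]"

definition nc0 :: dfpoly where
"nc0 a b c g q = [:2*a*c + a*q + 2*b*c + b*q + 2*c^2 + c*g + 2*c*q + q^2 + a + b + 4*c + 3*q +
    2, - a - b - 2*c - 2*q - 3, 1:]"

definition nc1 :: dfpoly where
"nc1 a b c g q = [:- 2*a*c - a*q - 2*b*c - 2*c^2 - c*g - c*q - 2*c, 2*a + b + 3*c + 2*q + 2, -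
    2:]"

definition nc2 :: dfpoly where
"nc2 a b c g q = [:- a - c, - a - c + 1, 1:]"

definition nck0 :: dfpoly where
"nck0 a b c g q = [:2*a*c + a*q + 2*b*c + b*q + 2*c^2 + c*g + 2*c*q + q^2 + a + b + 4*c + 3*q +
    2, - a - b - 2*c - 2*q - 3, 1:]"

definition nck1 :: dfpoly where
"nck1 a b c g q = [:- 2*a*c - a*q - 2*b*c - 2*c^2 - c*g - c*q + a + 2*b + c + 3*q + 3, 2*a + b +
    3*c + 2*q - 1, - 2:]"

definition nck2 :: dfpoly where
"nck2 a b c g q = [:- 2*a - 2*c + 4, - a - c + 4, 1:]"

definition ng0 :: dfpoly where
"ng0 a b c g q = [:4*a^3*c + 2*a^3*g + 12*a^2*b*c + 6*a^2*b*g + 12*a^2*c^2 + 16*a^2*c*g +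
    6*a^2*c*q + 5*a^2*g^2 + 3*a^2*g*q + 12*a*b^2*c + 6*a*b^2*g + 24*a*b*c^2 + 32*a*b*c*g +
    12*a*b*c*q + 10*a*b*g^2 + 6*a*b*g*q + 8*a*c^3 + 24*a*c^2*g + 8*a*c^2*q + 18*a*c*g^2 +
    14*a*c*g*q + 2*a*c*q^2 + 4*a*g^3 + 5*a*g^2*q + a*g*q^2 + 4*b^3*c + 2*b^3*g + 12*b^2*c^2 +
    16*b^2*c*g + 6*b^2*c*q + 5*b^2*g^2 + 3*b^2*g*q + 8*b*c^3 + 24*b*c^2*g + 8*b*c^2*q +
    18*b*c*g^2 + 14*b*c*g*q + 2*b*c*q^2 + 4*b*g^3 + 5*b*g^2*q + b*g*q^2 + 8*c^3*g + 12*c^2*g^2 +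
    8*c^2*g*q + 6*c*g^3 + 8*c*g^2*q + 2*c*g*q^2 + g^4 + 2*g^3*q + g^2*q^2 + 14*a^2*c + 7*a^2*g +
    28*a*b*c + 14*a*b*g + 20*a*c^2 + 34*a*c*g + 10*a*c*q + 12*a*g^2 + 5*a*g*q + 14*b^2*c +
    7*b^2*g + 20*b*c^2 + 34*b*c*g + 10*b*c*q + 12*b*g^2 + 5*b*g*q + 20*c^2*g + 20*c*g^2 +
    10*c*g*q + 5*g^3 + 5*g^2*q + 12*a*c + 6*a*g + 12*b*c + 6*b*g + 12*c*g + 6*g^2, - 6*a^2*c -
    3*a^2*g - 12*a*b*c - 6*a*b*g - 8*a*c^2 - 14*a*c*g - 4*a*c*q - 5*a*g^2 - 2*a*g*q - 6*b^2*c -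
    3*b^2*g - 8*b*c^2 - 14*b*c*g - 4*b*c*q - 5*b*g^2 - 2*b*g*q - 8*c^2*g - 8*c*g^2 - 4*c*g*q -
    2*g^3 - 2*g^2*q - 10*a*c - 5*a*g - 10*b*c - 5*b*g - 10*c*g - 5*g^2, 2*a*c + a*g + 2*b*c +
    b*g + 2*c*g + g^2:]"

definition ng1 :: dfpoly where
"ng1 a b c g q = [:- 8*a^3*c - 4*a^3*g - 24*a^2*b*c - 12*a^2*b*g - 20*a^2*c^2 - 30*a^2*c*g -
    6*a^2*c*q - 10*a^2*g^2 - 3*a^2*g*q - 24*a*b^2*c - 12*a*b^2*g - 48*a*b*c^2 - 64*a*b*c*g -
    18*a*b*c*q - 20*a*b*g^2 - 9*a*b*g*q - 12*a*c^3 - 44*a*c^2*g - 6*a*c^2*q - 35*a*c*g^2 -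
    17*a*c*g*q - 8*a*g^3 - 7*a*g^2*q - 8*b^3*c - 4*b^3*g - 28*b^2*c^2 - 34*b^2*c*g - 12*b^2*c*q
    - 10*b^2*g^2 - 6*b^2*g*q - 20*b*c^3 - 52*b*c^2*g - 18*b*c^2*q - 37*b*c*g^2 - 25*b*c*g*q -
    4*b*c*q^2 - 8*b*g^3 - 8*b*g^2*q - 2*b*g*q^2 - 16*c^3*g - 24*c^2*g^2 - 12*c^2*g*q - 12*c*g^3
    - 12*c*g^2*q - 2*c*g*q^2 - 2*g^4 - 3*g^3*q - g^2*q^2 - 16*a^2*c - 8*a^2*g - 32*a*b*c -
    16*a*b*g - 20*a*c^2 - 38*a*c*g - 4*a*c*q - 14*a*g^2 - 2*a*g*q - 16*b^2*c - 8*b^2*g -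
    28*b*c^2 - 42*b*c*g - 12*b*c*q - 14*b*g^2 - 6*b*g*q - 24*c^2*g - 24*c*g^2 - 8*c*g*q - 6*g^3
    - 4*g^2*q - 8*a*c - 4*a*g - 8*b*c - 4*b*g - 8*c*g - 4*g^2, 12*a^2*c + 6*a^2*g + 30*a*b*c +
    15*a*b*g + 14*a*c^2 + 31*a*c*g + 4*a*c*q + 12*a*g^2 + 2*a*g*q + 18*b^2*c + 9*b^2*g +
    26*b*c^2 + 39*b*c*g + 12*b*c*q + 13*b*g^2 + 6*b*g*q + 20*c^2*g + 20*c*g^2 + 8*c*g*q + 5*g^3
    + 4*g^2*q + 12*a*c + 6*a*g + 20*b*c + 10*b*g + 16*c*g + 8*g^2, - 4*a*c - 2*a*g - 8*b*c -
    4*b*g - 6*c*g - 3*g^2:]"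

definition ng2 :: dfpoly where
"ng2 a b c g q = [:4*a^3*c + 2*a^3*g + 16*a^2*b*c + 6*a^2*b*g + 2*a^2*b*q + 8*a^2*c^2 +
    16*a^2*c*g + 5*a^2*g^2 + a^2*g*q + 16*a*b^2*c + 6*a*b^2*g + 2*a*b^2*q + 32*a*b*c^2 +
    40*a*b*c*g + 14*a*b*c*q + 10*a*b*g^2 + 7*a*b*g*q + 2*a*b*q^2 + 4*a*c^3 + 24*a*c^2*g +
    20*a*c*g^2 + 7*a*c*g*q + 4*a*g^3 + 3*a*g^2*q + a*g*q^2 + 4*b^3*c + 2*b^3*g + 20*b^2*c^2 +
    22*b^2*c*g + 6*b^2*c*q + 5*b^2*g^2 + 4*b^2*g*q + 16*b*c^3 + 36*b*c^2*g + 12*b*c^2*q +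
    23*b*c*g^2 + 15*b*c*g*q + 2*b*c*q^2 + 4*b*g^3 + 4*b*g^2*q + 2*b*g*q^2 + 10*c^3*g +
    15*c^2*g^2 + 6*c^2*g*q + 7*c*g^3 + 6*c*g^2*q + c*g*q^2 + g^4 + g^3*q + g^2*q^2 - 2*a^2*b +
    2*a^2*c - 2*a*b^2 - 12*a*b*c - 8*a*b*g - 2*a*b*q + 2*a*c^2 - 4*a*c*g - 3*a*g^2 - a*g*q -
    10*b^2*c - 6*b^2*g - 10*b*c^2 - 14*b*c*g - 6*b*c*q - 5*b*g^2 - 4*b*g*q - 4*c^2*g - 4*c*g^2 -
    3*c*g*q - g^3 - 2*g^2*q - 8*b*c - 4*b*g - 4*c*g - 2*g^2, - 2*a^2*b - 6*a^2*c - 4*a^2*g -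
    2*a*b^2 - 32*a*b*c - 16*a*b*g - 4*a*b*q - 6*a*c^2 - 24*a*c*g - 10*a*g^2 - 2*a*g*q - 18*b^2*c
    - 10*b^2*g - 30*b*c^2 - 40*b*c*g - 12*b*c*q - 12*b*g^2 - 8*b*g*q - 18*c^2*g - 18*c*g^2 -
    6*c*g*q - 4*g^3 - 4*g^2*q + 2*a*b - 2*a*c + b*g - c*g, 2*a*b + 2*a*c + 2*a*g + 12*b*c +
    7*b*g + 7*c*g + 4*g^2:]"

definition ng3 :: dfpoly where
"ng3 a b c g q = [:- 4*a^2*b*c - 2*a^2*b*q - 2*a^2*c*g - a^2*g*q - 4*a*b^2*c - 8*a*b*c^2 -
    8*a*b*c*g - 4*a*b*c*q - 2*a*b*g*q - 4*a*c^2*g - 3*a*c*g^2 - 2*a*c*g*q - a*g^2*q - 4*b^2*c^2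
    - 4*b^2*c*g - 4*b*c^3 - 8*b*c^2*g - 2*b*c^2*q - 4*b*c*g^2 - 2*b*c*g*q - 2*c^3*g - 3*c^2*g^2
    - c^2*g*q - c*g^3 - c*g^2*q + 8*a^2*b + 4*a^2*g + 4*a*b^2 + 32*a*b*c + 18*a*b*g + 8*a*b*q +
    16*a*c*g + 8*a*g^2 + 4*a*g*q + 12*b^2*c + 8*b^2*g + 24*b*c^2 + 30*b*c*g + 8*b*c*q + 8*b*g^2
    + 8*b*g*q + 12*c^2*g + 12*c*g^2 + 4*c*g*q + 2*g^3 + 4*g^2*q - 8*a*b - 4*a*g - 8*b*c - 8*b*g
    - 4*c*g - 4*g^2, 4*a^2*b + 2*a^2*g + 2*a*b^2 + 18*a*b*c + 9*a*b*g + 4*a*b*q + 9*a*c*g +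
    4*a*g^2 + 2*a*g*q + 6*b^2*c + 4*b^2*g + 14*b*c^2 + 17*b*c*g + 4*b*c*q + 4*b*g^2 + 4*b*g*q +
    7*c^2*g + 7*c*g^2 + 2*c*g*q + g^3 + 2*g^2*q - 12*a*b - 6*a*g - 20*b*c - 16*b*g - 10*c*g -
    8*g^2, - 4*a*b - 2*a*g - 8*b*c - 6*b*g - 4*c*g - 3*g^2:]"

definition ng4 :: dfpoly where
"ng4 a b c g q = [:- 6*a^2*b - 3*a^2*g - 12*a*b*c - 6*a*b*g - 6*a*c*g - 3*a*g^2 - 6*b*c^2 -
    6*b*c*g - 3*c^2*g - 3*c*g^2 + 12*a*b + 6*a*g + 12*b*c + 12*b*g + 6*c*g + 6*g^2, - 2*a^2*b -
    a^2*g - 4*a*b*c - 2*a*b*g - 2*a*c*g - a*g^2 - 2*b*c^2 - 2*b*c*g - c^2*g - c*g^2 + 10*a*b +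
    5*a*g + 10*b*c + 10*b*g + 5*c*g + 5*g^2, 2*a*b + a*g + 2*b*c + 2*b*g + c*g + g^2:]"

definition ngk0 :: dfpoly where
"ngk0 a b c g q = [:4*a^3*c + 2*a^3*g + 12*a^2*b*c + 6*a^2*b*g + 12*a^2*c^2 + 16*a^2*c*g +
    6*a^2*c*q + 5*a^2*g^2 + 3*a^2*g*q + 12*a*b^2*c + 6*a*b^2*g + 24*a*b*c^2 + 32*a*b*c*g +
    12*a*b*c*q + 10*a*b*g^2 + 6*a*b*g*q + 8*a*c^3 + 24*a*c^2*g + 8*a*c^2*q + 18*a*c*g^2 +
    14*a*c*g*q + 2*a*c*q^2 + 4*a*g^3 + 5*a*g^2*q + a*g*q^2 + 4*b^3*c + 2*b^3*g + 12*b^2*c^2 +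
    16*b^2*c*g + 6*b^2*c*q + 5*b^2*g^2 + 3*b^2*g*q + 8*b*c^3 + 24*b*c^2*g + 8*b*c^2*q +
    18*b*c*g^2 + 14*b*c*g*q + 2*b*c*q^2 + 4*b*g^3 + 5*b*g^2*q + b*g*q^2 + 8*c^3*g + 12*c^2*g^2 +
    8*c^2*g*q + 6*c*g^3 + 8*c*g^2*q + 2*c*g*q^2 + g^4 + 2*g^3*q + g^2*q^2 + 2*a^2*c + a^2*g +
    4*a*b*c + 2*a*b*g + 4*a*c^2 + 6*a*c*g + 2*a*c*q + 2*a*g^2 + a*g*q + 2*b^2*c + b^2*g +
    4*b*c^2 + 6*b*c*g + 2*b*c*q + 2*b*g^2 + b*g*q + 4*c^2*g + 4*c*g^2 + 2*c*g*q + g^3 + g^2*q, -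
    6*a^2*c - 3*a^2*g - 12*a*b*c - 6*a*b*g - 8*a*c^2 - 14*a*c*g - 4*a*c*q - 5*a*g^2 - 2*a*g*q -
    6*b^2*c - 3*b^2*g - 8*b*c^2 - 14*b*c*g - 4*b*c*q - 5*b*g^2 - 2*b*g*q - 8*c^2*g - 8*c*g^2 -
    4*c*g*q - 2*g^3 - 2*g^2*q - 2*a*c - a*g - 2*b*c - b*g - 2*c*g - g^2, 2*a*c + a*g + 2*b*c +
    b*g + 2*c*g + g^2:]"

definition ngk1 :: dfpoly where
"ngk1 a b c g q = [:- 8*a^3*c - 4*a^3*g - 24*a^2*b*c - 12*a^2*b*g - 20*a^2*c^2 - 30*a^2*c*g -
    6*a^2*c*q - 10*a^2*g^2 - 3*a^2*g*q - 24*a*b^2*c - 12*a*b^2*g - 48*a*b*c^2 - 64*a*b*c*g -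
    18*a*b*c*q - 20*a*b*g^2 - 9*a*b*g*q - 12*a*c^3 - 44*a*c^2*g - 6*a*c^2*q - 35*a*c*g^2 -
    17*a*c*g*q - 8*a*g^3 - 7*a*g^2*q - 8*b^3*c - 4*b^3*g - 28*b^2*c^2 - 34*b^2*c*g - 12*b^2*c*q
    - 10*b^2*g^2 - 6*b^2*g*q - 20*b*c^3 - 52*b*c^2*g - 18*b*c^2*q - 37*b*c*g^2 - 25*b*c*g*q -
    4*b*c*q^2 - 8*b*g^3 - 8*b*g^2*q - 2*b*g*q^2 - 16*c^3*g - 24*c^2*g^2 - 12*c^2*g*q - 12*c*g^3
    - 12*c*g^2*q - 2*c*g*q^2 - 2*g^4 - 3*g^3*q - g^2*q^2 + 18*a^2*c + 9*a^2*g + 34*a*b*c +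
    17*a*b*g + 22*a*c^2 + 39*a*c*g + 12*a*c*q + 14*a*g^2 + 6*a*g*q + 16*b^2*c + 8*b^2*g +
    18*b*c^2 + 35*b*c*g + 8*b*c*q + 13*b*g^2 + 4*b*g*q + 20*c^2*g + 20*c*g^2 + 10*c*g*q + 5*g^3
    + 5*g^2*q, 12*a^2*c + 6*a^2*g + 30*a*b*c + 15*a*b*g + 14*a*c^2 + 31*a*c*g + 4*a*c*q +
    12*a*g^2 + 2*a*g*q + 18*b^2*c + 9*b^2*g + 26*b*c^2 + 39*b*c*g + 12*b*c*q + 13*b*g^2 +
    6*b*g*q + 20*c^2*g + 20*c*g^2 + 8*c*g*q + 5*g^3 + 4*g^2*q - 12*a*c - 6*a*g - 8*b*c - 4*b*g -
    10*c*g - 5*g^2, - 4*a*c - 2*a*g - 8*b*c - 4*b*g - 6*c*g - 3*g^2:]"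

definition ngk2 :: dfpoly where
"ngk2 a b c g q = [:4*a^3*c + 2*a^3*g + 16*a^2*b*c + 6*a^2*b*g + 2*a^2*b*q + 8*a^2*c^2 +
    16*a^2*c*g + 5*a^2*g^2 + a^2*g*q + 16*a*b^2*c + 6*a*b^2*g + 2*a*b^2*q + 32*a*b*c^2 +
    40*a*b*c*g + 14*a*b*c*q + 10*a*b*g^2 + 7*a*b*g*q + 2*a*b*q^2 + 4*a*c^3 + 24*a*c^2*g +
    20*a*c*g^2 + 7*a*c*g*q + 4*a*g^3 + 3*a*g^2*q + a*g*q^2 + 4*b^3*c + 2*b^3*g + 20*b^2*c^2 +
    22*b^2*c*g + 6*b^2*c*q + 5*b^2*g^2 + 4*b^2*g*q + 16*b*c^3 + 36*b*c^2*g + 12*b*c^2*q +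
    23*b*c*g^2 + 15*b*c*g*q + 2*b*c*q^2 + 4*b*g^3 + 4*b*g^2*q + 2*b*g*q^2 + 10*c^3*g +
    15*c^2*g^2 + 6*c^2*g*q + 7*c*g^3 + 6*c*g^2*q + c*g*q^2 + g^4 + g^3*q + g^2*q^2 + 2*a^2*b -
    20*a^2*c - 9*a^2*g + 2*a*b^2 - 58*a*b*c - 27*a*b*g + 2*a*b*q - 20*a*c^2 - 55*a*c*g -
    22*a*g^2 + a*g*q - 38*b^2*c - 18*b^2*g - 56*b*c^2 - 77*b*c*g - 22*b*c*q - 24*b*g^2 -
    10*b*g*q - 38*c^2*g - 37*c*g^2 - 11*c*g*q - 9*g^3 - 5*g^2*q + 24*a*c + 12*a*g + 24*b*c +
    12*b*g + 24*c*g + 12*g^2, - 2*a^2*b - 6*a^2*c - 4*a^2*g - 2*a*b^2 - 32*a*b*c - 16*a*b*g -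
    4*a*b*q - 6*a*c^2 - 24*a*c*g - 10*a*g^2 - 2*a*g*q - 18*b^2*c - 10*b^2*g - 30*b*c^2 -
    40*b*c*g - 12*b*c*q - 12*b*g^2 - 8*b*g*q - 18*c^2*g - 18*c*g^2 - 6*c*g*q - 4*g^3 - 4*g^2*q -
    2*a*b + 14*a*c + 6*a*g + 36*b*c + 17*b*g + 25*c*g + 12*g^2, 2*a*b + 2*a*c + 2*a*g + 12*b*c +
    7*b*g + 7*c*g + 4*g^2:]"

definition ngk3 :: dfpoly where
"ngk3 a b c g q = [:- 4*a^2*b*c - 2*a^2*b*q - 2*a^2*c*g - a^2*g*q - 4*a*b^2*c - 8*a*b*c^2 -
    8*a*b*c*g - 4*a*b*c*q - 2*a*b*g*q - 4*a*c^2*g - 3*a*c*g^2 - 2*a*c*g*q - a*g^2*q - 4*b^2*c^2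
    - 4*b^2*c*g - 4*b*c^3 - 8*b*c^2*g - 2*b*c^2*q - 4*b*c*g^2 - 2*b*c*g*q - 2*c^3*g - 3*c^2*g^2
    - c^2*g*q - c*g^3 - c*g^2*q + 6*a^2*b + 3*a^2*g + 4*a*b^2 + 48*a*b*c + 22*a*b*g + 12*a*b*q +
    24*a*c*g + 10*a*g^2 + 6*a*g*q + 20*b^2*c + 12*b^2*g + 42*b*c^2 + 50*b*c*g + 12*b*c*q +
    12*b*g^2 + 12*b*g*q + 21*c^2*g + 20*c*g^2 + 6*c*g*q + 3*g^3 + 6*g^2*q - 48*b*c - 24*b*g -
    24*c*g - 12*g^2, 4*a^2*b + 2*a^2*g + 2*a*b^2 + 18*a*b*c + 9*a*b*g + 4*a*b*q + 9*a*c*g +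
    4*a*g^2 + 2*a*g*q + 6*b^2*c + 4*b^2*g + 14*b*c^2 + 17*b*c*g + 4*b*c*q + 4*b*g^2 + 4*b*g*q +
    7*c^2*g + 7*c*g^2 + 2*c*g*q + g^3 + 2*g^2*q - 12*a*b - 6*a*g - 40*b*c - 26*b*g - 20*c*g -
    13*g^2, - 4*a*b - 2*a*g - 8*b*c - 6*b*g - 4*c*g - 3*g^2:]"

definition ngk4 :: dfpoly where
"ngk4 a b c g q = [:- 8*a^2*b - 4*a^2*g - 16*a*b*c - 8*a*b*g - 8*a*c*g - 4*a*g^2 - 8*b*c^2 -
    8*b*c*g - 4*c^2*g - 4*c*g^2 + 24*a*b + 12*a*g + 24*b*c + 24*b*g + 12*c*g + 12*g^2, - 2*a^2*b
    - a^2*g - 4*a*b*c - 2*a*b*g - 2*a*c*g - a*g^2 - 2*b*c^2 - 2*b*c*g - c^2*g - c*g^2 + 14*a*b +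
    7*a*g + 14*b*c + 14*b*g + 7*c*g + 7*g^2, 2*a*b + a*g + 2*b*c + 2*b*g + c*g + g^2:]"

definition ja0 :: dfpoly where
"ja0 a b c g q = [:- a - b - 2*c - g - q - 1, 1:]"

definition ja1 :: dfpoly where
"ja1 a b c g q = [:a + c - 1, - 1:]"

definition jc0 :: dfpoly where
"jc0 a b c g q = [:- a - b - 2*c - q - 2, 1:]"

definition jc1 :: dfpoly where
"jc1 a b c g q = [:a + c - 1, - 1:]"

definition jg0 :: dfpoly where
"jg0 a b c g q = [:- 8*a^3*c - 4*a^3*g - 24*a^2*b*c - 12*a^2*b*g - 16*a^2*c^2 - 32*a^2*c*g -
    4*a^2*c*q - 12*a^2*g^2 - 2*a^2*g*q - 24*a*b^2*c - 12*a*b^2*g - 32*a*b*c^2 - 64*a*b*c*g -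
    8*a*b*c*q - 24*a*b*g^2 - 4*a*b*g*q - 8*a*c^3 - 40*a*c^2*g - 4*a*c^2*q - 42*a*c*g^2 -
    12*a*c*g*q - 12*a*g^3 - 5*a*g^2*q - 8*b^3*c - 4*b^3*g - 16*b^2*c^2 - 32*b^2*c*g - 4*b^2*c*q
    - 12*b^2*g^2 - 2*b^2*g*q - 8*b*c^3 - 40*b*c^2*g - 4*b*c^2*q - 42*b*c*g^2 - 12*b*c*g*q -
    12*b*g^3 - 5*b*g^2*q - 8*c^3*g - 24*c^2*g^2 - 4*c^2*g*q - 18*c*g^3 - 8*c*g^2*q - 4*g^4 -
    3*g^3*q - 4*a^2*c - 2*a^2*g - 8*a*b*c - 4*a*b*g - 8*a*c*g - 4*a*g^2 - 4*b^2*c - 2*b^2*g -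
    8*b*c*g - 4*b*g^2 - 4*c*g^2 - 2*g^3, 4*a^2*c + 2*a^2*g + 8*a*b*c + 4*a*b*g + 4*a*c^2 +
    12*a*c*g + 5*a*g^2 + 4*b^2*c + 2*b^2*g + 4*b*c^2 + 12*b*c*g + 5*b*g^2 + 4*c^2*g + 8*c*g^2 +
    3*g^3:]"

definition jg1 :: dfpoly where
"jg1 a b c g q = [:8*a^3*c + 4*a^3*g + 32*a^2*b*c + 16*a^2*b*g + 16*a^2*c^2 + 40*a^2*c*g +
    16*a^2*g^2 + 40*a*b^2*c + 20*a*b^2*g + 48*a*b*c^2 + 96*a*b*c*g + 8*a*b*c*q + 36*a*b*g^2 +
    4*a*b*g*q + 8*a*c^3 + 48*a*c^2*g + 58*a*c*g^2 + 4*a*c*g*q + 18*a*g^3 + 2*a*g^2*q + 16*b^3*c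
    + 8*b^3*g + 32*b^2*c^2 + 56*b^2*c*g + 8*b^2*c*q + 20*b^2*g^2 + 4*b^2*g*q + 16*b*c^3 +
    72*b*c^2*g + 8*b*c^2*q + 68*b*c*g^2 + 20*b*c*g*q + 18*b*g^3 + 8*b*g^2*q + 12*c^3*g +
    36*c^2*g^2 + 4*c^2*g*q + 27*c*g^3 + 8*c*g^2*q + 6*g^4 + 3*g^3*q - 12*a^2*c - 6*a^2*g -
    12*a*b*c - 6*a*b*g - 12*a*c^2 - 30*a*c*g - 12*a*g^2 - 12*b*c^2 - 18*b*c*g - 6*b*g^2 -
    12*c^2*g - 18*c*g^2 - 6*g^3, - 4*a^2*c - 2*a^2*g - 16*a*b*c - 8*a*b*g - 4*a*c^2 - 16*a*c*g -
    7*a*g^2 - 12*b^2*c - 6*b^2*g - 12*b*c^2 - 32*b*c*g - 13*b*g^2 - 8*c^2*g - 16*c*g^2 -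
    6*g^3:]"

definition jg2 :: dfpoly where
"jg2 a b c g q = [:- 8*a^2*b*c - 4*a^2*b*q - 4*a^2*c*g - 2*a^2*g*q - 16*a*b^2*c - 4*a*b^2*g -
    4*a*b^2*q - 16*a*b*c^2 - 32*a*b*c*g - 8*a*b*c*q - 4*a*b*g^2 - 12*a*b*g*q - 8*a*c^2*g -
    12*a*c*g^2 - 4*a*c*g*q - a*g^3 - 5*a*g^2*q - 8*b^3*c - 4*b^3*g - 16*b^2*c^2 - 20*b^2*c*g -
    4*b^2*c*q - 4*b^2*g^2 - 4*b^2*g*q - 8*b*c^3 - 32*b*c^2*g - 4*b*c^2*q - 22*b*c*g^2 -
    12*b*c*g*q - b*g^3 - 8*b*g^2*q - 4*c^3*g - 12*c^2*g^2 - 2*c^2*g*q - 7*c*g^3 - 5*c*g^2*q -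
    3*g^3*q - 4*a^2*b - 2*a^2*g - 4*a*b^2 + 20*a*b*c + 2*a*b*g + 10*a*c*g + 2*a*g^2 + 12*b^2*c +
    4*b^2*g + 24*b*c^2 + 46*b*c*g + 14*b*g^2 + 12*c^2*g + 20*c*g^2 + 6*g^3, 4*a^2*b + 2*a^2*g +
    4*a*b^2 + 16*a*b*c + 16*a*b*g + 8*a*c*g + 7*a*g^2 + 12*b^2*c + 8*b^2*g + 12*b*c^2 + 32*b*c*g
    + 16*b*g^2 + 6*c^2*g + 13*c*g^2 + 6*g^3:]"

definition jg3 :: dfpoly where
"jg3 a b c g q = [:- 4*a*b^2*g - 4*a*b*g^2 - a*g^3 - 4*b^2*c*g - 4*b^2*g^2 - 4*b*c*g^2 - 4*b*g^3
    - c*g^3 - g^4 - 12*a^2*b - 6*a^2*g - 8*a*b^2 - 24*a*b*c - 32*a*b*g - 12*a*c*g - 14*a*g^2 -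
    8*b^2*c - 8*b^2*g - 12*b*c^2 - 32*b*c*g - 20*b*g^2 - 6*c^2*g - 14*c*g^2 - 8*g^3, - 4*a^2*b -
    2*a^2*g - 4*a*b^2 - 8*a*b*c - 12*a*b*g - 4*a*c*g - 5*a*g^2 - 4*b^2*c - 4*b^2*g - 4*b*c^2 -
    12*b*c*g - 8*b*g^2 - 2*c^2*g - 5*c*g^2 - 3*g^3:]"

text \<open>The coefficients of \<partial>^0 to \<partial>^5 in the intertwining relation, without
  the rising factors. Arguments \<open>w + i\<close> come from moving \<partial>^i past a polynomial
  in \<theta>; the constant \<open>+ 2\<close> at the shifted parameters is the effect of
  \<open>r \<mapsto> r - 2\<close> on \<open>w = \<theta> - r - p\<close>.\<close>

lemma ma_intertwines:
  shows "poly (be0 (a + 1) b c g q) (w + 2) * poly (ma0 a b c g q) w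
    = poly (mak0 a b c g q) w * poly (be0 a b c g q) w"
  and "poly (be1 (a + 1) b c g q) (w + 2) * poly (ma0 a b c g q) (w + 1)
      + poly (be0 (a + 1) b c g q) (w + 2) * poly (ma1 a b c g q) w
    = poly (mak0 a b c g q) w * poly (be1 a b c g q) w
      + poly (mak1 a b c g q) w * poly (be0 a b c g q) (w + 1)"
  and "poly (be2 (a + 1) b c g q) (w + 2) * poly (ma0 a b c g q) (w + 2)
      + poly (be1 (a + 1) b c g q) (w + 2) * poly (ma1 a b c g q) (w + 1)
      + poly (be0 (a + 1) b c g q) (w + 2) * poly (ma2 a b c g q) w
    = poly (mak0 a b c g q) w * poly (be2 a b c g q) w
      + poly (mak1 a b c g q) w * poly (be1 a b c g q) (w + 1)
      + poly (mak2 a b c g q) w * poly (be0 a b c g q) (w + 2)"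
  and "poly (be3 (a + 1) b c g q) (w + 2) * poly (ma0 a b c g q) (w + 3)
      + poly (be2 (a + 1) b c g q) (w + 2) * poly (ma1 a b c g q) (w + 2)
      + poly (be1 (a + 1) b c g q) (w + 2) * poly (ma2 a b c g q) (w + 1)
    = poly (mak0 a b c g q) w * poly (be3 a b c g q) w
      + poly (mak1 a b c g q) w * poly (be2 a b c g q) (w + 1)
      + poly (mak2 a b c g q) w * poly (be1 a b c g q) (w + 2)"
  and "poly (be3 (a + 1) b c g q) (w + 2) * poly (ma1 a b c g q) (w + 3)
      + poly (be2 (a + 1) b c g q) (w + 2) * poly (ma2 a b c g q) (w + 2)
    = poly (mak1 a b c g q) w * poly (be3 a b c g q) (w + 1)
      + poly (mak2 a b c g q) w * poly (be2 a b c g q) (w + 2)"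
  and "poly (be3 (a + 1) b c g q) (w + 2) * poly (ma2 a b c g q) (w + 3)
    = poly (mak2 a b c g q) w * poly (be3 a b c g q) (w + 2)"
  unfolding be0_def be1_def be2_def be3_def ma0_def mak0_def ma1_def mak1_def ma2_def mak2_def
    poly_pCons poly_mult poly_minus poly_0
  by algebra+

lemma mc_intertwines:
  shows "poly (be0 a b (c + 1) g q) (w + 2) * poly (mc0 a b c g q) w
    = poly (mck0 a b c g q) w * poly (be0 a b c g q) w"
  and "poly (be1 a b (c + 1) g q) (w + 2) * poly (mc0 a b c g q) (w + 1)
      + poly (be0 a b (c + 1) g q) (w + 2) * poly (mc1 a b c g q) w
    = poly (mck0 a b c g q) w * poly (be1 a b c g q) w
      + poly (mck1 a b c g q) w * poly (be0 a b c g q) (w + 1)"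
  and "poly (be2 a b (c + 1) g q) (w + 2) * poly (mc0 a b c g q) (w + 2)
      + poly (be1 a b (c + 1) g q) (w + 2) * poly (mc1 a b c g q) (w + 1)
      + poly (be0 a b (c + 1) g q) (w + 2) * poly (mc2 a b c g q) w
    = poly (mck0 a b c g q) w * poly (be2 a b c g q) w
      + poly (mck1 a b c g q) w * poly (be1 a b c g q) (w + 1)
      + poly (mck2 a b c g q) w * poly (be0 a b c g q) (w + 2)"
  and "poly (be3 a b (c + 1) g q) (w + 2) * poly (mc0 a b c g q) (w + 3)
      + poly (be2 a b (c + 1) g q) (w + 2) * poly (mc1 a b c g q) (w + 2)
      + poly (be1 a b (c + 1) g q) (w + 2) * poly (mc2 a b c g q) (w + 1)
    = poly (mck0 a b c g q) w * poly (be3 a b c g q) w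
      + poly (mck1 a b c g q) w * poly (be2 a b c g q) (w + 1)
      + poly (mck2 a b c g q) w * poly (be1 a b c g q) (w + 2)"
  and "poly (be3 a b (c + 1) g q) (w + 2) * poly (mc1 a b c g q) (w + 3)
      + poly (be2 a b (c + 1) g q) (w + 2) * poly (mc2 a b c g q) (w + 2)
    = poly (mck1 a b c g q) w * poly (be3 a b c g q) (w + 1)
      + poly (mck2 a b c g q) w * poly (be2 a b c g q) (w + 2)"
  and "poly (be3 a b (c + 1) g q) (w + 2) * poly (mc2 a b c g q) (w + 3)
    = poly (mck2 a b c g q) w * poly (be3 a b c g q) (w + 2)"
  unfolding be0_def be1_def be2_def be3_def mc0_def mck0_def mc1_def mck1_def mc2_def mck2_def
    poly_pCons poly_mult poly_minus poly_0
  by algebra+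

lemma mg_intertwines:
  shows "poly (be0 a b c (g + 2) q) (w + 2) * poly (mg0 a b c g q) w
    = poly (mgk0 a b c g q) w * poly (be0 a b c g q) w"
  and "poly (be1 a b c (g + 2) q) (w + 2) * poly (mg0 a b c g q) (w + 1)
      + poly (be0 a b c (g + 2) q) (w + 2) * poly (mg1 a b c g q) w
    = poly (mgk0 a b c g q) w * poly (be1 a b c g q) w
      + poly (mgk1 a b c g q) w * poly (be0 a b c g q) (w + 1)"
  and "poly (be2 a b c (g + 2) q) (w + 2) * poly (mg0 a b c g q) (w + 2)
      + poly (be1 a b c (g + 2) q) (w + 2) * poly (mg1 a b c g q) (w + 1)
      + poly (be0 a b c (g + 2) q) (w + 2) * poly (mg2 a b c g q) w
    = poly (mgk0 a b c g q) w * poly (be2 a b c g q) w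
      + poly (mgk1 a b c g q) w * poly (be1 a b c g q) (w + 1)
      + poly (mgk2 a b c g q) w * poly (be0 a b c g q) (w + 2)"
  and "poly (be3 a b c (g + 2) q) (w + 2) * poly (mg0 a b c g q) (w + 3)
      + poly (be2 a b c (g + 2) q) (w + 2) * poly (mg1 a b c g q) (w + 2)
      + poly (be1 a b c (g + 2) q) (w + 2) * poly (mg2 a b c g q) (w + 1)
    = poly (mgk0 a b c g q) w * poly (be3 a b c g q) w
      + poly (mgk1 a b c g q) w * poly (be2 a b c g q) (w + 1)
      + poly (mgk2 a b c g q) w * poly (be1 a b c g q) (w + 2)"
  and "poly (be3 a b c (g + 2) q) (w + 2) * poly (mg1 a b c g q) (w + 3)
      + poly (be2 a b c (g + 2) q) (w + 2) * poly (mg2 a b c g q) (w + 2)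
    = poly (mgk1 a b c g q) w * poly (be3 a b c g q) (w + 1)
      + poly (mgk2 a b c g q) w * poly (be2 a b c g q) (w + 2)"
  and "poly (be3 a b c (g + 2) q) (w + 2) * poly (mg2 a b c g q) (w + 3)
    = poly (mgk2 a b c g q) w * poly (be3 a b c g q) (w + 2)"
  unfolding be0_def be1_def be2_def be3_def mg0_def mgk0_def mg1_def mgk1_def mg2_def mgk2_def
    poly_pCons poly_mult poly_minus poly_0
  by algebra+

text \<open>There is no constant \<open>+ 2\<close> here: with \<open>p \<mapsto> p + 2\<close> and
  \<open>r \<mapsto> r - 2\<close> the variable \<open>w\<close> stays fixed.\<close>

lemma na_intertwines:
  shows "poly (be0 (a - 1) b c g q) w * poly (na0 a b c g q) w
    = poly (nak0 a b c g q) w * poly (be0 a b c g q) w"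
  and "poly (be1 (a - 1) b c g q) w * poly (na0 a b c g q) (w + 1)
      + poly (be0 (a - 1) b c g q) w * poly (na1 a b c g q) w
    = poly (nak0 a b c g q) w * poly (be1 a b c g q) w
      + poly (nak1 a b c g q) w * poly (be0 a b c g q) (w + 1)"
  and "poly (be2 (a - 1) b c g q) w * poly (na0 a b c g q) (w + 2)
      + poly (be1 (a - 1) b c g q) w * poly (na1 a b c g q) (w + 1)
      + poly (be0 (a - 1) b c g q) w * poly (na2 a b c g q) w
    = poly (nak0 a b c g q) w * poly (be2 a b c g q) w
      + poly (nak1 a b c g q) w * poly (be1 a b c g q) (w + 1)
      + poly (nak2 a b c g q) w * poly (be0 a b c g q) (w + 2)"
  and "poly (be3 (a - 1) b c g q) w * poly (na0 a b c g q) (w + 3)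
      + poly (be2 (a - 1) b c g q) w * poly (na1 a b c g q) (w + 2)
      + poly (be1 (a - 1) b c g q) w * poly (na2 a b c g q) (w + 1)
    = poly (nak0 a b c g q) w * poly (be3 a b c g q) w
      + poly (nak1 a b c g q) w * poly (be2 a b c g q) (w + 1)
      + poly (nak2 a b c g q) w * poly (be1 a b c g q) (w + 2)"
  and "poly (be3 (a - 1) b c g q) w * poly (na1 a b c g q) (w + 3)
      + poly (be2 (a - 1) b c g q) w * poly (na2 a b c g q) (w + 2)
    = poly (nak1 a b c g q) w * poly (be3 a b c g q) (w + 1)
      + poly (nak2 a b c g q) w * poly (be2 a b c g q) (w + 2)"
  and "poly (be3 (a - 1) b c g q) w * poly (na2 a b c g q) (w + 3)
    = poly (nak2 a b c g q) w * poly (be3 a b c g q) (w + 2)"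
  unfolding be0_def be1_def be2_def be3_def na0_def nak0_def na1_def nak1_def na2_def nak2_def
    poly_pCons poly_mult poly_minus poly_0
  by algebra+

lemma nc_intertwines:
  shows "poly (be0 a b (c - 1) g (q + 2)) w * poly (nc0 a b c g q) w
    = poly (nck0 a b c g q) w * poly (be0 a b c g q) w"
  and "poly (be1 a b (c - 1) g (q + 2)) w * poly (nc0 a b c g q) (w + 1)
      + poly (be0 a b (c - 1) g (q + 2)) w * poly (nc1 a b c g q) w
    = poly (nck0 a b c g q) w * poly (be1 a b c g q) w
      + poly (nck1 a b c g q) w * poly (be0 a b c g q) (w + 1)"
  and "poly (be2 a b (c - 1) g (q + 2)) w * poly (nc0 a b c g q) (w + 2)
      + poly (be1 a b (c - 1) g (q + 2)) w * poly (nc1 a b c g q) (w + 1)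
      + poly (be0 a b (c - 1) g (q + 2)) w * poly (nc2 a b c g q) w
    = poly (nck0 a b c g q) w * poly (be2 a b c g q) w
      + poly (nck1 a b c g q) w * poly (be1 a b c g q) (w + 1)
      + poly (nck2 a b c g q) w * poly (be0 a b c g q) (w + 2)"
  and "poly (be3 a b (c - 1) g (q + 2)) w * poly (nc0 a b c g q) (w + 3)
      + poly (be2 a b (c - 1) g (q + 2)) w * poly (nc1 a b c g q) (w + 2)
      + poly (be1 a b (c - 1) g (q + 2)) w * poly (nc2 a b c g q) (w + 1)
    = poly (nck0 a b c g q) w * poly (be3 a b c g q) w
      + poly (nck1 a b c g q) w * poly (be2 a b c g q) (w + 1)
      + poly (nck2 a b c g q) w * poly (be1 a b c g q) (w + 2)"
  and "poly (be3 a b (c - 1) g (q + 2)) w * poly (nc1 a b c g q) (w + 3)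
      + poly (be2 a b (c - 1) g (q + 2)) w * poly (nc2 a b c g q) (w + 2)
    = poly (nck1 a b c g q) w * poly (be3 a b c g q) (w + 1)
      + poly (nck2 a b c g q) w * poly (be2 a b c g q) (w + 2)"
  and "poly (be3 a b (c - 1) g (q + 2)) w * poly (nc2 a b c g q) (w + 3)
    = poly (nck2 a b c g q) w * poly (be3 a b c g q) (w + 2)"
  unfolding be0_def be1_def be2_def be3_def nc0_def nck0_def nc1_def nck1_def nc2_def nck2_def
    poly_pCons poly_mult poly_minus poly_0
  by algebra+

text \<open>With \<open>p \<mapsto> p + 2\<close> and \<open>r \<mapsto> r - 4\<close> the variable
  \<open>w\<close> moves by 2.\<close>

lemma ng_intertwines:
  shows "poly (be0 a b c (g - 2) (q + 2)) (w + 2) * poly (ng0 a b c g q) w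
    = poly (ngk0 a b c g q) w * poly (be0 a b c g q) w"
  and "poly (be1 a b c (g - 2) (q + 2)) (w + 2) * poly (ng0 a b c g q) (w + 1)
      + poly (be0 a b c (g - 2) (q + 2)) (w + 2) * poly (ng1 a b c g q) w
    = poly (ngk0 a b c g q) w * poly (be1 a b c g q) w
      + poly (ngk1 a b c g q) w * poly (be0 a b c g q) (w + 1)"
  and "poly (be2 a b c (g - 2) (q + 2)) (w + 2) * poly (ng0 a b c g q) (w + 2)
      + poly (be1 a b c (g - 2) (q + 2)) (w + 2) * poly (ng1 a b c g q) (w + 1)
      + poly (be0 a b c (g - 2) (q + 2)) (w + 2) * poly (ng2 a b c g q) w
    = poly (ngk0 a b c g q) w * poly (be2 a b c g q) w
      + poly (ngk1 a b c g q) w * poly (be1 a b c g q) (w + 1)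
      + poly (ngk2 a b c g q) w * poly (be0 a b c g q) (w + 2)"
  and "poly (be3 a b c (g - 2) (q + 2)) (w + 2) * poly (ng0 a b c g q) (w + 3)
      + poly (be2 a b c (g - 2) (q + 2)) (w + 2) * poly (ng1 a b c g q) (w + 2)
      + poly (be1 a b c (g - 2) (q + 2)) (w + 2) * poly (ng2 a b c g q) (w + 1)
      + poly (be0 a b c (g - 2) (q + 2)) (w + 2) * poly (ng3 a b c g q) w
    = poly (ngk0 a b c g q) w * poly (be3 a b c g q) w
      + poly (ngk1 a b c g q) w * poly (be2 a b c g q) (w + 1)
      + poly (ngk2 a b c g q) w * poly (be1 a b c g q) (w + 2)
      + poly (ngk3 a b c g q) w * poly (be0 a b c g q) (w + 3)"
  and "poly (be3 a b c (g - 2) (q + 2)) (w + 2) * poly (ng1 a b c g q) (w + 3)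
      + poly (be2 a b c (g - 2) (q + 2)) (w + 2) * poly (ng2 a b c g q) (w + 2)
      + poly (be1 a b c (g - 2) (q + 2)) (w + 2) * poly (ng3 a b c g q) (w + 1)
      + poly (be0 a b c (g - 2) (q + 2)) (w + 2) * poly (ng4 a b c g q) w
    = poly (ngk1 a b c g q) w * poly (be3 a b c g q) (w + 1)
      + poly (ngk2 a b c g q) w * poly (be2 a b c g q) (w + 2)
      + poly (ngk3 a b c g q) w * poly (be1 a b c g q) (w + 3)
      + poly (ngk4 a b c g q) w * poly (be0 a b c g q) (w + 4)"
  and "poly (be3 a b c (g - 2) (q + 2)) (w + 2) * poly (ng2 a b c g q) (w + 3)
      + poly (be2 a b c (g - 2) (q + 2)) (w + 2) * poly (ng3 a b c g q) (w + 2)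
      + poly (be1 a b c (g - 2) (q + 2)) (w + 2) * poly (ng4 a b c g q) (w + 1)
    = poly (ngk2 a b c g q) w * poly (be3 a b c g q) (w + 2)
      + poly (ngk3 a b c g q) w * poly (be2 a b c g q) (w + 3)
      + poly (ngk4 a b c g q) w * poly (be1 a b c g q) (w + 4)"
  and "poly (be3 a b c (g - 2) (q + 2)) (w + 2) * poly (ng3 a b c g q) (w + 3)
      + poly (be2 a b c (g - 2) (q + 2)) (w + 2) * poly (ng4 a b c g q) (w + 2)
    = poly (ngk3 a b c g q) w * poly (be3 a b c g q) (w + 3)
      + poly (ngk4 a b c g q) w * poly (be2 a b c g q) (w + 4)"
  and "poly (be3 a b c (g - 2) (q + 2)) (w + 2) * poly (ng4 a b c g q) (w + 3)
    = poly (ngk4 a b c g q) w * poly (be3 a b c g q) (w + 4)"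
  unfolding be0_def be1_def be2_def be3_def ng0_def ngk0_def ng1_def ngk1_def ng2_def ngk2_def ng3_def ngk3_def ng4_def ngk4_def
    poly_pCons poly_mult poly_minus poly_0
  by algebra+

text \<open>The scalars \<kappa> left when a lowering multiplier followed by the raising one is
  reduced modulo \<open>SE6\<close>. They do not involve \<open>p\<close>, \<open>q\<close>,
  \<open>r\<close>.\<close>

definition kap_a :: "complex \<Rightarrow> complex \<Rightarrow> complex \<Rightarrow> complex \<Rightarrow> complex" where
  "kap_a a b c g = a * (2*a + g) * (a + b + c + g + 1) * (2*a + 2*b + 2*c + g + 2)"

definition kap_c :: "complex \<Rightarrow> complex \<Rightarrow> complex \<Rightarrow> complex \<Rightarrow> complex" where
  "kap_c a b c g = c * (2*c + g) * (a + b + c + g + 1) * (2*a + 2*b + 2*c + g + 2)"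

definition kap_g :: "complex \<Rightarrow> complex \<Rightarrow> complex \<Rightarrow> complex \<Rightarrow> complex" where
  "kap_g a b c g = - ((g - 1) * (2*a + g) * (2*b + g) * (2*c + g) * (a + b + c + g)
     * (a + b + c + g + 1) * (2*a + 2*b + 2*c + g + 2))"

text \<open>The scalar stands at \<partial>^2 alone because the composite is compared with the list
  \<open>[0, 0, 1, 0, 0]\<close> of \<open>xi2_d2\<close>, which is multiplication by
  \<open>x^2\<close> before the transform.\<close>

lemma ma_na:
  shows "poly (ma0 (a - 1) b c g q) w * poly (na0 a b c g q) w
    = poly (ja0 a b c g q) w * poly (be0 a b c g q) w"
  and "poly (ma0 (a - 1) b c g q) w * poly (na1 a b c g q) w
      + poly (ma1 (a - 1) b c g q) w * poly (na0 a b c g q) (w + 1)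
    = poly (ja0 a b c g q) w * poly (be1 a b c g q) w
      + poly (ja1 a b c g q) w * poly (be0 a b c g q) (w + 1)"
  and "poly (ma0 (a - 1) b c g q) w * poly (na2 a b c g q) w
      + poly (ma1 (a - 1) b c g q) w * poly (na1 a b c g q) (w + 1)
      + poly (ma2 (a - 1) b c g q) w * poly (na0 a b c g q) (w + 2)
    = (kap_a a b c g)
      + poly (ja0 a b c g q) w * poly (be2 a b c g q) w
      + poly (ja1 a b c g q) w * poly (be1 a b c g q) (w + 1)"
  and "poly (ma1 (a - 1) b c g q) w * poly (na2 a b c g q) (w + 1)
      + poly (ma2 (a - 1) b c g q) w * poly (na1 a b c g q) (w + 2)
    = poly (ja0 a b c g q) w * poly (be3 a b c g q) w
      + poly (ja1 a b c g q) w * poly (be2 a b c g q) (w + 1)"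
  and "poly (ma2 (a - 1) b c g q) w * poly (na2 a b c g q) (w + 2)
    = poly (ja1 a b c g q) w * poly (be3 a b c g q) (w + 1)"
  unfolding be0_def be1_def be2_def be3_def ma0_def ma1_def ma2_def na0_def na1_def na2_def ja0_def ja1_def kap_a_def
    poly_pCons poly_mult poly_minus poly_0
  by algebra+

text \<open>The pattern 1, -2, 1, 0, 0 is the list of \<open>eta2_xi2\<close>, which is
  multiplication by \<open>x^2 (x - 1)^2\<close> before the transform. The same pattern preceded by
  two zeros appears in \<open>mg_ng\<close>.\<close>

lemma mc_nc:
  shows "poly (mc0 a b (c - 1) g (q + 2)) w * poly (nc0 a b c g q) w
    = (kap_c a b c g)
      + poly (jc0 a b c g q) w * poly (be0 a b c g q) w"
  and "poly (mc0 a b (c - 1) g (q + 2)) w * poly (nc1 a b c g q) w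
      + poly (mc1 a b (c - 1) g (q + 2)) w * poly (nc0 a b c g q) (w + 1)
    = - 2 * (kap_c a b c g)
      + poly (jc0 a b c g q) w * poly (be1 a b c g q) w
      + poly (jc1 a b c g q) w * poly (be0 a b c g q) (w + 1)"
  and "poly (mc0 a b (c - 1) g (q + 2)) w * poly (nc2 a b c g q) w
      + poly (mc1 a b (c - 1) g (q + 2)) w * poly (nc1 a b c g q) (w + 1)
      + poly (mc2 a b (c - 1) g (q + 2)) w * poly (nc0 a b c g q) (w + 2)
    = (kap_c a b c g)
      + poly (jc0 a b c g q) w * poly (be2 a b c g q) w
      + poly (jc1 a b c g q) w * poly (be1 a b c g q) (w + 1)"
  and "poly (mc1 a b (c - 1) g (q + 2)) w * poly (nc2 a b c g q) (w + 1)
      + poly (mc2 a b (c - 1) g (q + 2)) w * poly (nc1 a b c g q) (w + 2)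
    = poly (jc0 a b c g q) w * poly (be3 a b c g q) w
      + poly (jc1 a b c g q) w * poly (be2 a b c g q) (w + 1)"
  and "poly (mc2 a b (c - 1) g (q + 2)) w * poly (nc2 a b c g q) (w + 2)
    = poly (jc1 a b c g q) w * poly (be3 a b c g q) (w + 1)"
  unfolding be0_def be1_def be2_def be3_def mc0_def mc1_def mc2_def nc0_def nc1_def nc2_def jc0_def jc1_def kap_c_def
    poly_pCons poly_mult poly_minus poly_0
  by algebra+

lemma mg_ng:
  shows "poly (mg0 a b c (g - 2) (q + 2)) (w + 2) * poly (ng0 a b c g q) w
    = poly (jg0 a b c g q) w * poly (be0 a b c g q) w"
  and "poly (mg0 a b c (g - 2) (q + 2)) (w + 2) * poly (ng1 a b c g q) w
      + poly (mg1 a b c (g - 2) (q + 2)) (w + 2) * poly (ng0 a b c g q) (w + 1)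
    = poly (jg0 a b c g q) w * poly (be1 a b c g q) w
      + poly (jg1 a b c g q) w * poly (be0 a b c g q) (w + 1)"
  and "poly (mg0 a b c (g - 2) (q + 2)) (w + 2) * poly (ng2 a b c g q) w
      + poly (mg1 a b c (g - 2) (q + 2)) (w + 2) * poly (ng1 a b c g q) (w + 1)
      + poly (mg2 a b c (g - 2) (q + 2)) (w + 2) * poly (ng0 a b c g q) (w + 2)
    = (kap_g a b c g)
      + poly (jg0 a b c g q) w * poly (be2 a b c g q) w
      + poly (jg1 a b c g q) w * poly (be1 a b c g q) (w + 1)
      + poly (jg2 a b c g q) w * poly (be0 a b c g q) (w + 2)"
  and "poly (mg0 a b c (g - 2) (q + 2)) (w + 2) * poly (ng3 a b c g q) w
      + poly (mg1 a b c (g - 2) (q + 2)) (w + 2) * poly (ng2 a b c g q) (w + 1)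
      + poly (mg2 a b c (g - 2) (q + 2)) (w + 2) * poly (ng1 a b c g q) (w + 2)
    = - 2 * (kap_g a b c g)
      + poly (jg0 a b c g q) w * poly (be3 a b c g q) w
      + poly (jg1 a b c g q) w * poly (be2 a b c g q) (w + 1)
      + poly (jg2 a b c g q) w * poly (be1 a b c g q) (w + 2)
      + poly (jg3 a b c g q) w * poly (be0 a b c g q) (w + 3)"
  and "poly (mg0 a b c (g - 2) (q + 2)) (w + 2) * poly (ng4 a b c g q) w
      + poly (mg1 a b c (g - 2) (q + 2)) (w + 2) * poly (ng3 a b c g q) (w + 1)
      + poly (mg2 a b c (g - 2) (q + 2)) (w + 2) * poly (ng2 a b c g q) (w + 2)
    = (kap_g a b c g)
      + poly (jg1 a b c g q) w * poly (be3 a b c g q) (w + 1)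
      + poly (jg2 a b c g q) w * poly (be2 a b c g q) (w + 2)
      + poly (jg3 a b c g q) w * poly (be1 a b c g q) (w + 3)"
  and "poly (mg1 a b c (g - 2) (q + 2)) (w + 2) * poly (ng4 a b c g q) (w + 1)
      + poly (mg2 a b c (g - 2) (q + 2)) (w + 2) * poly (ng3 a b c g q) (w + 2)
    = poly (jg2 a b c g q) w * poly (be3 a b c g q) (w + 2)
      + poly (jg3 a b c g q) w * poly (be2 a b c g q) (w + 3)"
  and "poly (mg2 a b c (g - 2) (q + 2)) (w + 2) * poly (ng4 a b c g q) (w + 2)
    = poly (jg3 a b c g q) w * poly (be3 a b c g q) (w + 3)"
  unfolding be0_def be1_def be2_def be3_def mg0_def mg1_def mg2_def ng0_def ng1_def ng2_def ng3_def ng4_def jg0_def jg1_def jg2_def jg3_def kap_g_def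
    poly_pCons poly_mult poly_minus poly_0
  by algebra+

section \<open>Transforms of coefficient lists, and \<open>SE6\<close> as such a transform\<close>

lemma complex_poly_ext: "(\<And>t. poly p t = poly q t) \<Longrightarrow> p = (q :: complex poly)"
  by (simp add: poly_eq_poly_eq_iff[symmetric] fun_eq_iff)

text \<open>\<open>p\<close> and \<open>r\<close> enter only through \<open>r + p\<close>. So a
  shift that preserves \<open>r + p\<close> leaves \<open>pv f\<close> unchanged, and
  \<open>r \<mapsto> r - 1\<close> alone acts as \<open>shp\<close>.\<close>

definition pv :: "dfpoly \<Rightarrow> params \<Rightarrow> complex poly" where
  "pv f v = pcompose (f (v par_a) (v par_b) (v par_c) (v par_g) (v par_q)) [:- v par_r - v par_p, 1:]"

lemma poly_pv: "poly (pv f v) t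
    = poly (f (v par_a) (v par_b) (v par_c) (v par_g) (v par_q)) (t - v par_r - v par_p)"
  by (simp add: pv_def poly_pcompose algebra_simps)

text \<open>\<open>psi s A\<close> with \<open>A = [A\<^sub>0, \<dots>, A\<^sub>n]\<close> is the conjugate by a complex power of \<open>\<partial>\<close> (the Riemann-Liouville
  transform, which shifts \<open>\<theta>\<close> and fixes \<open>\<partial>\<close>) of \<open>\<partial>\<^sup>n (x\<^sup>n A\<^sub>0(\<theta>) + \<dots> + A\<^sub>n(\<theta>))\<close>.  Hence identities between
  operators of low order carry over to their transforms.\<close>

fun rising :: "complex \<Rightarrow> nat \<Rightarrow> complex poly" where
  "rising s 0 = 1"
| "rising s (Suc n) = [:s, 1:] * rising (s + 1) n"

fun Ms :: "complex \<Rightarrow> complex poly list \<Rightarrow> complex poly list" where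
  "Ms s [] = []"
| "Ms s (h # hs) = (rising s (length hs) * h) # Ms (s + 1) hs"

definition psi :: "complex \<Rightarrow> complex poly list \<Rightarrow> diffop" where
  "psi s A = lop (Ms s A)"

lemma rising_add: "rising s m * rising (s + of_nat m) n = rising s (m + n)"
proof (induction m arbitrary: s)
  case (Suc m)
  then show ?case
    using Suc.IH[of "s + 1"] by (simp add: mult.assoc add.assoc del: mult_pCons_left)
qed simp

lemma shp_rising: "shp (rising s n) = rising (s + 1) n"
proof (induction n arbitrary: s)
  case 0
  show ?case by (simp add: complex_poly_ext)
next
  case (Suc n)
  have "shp [:s, 1:] = [:s + 1, 1:]" by (rule complex_poly_ext) simp
  then show ?case by (simp add: Suc.IH del: mult_pCons_left)
qed

lemma map_shp_Ms: "map shp (Ms s B) = Ms (s + 1) (map shp B)"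
  by (induction B arbitrary: s) (simp_all add: shp_rising)

lemma Ms_map_mult: "Ms s (map ((*) a) B) = map ((*) a) (Ms s B)"
  by (induction B arbitrary: s) (simp_all add: mult.left_commute)

lemma psi_Cons: "psi s (h # hs) = thp (rising s (length hs) * h) + psi (s + 1) hs * op_d"
  by (simp add: psi_def)

lemma psi_Nil [simp]: "psi s [] = 0"
  by (simp add: psi_def)

lemma psi_replicate_0 [simp]: "psi s (replicate n 0) = 0"
  by (induction n arbitrary: s) (simp_all add: psi_Cons)

text \<open>The length of a list matters for \<open>psi\<close>: a trailing zero raises the power of
  \<partial> in front, and this shows as one more linear factor in \<theta>.\<close>

lemma psi_pad:
  "B \<noteq> [] \<Longrightarrow> psi s (B @ replicate n 0) = thp (rising (s + of_nat (length B - 1)) n) * psi s B"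
proof (induction B arbitrary: s)
  case (Cons b B)
  show ?case
  proof (cases "B = []")
    case True
    then show ?thesis by (simp add: psi_Cons thp_mult)
  next
    case False
    then have "psi (s + 1) (B @ replicate n 0)
        = thp (rising (s + of_nat (length (b # B) - 1)) n) * psi (s + 1) B"
      using Cons.IH[OF False, of "s + 1"] by (cases B) (simp_all add: add_ac)
    moreover have "rising s (length (B @ replicate n 0))
        = rising (s + of_nat (length (b # B) - 1)) n * rising s (length B)"
      using rising_add[of s "length B" n] by (simp add: mult.commute)
    ultimately show ?thesis by (simp add: psi_Cons thp_mult distrib_left mult.assoc)
  qed
qed simp

lemma psi_ladd: "length X + n = length Y \<Longrightarrow> psi s (ladd X Y) = psi s (X @ replicate n 0) + psi s Y"
proof (induction X Y arbitrary: s rule: ladd.induct)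
  case (3 a A b B)
  have "length (ladd A B) = length B"
    using "3.prems" by (induction A B rule: ladd.induct) auto
  then show ?case using 3 by (simp add: psi_Cons thp_add distrib_left distrib_right add_ac)
qed simp_all

lemma length_ladd: "length (ladd A B) = max (length A) (length B)"
  by (induction A B rule: ladd.induct) auto

lemma length_lmult: "A \<noteq> [] \<Longrightarrow> B \<noteq> [] \<Longrightarrow> length (lmult A B) = length A + length B - 1"
proof (induction A arbitrary: B)
  case (Cons a A)
  then show ?case by (cases "A = []"; cases B) (auto simp: length_ladd)
qed simp

text \<open>The left factor has to pass the power of \<partial> belonging to \<open>B\<close>, which
  shifts \<open>s\<close> by \<open>length B - 1\<close>. In the induction the rising factor of the
  head of \<open>A\<close> is exactly the one produced by padding with
  \<open>psi_pad\<close>.\<close>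

lemma psi_mult:
  assumes "A \<noteq> []" "B \<noteq> []"
  shows "psi (s + of_nat (length B - 1)) A * psi s B = psi s (lmult A B)"
  using assms
proof (induction A arbitrary: s B)
  case (Cons a A)
  let ?m = "length B - 1"
  have len: "Suc ?m = length B" using Cons.prems by (cases B) auto
  show ?case
  proof (cases "A = []")
    case True
    have "length (0 # lmult A (map shp B)) \<le> length (map ((*) a) B)"
      using True len by simp
    moreover have "ladd X [0] = X" if "X \<noteq> []" for X :: "complex poly list"
      using that by (cases X) (auto, metis ladd.simps(1) ladd.simps(2) neq_Nil_conv)
    ultimately show ?thesis using True Cons.prems
      by (simp add: psi_Cons psi_def Ms_map_mult lop_map_mult)
  next
    case False
    have 1: "psi (s + 1 + of_nat ?m) A * psi (s + 1) (map shp B) = psi (s + 1) (lmult A (map shp B))"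
      using Cons.IH[OF False, of "map shp B" "s + 1"] Cons.prems by simp
    have dB: "op_d * psi s B = psi (s + 1) (map shp B) * op_d"
      by (simp add: psi_def op_d_lop map_shp_Ms)
    have "psi (s + of_nat ?m) (a # A) * psi s B
        = thp (rising (s + of_nat ?m) (length A)) * (thp a * psi s B)
          + psi (s + 1 + of_nat ?m) A * psi (s + 1) (map shp B) * op_d"
      by (simp add: psi_Cons distrib_right mult.assoc dB thp_mult add_ac)
    also have "thp a * psi s B = psi s (map ((*) a) B)"
      by (simp add: psi_def Ms_map_mult lop_map_mult)
    also have "thp (rising (s + of_nat ?m) (length A)) * psi s (map ((*) a) B)
        = psi s (map ((*) a) B @ replicate (length A) 0)"
      using psi_pad[of "map ((*) a) B" s "length A"] Cons.prems by simp
    also have "psi (s + 1 + of_nat ?m) A * psi (s + 1) (map shp B) * op_d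
        = psi s (0 # lmult A (map shp B))"
      unfolding 1 by (simp add: psi_Cons)
    also have "psi s (map ((*) a) B @ replicate (length A) 0) + psi s (0 # lmult A (map shp B))
        = psi s (lmult (a # A) B)"
      using length_lmult[OF False, of "map shp B"] Cons.prems len
      by (simp add: psi_ladd[of _ "length A"])
    finally show ?thesis .
  qed
qed simp

lemma psi_4: "psi s [b0, b1, b2, b3] = thp ([:s + 2, 1:] * [:s + 1, 1:] * [:s, 1:] * b0)
    + (thp ([:s + 2, 1:] * [:s + 1, 1:] * b1) + (thp ([:s + 2, 1:] * b2) + thp b3 * op_d) * op_d) * op_d"
  by (simp add: psi_Cons mult_ac add_ac del: mult_pCons_left mult_pCons_right)

lemma sum_1_9: "(\<Sum>i=1..9. f i) = f 1 + f 2 + f 3 + f 4 + f 5 + f 6 + f 7 + f 8 + (f 9 :: complex)" for f :: "nat \<Rightarrow> complex"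
proof -
  have "{1..9::nat} = {1, 2, 3, 4, 5, 6, 7, 8, 9}" by auto
  then show ?thesis by (simp add: add_ac)
qed

lemma thp_cubic: "op_const c3 * op_theta ^ 3 + op_const c2 * op_theta ^ 2 + op_const c1 * op_theta + op_const c0
    = thp [:c0, c1, c2, c3:]"
  by (simp add: thp_pCons distrib_right power3_eq_cube power2_eq_square mult.assoc add_ac)

text \<open>The reduction to order 3. Since \<open>s = - r\<close>, the factors \<theta> +
  \<open>s\<close>, \<theta> + \<open>s + 1\<close>, \<theta> + \<open>s + 2\<close> of
  \<open>E6\<close> are the rising factors of \<open>psi\<close>, and the cubics that remain depend
  on \<theta>, \<open>r\<close>, \<open>p\<close> only through \<theta> -
  \<open>r - p\<close>.\<close>

lemma SE6_lop: "SE6 v = psi (- v par_r) [pv be0 v, pv be1 v, pv be2 v, pv be3 v]"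
proof -
  define a b c g p q r where abc: "a = v par_a" "b = v par_b" "c = v par_c" "g = v par_g"
    "p = v par_p" "q = v par_q" "r = v par_r"
  let ?e = "SE6_exponent v"
  have e: "?e 1 = p + r + 1" "?e 2 = a + c + p + r + 2" "?e 3 = 2 * a + 2 * c + g + p + r + 3"
    "?e 4 = q + r + 1" "?e 5 = b + c + q + r + 2" "?e 6 = 2 * b + 2 * c + g + q + r + 3"
    "?e 7 = - 2 * c - (p + q + r) - 1" "?e 8 = - (a + b + c) - c - (p + q + r + g) - 2"
    "?e 9 = - 2 * (a + b + c) - (p + q + r + g) - 3"
    by (simp_all add: SE6_exponent_def Let_def abc numeral_eq_Suc)
  have "(6 - (\<Sum>i=1..9. ?e i)) / 3 = - r"
    unfolding sum_1_9 e by (simp add: field_simps)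
  note s = this
  have B0: "[:?e 7, 1:] * [:?e 8, 1:] * [:?e 9, 1:] = pv be0 v"
    unfolding pv_def be0_def pcompose_mult abc[symmetric]
    by (intro arg_cong2[where f = "(*)"]) (simp_all add: pcompose_pCons e)
  have B3: "- ([:3 - ?e 1, 1:] * [:3 - ?e 2, 1:] * [:3 - ?e 3, 1:]) = pv be3 v"
    unfolding pv_def be3_def pcompose_mult pcompose_uminus abc[symmetric]
    by (intro arg_cong2[where f = "(*)"] arg_cong[where f = uminus])
      (simp_all add: pcompose_pCons e e(1)[unfolded One_nat_def])
  have T: "T0 = U0 \<Longrightarrow> T1 = U1 \<Longrightarrow> T2 = U2 \<Longrightarrow> T3 = U3 \<Longrightarrow>
      T0 + T1 * op_d + T2 * op_d^2 + T3 * op_d^3 = U0 + (U1 + (U2 + U3 * op_d) * op_d) * op_d" for T0 T1 T2 T3 U0 U1 U2 U3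
    by (simp add: distrib_right power2_eq_square power3_eq_cube mult.assoc add.assoc)
  show ?thesis
    unfolding SE6_def E6_def Let_def s thp_cubic thp_linear[symmetric] thp_mult[symmetric] thp_uminus[symmetric]
      psi_4 abc(7)[symmetric]
    apply (rule T; rule arg_cong[where f = thp])
    subgoal unfolding B0[symmetric] by (simp only: mult_ac)
    subgoal by (rule arg_cong2[where f = "(*)", OF refl], rule complex_poly_ext,
        unfold poly_pv be1_def poly_pCons poly_0 abc[symmetric] e, algebra)
    subgoal by (rule arg_cong2[where f = "(*)", OF refl], rule complex_poly_ext,
        unfold poly_pv be2_def poly_pCons poly_0 abc[symmetric] e, algebra)
    subgoal by (rule B3)
    done
qed

subsection \<open>Intertwining relations\<close>

abbreviation SEl :: "params \<Rightarrow> complex poly list" where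
  "SEl v \<equiv> [pv be0 v, pv be1 v, pv be2 v, pv be3 v]"

lemma op_d_psi: "op_d * psi s B = psi (s + 1) (map shp B) * op_d"
  by (simp add: psi_def op_d_lop map_shp_Ms)

text \<open>Multiplication by \<open>x\<close> in transformed form: moving \<theta> +
  \<open>s\<close> through a rising factor of length \<open>n\<close> turns it into \<theta> +
  \<open>s + n\<close>.\<close>

lemma psi_mult_thp:
  "B \<noteq> [] \<Longrightarrow> psi (s + 1) B * thp [:s, 1:] = thp [:s + of_nat (length B - 1), 1:] * psi s B"
proof (induction B arbitrary: s)
  case (Cons b B)
  have r: "rising (s + 1) n * [:s, 1:] = rising s n * [:s + of_nat n, 1:]" for n
    using rising_add[of s n 1] rising_add[of s 1 n] by (simp add: mult.commute del: mult_pCons_left mult_pCons_right)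
  have sh: "shp [:s, 1:] = [:s + 1, 1:]" by (rule complex_poly_ext) simp
  have IH: "psi (s + 2) B * thp [:s + 1, 1:] = thp [:s + of_nat (length B), 1:] * psi (s + 1) B"
  proof (cases "B = []")
    case False
    then have "s + 1 + of_nat (length B - 1) = s + of_nat (length B)" by (cases B) simp_all
    then show ?thesis using Cons.IH[OF False, of "s + 1"] by (simp add: add.assoc)
  qed simp
  have "psi (s + 1) (b # B) * thp [:s, 1:]
      = thp (rising (s + 1) (length B) * [:s, 1:] * b) + psi (s + 2) B * (op_d * thp [:s, 1:])"
    by (simp add: psi_Cons distrib_right mult_ac thp_mult[symmetric] add_ac mult.assoc del: mult_pCons_left mult_pCons_right)
  also have "\<dots> = thp [:s + of_nat (length B), 1:] * psi s (b # B)"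
    unfolding r op_d_thp sh mult.assoc[symmetric, of _ "thp _"] IH
    by (simp add: psi_Cons distrib_left mult_ac thp_mult[symmetric] mult.assoc del: mult_pCons_left mult_pCons_right)
  finally show ?case by simp
qed simp

lemma pv_shift_r: "pv f (v(par_r := v par_r - 1)) = shp (pv f v)"
  by (rule complex_poly_ext) (simp add: poly_pv algebra_simps)

lemma SE6_op_d: "op_d * SE6 v = SE6 (v(par_r := v par_r - 1)) * op_d"
  by (simp add: SE6_lop op_d_psi pv_shift_r)

definition xi :: "complex \<Rightarrow> diffop" where "xi r = op_theta - op_const r"

lemma xi_thp: "xi r = thp [:- r, 1:]"
  by (simp add: xi_def thp_linear op_const_simps)

text \<open>\<open>r + p\<close> is preserved, so both operators \<open>SE6\<close> have the same
  coefficient list and differ only in \<open>s\<close>. The \<open>- 3\<close> is the length of the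
  list minus one.\<close>

lemma SE6_xi: "xi (v par_r - 3) * SE6 v
    = SE6 (v(par_p := v par_p + 1, par_r := v par_r - 1)) * xi (v par_r)"
proof -
  have "pv f (v(par_p := v par_p + 1, par_r := v par_r - 1)) = pv f v" for f
    by (rule complex_poly_ext) (simp add: poly_pv algebra_simps)
  then show ?thesis
    using psi_mult_thp[of "SEl v" "- v par_r"] by (simp add: SE6_lop xi_thp)
qed

definition psi2 :: "params \<Rightarrow> dfpoly \<Rightarrow> dfpoly \<Rightarrow> dfpoly \<Rightarrow> diffop" where
  "psi2 v h0 h1 h2 = psi (- v par_r) [pv h0 v, pv h1 v, pv h2 v]"

definition M_a where "M_a v = psi2 v ma0 ma1 ma2"
definition M_c where "M_c v = psi2 v mc0 mc1 mc2"
definition M_g where "M_g v = psi2 v mg0 mg1 mg2"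
definition N_a where "N_a v = psi2 v na0 na1 na2"
definition N_c where "N_c v = psi2 v nc0 nc1 nc2"
definition N_g where "N_g v = psi (- v par_r) [pv ng0 v, pv ng1 v, pv ng2 v, pv ng3 v, pv ng4 v]"
text \<open>This is \<partial> (\<theta> - \<open>r\<close>), see \<open>M_p_eq\<close>. It raises
  \<open>p\<close> with \<open>r \<mapsto> r - 2\<close>; since \<open>p + 1 = (p - 1) + 2\<close>,
  it also serves as the multiplier for lowering \<open>p\<close>.\<close>

definition M_p :: "params \<Rightarrow> diffop" where "M_p v = psi (- v par_r) [0, 1, 0]"

lemma lmult_4_3:
  assumes "\<And>t. poly b0' t * poly h0 t = poly k0 t * poly b0 t"
    and "\<And>t. poly b1' t * poly h0 (t + 1) + poly b0' t * poly h1 t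
       = poly k0 t * poly b1 t + poly k1 t * poly b0 (t + 1)"
    and "\<And>t. poly b2' t * poly h0 (t + 2) + poly b1' t * poly h1 (t + 1) + poly b0' t * poly h2 t
       = poly k0 t * poly b2 t + poly k1 t * poly b1 (t + 1) + poly k2 t * poly b0 (t + 2)"
    and "\<And>t. poly b3' t * poly h0 (t + 3) + poly b2' t * poly h1 (t + 2) + poly b1' t * poly h2 (t + 1)
       = poly k0 t * poly b3 t + poly k1 t * poly b2 (t + 1) + poly k2 t * poly b1 (t + 2)"
    and "\<And>t. poly b3' t * poly h1 (t + 3) + poly b2' t * poly h2 (t + 2)
       = poly k1 t * poly b3 (t + 1) + poly k2 t * poly b2 (t + 2)"
    and "\<And>t. poly b3' t * poly h2 (t + 3) = poly k2 t * poly b3 (t + 2)"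
  shows "lmult [b0', b1', b2', b3'] [h0, h1, h2] = lmult [k0, k1, k2] [b0, b1, b2, b3]"
  unfolding lmult.simps ladd.simps list.map list.inject
  using assms by (intro conjI refl; intro complex_poly_ext) (simp_all add: add_ac)

lemma lmult_4_5:
  assumes "\<And>t. poly b0' t * poly h0 t = poly k0 t * poly b0 t"
    and "\<And>t. poly b1' t * poly h0 (t + 1) + poly b0' t * poly h1 t
       = poly k0 t * poly b1 t + poly k1 t * poly b0 (t + 1)"
    and "\<And>t. poly b2' t * poly h0 (t + 2) + poly b1' t * poly h1 (t + 1) + poly b0' t * poly h2 t
       = poly k0 t * poly b2 t + poly k1 t * poly b1 (t + 1) + poly k2 t * poly b0 (t + 2)"
    and "\<And>t. poly b3' t * poly h0 (t + 3) + poly b2' t * poly h1 (t + 2) + poly b1' t * poly h2 (t + 1)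
         + poly b0' t * poly h3 t
       = poly k0 t * poly b3 t + poly k1 t * poly b2 (t + 1) + poly k2 t * poly b1 (t + 2)
         + poly k3 t * poly b0 (t + 3)"
    and "\<And>t. poly b3' t * poly h1 (t + 3) + poly b2' t * poly h2 (t + 2) + poly b1' t * poly h3 (t + 1)
         + poly b0' t * poly h4 t
       = poly k1 t * poly b3 (t + 1) + poly k2 t * poly b2 (t + 2) + poly k3 t * poly b1 (t + 3)
         + poly k4 t * poly b0 (t + 4)"
    and "\<And>t. poly b3' t * poly h2 (t + 3) + poly b2' t * poly h3 (t + 2) + poly b1' t * poly h4 (t + 1)
       = poly k2 t * poly b3 (t + 2) + poly k3 t * poly b2 (t + 3) + poly k4 t * poly b1 (t + 4)"
    and "\<And>t. poly b3' t * poly h3 (t + 3) + poly b2' t * poly h4 (t + 2)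
       = poly k3 t * poly b3 (t + 3) + poly k4 t * poly b2 (t + 4)"
    and "\<And>t. poly b3' t * poly h4 (t + 3) = poly k4 t * poly b3 (t + 4)"
  shows "lmult [b0', b1', b2', b3'] [h0, h1, h2, h3, h4] = lmult [k0, k1, k2, k3, k4] [b0, b1, b2, b3]"
  unfolding lmult.simps ladd.simps list.map list.inject
  using assms by (intro conjI refl; intro complex_poly_ext) (simp_all add: add_ac)

lemma psi_hom_3:
  assumes "lmult b' [h0, h1, h2] = lmult [k0, k1, k2] [b0, b1, b2, b3 :: complex poly]" "b' \<noteq> []"
  shows "psi (s + 2) b' * psi s [h0, h1, h2] \<in> left_ideal (psi s [b0, b1, b2, b3])"
proof -
  have "psi (s + 2) b' * psi s [h0, h1, h2] = psi (s + 3) [k0, k1, k2] * psi s [b0, b1, b2, b3]"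
    using psi_mult[of b' "[h0, h1, h2]" s] psi_mult[of "[k0, k1, k2]" "[b0, b1, b2, b3]" s] assms
    by (simp del: lmult.simps)
  then show ?thesis by simp
qed

lemma psi_hom_5:
  assumes "lmult b' [h0, h1, h2, h3, h4] = lmult [k0, k1, k2, k3, k4] [b0, b1, b2, b3 :: complex poly]" "b' \<noteq> []"
  shows "psi (s + 4) b' * psi s [h0, h1, h2, h3, h4] \<in> left_ideal (psi s [b0, b1, b2, b3])"
proof -
  have "psi (s + 4) b' * psi s [h0, h1, h2, h3, h4]
      = psi (s + 3) [k0, k1, k2, k3, k4] * psi s [b0, b1, b2, b3]"
    using psi_mult[of b' "[h0, h1, h2, h3, h4]" s] psi_mult[of "[k0, k1, k2, k3, k4]" "[b0, b1, b2, b3]" s] assms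
    by (simp del: lmult.simps)
  then show ?thesis by simp
qed

context
  fixes v :: params and a b c g p q r s w
  defines "a \<equiv> v par_a" and "b \<equiv> v par_b" and "c \<equiv> v par_c" and "g \<equiv> v par_g"
    and "p \<equiv> v par_p" and "q \<equiv> v par_q" and "r \<equiv> v par_r" and "s \<equiv> - v par_r"
    and "w \<equiv> \<lambda>t. t - v par_r - v par_p"
begin

lemmas abc = a_def b_def c_def g_def p_def q_def r_def s_def w_def

lemma M_a_hom: "SE6 (v(par_a := a + 1, par_r := r - 2)) * M_a v \<in> left_ideal (SE6 v)"
proof -
  have "lmult (SEl (v(par_a := a + 1, par_r := r - 2))) [pv ma0 v, pv ma1 v, pv ma2 v]
      = lmult [pv mak0 v, pv mak1 v, pv mak2 v] (SEl v)"
    by (rule lmult_4_3) (use ma_intertwines[of a b c g q "w _"] in \<open>simp_all add: poly_pv abc algebra_simps\<close>)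
  from psi_hom_3[OF this, of "- v par_r"] show ?thesis
    by (simp add: SE6_lop M_a_def psi2_def abc)
qed

lemma M_c_hom: "SE6 (v(par_c := c + 1, par_r := r - 2)) * M_c v \<in> left_ideal (SE6 v)"
proof -
  have "lmult (SEl (v(par_c := c + 1, par_r := r - 2))) [pv mc0 v, pv mc1 v, pv mc2 v]
      = lmult [pv mck0 v, pv mck1 v, pv mck2 v] (SEl v)"
    by (rule lmult_4_3) (use mc_intertwines[of a b c g q "w _"] in \<open>simp_all add: poly_pv abc algebra_simps\<close>)
  from psi_hom_3[OF this, of "- v par_r"] show ?thesis
    by (simp add: SE6_lop M_c_def psi2_def abc)
qed

lemma M_g_hom: "SE6 (v(par_g := g + 2, par_r := r - 2)) * M_g v \<in> left_ideal (SE6 v)"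
proof -
  have "lmult (SEl (v(par_g := g + 2, par_r := r - 2))) [pv mg0 v, pv mg1 v, pv mg2 v]
      = lmult [pv mgk0 v, pv mgk1 v, pv mgk2 v] (SEl v)"
    by (rule lmult_4_3) (use mg_intertwines[of a b c g q "w _"] in \<open>simp_all add: poly_pv abc algebra_simps\<close>)
  from psi_hom_3[OF this, of "- v par_r"] show ?thesis
    by (simp add: SE6_lop M_g_def psi2_def abc)
qed

lemma N_a_hom: "SE6 (v(par_a := a - 1, par_p := p + 2, par_r := r - 2)) * N_a v \<in> left_ideal (SE6 v)"
proof -
  have "lmult (SEl (v(par_a := a - 1, par_p := p + 2, par_r := r - 2))) [pv na0 v, pv na1 v, pv na2 v]
      = lmult [pv nak0 v, pv nak1 v, pv nak2 v] (SEl v)"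
    by (rule lmult_4_3) (use na_intertwines[of a b c g q "w _"] in \<open>simp_all add: poly_pv abc algebra_simps\<close>)
  from psi_hom_3[OF this, of "- v par_r"] show ?thesis
    by (simp add: SE6_lop N_a_def psi2_def abc)
qed

lemma N_c_hom: "SE6 (v(par_c := c - 1, par_p := p + 2, par_q := q + 2, par_r := r - 2)) * N_c v \<in> left_ideal (SE6 v)"
proof -
  have "lmult (SEl (v(par_c := c - 1, par_p := p + 2, par_q := q + 2, par_r := r - 2))) [pv nc0 v, pv nc1 v, pv nc2 v]
      = lmult [pv nck0 v, pv nck1 v, pv nck2 v] (SEl v)"
    by (rule lmult_4_3) (use nc_intertwines[of a b c g q "w _"] in \<open>simp_all add: poly_pv abc algebra_simps\<close>)
  from psi_hom_3[OF this, of "- v par_r"] show ?thesis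
    by (simp add: SE6_lop N_c_def psi2_def abc)
qed

lemma N_g_hom: "SE6 (v(par_g := g - 2, par_p := p + 2, par_q := q + 2, par_r := r - 4)) * N_g v \<in> left_ideal (SE6 v)"
proof -
  have "lmult (SEl (v(par_g := g - 2, par_p := p + 2, par_q := q + 2, par_r := r - 4))) [pv ng0 v, pv ng1 v, pv ng2 v, pv ng3 v, pv ng4 v]
      = lmult [pv ngk0 v, pv ngk1 v, pv ngk2 v, pv ngk3 v, pv ngk4 v] (SEl v)"
    by (rule lmult_4_5) (use ng_intertwines[of a b c g q "w _"] in \<open>simp_all add: poly_pv abc algebra_simps\<close>)
  from psi_hom_5[OF this, of "- v par_r"] show ?thesis
    by (simp add: SE6_lop N_g_def abc)
qed

end

subsection \<open>The reflection of \<open>SE\<^sub>6\<close>\<close>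

definition swap :: "params \<Rightarrow> params" where
  "swap v = v(par_a := v par_b, par_b := v par_a, par_p := v par_q, par_q := v par_p)"

lemma swap_simps [simp]:
  "swap v par_a = v par_b" "swap v par_b = v par_a" "swap v par_c = v par_c" "swap v par_g = v par_g"
  "swap v par_p = v par_q" "swap v par_q = v par_p" "swap v par_r = v par_r" "swap (swap v) = v"
  by (auto simp: swap_def)

definition flin :: "complex \<Rightarrow> complex poly list" where "flin c = [[:c, 1:], - 1]"

lemma lop_const: "lop [[:c:]] = op_const c"
  by (simp add: thp_const)

lemma oflip_linear: "oflip (thp [:c, 1:]) = lop (flin c)"
  by (simp add: flin_def thp_linear oflip_add oflip_theta thp_uminus)

text \<open>The inner cubics do not split into linear factors over the parameters, so they are
  reflected in Horner form with respect to \<theta> + \<open>d\<close>.\<close>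

lemma oflip_cubic:
  "oflip (thp (pcompose [:c0, c1, c2, c3:] [:d, 1:]))
     = lop (ladd [[:c0:]] (lmult (flin d) (ladd [[:c1:]] (lmult (flin d) (ladd [[:c2:]] (lmult (flin d) [[:c3:]]))))))"
proof -
  have "pcompose [:c0, c1, c2, c3:] [:d, 1:]
      = [:c0:] + [:d, 1:] * ([:c1:] + [:d, 1:] * ([:c2:] + [:d, 1:] * [:c3:]))"
    by (simp add: pcompose_pCons)
  then show ?thesis
    by (simp only: thp_add thp_mult thp_const oflip_add oflip_mult oflip_op_const oflip_linear
        lop_ladd lop_lmult lop_const)
qed

lemma lop_map_uminus: "lop (map uminus X) = - lop X"
  by (induction X) (simp_all add: thp_uminus)

lemma coeff_pCons_1_2: "coeff (pCons a p) 1 = coeff p 0" "coeff (pCons a (pCons b p)) 2 = coeff p 0"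
  by (simp_all add: numeral_2_eq_2)

text \<open>Every factor \<theta> + \<open>c\<close> becomes \<theta> + \<open>c\<close> -
  \<partial>. Expanding the products of such factors as lists turns the claim into seven polynomial
  identities.\<close>

lemma SE6_flip: "oflip (SE6 (swap v)) = SE6 v"
proof -
  define a b c g p q r where abc: "a = v par_a" "b = v par_b" "c = v par_c" "g = v par_g"
    "p = v par_p" "q = v par_q" "r = v par_r"
  let ?d = "- r - q"
  have be0: "pv be0 (swap v) = [:?d + (- 2*c - p - 1), 1:] * [:?d + (- b - a - 2*c - g - p - 2), 1:]
      * [:?d + (- 2*b - 2*a - 2*c - g - p - 3), 1:]"
    unfolding pv_def be0_def pcompose_mult swap_simps abc[symmetric]
    by (intro arg_cong2[where f = "(*)"]) (simp_all add: pcompose_pCons)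
  have be3: "pv be3 (swap v) = - ([:?d + 2, 1:] * [:?d + (1 - b - c), 1:] * [:?d + (- 2*b - 2*c - g), 1:])"
    unfolding pv_def be3_def pcompose_mult pcompose_uminus swap_simps abc[symmetric]
    by (intro arg_cong2[where f = "(*)"] arg_cong[where f = uminus]) (simp_all add: pcompose_pCons)
  \<comment> \<open>Abbreviations for the lower coefficients of the two inner cubics at the
    exchanged parameters; they keep the expansion small and are inserted only for the final
    identities.\<close>
  define x0 x1 x2 where x: "x0 = coeff (be1 b a c g p) 0" "x1 = coeff (be1 b a c g p) 1" "x2 = coeff (be1 b a c g p) 2"
  define y0 y1 y2 where y: "y0 = coeff (be2 b a c g p) 0" "y1 = coeff (be2 b a c g p) 1" "y2 = coeff (be2 b a c g p) 2"
  have be1: "pv be1 (swap v) = pcompose [:x0, x1, x2, - 3:] [:?d, 1:]"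
    unfolding pv_def swap_simps abc[symmetric] x by (simp add: be1_def numeral_eq_Suc)
  have be2: "pv be2 (swap v) = pcompose [:y0, y1, y2, 3:] [:?d, 1:]"
    unfolding pv_def swap_simps abc[symmetric] y by (simp add: be2_def numeral_eq_Suc)
  define H1 where "H1 = lmult (flin (2 - r)) (lmult (flin (1 - r)) (ladd [[:x0:]] (lmult (flin ?d)
     (ladd [[:x1:]] (lmult (flin ?d) (ladd [[:x2:]] (lmult (flin ?d) [[:- 3:]])))))))"
  define H2 where "H2 = lmult (flin (2 - r)) (ladd [[:y0:]] (lmult (flin ?d)
     (ladd [[:y1:]] (lmult (flin ?d) (ladd [[:y2:]] (lmult (flin ?d) [[:3:]]))))))"
  define H0 where "H0 = lmult (flin (2 - r)) (lmult (flin (1 - r)) (lmult (flin (- r)) (lmult (flin (?d + (- 2*c - p - 1)))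
     (lmult (flin (?d + (- b - a - 2*c - g - p - 2))) (flin (?d + (- 2*b - 2*a - 2*c - g - p - 3)))))))"
  define H3 where "H3 = lmult (flin (?d + 2)) (lmult (flin (?d + (1 - b - c))) (flin (?d + (- 2*b - 2*c - g))))"
  have m: "lop X * op_d = lop (0 # X)" for X by simp
  have "oflip (SE6 (swap v)) = lop H0 - lop (0 # H1) + lop (0 # 0 # H2) + lop (0 # 0 # 0 # H3)"
    unfolding SE6_lop psi_4 be0 be1 be2 be3 thp_mult thp_uminus oflip_add oflip_mult oflip_mult_d oflip_uminus
      oflip_linear oflip_cubic H0_def H1_def H2_def H3_def m[symmetric] lop_lmult swap_simps abc[symmetric]
    by (simp add: oflip_d distrib_right left_diff_distrib mult.assoc)
  also have "\<dots> = lop (ladd (ladd H0 (map uminus (0 # H1))) (ladd (0 # 0 # H2) (0 # 0 # 0 # H3)))"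
    using lop_map_uminus[of "0 # H1"] by (simp add: lop_ladd add_ac distrib_right)
  \<comment> \<open>The three zeros say that the coefficients of \<partial>^4, \<partial>^5 and
    \<partial>^6 cancel.\<close>
  also have "ladd (ladd H0 (map uminus (0 # H1))) (ladd (0 # 0 # H2) (0 # 0 # 0 # H3))
      = [[:2 - r, 1:] * [:1 - r, 1:] * [:- r, 1:] * pv be0 v, [:2 - r, 1:] * [:1 - r, 1:] * pv be1 v,
         [:2 - r, 1:] * pv be2 v, pv be3 v, 0, 0, 0]"
    unfolding H0_def H1_def H2_def H3_def flin_def lmult.simps ladd.simps list.map list.inject
    apply (intro conjI refl; rule complex_poly_ext;
      unfold poly_add poly_mult poly_minus poly_shp poly_pv poly_pCons poly_0 poly_1 abc[symmetric] be0_def be1_def be2_def be3_def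
      x[unfolded be1_def coeff_pCons_0 coeff_pCons_1_2] y[unfolded be2_def coeff_pCons_0 coeff_pCons_1_2])
    subgoal for t by algebra
    subgoal for t by algebra
    subgoal for t by algebra
    subgoal for t by algebra
    subgoal for t by algebra
    subgoal for t by algebra
    subgoal for t by algebra
    done
  also have "lop \<dots> = SE6 v"
    unfolding SE6_lop psi_4 by (simp add: abc[symmetric] add.commute del: mult_pCons_left mult_pCons_right)
  finally show ?thesis .
qed


subsection \<open>Composites of the intertwining operators\<close>

definition xi2 :: "complex \<Rightarrow> diffop" where "xi2 r = xi (r - 1) * xi r"

definition eta2 :: "complex \<Rightarrow> diffop" where "eta2 r = oflip (xi2 r)"

lemma shp_const [simp]: "shp 1 = 1" "shp (- p) = - shp p" "shp [:c:] = [:c:]"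
  by (rule complex_poly_ext, simp)+

lemma shp_numeral [simp]: "shp (numeral n) = numeral n"
  by (rule complex_poly_ext) simp

lemma xi2_psi: "xi2 r = psi (- r) [1, 0, 0]"
  by (simp add: xi2_def xi_thp psi_Cons mult.commute flip: thp_mult del: mult_pCons_left mult_pCons_right)

lemma oflip_xi: "oflip (xi r) = psi (- r) [1, - 1]"
  unfolding xi_thp oflip_linear by (simp add: psi_Cons flin_def)

lemma eta2_psi: "eta2 r = psi (- r) [1, - 2, 1]"
proof -
  have "psi (- r + of_nat (length [1, - 1 :: complex poly] - 1)) [1, - 1] * psi (- r) [1, - 1] = psi (- r) [1, - 2, 1]"
    by (subst psi_mult) simp_all
  then show ?thesis by (simp add: eta2_def xi2_def oflip_mult oflip_xi)
qed

lemma op_d_psi2: "op_d = psi s [0, 1]" "op_d ^ 2 = psi s [0, 0, 1]"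
  by (simp_all add: psi_Cons power2_eq_square)

lemma xi2_shift: "xi2 (r - 1) * op_d = op_d * xi2 r"
  by (simp add: xi2_psi op_d_psi)

lemma eta2_shift: "eta2 (r - 1) * op_d = op_d * eta2 r"
  by (simp add: eta2_psi op_d_psi)

lemma eta2_xi2: "eta2 (r - 2) * xi2 r = psi (- r) [1, - 2, 1, 0, 0]"
  using psi_mult[of "[1, - 2, 1]" "[1, 0, 0]" "- r"] by (simp add: eta2_psi xi2_psi)

lemma xi2_eta2: "xi2 (r - 2) * eta2 r = eta2 (r - 2) * xi2 r"
  unfolding eta2_xi2 using psi_mult[of "[1, 0, 0]" "[1, - 2, 1]" "- r"] by (simp add: eta2_psi xi2_psi)

lemma xi2_d2: "xi2 (r - 2) * op_d ^ 2 = psi (- r) [0, 0, 1, 0, 0]"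
  using psi_mult[of "[1, 0, 0]" "[0, 0, 1]" "- r"] by (simp add: xi2_psi op_d_psi2(2)[of "- r"])

lemma eta2_xi2_d2: "eta2 (r - 4) * xi2 (r - 2) * op_d ^ 2 = psi (- r) [0, 0, 1, - 2, 1, 0, 0]"
  using psi_mult[of "[1, - 2, 1]" "[0, 0, 1, 0, 0]" "- r"]
  by (simp add: mult.assoc xi2_d2 eta2_psi)

lemma psi_xi2:
  "psi (2 - r) [h0, h1, h2] * xi2 r = xi2 (r - 2) * psi (- r) [h0, h1, h2]"
  using psi_mult[of "[h0, h1, h2]" "[1, 0, 0]" "- r"] psi_mult[of "[1, 0, 0]" "[h0, h1, h2]" "- r"]
  by (simp add: xi2_psi)

lemma psi_smult: "psi s (map (smult k) A) = op_const k * psi s A"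
  by (induction A arbitrary: s) (simp_all add: psi_Cons thp_smult distrib_left mult.assoc)

lemma psi_add: "length X = length Y \<Longrightarrow> psi s (ladd X Y) = psi s X + psi s Y"
  using psi_ladd[of X 0 Y s] by simp

lemma psi_comp_3_3:
  assumes "\<And>t. poly u0 t * poly h0 t = poly z0 t + poly j0 t * poly b0 t"
    and "\<And>t. poly u0 t * poly h1 t + poly u1 t * poly h0 (t + 1)
       = poly z1 t + poly j0 t * poly b1 t + poly j1 t * poly b0 (t + 1)"
    and "\<And>t. poly u0 t * poly h2 t + poly u1 t * poly h1 (t + 1) + poly u2 t * poly h0 (t + 2)
       = poly z2 t + poly j0 t * poly b2 t + poly j1 t * poly b1 (t + 1)"
    and "\<And>t. poly u1 t * poly h2 (t + 1) + poly u2 t * poly h1 (t + 2)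
       = poly z3 t + poly j0 t * poly b3 t + poly j1 t * poly b2 (t + 1)"
    and "\<And>t. poly u2 t * poly h2 (t + 2) = poly z4 t + poly j1 t * poly b3 (t + 1)"
  shows "psi (s + 2) [u0, u1, u2] * psi s [h0, h1, h2] - psi s [z0, z1, z2, z3, z4]
    \<in> left_ideal (psi s [b0, b1, b2, b3])"
proof -
  have "lmult [u0, u1, u2] [h0, h1, h2] = ladd [z0, z1, z2, z3, z4] (lmult [j0, j1] [b0, b1, b2, b3])"
    unfolding lmult.simps ladd.simps list.map list.inject
    using assms by (intro conjI refl; intro complex_poly_ext) (simp_all add: add_ac)
  then have "psi (s + 2) [u0, u1, u2] * psi s [h0, h1, h2]
      = psi s [z0, z1, z2, z3, z4] + psi (s + 3) [j0, j1] * psi s [b0, b1, b2, b3]"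
    using psi_mult[of "[u0, u1, u2]" "[h0, h1, h2]" s] psi_mult[of "[j0, j1]" "[b0, b1, b2, b3]" s]
      psi_add[of "[z0, z1, z2, z3, z4]" "lmult [j0, j1] [b0, b1, b2, b3]" s]
    by (simp del: lmult.simps ladd.simps add: length_lmult)
  then show ?thesis by simp
qed

lemma psi_comp_3_5:
  assumes "\<And>t. poly u0 t * poly h0 t = poly z0 t + poly j0 t * poly b0 t"
    and "\<And>t. poly u0 t * poly h1 t + poly u1 t * poly h0 (t + 1)
       = poly z1 t + poly j0 t * poly b1 t + poly j1 t * poly b0 (t + 1)"
    and "\<And>t. poly u0 t * poly h2 t + poly u1 t * poly h1 (t + 1) + poly u2 t * poly h0 (t + 2)
       = poly z2 t + poly j0 t * poly b2 t + poly j1 t * poly b1 (t + 1) + poly j2 t * poly b0 (t + 2)"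
    and "\<And>t. poly u0 t * poly h3 t + poly u1 t * poly h2 (t + 1) + poly u2 t * poly h1 (t + 2)
       = poly z3 t + poly j0 t * poly b3 t + poly j1 t * poly b2 (t + 1) + poly j2 t * poly b1 (t + 2)
         + poly j3 t * poly b0 (t + 3)"
    and "\<And>t. poly u0 t * poly h4 t + poly u1 t * poly h3 (t + 1) + poly u2 t * poly h2 (t + 2)
       = poly z4 t + poly j1 t * poly b3 (t + 1) + poly j2 t * poly b2 (t + 2) + poly j3 t * poly b1 (t + 3)"
    and "\<And>t. poly u1 t * poly h4 (t + 1) + poly u2 t * poly h3 (t + 2)
       = poly z5 t + poly j2 t * poly b3 (t + 2) + poly j3 t * poly b2 (t + 3)"
    and "\<And>t. poly u2 t * poly h4 (t + 2) = poly z6 t + poly j3 t * poly b3 (t + 3)"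
  shows "psi (s + 4) [u0, u1, u2] * psi s [h0, h1, h2, h3, h4] - psi s [z0, z1, z2, z3, z4, z5, z6]
    \<in> left_ideal (psi s [b0, b1, b2, b3])"
proof -
  have "lmult [u0, u1, u2] [h0, h1, h2, h3, h4]
      = ladd [z0, z1, z2, z3, z4, z5, z6] (lmult [j0, j1, j2, j3] [b0, b1, b2, b3])"
    unfolding lmult.simps ladd.simps list.map list.inject
    using assms by (intro conjI refl; intro complex_poly_ext) (simp_all add: add_ac)
  then have "psi (s + 4) [u0, u1, u2] * psi s [h0, h1, h2, h3, h4]
      = psi s [z0, z1, z2, z3, z4, z5, z6] + psi (s + 3) [j0, j1, j2, j3] * psi s [b0, b1, b2, b3]"
    using psi_mult[of "[u0, u1, u2]" "[h0, h1, h2, h3, h4]" s] psi_mult[of "[j0, j1, j2, j3]" "[b0, b1, b2, b3]" s]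
      psi_add[of "[z0, z1, z2, z3, z4, z5, z6]" "lmult [j0, j1, j2, j3] [b0, b1, b2, b3]" s]
    by (simp del: lmult.simps ladd.simps add: length_lmult)
  then show ?thesis by simp
qed

context
  fixes v :: params and a b c g p q r s w
  defines "a \<equiv> v par_a" and "b \<equiv> v par_b" and "c \<equiv> v par_c" and "g \<equiv> v par_g"
    and "p \<equiv> v par_p" and "q \<equiv> v par_q" and "r \<equiv> v par_r" and "s \<equiv> - v par_r"
    and "w \<equiv> \<lambda>t. t - v par_r - v par_p"
begin

lemmas abc2 = a_def b_def c_def g_def p_def q_def r_def s_def w_def

lemma M_a_N_a: "M_a (v(par_a := a - 1, par_p := p + 2, par_r := r - 2)) * N_a v
    - op_const (kap_a a b c g) * (xi2 (r - 2) * op_d ^ 2) \<in> left_ideal (SE6 v)"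
proof -
  let ?v = "v(par_a := a - 1, par_p := p + 2, par_r := r - 2)"
  have "psi (s + 2) [pv ma0 ?v, pv ma1 ?v, pv ma2 ?v] * psi s [pv na0 v, pv na1 v, pv na2 v]
      - psi s [0, 0, [:kap_a a b c g:], 0, 0] \<in> left_ideal (psi s (SEl v))"
    by (rule psi_comp_3_3[where ?j0.0 = "pv ja0 v" and ?j1.0 = "pv ja1 v"])
      (use ma_na[of a b c g q "w _"] in \<open>simp_all add: poly_pv abc2 algebra_simps\<close>)
  moreover have "psi s [0, 0, [:kap_a a b c g:], 0, 0]
      = op_const (kap_a a b c g) * (xi2 (r - 2) * op_d ^ 2)"
    using psi_smult[of s "kap_a a b c g" "[0, 0, 1, 0, 0]"] by (simp add: xi2_d2 abc2)
  ultimately show ?thesis by (simp add: SE6_lop M_a_def N_a_def psi2_def abc2)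
qed

lemma M_c_N_c: "M_c (v(par_c := c - 1, par_p := p + 2, par_q := q + 2, par_r := r - 2)) * N_c v
    - op_const (kap_c a b c g) * (eta2 (r - 2) * xi2 r) \<in> left_ideal (SE6 v)"
proof -
  let ?v = "v(par_c := c - 1, par_p := p + 2, par_q := q + 2, par_r := r - 2)" and ?k = "kap_c a b c g"
  have "psi (s + 2) [pv mc0 ?v, pv mc1 ?v, pv mc2 ?v] * psi s [pv nc0 v, pv nc1 v, pv nc2 v]
      - psi s [[:?k:], [:- 2 * ?k:], [:?k:], 0, 0] \<in> left_ideal (psi s (SEl v))"
    by (rule psi_comp_3_3[where ?j0.0 = "pv jc0 v" and ?j1.0 = "pv jc1 v"])
      (use mc_nc[of a b c g q "w _"] in \<open>simp_all add: poly_pv abc2 algebra_simps\<close>)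
  moreover have "psi s [[:?k:], [:- 2 * ?k:], [:?k:], 0, 0] = op_const ?k * (eta2 (r - 2) * xi2 r)"
    using psi_smult[of s ?k "[1, [:- 2:], 1, 0, 0]"] by (simp add: eta2_xi2 abc2 numeral_poly mult.commute)
  ultimately show ?thesis by (simp add: SE6_lop M_c_def N_c_def psi2_def abc2)
qed

lemma M_g_N_g: "M_g (v(par_g := g - 2, par_p := p + 2, par_q := q + 2, par_r := r - 4)) * N_g v
    - op_const (kap_g a b c g) * (eta2 (r - 4) * xi2 (r - 2) * op_d ^ 2) \<in> left_ideal (SE6 v)"
proof -
  let ?v = "v(par_g := g - 2, par_p := p + 2, par_q := q + 2, par_r := r - 4)" and ?k = "kap_g a b c g"
  have "psi (s + 4) [pv mg0 ?v, pv mg1 ?v, pv mg2 ?v] * psi s [pv ng0 v, pv ng1 v, pv ng2 v, pv ng3 v, pv ng4 v]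
      - psi s [0, 0, [:?k:], [:- 2 * ?k:], [:?k:], 0, 0] \<in> left_ideal (psi s (SEl v))"
    by (rule psi_comp_3_5[where ?j0.0 = "pv jg0 v" and ?j1.0 = "pv jg1 v" and ?j2.0 = "pv jg2 v" and ?j3.0 = "pv jg3 v"])
      (use mg_ng[of a b c g q "w _"] in \<open>simp_all add: poly_pv abc2 algebra_simps\<close>)
  moreover have "psi s [0, 0, [:?k:], [:- 2 * ?k:], [:?k:], 0, 0]
      = op_const ?k * (eta2 (r - 4) * xi2 (r - 2) * op_d ^ 2)"
    using psi_smult[of s ?k "[0, 0, 1, [:- 2:], 1, 0, 0]"]
    by (simp add: eta2_xi2_d2 abc2 numeral_poly mult.commute)
  ultimately show ?thesis by (simp add: SE6_lop M_g_def N_g_def psi2_def abc2)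
qed

lemma psi2_xi2:
  "psi2 (v(par_p := p + 2, par_r := r - 2)) h0 h1 h2 * xi2 r = xi2 (r - 2) * psi2 v h0 h1 h2"
proof -
  have "pv f (v(par_p := p + 2, par_r := r - 2)) = pv f v" for f
    by (rule complex_poly_ext) (simp add: poly_pv abc2 algebra_simps)
  then show ?thesis using psi_xi2[of r] by (simp add: psi2_def abc2)
qed

lemma op_d2_psi2: "op_d ^ 2 * psi2 v h0 h1 h2 = psi2 (v(par_r := r - 2)) h0 h1 h2 * op_d ^ 2"
proof -
  have "pv f (v(par_r := r - 2)) = shp (shp (pv f v))" for f
    by (rule complex_poly_ext) (simp add: poly_pv abc2 algebra_simps)
  then show ?thesis
    by (simp add: psi2_def power2_eq_square mult.assoc op_d_psi abc2) (simp add: op_d_psi flip: mult.assoc)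
qed

end

lemma psi_eta2:
  assumes "\<And>t. poly u0 t = poly h0 t" "\<And>t. - 2 * poly u0 t + poly u1 t = poly h1 t - 2 * poly h0 (t + 1)"
    "\<And>t. poly u0 t - 2 * poly u1 t + poly u2 t = poly h2 t - 2 * poly h1 (t + 1) + poly h0 (t + 2)"
    "\<And>t. poly u1 t - 2 * poly u2 t = - 2 * poly h2 (t + 1) + poly h1 (t + 2)"
    "\<And>t. poly u2 t = poly h2 (t + 2)"
  shows "psi (2 - r) [u0, u1, u2] * eta2 r = eta2 (r - 2) * psi (- r) [h0, h1, h2]"
proof -
  have "lmult [u0, u1, u2] [1, - 2, 1] = lmult [1, - 2, 1] [h0, h1, h2]"
    unfolding lmult.simps ladd.simps list.map list.inject
    using assms by (intro conjI refl; intro complex_poly_ext) (simp_all add: algebra_simps)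
  then show ?thesis
    using psi_mult[of "[u0, u1, u2]" "[1, - 2, 1]" "- r"] psi_mult[of "[1, - 2, 1]" "[h0, h1, h2]" "- r"]
    by (simp add: eta2_psi del: lmult.simps)
qed

text \<open>Needed for \<open>c\<close> and \<open>g\<close>, whose composites contain
  \<open>eta2\<close>. The shift \<open>q \<mapsto> q + 2\<close> changes the coefficient
  polynomials, so unlike \<open>psi2_xi2\<close> this takes an explicit check.\<close>

lemma M_c_eta2: "M_c (v(par_q := v par_q + 2, par_r := v par_r - 2)) * eta2 (v par_r) = eta2 (v par_r - 2) * M_c v"
proof -
  define a b c g q where abc: "a = v par_a" "b = v par_b" "c = v par_c" "g = v par_g" "q = v par_q"
  show ?thesis
    unfolding M_c_def psi2_def
    apply simp
    apply (rule psi_eta2)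
    apply (simp_all add: poly_pv abc[symmetric] mc0_def mc1_def mc2_def)
    by algebra+
qed

lemma M_g_eta2: "M_g (v(par_q := v par_q + 2, par_r := v par_r - 2)) * eta2 (v par_r) = eta2 (v par_r - 2) * M_g v"
proof -
  define a b c g q where abc: "a = v par_a" "b = v par_b" "c = v par_c" "g = v par_g" "q = v par_q"
  show ?thesis
    unfolding M_g_def psi2_def
    apply simp
    apply (rule psi_eta2)
    apply (simp_all add: poly_pv abc[symmetric] mg0_def mg1_def mg2_def)
    by algebra+
qed

section \<open>Order and leading coefficient of \<open>SE\<^sub>6\<close>\<close>

definition has_top :: "complex poly \<Rightarrow> nat \<Rightarrow> complex \<Rightarrow> bool" where
  "has_top p n c \<longleftrightarrow> degree p \<le> n \<and> coeff p n = c"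

lemma has_top_mult: "has_top p m c \<Longrightarrow> has_top q n d \<Longrightarrow> has_top (p * q) (m + n) (c * d)"
  using extremal_mult[of "(<)" p m q n] degree_mult_le[of p q]
  by (auto simp: has_top_def extremal_def coeff_eq_0)

lemma has_top_linear: "has_top [:c, 1:] 1 1"
  by (simp add: has_top_def)

lemma has_top_uminus: "has_top p m c \<Longrightarrow> has_top (- p) m (- c)"
  by (simp add: has_top_def)

lemma has_top_cubic_product: "has_top ([:c, 1:] * [:d, 1:] * [:e, 1:]) 3 1"
  using has_top_mult[OF has_top_mult[OF has_top_linear has_top_linear] has_top_linear, of c d e]
  by (simp only: mult_1 numeral_3_eq_3 One_nat_def add_Suc_right add_0_right)

lemma has_top_cubic: "has_top (pcompose [:c0, c1, c2, c3:] [:d, 1:]) 3 c3"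
  using degree_pcompose_le[of "[:c0, c1, c2, c3:]" "[:d, 1:]"]
  by (auto simp: has_top_def pcompose_pCons numeral_3_eq_3 intro: order_trans)

lemma has_top_be:
  "has_top (pv be0 v) 3 1" "has_top (pv be1 v) 3 (- 3)" "has_top (pv be2 v) 3 3" "has_top (pv be3 v) 3 (- 1)"
proof -
  have l: "pcompose [:c, 1:] [:d, 1:] = [:c + d, 1:]" for c d :: complex
    by (simp add: pcompose_pCons)
  show "has_top (pv be0 v) 3 1"
    unfolding pv_def be0_def pcompose_mult l
    by (rule has_top_cubic_product)
  show "has_top (pv be3 v) 3 (- 1)"
    unfolding pv_def be3_def pcompose_mult pcompose_uminus l
    by (rule has_top_uminus[OF has_top_cubic_product])
  show "has_top (pv be1 v) 3 (- 3)" "has_top (pv be2 v) 3 3"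
    unfolding pv_def be1_def be2_def by (rule has_top_cubic)+
qed

lemma has_top_rising: "has_top (rising s n) n 1"
proof (induction n arbitrary: s)
  case (Suc n)
  show ?case using has_top_mult[OF has_top_linear Suc] by simp
qed (simp add: has_top_def)

text \<open>This is \<open>x^3 (x - 1)^3\<close>. Its independence of the parameters is what
  \<open>right_division\<close> asks for.\<close>

definition SE6_lc :: ratfun where
  "SE6_lc = to_fract (monom 1 6 + monom (- 3) 5 + monom 3 4 + monom (- 1) 3)"

lemma SE6_lc_nz: "SE6_lc \<noteq> 0"
proof
  assume "SE6_lc = 0"
  then have "monom 1 6 + monom (- 3) 5 + monom 3 4 + monom (- 1) 3 = (0 :: complex poly)"
    using to_fract_eq_0_iff[of "monom 1 6 + monom (- 3) 5 + monom 3 4 + monom (- 1) 3 :: complex poly"]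
    unfolding SE6_lc_def by blast
  then have "coeff (monom 1 6 + monom (- 3) 5 + monom 3 4 + monom (- 1) 3 :: complex poly) 6 = 0" by simp
  then show False by simp
qed

lemma lop_4_top:
  assumes "has_top A0 6 1" "has_top A1 5 (- 3)" "has_top A2 4 3" "has_top A3 3 (- 1)"
  shows "op_order (lop [A0, A1, A2, A3]) \<le> 6 \<and> op_coeff (lop [A0, A1, A2, A3]) 6 = SE6_lc"
proof -
  let ?As = "[A0, A1, A2, A3]"
  have d: "degree (?As ! i) + i \<le> 6" if "i < length ?As" for i
  proof -
    have "i = 0 \<or> i = 1 \<or> i = 2 \<or> i = 3" using that by auto
    then show ?thesis using assms by (auto simp: has_top_def numeral_2_eq_2 numeral_3_eq_3)
  qed
  have "(\<Sum>i<4. f i) = f 0 + f 1 + f 2 + f 3" for f :: "nat \<Rightarrow> complex poly"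
    by (simp add: numeral_eq_Suc add_ac)
  then have "(\<Sum>i<length ?As. monom (coeff (?As ! i) (6 - i)) (6 - i))
      = monom 1 6 + monom (- 3) 5 + monom 3 4 + monom (- 1) 3"
    using assms by (simp add: has_top_def)
  with lop_coeff_order[of ?As 6, OF d]
  have "op_order (lop ?As) \<le> 6 \<and> op_coeff (lop ?As) 6 = to_fract (monom 1 6 + monom (- 3) 5 + monom 3 4 + monom (- 1) 3)"
    by metis
  then show ?thesis by (simp only: SE6_lc_def)
qed

lemma SE6_order: "op_order (SE6 v) \<le> 6" and SE6_coeff: "op_coeff (SE6 v) 6 = SE6_lc"
proof -
  let ?s = "- v par_r"
  have t: "has_top (rising ?s 3 * pv be0 v) 6 1" "has_top (rising (?s + 1) 2 * pv be1 v) 5 (- 3)"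
    "has_top (rising (?s + 1 + 1) 1 * pv be2 v) 4 3" "has_top (rising (?s + 1 + 1 + 1) 0 * pv be3 v) 3 (- 1)"
    using has_top_mult[OF has_top_rising has_top_be(1), of ?s 3 v]
      has_top_mult[OF has_top_rising has_top_be(2), of "?s + 1" 2 v]
      has_top_mult[OF has_top_rising has_top_be(3), of "?s + 1 + 1" 1 v]
      has_top_mult[OF has_top_rising has_top_be(4), of "?s + 1 + 1 + 1" 0 v] by simp_all
  have "SE6 v = lop [rising ?s 3 * pv be0 v, rising (?s + 1) 2 * pv be1 v, rising (?s + 1 + 1) 1 * pv be2 v,
      rising (?s + 1 + 1 + 1) 0 * pv be3 v]"
    unfolding SE6_lop psi_def
    by (simp only: Ms.simps list.size numeral_3_eq_3 numeral_2_eq_2 One_nat_def add_0 add_Suc plus_1_eq_Suc add_Suc_right add_0_right)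
  then show "op_order (SE6 v) \<le> 6" "op_coeff (SE6 v) 6 = SE6_lc"
    using lop_4_top[OF t] by simp_all
qed

lemma pfam_pv:
  "pfam (\<lambda>c. [:c:]) (\<lambda>v. f (v par_a) (v par_b) (v par_c) (v par_g) (v par_q)) \<Longrightarrow> pfam (\<lambda>c. [:c:]) (pv f)"
  unfolding pv_def[abs_def] by (intro pfam_pcompose pfam_pCons pfam_intros)

lemma pfam_be: "pfam (\<lambda>c. [:c:]) (pv be0)" "pfam (\<lambda>c. [:c:]) (pv be1)"
  "pfam (\<lambda>c. [:c:]) (pv be2)" "pfam (\<lambda>c. [:c:]) (pv be3)"
  by (rule pfam_pv; unfold be0_def be1_def be2_def be3_def; intro pfam_pCons pfam_intros)+

lemma pfam_SE6: "pfam op_const SE6"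
  unfolding SE6_lop[abs_def] psi_4
  by (intro pfam_add pfam_mult pfam_const pfam_thp pfam_be pfam_pCons pfam_intros)

subsection \<open>Generic parameters\<close>

text \<open>The conditions on \<open>r\<close> and on the exponents 7 to 9 keep the zeros of the
  leading coefficient polynomial off the integers, for cancelling \<partial>. Those on exponents 1
  to 3 do the same for \<open>be3\<close> relative to \<open>r\<close>, for cancelling \<theta> -
  \<open>r - k\<close>. Exponents 4 to 6 are the latter condition at \<open>swap v\<close>, for
  cancelling the reflected operators.\<close>

definition generic :: "params \<Rightarrow> bool" where
  "generic v \<longleftrightarrow> v par_r \<notin> \<int> \<and> (\<forall>i\<in>{7, 8, 9}. SE6_exponent v i \<notin> \<int>)
     \<and> (\<forall>i\<in>{1, 2, 3, 4, 5, 6}. SE6_exponent v i - v par_r \<notin> \<int>)"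

lemma SE6_exponents:
  "SE6_exponent v 1 = v par_p + v par_r + 1"
  "SE6_exponent v 2 = v par_a + v par_c + v par_p + v par_r + 2"
  "SE6_exponent v 3 = 2 * v par_a + 2 * v par_c + v par_g + v par_p + v par_r + 3"
  "SE6_exponent v 4 = v par_q + v par_r + 1"
  "SE6_exponent v 5 = v par_b + v par_c + v par_q + v par_r + 2"
  "SE6_exponent v 6 = 2 * v par_b + 2 * v par_c + v par_g + v par_q + v par_r + 3"
  "SE6_exponent v 7 = - 2 * v par_c - (v par_p + v par_q + v par_r) - 1"
  "SE6_exponent v 8 = - (v par_a + v par_b + v par_c) - v par_c - (v par_p + v par_q + v par_r + v par_g) - 2"
  "SE6_exponent v 9 = - 2 * (v par_a + v par_b + v par_c) - (v par_p + v par_q + v par_r + v par_g) - 3"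
  by (simp_all add: SE6_exponent_def Let_def numeral_eq_Suc)

lemma generic_swap: "generic (swap v) \<longleftrightarrow> generic v"
proof -
  have "SE6_exponent (swap v) 1 = SE6_exponent v 4" "SE6_exponent (swap v) 2 = SE6_exponent v 5"
    "SE6_exponent (swap v) 3 = SE6_exponent v 6" "SE6_exponent (swap v) 4 = SE6_exponent v 1"
    "SE6_exponent (swap v) 5 = SE6_exponent v 2" "SE6_exponent (swap v) 6 = SE6_exponent v 3"
    "SE6_exponent (swap v) 7 = SE6_exponent v 7" "SE6_exponent (swap v) 8 = SE6_exponent v 8"
    "SE6_exponent (swap v) 9 = SE6_exponent v 9"
    by (simp_all only: SE6_exponents swap_simps) (simp_all add: algebra_simps)
  then show ?thesis by (auto simp: generic_def)
qed

text \<open>In the direction in which all parameters grow equally, each excluded quantity is a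
  nonconstant affine function of \<open>t\<close>; so only countably many \<open>t\<close> are
  excluded.\<close>

lemma dense_generic: "dense_params {v. generic v}"
  unfolding dense_params_def
proof
  fix v :: params
  have cnt: "countable {t. \<alpha> + t * \<beta> \<in> \<int>}" if "\<beta> \<noteq> 0" for \<alpha> \<beta> :: complex
  proof -
    have "{t. \<alpha> + t * \<beta> \<in> \<int>} \<subseteq> (\<lambda>n. (of_int n - \<alpha>) / \<beta>) ` (UNIV :: int set)"
      using that by (auto simp: Ints_def field_simps)
    then show ?thesis by (rule countable_subset) simp
  qed
  \<comment> \<open>The slopes are the sums of the coefficients of the seven parameters in the
    respective expressions.\<close>
  define B where "B = {t. v par_r + t * 1 \<in> \<int>} \<union>
     {t. SE6_exponent v 7 + t * (- 5) \<in> \<int>} \<union> {t. SE6_exponent v 8 + t * (- 8) \<in> \<int>} \<union>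
     {t. SE6_exponent v 9 + t * (- 10) \<in> \<int>} \<union>
     {t. SE6_exponent v 1 - v par_r + t * 1 \<in> \<int>} \<union> {t. SE6_exponent v 2 - v par_r + t * 3 \<in> \<int>} \<union>
     {t. SE6_exponent v 3 - v par_r + t * 6 \<in> \<int>} \<union>
     {t. SE6_exponent v 4 - v par_r + t * 1 \<in> \<int>} \<union> {t. SE6_exponent v 5 - v par_r + t * 3 \<in> \<int>} \<union>
     {t. SE6_exponent v 6 - v par_r + t * 6 \<in> \<int>}"
  have "countable B" unfolding B_def by (intro countable_Un cnt) auto
  then have "infinite (- B)"
    using uncountable_UNIV_complex by (metis Compl_eq_Diff_UNIV countable_finite uncountable_minus_countable)
  moreover have "- B \<subseteq> {t. (\<lambda>i. v i + t * 1) \<in> {v. generic v}}"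
  proof
    fix t assume t: "t \<in> - B"
    let ?v = "\<lambda>i. v i + t * 1"
    have e: "SE6_exponent ?v 7 = SE6_exponent v 7 + t * (- 5)"
      "SE6_exponent ?v 8 = SE6_exponent v 8 + t * (- 8)" "SE6_exponent ?v 9 = SE6_exponent v 9 + t * (- 10)"
      "SE6_exponent ?v 1 - ?v par_r = SE6_exponent v 1 - v par_r + t * 1"
      "SE6_exponent ?v 2 - ?v par_r = SE6_exponent v 2 - v par_r + t * 3"
      "SE6_exponent ?v 3 - ?v par_r = SE6_exponent v 3 - v par_r + t * 6"
      "SE6_exponent ?v 4 - ?v par_r = SE6_exponent v 4 - v par_r + t * 1"
      "SE6_exponent ?v 5 - ?v par_r = SE6_exponent v 5 - v par_r + t * 3"
      "SE6_exponent ?v 6 - ?v par_r = SE6_exponent v 6 - v par_r + t * 6"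
      by (simp_all only: SE6_exponents) (simp_all add: algebra_simps)
    show "t \<in> {t. (\<lambda>i. v i + t * 1) \<in> {v. generic v}}"
      using t by (simp only: mem_Collect_eq generic_def ball_simps e B_def Compl_iff Un_iff de_Morgan_disj simp_thms)
  qed
  ultimately show "\<exists>w. infinite {t. (\<lambda>i. v i + t * w i) \<in> {v. generic v}}"
    by (intro exI[of _ "\<lambda>_. 1"]) (metis (no_types, lifting) infinite_super)
qed

section \<open>Cancelling the elementary operators modulo \<open>SE6\<close>\<close>

lemma poly_rising_eq_0_iff: "poly (rising s n) t = 0 \<longleftrightarrow> (\<exists>i<n. s + t + of_nat i = 0)"
proof (induction n arbitrary: s)
  case (Suc n)
  have "poly (rising s (Suc n)) t = (s + t) * poly (rising (s + 1) n) t"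
    by (simp add: algebra_simps)
  then show ?case unfolding Ex_less_Suc2 by (simp add: Suc.IH add_ac)
qed simp

lemma poly_be3: "poly (pv be3 v) t
    = - ((t + 3 - SE6_exponent v 1) * (t + 3 - SE6_exponent v 2) * (t + 3 - SE6_exponent v 3))"
  unfolding poly_pv be3_def poly_minus poly_mult poly_pCons poly_0 SE6_exponents
  by (intro arg_cong[where f = uminus] arg_cong2[where f = "(*)"]) simp_all

lemma poly_be0: "poly (pv be0 v) t
    = (t + SE6_exponent v 7) * (t + SE6_exponent v 8) * (t + SE6_exponent v 9)"
  unfolding poly_pv be0_def poly_minus poly_mult poly_pCons poly_0 SE6_exponents
  by (intro arg_cong2[where f = "(*)"]) simp_all

text \<open>The zeros of the first coefficient are \<open>r\<close>, \<open>r - 1\<close>,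
  \<open>r - 2\<close> and the negatives of the exponents 7, 8, 9; for generic parameters none of
  them is an integer, as \<open>cancel_op_d\<close> demands.\<close>

lemma cancel_d_SE6:
  assumes "generic v" "op_d * B \<in> left_ideal (SE6 v)" shows "B \<in> left_ideal (SE6 v)"
proof -
  have p: "poly (rising (- v par_r) 3 * pv be0 v) (of_int n) \<noteq> 0" for n
  proof
    assume z: "poly (rising (- v par_r) 3 * pv be0 v) (of_int n) = 0"
    have "poly (rising (- v par_r) 3) (of_int n) \<noteq> 0"
    proof
      assume "poly (rising (- v par_r) 3) (of_int n) = 0"
      then obtain i where "- v par_r + of_int n + of_nat i = 0"
        by (auto simp: poly_rising_eq_0_iff)
      then have "v par_r = of_int n + of_nat i" by algebra
      then have "v par_r = of_int (n + int i)" by simp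
      then show False using assms(1) by (auto simp: generic_def)
    qed
    then have "poly (pv be0 v) (of_int n) = 0" using z by simp
    then have "SE6_exponent v 7 = of_int (- n) \<or> SE6_exponent v 8 = of_int (- n) \<or> SE6_exponent v 9 = of_int (- n)"
      by (auto simp: poly_be0 eq_neg_iff_add_eq_0 add.commute)
    then have "SE6_exponent v 7 \<in> \<int> \<or> SE6_exponent v 8 \<in> \<int> \<or> SE6_exponent v 9 \<in> \<int>"
      by (metis Ints_of_int)
    then show False using assms(1) by (simp add: generic_def)
  qed
  have "SE6 v = lop [rising (- v par_r) 3 * pv be0 v, rising (- v par_r + 1) 2 * pv be1 v,
      rising (- v par_r + 2) 1 * pv be2 v, pv be3 v]"
    unfolding SE6_lop psi_def by (simp add: numeral_3_eq_3 numeral_2_eq_2 add.assoc del: mult_pCons_left)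
  then show ?thesis using cancel_op_d[OF _ p] assms(2) by metis
qed

text \<open>The zeros of \<open>be3\<close> are the exponents 1, 2, 3 minus 3. By genericity they do
  not differ from \<open>r\<close> by integers, and \<open>r + k\<close> is not an integer
  either.\<close>

lemma cancel_xi_SE6:
  assumes "generic v" "xi (v par_r + of_int k) * B \<in> left_ideal (SE6 v)" shows "B \<in> left_ideal (SE6 v)"
proof -
  let ?c = "v par_r + of_int k"
  have "poly (pv be3 v) (?c + of_int n) \<noteq> 0" for n
  proof
    assume "poly (pv be3 v) (?c + of_int n) = 0"
    then have "SE6_exponent v 1 - v par_r = of_int (k + n + 3) \<or> SE6_exponent v 2 - v par_r = of_int (k + n + 3)
        \<or> SE6_exponent v 3 - v par_r = of_int (k + n + 3)"
      by (simp only: poly_be3 neg_equal_0_iff_equal mult_eq_0_iff) (auto simp: algebra_simps)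
    then have "SE6_exponent v 1 - v par_r \<in> \<int> \<or> SE6_exponent v 2 - v par_r \<in> \<int>
        \<or> SE6_exponent v 3 - v par_r \<in> \<int>"
      by (metis Ints_of_int)
    then show False using assms(1) by (simp add: generic_def)
  qed
  moreover have "?c \<notin> \<int>"
  proof
    assume "?c \<in> \<int>"
    then have "?c - of_int k \<in> \<int>" by (intro Ints_diff) auto
    then show False using assms(1) by (simp add: generic_def)
  qed
  ultimately show ?thesis
    using cancel_theta[of ?c B] assms(2) by (simp add: SE6_lop psi_def xi_def)
qed

lemma rflip_rflip: "rflip (rflip f) = f"
proof (cases f)
  case (Fract n d)
  have "pcompose [:1, - 1:] [:1, - 1 :: complex:] = [:0, 1:]" by (simp add: pcompose_pCons)
  then show ?thesis using Fract
    by (simp add: rflip_Fract pcompose_flip_nz flip: pcompose_assoc)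
qed

lemma oflip_oflip: "oflip (oflip P) = P"
  by (induction P rule: diffop_induct)
    (simp_all add: oflip_add oflip_ratfun oflip_mult_d oflip_diff oflip_uminus rflip_rflip)

text \<open>The reflection carries this to \<open>cancel_xi_SE6\<close> at \<open>swap v\<close>,
  which is again generic.\<close>

lemma cancel_eta_SE6:
  assumes "generic v" "oflip (xi (v par_r + of_int k)) * B \<in> left_ideal (SE6 v)" shows "B \<in> left_ideal (SE6 v)"
proof -
  have flip: "oflip (SE6 v) = SE6 (swap v)" using SE6_flip[of "swap v"] by simp
  have "xi (v par_r + of_int k) * oflip B \<in> left_ideal (SE6 (swap v))"
    using oflip_left_ideal[OF assms(2)] by (simp add: oflip_mult oflip_oflip flip)
  then have "oflip B \<in> left_ideal (SE6 (swap v))"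
    using cancel_xi_SE6[of "swap v"] assms(1) by (simp add: generic_swap)
  then show ?thesis using oflip_left_ideal SE6_flip oflip_oflip by metis
qed

section \<open>The shift operators\<close>

lemma op_d2_x2: "op_d ^ 2 * op_x ^ 2 = thp ([:1, 1:] * [:2, 1:])"
  and op_d2_x: "op_d ^ 2 * op_x = thp [:2, 1:] * op_d"
proof -
  have 1: "op_d * op_x = thp [:1, 1:]"
    by (simp add: op_d_x thp_linear op_theta_eq op_const_simps)
  have s: "shp [:1, 1:] = [:2, 1:]" by (rule complex_poly_ext) simp
  show 2: "op_d ^ 2 * op_x = thp [:2, 1:] * op_d"
    by (simp add: power2_eq_square mult.assoc 1 op_d_thp s)
  have "op_d ^ 2 * op_x ^ 2 = thp [:2, 1:] * (op_d * op_x)"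
    by (subst power2_eq_square[of op_x]) (simp add: 2 flip: mult.assoc)
  then show "op_d ^ 2 * op_x ^ 2 = thp ([:1, 1:] * [:2, 1:])"
    by (simp add: 1 mult.commute flip: thp_mult del: mult_pCons_left mult_pCons_right)
qed

lemma op_d2_lop: "op_d ^ 2 * lop X = lop (0 # 0 # map shp (map shp X))"
  by (simp add: power2_eq_square mult.assoc op_d_lop) (simp add: op_d_lop flip: mult.assoc)

text \<open>Shows which lists are left multiples of \<partial>^2: the first entry must contain
  (\<theta> + 1)(\<theta> + 2) and the second \<theta> + 2. In \<open>up_operator\<close> it is read
  backwards, to construct a quotient.\<close>

lemma op_d2_normal:
  "op_d ^ 2 * (op_x ^ 2 * thp q2 + op_x * thp q1 + lop [q0, m1, m2])
   = lop [[:1, 1:] * [:2, 1:] * q2, [:2, 1:] * shp q1, shp (shp q0), shp (shp m1), shp (shp m2)]"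
proof -
  have "op_d ^ 2 * (op_x ^ 2 * thp q2) = thp ([:1, 1:] * [:2, 1:] * q2)"
    by (simp add: op_d2_x2 thp_mult del: mult_pCons_left mult_pCons_right flip: mult.assoc)
  moreover have "op_d ^ 2 * (op_x * thp q1) = thp ([:2, 1:] * shp q1) * op_d"
    by (simp add: op_d2_x mult.assoc op_d_thp thp_mult del: mult_pCons_left mult_pCons_right flip: mult.assoc[of _ op_x])
  moreover have "op_d ^ 2 * lop [q0, m1, m2] = lop [0, 0, shp (shp q0), shp (shp m1), shp (shp m2)]"
    by (simp only: op_d2_lop list.map)
  ultimately show ?thesis
    unfolding distrib_left by (simp add: distrib_right mult.assoc add.assoc del: mult_pCons_left mult_pCons_right)
qed

lemma op_order_d2_mult: "op_order (op_d ^ 2 * P) \<le> n + 2 \<Longrightarrow> op_order P \<le> n"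
proof -
  assume *: "op_order (op_d ^ 2 * P) \<le> n + 2"
  have d: "op_d \<noteq> 0" using op_order_d by (metis op_order_0 zero_neq_one)
  have d2: "op_order (op_d ^ 2) = 2"
    using op_order_mult[OF d d] by (simp add: power2_eq_square)
  show ?thesis
  proof (cases "P = 0")
    case False
    then show ?thesis using * op_order_mult[of "op_d ^ 2" P] d d2 by simp
  qed simp
qed

lemma lop_order_le:
  assumes "\<And>i. i < length As \<Longrightarrow> degree (As ! i) + i \<le> n" shows "op_order (lop As) \<le> n"
  using lop_coeff_order[OF assms] by simp

lemma op_order_linear: "op_order (thp [:y0, y1:]) \<le> 1"
  using thp_coeff_top[of "[:y0, y1:]" 1] by simp

lemma op_order_const [simp]: "op_order (op_const c) = 0"
  by (simp add: op_const_def)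

lemma psi_3: "psi s [h0, h1, h2] = lop [[:s, 1:] * [:s + 1, 1:] * h0, [:s + 1, 1:] * h1, h2]"
  by (simp add: psi_def mult.assoc del: mult_pCons_left mult_pCons_right)

lemma SE6_lop_4: "SE6 v = lop [[:- v par_r, 1:] * [:- v par_r + 1, 1:] * [:- v par_r + 2, 1:] * pv be0 v,
    [:- v par_r + 1, 1:] * [:- v par_r + 2, 1:] * pv be1 v, [:- v par_r + 2, 1:] * pv be2 v, pv be3 v]"
  unfolding SE6_lop psi_4 by (simp add: mult_ac del: mult_pCons_left mult_pCons_right)

lemma op_order_psi_3:
  assumes "degree h0 \<le> 2" "degree h1 \<le> 2" "degree h2 \<le> 2"
  shows "op_order (psi s [h0, h1, h2]) \<le> 4"
proof -
  have "degree ([:s, 1:] * [:s + 1, 1:] * h0) \<le> 4"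
    using degree_mult_le[of "[:s, 1:] * [:s + 1, 1:]" h0] degree_mult_le[of "[:s, 1:]" "[:s + 1, 1:]"] assms(1)
    by (simp del: mult_pCons_left mult_pCons_right)
  moreover have "degree ([:s + 1, 1:] * h1) \<le> 3"
    using degree_mult_le[of "[:s + 1, 1:]" h1] assms(2) by (simp del: mult_pCons_left mult_pCons_right)
  ultimately have "degree ([[:s, 1:] * [:s + 1, 1:] * h0, [:s + 1, 1:] * h1, h2] ! i) + i \<le> 4" if "i < 3" for i
    using that assms(3) by (auto simp: less_Suc_eq numeral_3_eq_3 simp del: mult_pCons_left mult_pCons_right)
  then show ?thesis unfolding psi_3 by (intro lop_order_le) simp
qed

lemmas poly_eval = poly_add poly_mult poly_minus poly_diff poly_shp poly_pCons poly_0 poly_1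

text \<open>\<open>E1\<close>, \<open>E2\<close> and \<open>E3\<close> say that the first two coefficients of the right-hand side vanish at \<open>\<theta> = -1, -2\<close> and
  \<open>\<theta> = -2\<close>, so that \<open>\<partial>\<^sup>2\<close> divides it from the left.\<close>

lemma up_operator:
  fixes h0 h1 h2 :: "params \<Rightarrow> complex poly" and \<sigma> y0 y1 y2 :: "params \<Rightarrow> complex"
  assumes h: "pfam (\<lambda>c. [:c:]) h0" "pfam (\<lambda>c. [:c:]) h1" "pfam (\<lambda>c. [:c:]) h2"
    and y: "pfam (\<lambda>c. c) \<sigma>" "pfam (\<lambda>c. c) y0" "pfam (\<lambda>c. c) y1" "pfam (\<lambda>c. c) y2"
    and deg: "\<And>v. degree (h0 v) \<le> 2" "\<And>v. degree (h1 v) \<le> 2" "\<And>v. degree (h2 v) \<le> 2"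
    and E1: "\<And>v. \<sigma> v * poly (h0 v) (- 1) + (y0 v - y1 v) * (1 - v par_r) * poly (pv be0 v) (- 1) = 0"
    and E2: "\<And>v. \<sigma> v * poly (h0 v) (- 2) - (y0 v - 2 * y1 v) * v par_r * poly (pv be0 v) (- 2) = 0"
    and E3: "\<And>v. \<sigma> v * poly (h1 v) (- 2) - (y0 v - 2 * y1 v) * v par_r * poly (pv be1 v) (- 2)
       - y2 v * v par_r * (1 - v par_r) * poly (pv be0 v) (- 1) = 0"
  shows "\<exists>P. pfam op_const P \<and> (\<forall>v. op_order (P v) \<le> 5 \<and>
    op_d ^ 2 * P v = op_const (\<sigma> v) * psi (- v par_r) [h0 v, h1 v, h2 v]
      + (thp [:y0 v, y1 v:] + op_const (y2 v) * op_d) * SE6 v)"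
proof -
  let ?s = "\<lambda>v::params. - v par_r"
  define T0 where "T0 v = [:?s v, 1:] * [:?s v + 1, 1:] * [:?s v + 2, 1:] * pv be0 v" for v
  define T1 where "T1 v = [:?s v + 1, 1:] * [:?s v + 2, 1:] * pv be1 v" for v
  define T2 where "T2 v = [:?s v + 2, 1:] * pv be2 v" for v
  define Y where "Y v = [:y0 v, y1 v:]" for v
  define R0 where "R0 v = [:\<sigma> v:] * ([:?s v, 1:] * [:?s v + 1, 1:] * h0 v) + Y v * T0 v" for v
  define R1 where "R1 v = [:\<sigma> v:] * ([:?s v + 1, 1:] * h1 v) + Y v * T1 v + [:y2 v:] * shp (T0 v)" for v
  define R2 where "R2 v = [:\<sigma> v:] * h2 v + Y v * T2 v + [:y2 v:] * shp (T1 v)" for v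
  define R3 where "R3 v = Y v * pv be3 v + [:y2 v:] * shp (T2 v)" for v
  define R4 where "R4 v = [:y2 v:] * shp (pv be3 v)" for v
  note pc = pfam_pCons pfam_add pfam_mult pfam_const pfam_intros pfam_be h y pfam_pcompose
  have pT: "pfam (\<lambda>c. [:c:]) T0" "pfam (\<lambda>c. [:c:]) T1" "pfam (\<lambda>c. [:c:]) T2" "pfam (\<lambda>c. [:c:]) Y"
    unfolding T0_def[abs_def] T1_def[abs_def] T2_def[abs_def] Y_def[abs_def] by (intro pc)+
  have pR: "pfam (\<lambda>c. [:c:]) R0" "pfam (\<lambda>c. [:c:]) R1" "pfam (\<lambda>c. [:c:]) R2" "pfam (\<lambda>c. [:c:]) R3" "pfam (\<lambda>c. [:c:]) R4"
    unfolding R0_def[abs_def] R1_def[abs_def] R2_def[abs_def] R3_def[abs_def] R4_def[abs_def] shp_def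
    by (intro pc pT)+
  have L: "SE6 v = lop [T0 v, T1 v, T2 v, pv be3 v]" for v
    by (simp add: SE6_lop_4 T0_def T1_def T2_def del: mult_pCons_left mult_pCons_right)
  have RHS: "op_const (\<sigma> v) * psi (- v par_r) [h0 v, h1 v, h2 v] + (thp [:y0 v, y1 v:] + op_const (y2 v) * op_d) * SE6 v
      = lop [R0 v, R1 v, R2 v, R3 v, R4 v]" for v
    unfolding psi_3 L R0_def R1_def R2_def R3_def R4_def Y_def
    by (simp add: thp_add thp_mult thp_const distrib_left distrib_right mult.assoc op_d_thp[symmetric] add_ac
        del: mult_pCons_left mult_pCons_right)
  have z0: "poly (R0 v) (- 1) = 0" "poly (R0 v) (- 2) = 0" for v
  proof -
    have "poly (R0 v) (- 1) = (?s v - 1) * ?s v *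
       (\<sigma> v * poly (h0 v) (- 1) + (y0 v - y1 v) * (1 - v par_r) * poly (pv be0 v) (- 1))"
      unfolding R0_def Y_def T0_def poly_eval by algebra
    then show "poly (R0 v) (- 1) = 0" using E1[of v] by simp
    have "poly (R0 v) (- 2) = (?s v - 2) * (?s v - 1) *
       (\<sigma> v * poly (h0 v) (- 2) - (y0 v - 2 * y1 v) * v par_r * poly (pv be0 v) (- 2))"
      unfolding R0_def Y_def T0_def poly_eval by algebra
    then show "poly (R0 v) (- 2) = 0" using E2[of v] by simp
  qed
  have z1: "poly (R1 v) (- 2) = 0" for v
  proof -
    have e: "(- 2 :: complex) + 1 = - 1" by simp
    have "poly (R1 v) (- 2) = (?s v - 1) *
       (\<sigma> v * poly (h1 v) (- 2) - (y0 v - 2 * y1 v) * v par_r * poly (pv be1 v) (- 2)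
         - y2 v * v par_r * (1 - v par_r) * poly (pv be0 v) (- 1))"
      unfolding R1_def Y_def T0_def T1_def poly_eval e by algebra
    then show ?thesis using E3[of v] by simp
  qed
  obtain g where g: "pfam (\<lambda>c. [:c:]) g" "\<And>v. R0 v = [:1, 1:] * g v"
    using pfam_root_factor[OF pR(1), of "\<lambda>_. - 1"] z0(1) by (auto intro: pfam_const)
  have "poly (g v) (- 2) = 0" for v using z0(2)[of v] by (simp add: g(2))
  then obtain q2 where q2: "pfam (\<lambda>c. [:c:]) q2" "\<And>v. g v = [:2, 1:] * q2 v"
    using pfam_root_factor[OF g(1), of "\<lambda>_. - 2"] by (auto intro: pfam_const)
  obtain g1 where g1: "pfam (\<lambda>c. [:c:]) g1" "\<And>v. R1 v = [:2, 1:] * g1 v"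
    using pfam_root_factor[OF pR(2), of "\<lambda>_. - 2"] z1 by (auto intro: pfam_const)
  \<comment> \<open>Translation inverse to \<open>shp\<close>: the quotient by \<partial>^2 has its
    coefficients shifted back.\<close>
  define dn where "dn k p = pcompose p [:- k, 1 :: complex:]" for k p
  have dn: "shp (dn 1 p) = p" "shp (shp (dn 2 p)) = p" for p
    by (rule complex_poly_ext, simp add: dn_def poly_pcompose)+
  define P where "P v = op_x ^ 2 * thp (q2 v) + op_x * thp (dn 1 (g1 v)) + lop [dn 2 (R2 v), dn 2 (R3 v), dn 2 (R4 v)]" for v
  have "pfam op_const P"
    unfolding P_def[abs_def] lop.simps dn_def
    by (intro pfam_add pfam_mult pfam_const pfam_thp pfam_pcompose q2 g1 pR)
  moreover have eq: "op_d ^ 2 * P v = lop [R0 v, R1 v, R2 v, R3 v, R4 v]" for v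
    unfolding P_def op_d2_normal dn g(2) q2(2) g1(2) by (simp only: mult.assoc)
  \<comment> \<open>The right side has order at most 7, from order 4 of the multiplier and 1 + 6 of
    the multiple of \<open>SE6\<close>; dividing by \<partial>^2 leaves 5.\<close>
  moreover have "op_order (P v) \<le> 5" for v
  proof (rule op_order_d2_mult, unfold eq, fold RHS)
    have "op_order (op_const (\<sigma> v) * psi (- v par_r) [h0 v, h1 v, h2 v]) \<le> 0 + 4"
      by (intro op_order_mult_le op_order_psi_3 deg) simp
    moreover have "op_order ((thp [:y0 v, y1 v:] + op_const (y2 v) * op_d) * SE6 v) \<le> 1 + 6"
      using op_order_mult_le[of "op_const (y2 v)" 0 op_d 1]
      by (intro op_order_mult_le op_order_add_le op_order_linear SE6_order) simp
    ultimately show "op_order (op_const (\<sigma> v) * psi (- v par_r) [h0 v, h1 v, h2 v]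
        + (thp [:y0 v, y1 v:] + op_const (y2 v) * op_d) * SE6 v) \<le> 5 + 2"
      by (intro op_order_add_le) simp_all
  qed
  ultimately show ?thesis unfolding RHS by blast
qed

text \<open>\<open>D1\<close>, \<open>D2\<close> and \<open>D3\<close> play the same role for the zeros \<open>r\<close> and \<open>r - 1\<close> of \<open>xi2 r\<close>.\<close>

lemma down_operator:
  fixes h0 h1 h2 :: "params \<Rightarrow> complex poly" and \<sigma> y0 y1 y2 :: "params \<Rightarrow> complex"
  assumes h: "pfam (\<lambda>c. [:c:]) h0" "pfam (\<lambda>c. [:c:]) h1" "pfam (\<lambda>c. [:c:]) h2"
    and y: "pfam (\<lambda>c. c) \<sigma>" "pfam (\<lambda>c. c) y0" "pfam (\<lambda>c. c) y1" "pfam (\<lambda>c. c) y2"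
    and deg: "\<And>v. degree (h0 v) \<le> 2" "\<And>v. degree (h1 v) \<le> 2" "\<And>v. degree (h2 v) \<le> 2"
    and D1: "\<And>v. \<sigma> v * poly (h2 v) (v par_r)
       + (y0 v + y1 v * (v par_r - 1)) * v par_r * poly (pv be3 v) (v par_r - 1) = 0"
    and D2: "\<And>v. \<sigma> v * poly (h2 v) (v par_r - 1)
       + (y0 v + y1 v * (v par_r - 2)) * (v par_r - 1) * poly (pv be3 v) (v par_r - 2) = 0"
    and D3: "\<And>v. \<sigma> v * poly (h1 v) (v par_r)
       + (y0 v + y1 v * (v par_r - 1)) * v par_r * poly (pv be2 v) (v par_r - 1)
       + y2 v * v par_r * (v par_r - 1) * poly (pv be3 v) (v par_r - 2) = 0"
  shows "\<exists>P. pfam op_const P \<and> (\<forall>v. op_order (P v) \<le> 5 \<and>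
    xi2 (v par_r) * P v = op_const (\<sigma> v) * psi (- v par_r) [h0 v, h1 v, h2 v]
      + (op_x * thp [:y0 v, y1 v:] + op_x ^ 2 * thp ([:y2 v:] * [:3 - v par_r, 1:])) * SE6 v)"
proof -
  let ?X = "[:0, 1 :: complex:]"
  define dn where "dn k p = pcompose p [:- k, 1 :: complex:]" for k p
  have dn: "poly (dn k p) t = poly p (t - k)" for k p t
    by (simp add: dn_def poly_pcompose)
  \<comment> \<open>\<open>Y1\<close> and \<open>Y2\<close> arise from
    \<open>x (y0 + y1 \<theta>) \<partial>\<close> and \<open>y2 x^2 \<partial>^2\<close> when
    \<open>x\<close> and \<open>x^2\<close> are moved to the right, where
    \<open>x \<partial> = \<theta>\<close> and
    \<open>x^2 \<partial>^2 = \<theta> (\<theta> - 1)\<close>. In the same way \<theta> +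
    \<open>3 - r\<close> becomes \<theta> + \<open>1 - r\<close>, one of the factors of
    \<open>xi2 r\<close>.\<close>
  define Y1 where "Y1 v = [:y0 v - y1 v, y1 v:] * ?X" for v
  define Y2 where "Y2 v = [:y2 v:] * (?X * [:- 1, 1:])" for v
  define S2 where "S2 v = [:\<sigma> v:] * h2 v + Y1 v * dn 1 (pv be3 v)" for v
  define S1 where "S1 v = [:\<sigma> v:] * h1 v + Y1 v * dn 1 (pv be2 v) + Y2 v * dn 2 (pv be3 v)" for v
  define q0 where "q0 v = [:\<sigma> v:] * h0 v + Y1 v * dn 1 (pv be1 v) + Y2 v * dn 2 (pv be2 v)" for v
  define q1 where "q1 v = [:y0 v, y1 v:] * [:- v par_r, 1:] * pv be0 v
    + [:y2 v:] * ?X * [:- v par_r, 1:] * dn 1 (pv be1 v)" for v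
  define q2 where "q2 v = [:y2 v:] * [:- v par_r, 1:] * [:1 - v par_r, 1:] * pv be0 v" for v
  note pc = pfam_pCons pfam_add pfam_mult pfam_const pfam_intros pfam_be h y pfam_pcompose
  have pf: "pfam (\<lambda>c. [:c:]) S2" "pfam (\<lambda>c. [:c:]) S1" "pfam (\<lambda>c. [:c:]) q0" "pfam (\<lambda>c. [:c:]) q1" "pfam (\<lambda>c. [:c:]) q2"
    unfolding S2_def[abs_def] S1_def[abs_def] q0_def[abs_def] q1_def[abs_def] q2_def[abs_def] Y1_def Y2_def dn_def
    by (intro pc)+
  have pr: "pfam (\<lambda>c. c) (\<lambda>v. v par_r)" "pfam (\<lambda>c. c) (\<lambda>v. v par_r - 1)" by (intro pfam_intros)+
  have "poly (S2 v) (v par_r) = 0" "poly (S2 v) (v par_r - 1) = 0" "poly (S1 v) (v par_r) = 0" for v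
  proof -
    show "poly (S2 v) (v par_r) = 0"
      using D1[of v] unfolding S2_def Y1_def dn poly_eval by algebra
    have e: "v par_r - 1 - 1 = v par_r - 2" by simp
    show "poly (S2 v) (v par_r - 1) = 0"
      using D2[of v] unfolding S2_def Y1_def dn poly_eval e by algebra
    show "poly (S1 v) (v par_r) = 0"
      using D3[of v] unfolding S1_def Y1_def Y2_def dn poly_eval by algebra
  qed
  note z = this
  obtain g where g: "pfam (\<lambda>c. [:c:]) g" "\<And>v. S2 v = [:- v par_r, 1:] * g v"
    using pfam_root_factor[OF pf(1) pr(1)] z(1) by auto
  have "poly (g v) (v par_r - 1) = 0" for v using z(2)[of v] by (simp add: g(2))
  then obtain m2 where m2: "pfam (\<lambda>c. [:c:]) m2" "\<And>v. g v = [:- (v par_r - 1), 1:] * m2 v"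
    using pfam_root_factor[OF g(1) pr(2)] by auto
  obtain m1 where m1: "pfam (\<lambda>c. [:c:]) m1" "\<And>v. S1 v = [:- v par_r, 1:] * m1 v"
    using pfam_root_factor[OF pf(2) pr(1)] z(3) by auto
  define P where "P v = op_x ^ 2 * thp (q2 v) + op_x * thp (q1 v) + lop [q0 v, m1 v, m2 v]" for v
  have "pfam op_const P"
    unfolding P_def[abs_def] lop.simps
    by (intro pfam_add pfam_mult pfam_const pfam_thp pf m1 m2)
  moreover have eq: "xi2 (v par_r) * P v = op_const (\<sigma> v) * psi (- v par_r) [h0 v, h1 v, h2 v]
      + (op_x * thp [:y0 v, y1 v:] + op_x ^ 2 * thp ([:y2 v:] * [:3 - v par_r, 1:])) * SE6 v" for v
  proof -
    define r where "r = v par_r"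
    let ?A = "[:- r, 1:] * [:1 - r, 1:]"
    have xi: "xi2 r = thp ?A"
      by (simp add: xi2_def xi_thp mult.commute flip: thp_mult del: mult_pCons_left mult_pCons_right)
    have dthp: "op_d ^ 2 * thp p = thp (shp (shp p)) * op_d ^ 2" for p
      by (simp add: power2_eq_square mult.assoc op_d_thp) (simp add: op_d_thp flip: mult.assoc)
    let ?T = "[[:- r, 1:] * [:- r + 1, 1:] * [:- r + 2, 1:] * pv be0 v, [:- r + 1, 1:] * [:- r + 2, 1:] * pv be1 v,
       [:- r + 2, 1:] * pv be2 v, pv be3 v]"
    let ?M = "[[:- r, 1:] * [:- r + 1, 1:] * h0 v, [:- r + 1, 1:] * h1 v, h2 v]"
    \<comment> \<open>Both sides are compared after multiplication by \<partial>^2, which absorbs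
      the powers of \<open>x\<close> and turns everything into lists. \<partial>^2 is cancelled at
      the end, as there are no zero divisors.\<close>
    have lhs: "op_d ^ 2 * (xi2 r * P v) = lop (map ((*) (shp (shp ?A)))
        [[:1, 1:] * [:2, 1:] * q2 v, [:2, 1:] * shp (q1 v), shp (shp (q0 v)), shp (shp (m1 v)), shp (shp (m2 v))])"
      unfolding xi lop_map_mult op_d2_normal[symmetric] P_def by (simp add: dthp flip: mult.assoc)
    have 1: "op_d ^ 2 * (op_const (\<sigma> v) * lop ?M) = lop (0 # 0 # map shp (map shp (map ((*) [:\<sigma> v:]) ?M)))"
      unfolding op_d2_lop[symmetric] lop_map_mult thp_const ..
    have 2: "op_d ^ 2 * (op_x * thp [:y0 v, y1 v:] * lop ?T)
        = lop (map ((*) ([:2, 1:] * shp [:y0 v, y1 v:])) (0 # map shp ?T))"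
      unfolding lop_map_mult thp_mult lop.simps(2)[of 0] thp_0 add_0_left op_d_lop[symmetric]
      by (simp add: op_d2_x op_d_thp mult.assoc flip: mult.assoc[of _ op_x] mult.assoc[of op_d] del: lop.simps)
    have 3: "op_d ^ 2 * (op_x ^ 2 * thp ([:y2 v:] * [:3 - r, 1:]) * lop ?T)
        = lop (map ((*) ([:1, 1:] * [:2, 1:] * ([:y2 v:] * [:3 - r, 1:]))) ?T)"
      unfolding lop_map_mult thp_mult[of "[:1, 1:] * [:2, 1:]"] op_d2_x2[symmetric] by (simp add: mult.assoc)
    have m2e: "(t + 2 - r) * (t + 3 - r) * poly (m2 v) (t + 2) = poly (S2 v) (t + 2)" for t
      unfolding g(2) m2(2) r_def[symmetric] poly_eval by algebra
    have m1e: "(t + 2 - r) * poly (m1 v) (t + 2) = poly (S1 v) (t + 2)" for t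
      unfolding m1(2) r_def[symmetric] poly_eval by algebra
    have "op_d ^ 2 * (xi2 r * P v) = op_d ^ 2 * (op_const (\<sigma> v) * lop ?M)
      + (op_d ^ 2 * (op_x * thp [:y0 v, y1 v:] * lop ?T)
        + op_d ^ 2 * (op_x ^ 2 * thp ([:y2 v:] * [:3 - r, 1:]) * lop ?T))"
      unfolding lhs 1 2 3 lop_ladd[symmetric]
    proof -
      note ds = q0_def q1_def q2_def Y1_def Y2_def dn poly_eval r_def[symmetric]
      have n: "t + 1 + 1 = t + 2" "t + 2 - 1 = t + 1" "t + 2 - 2 = t" "t + 1 - 1 = t" for t :: complex
        by simp_all
      show "lop (map ((*) (shp (shp ?A)))
          [[:1, 1:] * [:2, 1:] * q2 v, [:2, 1:] * shp (q1 v), shp (shp (q0 v)), shp (shp (m1 v)), shp (shp (m2 v))])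
        = lop (ladd (0 # 0 # map shp (map shp (map ((*) [:\<sigma> v:]) ?M)))
            (ladd (map ((*) ([:2, 1:] * shp [:y0 v, y1 v:])) (0 # map shp ?T))
              (map ((*) ([:1, 1:] * [:2, 1:] * ([:y2 v:] * [:3 - r, 1:]))) ?T)))"
        apply (rule arg_cong[where f = lop], unfold list.map ladd.simps list.inject, intro conjI refl; rule complex_poly_ext)
        subgoal for t unfolding ds n by algebra
        subgoal for t unfolding ds n by algebra
        subgoal for t unfolding ds n by algebra
        subgoal for t using m1e[of t] unfolding S1_def ds n by algebra
        subgoal for t using m2e[of t] unfolding S2_def ds n by algebra
        done
    qed
    then have "op_d ^ 2 * (xi2 r * P v) = op_d ^ 2 * (op_const (\<sigma> v) * lop ?M + (op_x * thp [:y0 v, y1 v:]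
        + op_x ^ 2 * thp ([:y2 v:] * [:3 - r, 1:])) * lop ?T)"
      by (simp only: distrib_left distrib_right mult.assoc)
    moreover have "op_d ^ 2 \<noteq> 0" using op_order_d by (metis op_order_0 power_not_zero zero_neq_one)
    ultimately have "xi2 r * P v = op_const (\<sigma> v) * lop ?M + (op_x * thp [:y0 v, y1 v:]
        + op_x ^ 2 * thp ([:y2 v:] * [:3 - r, 1:])) * lop ?T"
      by (simp only: mult_cancel_left) simp
    then show ?thesis unfolding psi_3 SE6_lop_4 r_def .
  qed
  moreover have "op_order (P v) \<le> 5" for v
  proof (cases "P v = 0")
    case False
    have x: "op_order op_x = 0" by (simp add: op_x_def)
    have x2: "op_order (op_x ^ 2) \<le> 0" using op_order_mult_le[of op_x 0 op_x 0] x by (simp add: power2_eq_square)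
    have "degree ([:y2 v:] * [:3 - v par_r, 1:]) \<le> 1" by simp
    then have l: "op_order (thp ([:y2 v:] * [:3 - v par_r, 1:])) \<le> 1" using thp_coeff_top by blast
    have "op_order (op_const (\<sigma> v) * psi (- v par_r) [h0 v, h1 v, h2 v]) \<le> 0 + 4"
      by (intro op_order_mult_le op_order_psi_3 deg) simp
    moreover have "op_order ((op_x * thp [:y0 v, y1 v:] + op_x ^ 2 * thp ([:y2 v:] * [:3 - v par_r, 1:])) * SE6 v) \<le> 1 + 6"
      using op_order_mult_le[OF _ op_order_linear, of op_x 0] op_order_mult_le[OF x2 l] x
      by (intro op_order_mult_le op_order_add_le SE6_order) simp_all
    ultimately have 7: "op_order (xi2 (v par_r) * P v) \<le> 7"
      unfolding eq by (intro op_order_add_le) simp_all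
    have o: "op_order (xi c) = 1" for c
    proof -
      have "op_coeff (xi c) 1 \<noteq> 0"
        using thp_coeff_top[of "[:- c, 1:]" 1] by (simp add: xi_thp monom_eq_0_iff)
      moreover have "op_order (xi c) \<le> 1" using op_order_linear[of "- c" 1] by (simp add: xi_thp)
      ultimately show ?thesis using op_coeff_eq_0[of "xi c" 1] by (metis le_neq_implies_less)
    qed
    then have nz: "xi c \<noteq> 0" for c by (metis op_order_0 zero_neq_one)
    have "op_order (xi2 (v par_r) * P v) = 2 + op_order (P v)"
      using False nz o by (simp add: xi2_def op_order_mult mult.assoc)
    then show ?thesis using 7 by simp
  qed simp
  ultimately show ?thesis by blast
qed

subsection \<open>Shift operators from intertwining operators\<close>

lemma pfam_upd:
  assumes "pfam \<iota> F" "ring_emb \<iota>" "pfam (\<lambda>c. c) h"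
  shows "pfam \<iota> (\<lambda>v. F (v(e := h v)))"
proof (rule pfam_subst[OF assms(1) _ assms(2)])
  fix i show "pfam (\<lambda>c. c) (\<lambda>v. (v(e := h v)) i)"
    using assms(3) pfam_id_var[of i] by (cases "i = e") simp_all
qed

lemma left_ideal_SE6_dense:
  assumes "pfam op_const F" "\<And>v. generic v \<Longrightarrow> F v \<in> left_ideal (SE6 v)"
  shows "F v \<in> left_ideal (SE6 v)"
  by (rule left_ideal_dense[OF dense_generic assms(1) pfam_SE6 SE6_order SE6_coeff SE6_lc_nz])
    (use assms(2) in auto)

text \<open>\<partial>^2 carries \<open>SE6 w\<close> to \<open>SE6\<close> with \<open>r\<close>
  lowered by 2. There \<open>P\<close> is replaced by the multiplier, for which the relation is
  known, and \<partial>^2 is cancelled.\<close>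

lemma up_hom:
  assumes "generic v" "op_d ^ 2 * P = op_const \<sigma> * M + Z * SE6 v"
    "SE6 (w(par_r := w par_r - 2)) * M \<in> left_ideal (SE6 v)"
  shows "SE6 w * P \<in> left_ideal (SE6 v)"
proof -
  have "op_d * op_d * SE6 w = SE6 (w(par_r := w par_r - 2)) * (op_d * op_d)"
    using SE6_op_d[of w] SE6_op_d[of "w(par_r := w par_r - 1)"]
    by (simp add: mult.assoc) (metis mult.assoc)
  then have "op_d * (op_d * (SE6 w * P)) = SE6 (w(par_r := w par_r - 2)) * (op_d ^ 2 * P)"
    by (simp add: power2_eq_square flip: mult.assoc)
  also have "\<dots> = op_const \<sigma> * (SE6 (w(par_r := w par_r - 2)) * M) + (SE6 (w(par_r := w par_r - 2)) * Z) * SE6 v"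
    by (simp add: assms(2) distrib_left op_const_left_commute mult.assoc)
  also have "\<dots> \<in> left_ideal (SE6 v)"
    by (rule left_ideal_add[OF left_ideal_mult[OF assms(3)] left_ideal_self])
  finally show ?thesis using cancel_d_SE6[OF assms(1)] by blast
qed

lemma SE6_xi2: "xi (w par_r - 4) * xi (w par_r - 3) * SE6 w
   = SE6 (w(par_p := w par_p + 2, par_r := w par_r - 2)) * xi2 (w par_r)"
proof -
  let ?v = "w(par_p := w par_p + 1, par_r := w par_r - 1)"
  have e: "?v(par_p := ?v par_p + 1, par_r := ?v par_r - 1) = w(par_p := w par_p + 2, par_r := w par_r - 2)"
    by auto
  have "xi (w par_r - 4) * (xi (w par_r - 3) * SE6 w) = xi (w par_r - 4) * SE6 ?v * xi (w par_r)"
    unfolding SE6_xi[of w] by (simp add: mult.assoc)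
  also have "xi (w par_r - 4) * SE6 ?v
      = SE6 (w(par_p := w par_p + 2, par_r := w par_r - 2)) * xi (w par_r - 1)"
    using SE6_xi[of ?v] unfolding e by simp
  finally show ?thesis by (simp add: xi2_def mult.assoc)
qed

lemma SE6_eta2: "oflip (xi (w par_r - 4)) * oflip (xi (w par_r - 3)) * SE6 w
   = SE6 (w(par_q := w par_q + 2, par_r := w par_r - 2)) * eta2 (w par_r)"
proof -
  have "oflip (xi (w par_r - 4) * xi (w par_r - 3) * SE6 (swap w))
    = oflip (SE6 ((swap w)(par_p := w par_q + 2, par_r := w par_r - 2)) * xi2 (w par_r))"
    using SE6_xi2[of "swap w"] by simp
  moreover have "(swap w)(par_p := w par_q + 2, par_r := w par_r - 2)
      = swap (w(par_q := w par_q + 2, par_r := w par_r - 2))"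
    by (auto simp: swap_def)
  ultimately show ?thesis by (simp add: oflip_mult SE6_flip eta2_def)
qed

lemma cancel_xi2: 
  assumes "generic v" "xi (v par_r + of_int j) * xi (v par_r + of_int k) * B \<in> left_ideal (SE6 v)"
  shows "B \<in> left_ideal (SE6 v)"
  using assms cancel_xi_SE6 by (metis mult.assoc)

lemma cancel_eta2:
  assumes "generic v" "oflip (xi (v par_r + of_int j)) * oflip (xi (v par_r + of_int k)) * B \<in> left_ideal (SE6 v)"
  shows "B \<in> left_ideal (SE6 v)"
  using assms cancel_eta_SE6 by (metis mult.assoc)

lemma down_hom_xi:
  assumes v: "generic v" and w: "w par_r = v par_r"
    and P: "xi2 (v par_r) * P = op_const \<sigma> * M + Z * SE6 v"
    and M: "SE6 (w(par_p := w par_p + 2, par_r := w par_r - 2)) * M \<in> left_ideal (SE6 v)"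
  shows "SE6 w * P \<in> left_ideal (SE6 v)"
proof -
  let ?w = "w(par_p := w par_p + 2, par_r := w par_r - 2)"
  have "xi (w par_r - 4) * xi (w par_r - 3) * (SE6 w * P) = SE6 ?w * (xi2 (v par_r) * P)"
    using SE6_xi2[of w] by (simp add: w flip: mult.assoc)
  also have "\<dots> = op_const \<sigma> * (SE6 ?w * M) + (SE6 ?w * Z) * SE6 v"
    by (simp add: P distrib_left op_const_left_commute mult.assoc)
  also have "\<dots> \<in> left_ideal (SE6 v)"
    by (rule left_ideal_add[OF left_ideal_mult[OF M] left_ideal_self])
  finally show ?thesis using cancel_xi2[OF v, of "- 4" "- 3"] by (simp add: w)
qed

text \<open>As in \<open>down_hom_xi\<close>, but \<open>w\<close> is carried in two steps, first by
  \<open>xi2\<close> and then by \<open>eta2\<close>, so four first-order factors are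
  cancelled.\<close>

lemma down_hom_eta_xi:
  assumes v: "generic v" and w: "w par_r = v par_r"
    and P: "eta2 (v par_r - 2) * xi2 (v par_r) * P = op_const \<sigma> * M + Z * SE6 v"
    and M: "SE6 (w(par_p := w par_p + 2, par_q := w par_q + 2, par_r := w par_r - 4)) * M \<in> left_ideal (SE6 v)"
  shows "SE6 w * P \<in> left_ideal (SE6 v)"
proof -
  let ?w = "w(par_p := w par_p + 2, par_r := w par_r - 2)"
  let ?w2 = "w(par_p := w par_p + 2, par_q := w par_q + 2, par_r := w par_r - 4)"
  have e: "?w(par_q := ?w par_q + 2, par_r := ?w par_r - 2) = ?w2"
    by auto
  have eta: "oflip (xi (w par_r - 6)) * oflip (xi (w par_r - 5)) * SE6 ?w = SE6 ?w2 * eta2 (w par_r - 2)"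
    using SE6_eta2[of ?w] unfolding e by simp
  have ring: "A * (B * (C * P)) = E * (F * G * P)" if "A * D = E * F" "B * C = D * G"
    for A B C D E F G :: diffop
  proof -
    have "A * (B * (C * P)) = A * (D * G) * P" by (simp only: that(2)[symmetric] mult.assoc)
    also have "\<dots> = A * D * G * P" by (simp only: mult.assoc)
    finally show ?thesis by (simp only: that(1) mult.assoc)
  qed
  have "oflip (xi (w par_r - 6)) * oflip (xi (w par_r - 5)) * (xi (w par_r - 4) * xi (w par_r - 3) * (SE6 w * P))
      = SE6 ?w2 * (eta2 (w par_r - 2) * xi2 (w par_r) * P)"
    by (rule ring[OF eta SE6_xi2])
  also have "\<dots> = op_const \<sigma> * (SE6 ?w2 * M) + (SE6 ?w2 * Z) * SE6 v"
    unfolding w P by (simp add: distrib_left op_const_left_commute mult.assoc)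
  also have "\<dots> \<in> left_ideal (SE6 v)"
    by (rule left_ideal_add[OF left_ideal_mult[OF M] left_ideal_self])
  finally have "xi (w par_r - 4) * xi (w par_r - 3) * (SE6 w * P) \<in> left_ideal (SE6 v)"
    using cancel_eta2[OF v, of "- 6" "- 5"] by (simp add: w)
  then show ?thesis using cancel_xi2[OF v, of "- 4" "- 3"] by (simp add: w)
qed

text \<open>Apply \<open>A' \<partial>^2\<close> from the left. Then \<partial>^2 \<open>Pu\<close>
  becomes \<open>Mu\<close>, \<open>A'\<close> is moved through \<open>Mu\<close> to give
  \<open>A\<close> in front of \<open>Pd\<close>, \<open>A Pd\<close> becomes \<open>Md\<close>, and
  \<open>comp\<close> leaves the scalar \<kappa> times \<open>A' \<partial>^2\<close>, which is
  cancelled. The error term of \<open>Pu\<close> contains \<open>SE6 w * Pd\<close>, so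
  \<open>hom\<close> is what places it in the ideal.\<close>

lemma S_value_composite:
  assumes Pu: "op_d ^ 2 * Pu = op_const \<sigma> * Mu + Zu * SE6 w"
    and hom: "SE6 w * Pd \<in> left_ideal (SE6 v)"
    and Pd: "A * Pd = op_const \<sigma>' * Md + Zd * SE6 v"
    and comm: "A' * Mu = Mu' * A"
    and comp: "Mu' * Md - op_const \<kappa> * (A' * op_d ^ 2) \<in> left_ideal (SE6 v)"
    and cancel: "\<And>B. A' * op_d ^ 2 * B \<in> left_ideal (SE6 v) \<Longrightarrow> B \<in> left_ideal (SE6 v)"
    and k: "k = \<sigma> * \<sigma>' * \<kappa>"
  shows "Pu * Pd - op_const k \<in> left_ideal (SE6 v)"
proof (rule cancel)
  have "A' * op_d ^ 2 * (Pu * Pd) = A' * (op_d ^ 2 * Pu) * Pd"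
    by (simp add: mult.assoc)
  also have "\<dots> = op_const \<sigma> * (A' * Mu * Pd) + A' * Zu * (SE6 w * Pd)"
    by (simp add: Pu distrib_left distrib_right op_const_left_commute mult.assoc)
  also have "A' * Mu * Pd = Mu' * (A * Pd)" by (simp add: comm mult.assoc)
  also have "op_const \<sigma> * (Mu' * (A * Pd))
      = op_const (\<sigma> * \<sigma>') * (Mu' * Md) + op_const \<sigma> * Mu' * Zd * SE6 v"
    by (simp only: Pd distrib_left op_const_left_commute[of Mu'] op_const_simps(2) mult.assoc)
  finally have 1: "A' * op_d ^ 2 * (Pu * Pd) = op_const (\<sigma> * \<sigma>') * (Mu' * Md)
      + op_const \<sigma> * Mu' * Zd * SE6 v + A' * Zu * (SE6 w * Pd)" .
  have "A' * op_d ^ 2 * op_const k = op_const (\<sigma> * \<sigma>') * (op_const \<kappa> * (A' * op_d ^ 2))"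
    by (subst op_const_commute[symmetric]) (simp add: k op_const_simps mult.assoc)
  with 1 have 2: "A' * op_d ^ 2 * (Pu * Pd - op_const k)
      = op_const (\<sigma> * \<sigma>') * (Mu' * Md - op_const \<kappa> * (A' * op_d ^ 2))
        + op_const \<sigma> * Mu' * Zd * SE6 v + A' * Zu * (SE6 w * Pd)"
    by (simp add: right_diff_distrib)
  show "A' * op_d ^ 2 * (Pu * Pd - op_const k) \<in> left_ideal (SE6 v)"
    unfolding 2
    by (rule left_ideal_add[OF left_ideal_add[OF left_ideal_mult[OF comp] left_ideal_self] left_ideal_mult[OF hom]])
qed

lemma cancel_d2:
  "generic v \<Longrightarrow> op_d ^ 2 * B \<in> left_ideal (SE6 v) \<Longrightarrow> B \<in> left_ideal (SE6 v)"
  using cancel_d_SE6 by (metis mult.assoc power2_eq_square)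

lemma cancel_xi2_d2:
  assumes "generic v" "xi2 (v par_r - 2) * op_d ^ 2 * B \<in> left_ideal (SE6 v)"
  shows "B \<in> left_ideal (SE6 v)"
  using cancel_d2[OF assms(1)] cancel_xi2[OF assms(1), of "- 3" "- 2" "op_d ^ 2 * B"] assms(2)
  by (simp add: xi2_def mult.assoc)

lemma cancel_eta2_xi2_d2:
  assumes "generic v" "eta2 (v par_r - 4) * xi2 (v par_r - 2) * op_d ^ 2 * B \<in> left_ideal (SE6 v)"
  shows "B \<in> left_ideal (SE6 v)"
proof -
  have "oflip (xi (v par_r + of_int (- 5))) * oflip (xi (v par_r + of_int (- 4))) * (xi2 (v par_r - 2) * op_d ^ 2 * B)
      \<in> left_ideal (SE6 v)"
    using assms(2) by (simp add: eta2_def xi2_def oflip_mult mult.assoc)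
  from cancel_xi2_d2[OF assms(1) cancel_eta2[OF assms(1) this]] show ?thesis .
qed

text \<open>Ideal memberships are asked for generic parameters, where cancelling is possible;
  \<open>shift_pairI\<close> extends them to all. In this form a pair can also be transported by the
  reflection (\<open>hom_pair_swap\<close>).\<close>

definition hom_pair :: "param \<Rightarrow> (params \<Rightarrow> diffop) \<Rightarrow> (params \<Rightarrow> diffop) \<Rightarrow> (params \<Rightarrow> complex) \<Rightarrow> bool" where
  "hom_pair e Pu Pd k \<longleftrightarrow> pfam op_const Pu \<and> pfam op_const Pd \<and>
     (\<forall>v. op_order (Pu v) \<le> 5 \<and> op_order (Pd v) \<le> 5 \<and>
       (generic v \<longrightarrow> SE6 (shift_up e v) * Pu v \<in> left_ideal (SE6 v) \<and>
          SE6 (shift_down e v) * Pd v \<in> left_ideal (SE6 v) \<and>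
          Pu (shift_down e v) * Pd v - op_const (k v) \<in> left_ideal (SE6 v)))"

definition shift_pair :: "param \<Rightarrow> (params \<Rightarrow> diffop) \<Rightarrow> (params \<Rightarrow> diffop) \<Rightarrow> (params \<Rightarrow> complex) \<Rightarrow> bool" where
  "shift_pair e Pu Pd k \<longleftrightarrow> shift_operator_family (shift_up e) Pu \<and> shift_operator_family (shift_down e) Pd
     \<and> (\<forall>v. is_S_value_down e Pu Pd v (k v))"

lemma pfam_shift:
  assumes "pfam \<iota> F" "ring_emb \<iota>"
  shows "pfam \<iota> (\<lambda>v. F (shift_up e v))" "pfam \<iota> (\<lambda>v. F (shift_down e v))"
  unfolding shift_up_def shift_down_def
  by (rule pfam_upd[OF assms]; intro pfam_intros)+

lemma ring_emb_id: "ring_emb (\<lambda>c. c)"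
  by (simp add: ring_emb_def)

lemma shift_up_down [simp]: "shift_up e (shift_down e v) = v" "shift_down e (shift_up e v) = v"
  by (auto simp: shift_up_def shift_down_def)

lemma shift_pairI:
  assumes "hom_pair e Pu Pd k" and k: "pfam (\<lambda>c. c) k" "k v0 \<noteq> 0"
  shows "shift_pair e Pu Pd k"
proof -
  have Pu: "pfam op_const Pu" "\<And>v. op_order (Pu v) \<le> 5"
    and Pd: "pfam op_const Pd" "\<And>v. op_order (Pd v) \<le> 5"
    and hu: "\<And>v. generic v \<Longrightarrow> SE6 (shift_up e v) * Pu v \<in> left_ideal (SE6 v)"
    and hd: "\<And>v. generic v \<Longrightarrow> SE6 (shift_down e v) * Pd v \<in> left_ideal (SE6 v)"
    and S: "\<And>v. generic v \<Longrightarrow> Pu (shift_down e v) * Pd v - op_const (k v) \<in> left_ideal (SE6 v)"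
    using assms(1) unfolding hom_pair_def by blast+
  note re = ring_emb_op_const
  have S': "Pu (shift_down e v) * Pd v - op_const (k v) \<in> left_ideal (SE6 v)" for v
    by (rule left_ideal_SE6_dense[of "\<lambda>v. Pu (shift_down e v) * Pd v - op_const (k v)"])
      (intro pfam_diff pfam_mult pfam_emb[OF k(1) re] Pd pfam_shift(2)[OF Pu(1) re], rule S)
  have hu': "SE6 (shift_up e v) * Pu v \<in> left_ideal (SE6 v)" for v
    by (rule left_ideal_SE6_dense[of "\<lambda>v. SE6 (shift_up e v) * Pu v"])
      (intro pfam_mult Pu pfam_shift(1)[OF pfam_SE6 re], rule hu)
  have hd': "SE6 (shift_down e v) * Pd v \<in> left_ideal (SE6 v)" for v
    by (rule left_ideal_SE6_dense[of "\<lambda>v. SE6 (shift_down e v) * Pd v"])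
      (intro pfam_mult Pd pfam_shift(2)[OF pfam_SE6 re], rule hd)
  have oL: "op_order (SE6 v) = 6" for v
    using SE6_order[of v] SE6_coeff[of v] SE6_lc_nz op_coeff_eq_0[of "SE6 v" 6] by (metis le_neq_implies_less)
  \<comment> \<open>A nonzero constant has order 0 and cannot lie in the left ideal of an operator
    of order 6. So neither operator vanishes where the S-value does not.\<close>
  have nz: "Pu (shift_down e v) * Pd v \<noteq> 0" if "k v \<noteq> 0" for v
  proof
    assume "Pu (shift_down e v) * Pd v = 0"
    from S'[of v, unfolded this] have "0 - op_const (k v) \<in> left_ideal (SE6 v)" .
    then have "op_const (- k v) \<in> left_ideal (SE6 v)" by (simp add: op_const_simps)
    then have "op_const (- k v) = 0" by (rule order_less_in_left_ideal) (simp add: oL)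
    then show False using that by simp
  qed
  have gu: "for_generic_params (\<lambda>v. Pu v \<noteq> 0)"
    unfolding for_generic_params_def
  proof (intro exI[of _ "\<lambda>v. k (shift_up e v)"] conjI allI impI)
    show "polynomial_function (\<lambda>v. k (shift_up e v))"
      by (rule pfam_imp_polynomial_function[OF pfam_shift(1)[OF k(1) ring_emb_id]])
    show "\<exists>v. k (shift_up e v) \<noteq> 0" by (rule exI[of _ "shift_down e v0"]) (simp add: k(2))
    fix v assume "k (shift_up e v) \<noteq> 0"
    then show "Pu v \<noteq> 0" using nz[of "shift_up e v"] by auto
  qed
  have gd: "for_generic_params (\<lambda>v. Pd v \<noteq> 0)"
    unfolding for_generic_params_def
  proof (intro exI[of _ k] conjI allI impI)
    show "polynomial_function k" by (rule pfam_imp_polynomial_function[OF k(1)])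
    show "\<exists>v. k v \<noteq> 0" using k(2) by blast
    fix v assume "k v \<noteq> 0"
    then show "Pd v \<noteq> 0" using nz[of v] by force
  qed
  have lt: "op_order (Pu v) < 6" "op_order (Pd v) < 6" for v
    using Pu(2)[of v] Pd(2)[of v] by linarith+
  have "shift_operator_family (shift_up e) Pu"
    unfolding shift_operator_family_def is_shift_operator_def polynomial_family_iff_pfam
    using Pu(1) gu lt(1) maps_solutions_if_left_ideal[OF hu'] by blast
  moreover have "shift_operator_family (shift_down e) Pd"
    unfolding shift_operator_family_def is_shift_operator_def polynomial_family_iff_pfam
    using Pd(1) gd lt(2) maps_solutions_if_left_ideal[OF hd'] by blast
  ultimately show ?thesis
    unfolding shift_pair_def is_S_value_down_def using S' by blast
qed

lemma swap_shift: "swap (shift_up par_b v) = shift_up par_a (swap v)" "swap (shift_down par_b v) = shift_down par_a (swap v)"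
  "swap (shift_up par_q v) = shift_up par_p (swap v)" "swap (shift_down par_q v) = shift_down par_p (swap v)"
  by (auto simp: swap_def shift_up_def shift_down_def)

lemma pfam_swap: "pfam \<iota> F \<Longrightarrow> ring_emb \<iota> \<Longrightarrow> pfam \<iota> (\<lambda>v. F (swap v))"
proof (rule pfam_subst, assumption)
  fix i show "pfam (\<lambda>c. c) (\<lambda>v. swap v i)"
    by (cases i) (simp_all add: pfam_id_var)
qed

lemma hom_pair_swap:
  assumes h: "hom_pair e Pu Pd k"
    and e: "\<And>v. swap (shift_up e' v) = shift_up e (swap v)" "\<And>v. swap (shift_down e' v) = shift_down e (swap v)"
  shows "hom_pair e' (\<lambda>v. oflip (Pu (swap v))) (\<lambda>v. oflip (Pd (swap v))) (\<lambda>v. k (swap v))"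
  unfolding hom_pair_def
proof (intro conjI allI impI)
  show "pfam op_const (\<lambda>v. oflip (Pu (swap v)))" "pfam op_const (\<lambda>v. oflip (Pd (swap v)))"
    using h unfolding hom_pair_def by (intro pfam_oflip pfam_swap ring_emb_op_const; blast)+
  fix v
  show "op_order (oflip (Pu (swap v))) \<le> 5" "op_order (oflip (Pd (swap v))) \<le> 5"
    using h op_order_oflip unfolding hom_pair_def by (meson order_trans)+
  assume g: "generic v"
  then have g': "generic (swap v)" by (simp add: generic_swap)
  then have h': "SE6 (shift_up e (swap v)) * Pu (swap v) \<in> left_ideal (SE6 (swap v))"
    "SE6 (shift_down e (swap v)) * Pd (swap v) \<in> left_ideal (SE6 (swap v))"
    "Pu (shift_down e (swap v)) * Pd (swap v) - op_const (k (swap v)) \<in> left_ideal (SE6 (swap v))"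
    using h unfolding hom_pair_def by blast+
  have f: "SE6 u = oflip (SE6 (swap u))" for u by (simp add: SE6_flip)
  show "SE6 (shift_up e' v) * oflip (Pu (swap v)) \<in> left_ideal (SE6 v)"
    using oflip_left_ideal[OF h'(1)] by (simp add: oflip_mult f[of v] f[of "shift_up e' v"] e)
  show "SE6 (shift_down e' v) * oflip (Pd (swap v)) \<in> left_ideal (SE6 v)"
    using oflip_left_ideal[OF h'(2)] by (simp add: oflip_mult f[of v] f[of "shift_down e' v"] e)
  show "oflip (Pu (swap (shift_down e' v))) * oflip (Pd (swap v)) - op_const (k (swap v)) \<in> left_ideal (SE6 v)"
    using oflip_left_ideal[OF h'(3)] by (simp add: oflip_mult oflip_diff f[of v] e)
qed

text \<open>The scheme for \<open>a\<close> and \<open>p\<close>. As \<open>e\<close> may be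
  \<open>par_p\<close>, the drop of \<open>r\<close> is paid for relative to
  \<open>shift_down e v par_p\<close>.\<close>

lemma hom_pair_xi:
  assumes Pu: "pfam op_const Pu" "\<And>v. op_order (Pu v) \<le> 5"
      "\<And>v. op_d ^ 2 * Pu v = op_const (su v) * M v + Zu v * SE6 v"
    and Pd: "pfam op_const Pd" "\<And>v. op_order (Pd v) \<le> 5"
      "\<And>v. xi2 (v par_r) * Pd v = op_const (sd v) * N v + Zd v * SE6 v"
    and e: "e \<noteq> par_r"
    and M: "\<And>v. SE6 ((shift_up e v)(par_r := v par_r - 2)) * M v \<in> left_ideal (SE6 v)"
    and N: "\<And>v. SE6 ((shift_down e v)(par_p := shift_down e v par_p + 2, par_r := v par_r - 2)) * N v
        \<in> left_ideal (SE6 v)"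
    and comm: "\<And>v. xi2 (v par_r - 2) * M v = M (v(par_p := v par_p + 2, par_r := v par_r - 2)) * xi2 (v par_r)"
    and comp: "\<And>v. M ((shift_down e v)(par_p := shift_down e v par_p + 2, par_r := v par_r - 2)) * N v
        - op_const (\<kappa> v) * (xi2 (v par_r - 2) * op_d ^ 2) \<in> left_ideal (SE6 v)"
    and k: "\<And>v. k v = su (shift_down e v) * sd v * \<kappa> v"
  shows "hom_pair e Pu Pd k"
proof -
  have r: "shift_up e v par_r = v par_r" "shift_down e v par_r = v par_r" for v
    using e by (auto simp: shift_up_def shift_down_def)
  have hd: "SE6 (shift_down e v) * Pd v \<in> left_ideal (SE6 v)" if "generic v" for v
    by (rule down_hom_xi[where v = v and w = "shift_down e v" and P = "Pd v" and \<sigma> = "sd v" and M = "N v" and Z = "Zd v",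
        OF that r(2)[of v] Pd(3)[of v]]) (simp only: r N)
  moreover have "SE6 (shift_up e v) * Pu v \<in> left_ideal (SE6 v)" if "generic v" for v
    by (rule up_hom[where v = v and w = "shift_up e v" and P = "Pu v" and \<sigma> = "su v" and M = "M v" and Z = "Zu v",
        OF that Pu(3)[of v]]) (simp only: r M)
  moreover have "Pu (shift_down e v) * Pd v - op_const (k v) \<in> left_ideal (SE6 v)" if "generic v" for v
    by (rule S_value_composite[where w = "shift_down e v" and v = v and Pu = "Pu (shift_down e v)" and Pd = "Pd v"
          and Mu = "M (shift_down e v)" and Md = "N v" and Zu = "Zu (shift_down e v)" and Zd = "Zd v"
          and \<sigma> = "su (shift_down e v)" and \<sigma>' = "sd v" and \<kappa> = "\<kappa> v", OF Pu(3)[of "shift_down e v"] hd[OF that] Pd(3)[of v]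
          comm[of "shift_down e v", unfolded r] comp[of v] _ k[of v]])
      (rule cancel_xi2_d2[OF that])
  ultimately show ?thesis using Pu Pd by (auto simp: hom_pair_def)
qed

text \<open>The scheme for \<open>c\<close> and \<open>g\<close>, where the lowering multiplier
  shifts both \<open>p\<close> and \<open>q\<close> by 2 and so needs \<open>eta2\<close> as well as
  \<open>xi2\<close>.\<close>

lemma hom_pair_eta_xi:
  assumes Pu: "pfam op_const Pu" "\<And>v. op_order (Pu v) \<le> 5"
      "\<And>v. op_d ^ 2 * Pu v = op_const (su v) * M v + Zu v * SE6 v"
    and Pd: "pfam op_const Pd" "\<And>v. op_order (Pd v) \<le> 5"
      "\<And>v. eta2 (v par_r - 2) * xi2 (v par_r) * Pd v = op_const (sd v) * N v + Zd v * SE6 v"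
    and e: "e \<noteq> par_r" "e \<noteq> par_p" "e \<noteq> par_q"
    and M: "\<And>v. SE6 ((shift_up e v)(par_r := v par_r - 2)) * M v \<in> left_ideal (SE6 v)"
    and N: "\<And>v. SE6 ((shift_down e v)(par_p := v par_p + 2, par_q := v par_q + 2, par_r := v par_r - 4)) * N v
        \<in> left_ideal (SE6 v)"
    and xi: "\<And>v. xi2 (v par_r - 2) * M v = M (v(par_p := v par_p + 2, par_r := v par_r - 2)) * xi2 (v par_r)"
    and eta: "\<And>v. eta2 (v par_r - 2) * M v = M (v(par_q := v par_q + 2, par_r := v par_r - 2)) * eta2 (v par_r)"
    and comp: "\<And>v. M ((shift_down e v)(par_p := v par_p + 2, par_q := v par_q + 2, par_r := v par_r - 4)) * N v
        - op_const (\<kappa> v) * (eta2 (v par_r - 4) * xi2 (v par_r - 2) * op_d ^ 2) \<in> left_ideal (SE6 v)"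
    and k: "\<And>v. k v = su (shift_down e v) * sd v * \<kappa> v"
  shows "hom_pair e Pu Pd k"
proof -
  have r: "shift_up e v par_r = v par_r" "shift_down e v par_r = v par_r"
    "shift_down e v par_p = v par_p" "shift_down e v par_q = v par_q" for v
    using e by (auto simp: shift_up_def shift_down_def)
  have comm: "eta2 (v par_r - 4) * xi2 (v par_r - 2) * M v
      = M (v(par_p := v par_p + 2, par_q := v par_q + 2, par_r := v par_r - 4)) * (eta2 (v par_r - 2) * xi2 (v par_r))" for v
  proof -
    let ?v = "v(par_p := v par_p + 2, par_r := v par_r - 2)"
    have w: "?v(par_q := ?v par_q + 2, par_r := ?v par_r - 2)
        = v(par_p := v par_p + 2, par_q := v par_q + 2, par_r := v par_r - 4)" by auto
    show ?thesis using xi[of v] eta[of ?v, unfolded w] by (simp add: mult.assoc) (simp flip: mult.assoc)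
  qed
  have hd: "SE6 (shift_down e v) * Pd v \<in> left_ideal (SE6 v)" if "generic v" for v
    by (rule down_hom_eta_xi[where v = v and w = "shift_down e v" and P = "Pd v" and \<sigma> = "sd v" and M = "N v" and Z = "Zd v",
        OF that r(2)[of v] Pd(3)[of v]]) (simp only: r N)
  moreover have "SE6 (shift_up e v) * Pu v \<in> left_ideal (SE6 v)" if "generic v" for v
    by (rule up_hom[where v = v and w = "shift_up e v" and P = "Pu v" and \<sigma> = "su v" and M = "M v" and Z = "Zu v",
        OF that Pu(3)[of v]]) (simp only: r M)
  moreover have "Pu (shift_down e v) * Pd v - op_const (k v) \<in> left_ideal (SE6 v)" if "generic v" for v
    by (rule S_value_composite[where w = "shift_down e v" and v = v and Pu = "Pu (shift_down e v)" and Pd = "Pd v"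
          and Mu = "M (shift_down e v)" and Md = "N v" and Zu = "Zu (shift_down e v)" and Zd = "Zd v"
          and \<sigma> = "su (shift_down e v)" and \<sigma>' = "sd v" and \<kappa> = "\<kappa> v", OF Pu(3)[of "shift_down e v"] hd[OF that] Pd(3)[of v]
          comm[of "shift_down e v", unfolded r] comp[of v] _ k[of v]])
      (rule cancel_eta2_xi2_d2[OF that])
  ultimately show ?thesis using Pu Pd by (auto simp: hom_pair_def)
qed

subsection \<open>Coefficients of the shift operators\<close>

text \<open>Found by solving the divisibility conditions: \<open>ya, yg, za, zc, zg\<close> are the values of \<open>y2\<close> in \<open>lifts_up\<close> and
  \<open>lifts_down\<close> below, \<open>lamg\<close> is a linear factor of \<open>mg0\<close>, and \<open>al_c, al_g, be_g\<close> split the lowering operators.\<close>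

definition ya :: "complex \<Rightarrow> complex \<Rightarrow> complex \<Rightarrow> complex \<Rightarrow> complex \<Rightarrow> complex \<Rightarrow> complex" where
"ya a b c g z q = - 2*a^2 - 2*a*b - 2*a*c - a*g + a*z + b*z + 2*c*z + g*z + z^2 + z*q - 6*a -
    2*b - 2*c - g + 3*z - 4"

definition yg :: "complex \<Rightarrow> complex \<Rightarrow> complex \<Rightarrow> complex \<Rightarrow> complex \<Rightarrow> complex \<Rightarrow> complex" where
"yg a b c g z q = - 8*a^4 - 24*a^3*b - 32*a^3*c - 20*a^3*g - 16*a^3*z - 8*a^3*q - 24*a^2*b^2 -
    72*a^2*b*c - 48*a^2*b*g - 40*a^2*b*z - 16*a^2*b*q - 48*a^2*c^2 - 64*a^2*c*g - 48*a^2*c*z -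
    24*a^2*c*q - 20*a^2*g^2 - 36*a^2*g*z - 16*a^2*g*q - 10*a^2*z^2 - 12*a^2*z*q - 2*a^2*q^2 -
    8*a*b^3 - 48*a*b^2*c - 36*a*b^2*g - 32*a*b^2*z - 8*a*b^2*q - 72*a*b*c^2 - 108*a*b*c*g -
    80*a*b*c*z - 32*a*b*c*q - 36*a*b*g^2 - 64*a*b*g*z - 24*a*b*g*q - 18*a*b*z^2 - 20*a*b*z*q -
    2*a*b*q^2 - 32*a*c^3 - 72*a*c^2*g - 48*a*c^2*z - 24*a*c^2*q - 48*a*c*g^2 - 82*a*c*g*z -
    36*a*c*g*q - 20*a*c*z^2 - 24*a*c*z*q - 4*a*c*q^2 - 10*a*g^3 - 29*a*g^2*z - 12*a*g^2*q -
    19*a*g*z^2 - 22*a*g*z*q - 3*a*g*q^2 - 2*a*z^3 - 4*a*z^2*q - 2*a*z*q^2 - 8*b^3*c - 8*b^3*g -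
    8*b^3*z - 24*b^2*c^2 - 44*b^2*c*g - 32*b^2*c*z - 8*b^2*c*q - 16*b^2*g^2 - 28*b^2*g*z -
    8*b^2*g*q - 8*b^2*z^2 - 8*b^2*z*q - 24*b*c^3 - 64*b*c^2*g - 40*b*c^2*z - 16*b*c^2*q -
    46*b*c*g^2 - 74*b*c*g*z - 28*b*c*g*q - 18*b*c*z^2 - 20*b*c*z*q - 2*b*c*q^2 - 10*b*g^3 -
    27*b*g^2*z - 10*b*g^2*q - 18*b*g*z^2 - 20*b*g*z*q - 2*b*g*q^2 - 2*b*z^3 - 4*b*z^2*q -
    2*b*z*q^2 - 8*c^4 - 28*c^3*g - 16*c^3*z - 8*c^3*q - 30*c^2*g^2 - 48*c^2*g*z - 20*c^2*g*q -
    10*c^2*z^2 - 12*c^2*z*q - 2*c^2*q^2 - 13*c*g^3 - 36*c*g^2*z - 14*c*g^2*q - 23*c*g*z^2 -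
    26*c*g*z*q - 3*c*g*q^2 - 2*c*z^3 - 4*c*z^2*q - 2*c*z*q^2 - 2*g^4 - 8*g^3*z - 3*g^3*q -
    9*g^2*z^2 - 10*g^2*z*q - g^2*q^2 - 3*g*z^3 - 6*g*z^2*q - 3*g*z*q^2 - 68*a^3 - 152*a^2*b -
    208*a^2*c - 134*a^2*g - 110*a^2*z - 50*a^2*q - 100*a*b^2 - 316*a*b*c - 222*a*b*g - 186*a*b*z
    - 66*a*b*q - 216*a*c^2 - 304*a*c*g - 230*a*c*z - 104*a*c*q - 98*a*g^2 - 178*a*g*z - 73*a*g*q
    - 50*a*z^2 - 58*a*z*q - 8*a*q^2 - 16*b^3 - 108*b^2*c - 88*b^2*g - 76*b^2*z - 16*b^2*q -
    168*b*c^2 - 268*b*c*g - 196*b*c*z - 70*b*c*q - 92*b*g^2 - 161*b*g*z - 56*b*g*q - 46*b*z^2 -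
    50*b*z*q - 4*b*q^2 - 76*c^3 - 180*c^2*g - 122*c^2*z - 54*c^2*q - 123*c*g^2 - 211*c*g*z -
    83*c*g*q - 54*c*z^2 - 62*c*z*q - 8*c*q^2 - 26*g^3 - 75*g^2*z - 28*g^2*q - 51*g*z^2 -
    57*g*z*q - 6*g*q^2 - 6*z^3 - 12*z^2*q - 6*z*q^2 - 220*a^2 - 332*a*b - 468*a*c - 314*a*g -
    262*a*z - 108*a*q - 112*b^2 - 368*b*c - 272*b*g - 226*b*z - 72*b*q - 256*c^2 - 376*c*g -
    288*c*z - 116*c*q - 124*g^2 - 226*g*z - 84*g*q - 66*z^2 - 74*z*q - 8*q^2 - 328*a - 256*b -
    368*c - 256*g - 216*z - 80*q - 192"

definition za :: "complex \<Rightarrow> complex \<Rightarrow> complex \<Rightarrow> complex \<Rightarrow> complex \<Rightarrow> complex \<Rightarrow> complex" where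
"za a b c g p q = - 2*a^2 - 2*a*b - 3*a*g + a*p + a*q - b*g + 2*c^2 - c*g + 3*c*p + c*q - g^2 +
    p^2 + p*q + 4*c - g + 3*p + q + 2"

definition zc :: "complex \<Rightarrow> complex \<Rightarrow> complex \<Rightarrow> complex \<Rightarrow> complex \<Rightarrow> complex \<Rightarrow> complex" where
"zc a b c g p q = 6*a^2 + 2*a*b + 16*a*c + 5*a*g + 9*a*p + a*q + 4*b*c + b*g + 2*b*p + 10*c^2 +
    7*c*g + 11*c*p + c*q + g^2 + 4*g*p + 3*p^2 + p*q + 12*a + 2*b + 16*c + 5*g + 9*p + q + 6"

definition zg :: "complex \<Rightarrow> complex \<Rightarrow> complex \<Rightarrow> complex \<Rightarrow> complex \<Rightarrow> complex \<Rightarrow> complex" where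
"zg a b c g p q = - 12*a^2*b - 6*a^2*g - 4*a*b^2 - 16*a*b*c - 16*a*b*g - 6*a*b*p - 2*a*b*q -
    8*a*c*g - 7*a*g^2 - 3*a*g*p - a*g*q - 2*b^2*g - 4*b*c^2 - 10*b*c*g - 2*b*c*p - 2*b*c*q -
    5*b*g^2 - 4*b*g*p - 2*b*g*q - 2*c^2*g - 5*c*g^2 - c*g*p - c*g*q - 2*g^3 - 2*g^2*p - g^2*q -
    12*a*b - 6*a*g - 4*b*c - 8*b*g - 2*c*g - 4*g^2"

definition al_c :: "complex \<Rightarrow> complex \<Rightarrow> complex \<Rightarrow> complex \<Rightarrow> complex \<Rightarrow> complex \<Rightarrow> complex" where
"al_c a b c g p q = - 2*a*c - a*q - 2*b*c - b*p - 2*c^2 - c*g - c*p - c*q - 2*p*q - 2*c"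

definition al_g :: "complex \<Rightarrow> complex \<Rightarrow> complex \<Rightarrow> complex \<Rightarrow> complex \<Rightarrow> complex \<Rightarrow> complex" where
"al_g a b c g p q = - 4*a^2*b*c - 2*a^2*b*q - 2*a^2*c*g - a^2*g*q - 4*a*b^2*c - 2*a*b^2*p -
    8*a*b*c^2 - 8*a*b*c*g - 10*a*b*c*p - 4*a*b*c*q - 5*a*b*g*p - 2*a*b*g*q - 4*a*b*p*q -
    4*a*c^2*g - 3*a*c*g^2 - 5*a*c*g*p - 2*a*c*g*q - 2*a*g^2*p - a*g^2*q - 2*a*g*p*q - 4*b^2*c^2
    - 4*b^2*c*g - 6*b^2*c*p - 4*b^2*g*p - 4*b*c^3 - 8*b*c^2*g - 10*b*c^2*p - 2*b*c^2*q -
    4*b*c*g^2 - 13*b*c*g*p - 2*b*c*g*q - 4*b*c*p^2 - 4*b*c*p*q - 4*b*g^2*p - 2*b*g*p^2 -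
    4*b*g*p*q - 2*c^3*g - 3*c^2*g^2 - 5*c^2*g*p - c^2*g*q - c*g^3 - 5*c*g^2*p - c*g^2*q -
    2*c*g*p^2 - 2*c*g*p*q - g^3*p - g^2*p^2 - 2*g^2*p*q - 4*a*b*c - 2*a*c*g - 4*b*c^2 - 4*b*c*g
    - 8*b*c*p - 4*b*g*p - 2*c^2*g - 2*c*g^2 - 4*c*g*p - 2*g^2*p"

definition be_g :: "complex \<Rightarrow> complex \<Rightarrow> complex \<Rightarrow> complex \<Rightarrow> complex \<Rightarrow> complex \<Rightarrow> complex" where
"be_g a b c g p q = 6*a*b*c + 3*a*b*g - 2*a*c^2 + 3*a*c*g - 4*a*c*q + 2*a*g^2 - 2*a*g*q +
    6*b^2*c + 3*b^2*g + 10*b*c^2 + 11*b*c*g + 4*b*c*p + 4*b*c*q + 3*b*g^2 + 2*b*g*p + 2*b*g*q +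
    4*c^2*g + 4*c*g^2 + 2*c*g*p + g^3 + g^2*p + 8*b*c + 4*b*g + 4*c*g + 2*g^2"

definition lamg :: dfpoly where
  "lamg a b c g q = [:- 4*a^2 - 8*a*b - 8*a*c - 8*a*g - 2*a*q - 4*b^2 - 8*b*c - 8*b*g - 2*b*q - 4*c^2 - 10*c*g - 2*c*q
    - 4*g^2 - 3*g*q - 18*a - 18*b - 20*c - 18*g - 6*q - 20, 2*a + 2*b + 2*c + 3*g + 6:]"

subsection \<open>Raising operators\<close>

lemma pfam_exponent: "i \<in> {1..9} \<Longrightarrow> pfam (\<lambda>c. c) (\<lambda>v. SE6_exponent v i)"
proof -
  assume "i \<in> {1..9}"
  then have "i = 1 \<or> i = 2 \<or> i = 3 \<or> i = 4 \<or> i = 5 \<or> i = 6 \<or> i = 7 \<or> i = 8 \<or> i = 9" by auto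
  then show ?thesis by (elim disjE; simp only: SE6_exponents; intro pfam_intros)
qed

lemma pfam_poly:
  assumes "pfam (\<lambda>c. [:c:]) F" "pfam (\<lambda>c. c) x" shows "pfam (\<lambda>c. c) (\<lambda>v. poly (F v) (x v))"
  using assms(1)
proof induction
  case (pfam_const K)
  show ?case
    by (induction K) (auto intro!: pfam.pfam_const pfam.pfam_add pfam.pfam_mult assms(2))
qed (auto intro: pfam.intros pfam_id_var)

lemmas pfam_data = pfam_pCons pfam_pcompose pfam_poly pfam_exponent pfam_intros

lemma pfam_pv_data:
  "pfam (\<lambda>c. [:c:]) (pv ma0)" "pfam (\<lambda>c. [:c:]) (pv ma1)" "pfam (\<lambda>c. [:c:]) (pv ma2)"
  "pfam (\<lambda>c. [:c:]) (pv mc0)" "pfam (\<lambda>c. [:c:]) (pv mc1)" "pfam (\<lambda>c. [:c:]) (pv mc2)"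
  "pfam (\<lambda>c. [:c:]) (pv mg0)" "pfam (\<lambda>c. [:c:]) (pv mg1)" "pfam (\<lambda>c. [:c:]) (pv mg2)"
  "pfam (\<lambda>c. [:c:]) (pv na0)" "pfam (\<lambda>c. [:c:]) (pv na1)" "pfam (\<lambda>c. [:c:]) (pv na2)"
  "pfam (\<lambda>c. [:c:]) (pv ng0)" "pfam (\<lambda>c. [:c:]) (pv lamg)"
  by (rule pfam_pv; unfold ma0_def ma1_def ma2_def mc0_def mc1_def mc2_def mg0_def mg1_def mg2_def
    na0_def na1_def na2_def ng0_def lamg_def; intro pfam_pCons pfam_intros)+

lemma degree_quadratic: "degree [:c0, c1, c2:] \<le> 2"
  by simp

lemma degree_pv: "(\<And>a b c g q. degree (f a b c g q) \<le> n) \<Longrightarrow> degree (pv f v) \<le> n"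
  unfolding pv_def by (rule order_trans[OF degree_pcompose_le]) simp

lemma degree_pv_data:
  "degree (pv ma0 v) \<le> 2" "degree (pv ma1 v) \<le> 2" "degree (pv ma2 v) \<le> 2"
  "degree (pv mc0 v) \<le> 2" "degree (pv mc1 v) \<le> 2" "degree (pv mc2 v) \<le> 2"
  "degree (pv mg0 v) \<le> 2" "degree (pv mg1 v) \<le> 2" "degree (pv mg2 v) \<le> 2"
  "degree (pv na0 v) \<le> 2" "degree (pv na1 v) \<le> 2" "degree (pv na2 v) \<le> 2"
  by (rule degree_pv; unfold ma0_def ma1_def ma2_def mc0_def mc1_def mc2_def mg0_def mg1_def mg2_def
    na0_def na1_def na2_def; rule degree_quadratic)+

text \<open>Solving \<open>E1\<close> to \<open>E3\<close> of \<open>lifts_up\<close> divides by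
  \<open>r\<close>, \<open>1 - r\<close> and the values of \<open>be0\<close> at -1 and -2, which
  are products of exponents 7, 8, 9 minus 1 or 2. The \<open>sig\<close> functions collect those
  factors that the multiplier does not cancel.\<close>

definition sig_a :: "params \<Rightarrow> complex" where
  "sig_a v = - v par_r * (1 - v par_r) * (SE6_exponent v 8 - 1) * (SE6_exponent v 9 - 1) * (SE6_exponent v 9 - 2)"

definition sig_c :: "params \<Rightarrow> complex" where
  "sig_c v = - v par_r * (1 - v par_r) * (SE6_exponent v 7 - 1) * (SE6_exponent v 7 - 2)
     * (SE6_exponent v 8 - 1) * (SE6_exponent v 8 - 2) * (SE6_exponent v 9 - 1) * (SE6_exponent v 9 - 2)"

definition sig_g :: "params \<Rightarrow> complex" where
  "sig_g v = - v par_r * (1 - v par_r) * (SE6_exponent v 8 - 1) * (SE6_exponent v 8 - 2)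
     * (SE6_exponent v 9 - 1) * (SE6_exponent v 9 - 2)"

definition sig_p :: "params \<Rightarrow> complex" where
  "sig_p v = - v par_r * (1 - v par_r) * (SE6_exponent v 7 - 1) * (SE6_exponent v 8 - 1) * (SE6_exponent v 9 - 1)"


definition lifts :: "(params \<Rightarrow> diffop) \<Rightarrow> (params \<Rightarrow> complex) \<Rightarrow> (params \<Rightarrow> diffop) \<Rightarrow> bool" where
  "lifts A \<sigma> M \<longleftrightarrow> (\<exists>P Z. pfam op_const P \<and> (\<forall>v. op_order (P v) \<le> 5 \<and>
     A v * P v = op_const (\<sigma> v) * M v + Z v * SE6 v))"

text \<open>The linear polynomial \<open>y0 + y1 \<theta>\<close> is given by its values
  \<open>u\<close> at -1 and \<open>w\<close> at -2; in these terms each divisibility condition can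
  be solved for one unknown.\<close>

lemma lifts_up:
  fixes h0 h1 h2 :: "params \<Rightarrow> complex poly" and \<sigma> u w y2 :: "params \<Rightarrow> complex"
  assumes h: "pfam (\<lambda>c. [:c:]) h0" "pfam (\<lambda>c. [:c:]) h1" "pfam (\<lambda>c. [:c:]) h2"
    and deg: "\<And>v. degree (h0 v) \<le> 2" "\<And>v. degree (h1 v) \<le> 2" "\<And>v. degree (h2 v) \<le> 2"
    and y: "pfam (\<lambda>c. c) \<sigma>" "pfam (\<lambda>c. c) u" "pfam (\<lambda>c. c) w" "pfam (\<lambda>c. c) y2"
    and E1: "\<And>v. \<sigma> v * poly (h0 v) (- 1) + u v * (1 - v par_r) * poly (pv be0 v) (- 1) = 0"
    and E2: "\<And>v. \<sigma> v * poly (h0 v) (- 2) - w v * v par_r * poly (pv be0 v) (- 2) = 0"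
    and E3: "\<And>v. \<sigma> v * poly (h1 v) (- 2) - w v * v par_r * poly (pv be1 v) (- 2)
       - y2 v * v par_r * (1 - v par_r) * poly (pv be0 v) (- 1) = 0"
  shows "lifts (\<lambda>_. op_d ^ 2) \<sigma> (\<lambda>v. psi (- v par_r) [h0 v, h1 v, h2 v])"
proof -
  have e: "2 * u v - w v - (u v - w v) = u v" "2 * u v - w v - 2 * (u v - w v) = w v" for v by simp_all
  have "\<exists>P. pfam op_const P \<and> (\<forall>v. op_order (P v) \<le> 5 \<and>
    op_d ^ 2 * P v = op_const (\<sigma> v) * psi (- v par_r) [h0 v, h1 v, h2 v]
      + (thp [:2 * u v - w v, u v - w v:] + op_const (y2 v) * op_d) * SE6 v)"
    by (rule up_operator[OF h y(1) _ _ y(4) deg], unfold e)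
      (intro pfam_intros y | rule E1 E2 E3)+
  then obtain P where P: "pfam op_const P" "\<And>v. op_order (P v) \<le> 5"
    "\<And>v. op_d ^ 2 * P v = op_const (\<sigma> v) * psi (- v par_r) [h0 v, h1 v, h2 v]
      + (thp [:2 * u v - w v, u v - w v:] + op_const (y2 v) * op_d) * SE6 v" by blast
  show ?thesis
    unfolding lifts_def
    by (rule exI[of _ P], rule exI[of _ "\<lambda>v. thp [:2 * u v - w v, u v - w v:] + op_const (y2 v) * op_d"])
      (simp add: P)
qed

text \<open>\<open>ma0\<close> is the product of \<theta> + \<open>e7\<close> and \<theta> +
  \<open>e8\<close>, so in \<open>E1\<close> and \<open>E2\<close> it cancels two of the three
  factors of \<open>be0\<close>. The factor \<open>e8 - 1\<close> of \<open>sig_a\<close> clears the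
  denominator of \<open>y2\<close> in \<open>E3\<close>.\<close>

lemma lifts_a_up: "lifts (\<lambda>_. op_d ^ 2) sig_a M_a"
proof -
  have E1: "sig_a v * poly (pv ma0 v) (- 1) + (v par_r * (SE6_exponent v 8 - 1) * (SE6_exponent v 9 - 2)) * (1 - v par_r) * poly (pv be0 v) (- 1) = 0" for v
  proof -
    define a b c g p q r where abc: "a = v par_a" "b = v par_b" "c = v par_c" "g = v par_g"
      "p = v par_p" "q = v par_q" "r = v par_r"
    show ?thesis
      unfolding sig_a_def poly_pv ma0_def be0_def SE6_exponents abc[symmetric]
        poly_mult poly_pCons poly_0 by algebra
  qed
  have E2: "sig_a v * poly (pv ma0 v) (- 2) - ((v par_r - 1) * (SE6_exponent v 8 - 1) * (SE6_exponent v 9 - 1)) * v par_r * poly (pv be0 v) (- 2) = 0" for v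
  proof -
    define a b c g p q r where abc: "a = v par_a" "b = v par_b" "c = v par_c" "g = v par_g"
      "p = v par_p" "q = v par_q" "r = v par_r"
    show ?thesis
      unfolding sig_a_def poly_pv ma0_def be0_def SE6_exponents abc[symmetric]
        poly_mult poly_pCons poly_0 by algebra
  qed
  have E3: "sig_a v * poly (pv ma1 v) (- 2) - ((v par_r - 1) * (SE6_exponent v 8 - 1) * (SE6_exponent v 9 - 1)) * v par_r * poly (pv be1 v) (- 2)
       - (- ya (v par_a) (v par_b) (v par_c) (v par_g) (v par_r + v par_p) (v par_q)) * v par_r * (1 - v par_r) * poly (pv be0 v) (- 1) = 0" for v
  proof -
    define a b c g p q r where abc: "a = v par_a" "b = v par_b" "c = v par_c" "g = v par_g"
      "p = v par_p" "q = v par_q" "r = v par_r"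
    show ?thesis
      unfolding sig_a_def poly_pv ma1_def be0_def be1_def ya_def SE6_exponents abc[symmetric]
        poly_mult poly_pCons poly_0 by algebra
  qed
  show ?thesis
    unfolding M_a_def[abs_def] psi2_def
    by (rule lifts_up[where ?h0.0 = "pv ma0" and ?h1.0 = "pv ma1" and ?h2.0 = "pv ma2" and u = "\<lambda>v. (v par_r * (SE6_exponent v 8 - 1) * (SE6_exponent v 9 - 2))"
        and w = "\<lambda>v. ((v par_r - 1) * (SE6_exponent v 8 - 1) * (SE6_exponent v 9 - 1))" and ?y2.0 = "\<lambda>v. (- ya (v par_a) (v par_b) (v par_c) (v par_g) (v par_r + v par_p) (v par_q))",
        OF pfam_pv_data(1-3) degree_pv_data(1-3) _ _ _ _ E1 E2 E3])
      (simp | (unfold sig_a_def[abs_def] ya_def)?, intro pfam_data pfam_pv_data pfam_be; simp)+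
qed

text \<open>\<open>sig_c\<close> contains both values of \<open>be0\<close> in full, so the
  conditions are solved by formulas in \<open>mc0\<close>, \<open>mc1\<close> and \<open>be1\<close>
  without use of their coefficients.\<close>

lemma lifts_c_up: "lifts (\<lambda>_. op_d ^ 2) sig_c M_c"
proof -
  have E1: "sig_c v * poly (pv mc0 v) (- 1) + (v par_r * (SE6_exponent v 7 - 2) * (SE6_exponent v 8 - 2) * (SE6_exponent v 9 - 2) * poly (pv mc0 v) (- 1)) * (1 - v par_r) * poly (pv be0 v) (- 1) = 0" for v
    unfolding sig_c_def poly_be0 by algebra
  have E2: "sig_c v * poly (pv mc0 v) (- 2) - ((v par_r - 1) * (SE6_exponent v 7 - 1) * (SE6_exponent v 8 - 1) * (SE6_exponent v 9 - 1) * poly (pv mc0 v) (- 2)) * v par_r * poly (pv be0 v) (- 2) = 0" for v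
    unfolding sig_c_def poly_be0 by algebra
  have E3: "sig_c v * poly (pv mc1 v) (- 2) - ((v par_r - 1) * (SE6_exponent v 7 - 1) * (SE6_exponent v 8 - 1) * (SE6_exponent v 9 - 1) * poly (pv mc0 v) (- 2)) * v par_r * poly (pv be1 v) (- 2)
       - (poly (pv mc0 v) (- 2) * poly (pv be1 v) (- 2)
        - poly (pv mc1 v) (- 2) * (SE6_exponent v 7 - 2) * (SE6_exponent v 8 - 2) * (SE6_exponent v 9 - 2)) * v par_r * (1 - v par_r) * poly (pv be0 v) (- 1) = 0" for v
    unfolding sig_c_def poly_be0 by algebra
  show ?thesis
    unfolding M_c_def[abs_def] psi2_def
    by (rule lifts_up[where ?h0.0 = "pv mc0" and ?h1.0 = "pv mc1" and ?h2.0 = "pv mc2" and u = "\<lambda>v. (v par_r * (SE6_exponent v 7 - 2) * (SE6_exponent v 8 - 2) * (SE6_exponent v 9 - 2) * poly (pv mc0 v) (- 1))"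
        and w = "\<lambda>v. ((v par_r - 1) * (SE6_exponent v 7 - 1) * (SE6_exponent v 8 - 1) * (SE6_exponent v 9 - 1) * poly (pv mc0 v) (- 2))" and ?y2.0 = "\<lambda>v. (poly (pv mc0 v) (- 2) * poly (pv be1 v) (- 2)
        - poly (pv mc1 v) (- 2) * (SE6_exponent v 7 - 2) * (SE6_exponent v 8 - 2) * (SE6_exponent v 9 - 2))",
        OF pfam_pv_data(4-6) degree_pv_data(4-6) _ _ _ _ E1 E2 E3])
      (simp | (unfold sig_c_def[abs_def] )?, intro pfam_data pfam_pv_data pfam_be; simp)+
qed

text \<open>The common factor with \<open>be0\<close> is the reason why exponent 7 is absent from
  \<open>sig_g\<close> and hence from the S-value of \<open>g\<close>.\<close>

lemma mg0_factor: "poly (pv mg0 v) t = poly (pv lamg v) t * (t + SE6_exponent v 7)"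
proof -
  define a b c g p q r where abc: "a = v par_a" "b = v par_b" "c = v par_c" "g = v par_g"
    "p = v par_p" "q = v par_q" "r = v par_r"
  show ?thesis
    unfolding poly_pv mg0_def lamg_def poly_pCons poly_0 SE6_exponents abc[symmetric] by algebra
qed

text \<open>The expression that \<open>E3\<close> requires to be divisible by \<open>e7 - 1\<close>
  once exponent 7 is left out of \<open>sig_g\<close>; \<open>yg\<close> is the quotient up to
  sign.\<close>

lemma mg1_be1: "poly (pv lamg v) (- 2) * poly (pv be1 v) (- 2)
     - poly (pv mg1 v) (- 2) * (SE6_exponent v 8 - 2) * (SE6_exponent v 9 - 2)
   = - yg (v par_a) (v par_b) (v par_c) (v par_g) (v par_r + v par_p) (v par_q) * (SE6_exponent v 7 - 1)"
proof -
  define a b c g z q where abc: "a = v par_a" "b = v par_b" "c = v par_c" "g = v par_g"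
    "z = v par_r + v par_p" "q = v par_q"
  have e: "SE6_exponent v 7 = - 2 * c - z - q - 1" "SE6_exponent v 8 = - a - b - 2 * c - z - q - g - 2"
    "SE6_exponent v 9 = - 2 * a - 2 * b - 2 * c - z - q - g - 3"
    by (simp_all add: SE6_exponents abc)
  have w: "- 2 - v par_r - v par_p = - 2 - z" by (simp add: abc)
  show ?thesis
    unfolding poly_pv w e mg1_def lamg_def be1_def yg_def poly_pCons poly_0 abc(5)[symmetric] abc(1-4,6)[symmetric] by algebra
qed

lemma lifts_g_up: "lifts (\<lambda>_. op_d ^ 2) sig_g M_g"
proof -
  have E1: "sig_g v * poly (pv mg0 v) (- 1) + (v par_r * (SE6_exponent v 8 - 2) * (SE6_exponent v 9 - 2) * poly (pv lamg v) (- 1)) * (1 - v par_r) * poly (pv be0 v) (- 1) = 0" for v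
    unfolding sig_g_def poly_be0 mg0_factor by algebra
  have E2: "sig_g v * poly (pv mg0 v) (- 2) - ((v par_r - 1) * (SE6_exponent v 8 - 1) * (SE6_exponent v 9 - 1) * poly (pv lamg v) (- 2)) * v par_r * poly (pv be0 v) (- 2) = 0" for v
    unfolding sig_g_def poly_be0 mg0_factor by algebra
  have E3: "sig_g v * poly (pv mg1 v) (- 2) - ((v par_r - 1) * (SE6_exponent v 8 - 1) * (SE6_exponent v 9 - 1) * poly (pv lamg v) (- 2)) * v par_r * poly (pv be1 v) (- 2)
       - (- yg (v par_a) (v par_b) (v par_c) (v par_g) (v par_r + v par_p) (v par_q)) * v par_r * (1 - v par_r) * poly (pv be0 v) (- 1) = 0" for v
    using mg1_be1[of v] unfolding sig_g_def poly_be0 by algebra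
  show ?thesis
    unfolding M_g_def[abs_def] psi2_def
    by (rule lifts_up[where ?h0.0 = "pv mg0" and ?h1.0 = "pv mg1" and ?h2.0 = "pv mg2" and u = "\<lambda>v. (v par_r * (SE6_exponent v 8 - 2) * (SE6_exponent v 9 - 2) * poly (pv lamg v) (- 1))"
        and w = "\<lambda>v. ((v par_r - 1) * (SE6_exponent v 8 - 1) * (SE6_exponent v 9 - 1) * poly (pv lamg v) (- 2))" and ?y2.0 = "\<lambda>v. (- yg (v par_a) (v par_b) (v par_c) (v par_g) (v par_r + v par_p) (v par_q))",
        OF pfam_pv_data(7-9) degree_pv_data(7-9) _ _ _ _ E1 E2 E3])
      (simp | (unfold sig_g_def[abs_def] yg_def)?, intro pfam_data pfam_pv_data pfam_be; simp)+
qed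

lemma lifts_p_up: "lifts (\<lambda>_. op_d ^ 2) sig_p M_p"
proof -
  have E1: "sig_p v * poly 0 (- 1) + 0 * (1 - v par_r) * poly (pv be0 v) (- 1) = 0" for v
    by simp
  have E2: "sig_p v * poly 0 (- 2) - 0 * v par_r * poly (pv be0 v) (- 2) = 0" for v
    by simp
  have E3: "sig_p v * poly 1 (- 2) - 0 * v par_r * poly (pv be1 v) (- 2)
       - (- 1) * v par_r * (1 - v par_r) * poly (pv be0 v) (- 1) = 0" for v
    unfolding sig_p_def poly_be0 poly_1 by algebra
  show ?thesis
    unfolding M_p_def[abs_def]
    by (rule lifts_up[where ?h0.0 = "\<lambda>_. 0" and ?h1.0 = "\<lambda>_. 1" and ?h2.0 = "\<lambda>_. 0" and u = "\<lambda>v. 0"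
        and w = "\<lambda>v. 0" and ?y2.0 = "\<lambda>v. (- 1)",
        OF pfam_const pfam_const pfam_const _ _ _ _ _ _ _ E1 E2 E3])
      (simp | (unfold sig_p_def[abs_def] )?, intro pfam_data pfam_pv_data pfam_be; simp)+
qed

subsection \<open>Lowering operators\<close>

text \<open>Here \<open>u\<close> and \<open>w\<close> are the values of
  \<open>y0 + y1 \<theta>\<close> at \<open>r - 1\<close> and \<open>r - 2\<close>.\<close>

lemma lifts_down:
  fixes h0 h1 h2 :: "params \<Rightarrow> complex poly" and \<sigma> u w y2 :: "params \<Rightarrow> complex"
  assumes h: "pfam (\<lambda>c. [:c:]) h0" "pfam (\<lambda>c. [:c:]) h1" "pfam (\<lambda>c. [:c:]) h2"
    and deg: "\<And>v. degree (h0 v) \<le> 2" "\<And>v. degree (h1 v) \<le> 2" "\<And>v. degree (h2 v) \<le> 2"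
    and y: "pfam (\<lambda>c. c) \<sigma>" "pfam (\<lambda>c. c) u" "pfam (\<lambda>c. c) w" "pfam (\<lambda>c. c) y2"
    and D1: "\<And>v. \<sigma> v * poly (h2 v) (v par_r) + u v * v par_r * poly (pv be3 v) (v par_r - 1) = 0"
    and D2: "\<And>v. \<sigma> v * poly (h2 v) (v par_r - 1) + w v * (v par_r - 1) * poly (pv be3 v) (v par_r - 2) = 0"
    and D3: "\<And>v. \<sigma> v * poly (h1 v) (v par_r) + u v * v par_r * poly (pv be2 v) (v par_r - 1)
       + y2 v * v par_r * (v par_r - 1) * poly (pv be3 v) (v par_r - 2) = 0"
  shows "lifts (\<lambda>v. xi2 (v par_r)) \<sigma> (\<lambda>v. psi (- v par_r) [h0 v, h1 v, h2 v])"
proof -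
  let ?y0 = "\<lambda>v. u v - (u v - w v) * (v par_r - 1)"
  have e: "?y0 v + (u v - w v) * (v par_r - 1) = u v" "?y0 v + (u v - w v) * (v par_r - 2) = w v" for v
    by (simp_all add: algebra_simps)
  let ?Z = "\<lambda>v. op_x * thp [:?y0 v, u v - w v:] + op_x ^ 2 * thp ([:y2 v:] * [:3 - v par_r, 1:])"
  have "\<exists>P. pfam op_const P \<and> (\<forall>v. op_order (P v) \<le> 5 \<and>
    xi2 (v par_r) * P v = op_const (\<sigma> v) * psi (- v par_r) [h0 v, h1 v, h2 v] + ?Z v * SE6 v)"
    by (rule down_operator[OF h y(1) _ _ y(4) deg], unfold e)
      (intro pfam_intros y | rule D1 D2 D3)+
  then obtain P where P: "pfam op_const P" "\<And>v. op_order (P v) \<le> 5"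
    "\<And>v. xi2 (v par_r) * P v = op_const (\<sigma> v) * psi (- v par_r) [h0 v, h1 v, h2 v] + ?Z v * SE6 v" by blast
  show ?thesis
    unfolding lifts_def by (rule exI[of _ P], rule exI[of _ ?Z]) (simp only: P simp_thms)
qed

text \<open>Solving \<open>D1\<close> to \<open>D3\<close> divides by the values of
  \<open>be3\<close> at \<open>r - 1\<close> and \<open>r - 2\<close>, products of
  \<open>r + 2 - e_i\<close> and \<open>r + 1 - e_i\<close> with \<open>i = 1, 2, 3\<close>. The
  \<open>rho\<close> functions keep what the multiplier does not cancel; at \<open>swap v\<close>
  they supply the factors with exponents 5 and 6.\<close>

definition rho_c :: "params \<Rightarrow> complex" where
  "rho_c v = (v par_r + 2 - SE6_exponent v 3) * (v par_r + 1 - SE6_exponent v 3) * (v par_r + 1 - SE6_exponent v 2)"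

definition rho_g :: "params \<Rightarrow> complex" where
  "rho_g v = (v par_r + 2 - SE6_exponent v 3) * (v par_r + 1 - SE6_exponent v 3)"

definition sig_down :: "(params \<Rightarrow> complex) \<Rightarrow> params \<Rightarrow> complex" where
  "sig_down \<rho> v = v par_r * (v par_r - 1) * \<rho> v"

definition rho_p :: "params \<Rightarrow> complex" where
  "rho_p v = - (v par_p * (v par_r + 1 - SE6_exponent v 2) * (v par_r + 1 - SE6_exponent v 3))"

text \<open>The factors are \<theta> + \<open>2 - e1\<close> and \<theta> + \<open>2 - e2\<close>,
  two of the three in \<open>be3\<close> at \<theta> - 1, so that \<open>D1\<close> and
  \<open>D2\<close> leave only factors with \<open>e3\<close>.\<close>

definition hq :: "params \<Rightarrow> complex poly" where
  "hq v = [:1 - v par_p - v par_r, 1:] * [:- v par_a - v par_c - v par_p - v par_r, 1:]"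

definition F_g :: "params \<Rightarrow> complex" where
  "F_g v = (2 * v par_b + v par_g) * (v par_a + v par_c + v par_g)"

definition H_c :: "params \<Rightarrow> diffop" where
  "H_c v = psi (- v par_r) [0, [:al_c (v par_a) (v par_b) (v par_c) (v par_g) (v par_p) (v par_q):], hq v]"

definition H_g :: "params \<Rightarrow> diffop" where
  "H_g v = psi (- v par_r) [0, [:al_g (v par_a) (v par_b) (v par_c) (v par_g) (v par_p) (v par_q):], [:F_g v:] * hq v]"

lemma pfam_rho: "pfam (\<lambda>c. c) rho_c" "pfam (\<lambda>c. c) rho_g" "pfam (\<lambda>c. c) rho_p"
  "pfam (\<lambda>c. c) (sig_down rho_c)" "pfam (\<lambda>c. c) (sig_down rho_g)" "pfam (\<lambda>c. c) (sig_down rho_p)"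
  by (unfold rho_c_def[abs_def] rho_g_def[abs_def] rho_p_def[abs_def] sig_down_def[abs_def]; intro pfam_data; simp)+

lemma pfam_hq: "pfam (\<lambda>c. [:c:]) hq" "pfam (\<lambda>c. c) F_g"
  by (unfold hq_def[abs_def] F_g_def[abs_def]; intro pfam_data)+

lemma degree_hq: "degree (hq v) \<le> 2" "degree ([:F_g v:] * hq v) \<le> 2"
proof -
  show "degree (hq v) \<le> 2" unfolding hq_def by (rule order_trans[OF degree_mult_le]) simp
  then show "degree ([:F_g v:] * hq v) \<le> 2" by (rule_tac order_trans[OF degree_mult_le]) simp
qed

lemma lifts_a_down: "lifts (\<lambda>v. xi2 (v par_r)) (sig_down rho_c) N_a"
proof -
  have D1: "sig_down rho_c v * poly (pv na2 v) (v par_r) + ((v par_r - 1) * (v par_r + 1 - SE6_exponent v 3) * (v par_r + 1 - SE6_exponent v 2)) * v par_r * poly (pv be3 v) (v par_r - 1) = 0" for v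
  proof -
    define a b c g p q r where abc: "a = v par_a" "b = v par_b" "c = v par_c" "g = v par_g"
      "p = v par_p" "q = v par_q" "r = v par_r"
    show ?thesis
      unfolding sig_down_def rho_c_def poly_pv na2_def be3_def SE6_exponents abc[symmetric]
        poly_mult poly_minus poly_pCons poly_0 poly_1 by algebra
  qed
  have D2: "sig_down rho_c v * poly (pv na2 v) (v par_r - 1) + (v par_r * (v par_r + 2 - SE6_exponent v 3) * (v par_r + 1 - SE6_exponent v 2)) * (v par_r - 1) * poly (pv be3 v) (v par_r - 2) = 0" for v
  proof -
    define a b c g p q r where abc: "a = v par_a" "b = v par_b" "c = v par_c" "g = v par_g"
      "p = v par_p" "q = v par_q" "r = v par_r"
    show ?thesis
      unfolding sig_down_def rho_c_def poly_pv na2_def be3_def SE6_exponents abc[symmetric]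
        poly_mult poly_minus poly_pCons poly_0 poly_1 by algebra
  qed
  have D3: "sig_down rho_c v * poly (pv na1 v) (v par_r) + ((v par_r - 1) * (v par_r + 1 - SE6_exponent v 3) * (v par_r + 1 - SE6_exponent v 2)) * v par_r * poly (pv be2 v) (v par_r - 1)
      + za (v par_a) (v par_b) (v par_c) (v par_g) (v par_p) (v par_q) * v par_r * (v par_r - 1) * poly (pv be3 v) (v par_r - 2) = 0" for v
  proof -
    define a b c g p q r where abc: "a = v par_a" "b = v par_b" "c = v par_c" "g = v par_g"
      "p = v par_p" "q = v par_q" "r = v par_r"
    show ?thesis
      unfolding sig_down_def rho_c_def poly_pv na1_def be2_def be3_def za_def SE6_exponents abc[symmetric]
        poly_mult poly_minus poly_pCons poly_0 poly_1 by algebra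
  qed
  show ?thesis
    unfolding N_a_def[abs_def] psi2_def
    by (rule lifts_down[where ?h0.0 = "pv na0" and ?h1.0 = "pv na1" and ?h2.0 = "pv na2" and u = "\<lambda>v. ((v par_r - 1) * (v par_r + 1 - SE6_exponent v 3) * (v par_r + 1 - SE6_exponent v 2))"
        and w = "\<lambda>v. (v par_r * (v par_r + 2 - SE6_exponent v 3) * (v par_r + 1 - SE6_exponent v 2))" and ?y2.0 = "\<lambda>v. za (v par_a) (v par_b) (v par_c) (v par_g) (v par_p) (v par_q)",
        OF pfam_pv_data(10-12) degree_pv_data(10-12) _ _ _ _ D1 D2 D3])
      (rule degree_hq pfam_rho | simp; fail | (unfold za_def zc_def zg_def al_c_def al_g_def)?, (intro pfam_data pfam_hq; simp))+
qed

lemma lifts_p_down: "lifts (\<lambda>v. xi2 (v par_r)) (sig_down rho_p) M_p"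
proof -
  have D1: "sig_down rho_p v * poly (0) (v par_r) + 0 * v par_r * poly (pv be3 v) (v par_r - 1) = 0" for v
  proof -
    define a b c g p q r where abc: "a = v par_a" "b = v par_b" "c = v par_c" "g = v par_g"
      "p = v par_p" "q = v par_q" "r = v par_r"
    show ?thesis
      unfolding sig_down_def rho_p_def poly_pv be3_def SE6_exponents abc[symmetric]
        poly_mult poly_minus poly_pCons poly_0 poly_1 by algebra
  qed
  have D2: "sig_down rho_p v * poly (0) (v par_r - 1) + 0 * (v par_r - 1) * poly (pv be3 v) (v par_r - 2) = 0" for v
  proof -
    define a b c g p q r where abc: "a = v par_a" "b = v par_b" "c = v par_c" "g = v par_g"
      "p = v par_p" "q = v par_q" "r = v par_r"
    show ?thesis
      unfolding sig_down_def rho_p_def poly_pv be3_def SE6_exponents abc[symmetric]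
        poly_mult poly_minus poly_pCons poly_0 poly_1 by algebra
  qed
  have D3: "sig_down rho_p v * poly (1) (v par_r) + 0 * v par_r * poly (pv be2 v) (v par_r - 1)
      + 1 * v par_r * (v par_r - 1) * poly (pv be3 v) (v par_r - 2) = 0" for v
  proof -
    define a b c g p q r where abc: "a = v par_a" "b = v par_b" "c = v par_c" "g = v par_g"
      "p = v par_p" "q = v par_q" "r = v par_r"
    show ?thesis
      unfolding sig_down_def rho_p_def poly_pv be3_def SE6_exponents abc[symmetric]
        poly_mult poly_minus poly_pCons poly_0 poly_1 by algebra
  qed
  show ?thesis
    unfolding M_p_def[abs_def]
    by (rule lifts_down[where ?h0.0 = "\<lambda>_. 0" and ?h1.0 = "\<lambda>_. 1" and ?h2.0 = "\<lambda>_. 0" and u = "\<lambda>v. 0"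
        and w = "\<lambda>v. 0" and ?y2.0 = "\<lambda>v. 1",
        OF pfam_const pfam_const pfam_const _ _ _ _ _ _ _ D1 D2 D3])
      (rule degree_hq pfam_rho | simp; fail | (unfold za_def zc_def zg_def al_c_def al_g_def)?, (intro pfam_data pfam_hq; simp))+
qed

lemma lifts_c_down: "lifts (\<lambda>v. xi2 (v par_r)) (sig_down rho_c) H_c"
proof -
  have D1: "sig_down rho_c v * poly (hq v) (v par_r) + ((v par_r - 1) * (v par_r + 1 - SE6_exponent v 3) * (v par_r + 1 - SE6_exponent v 2)) * v par_r * poly (pv be3 v) (v par_r - 1) = 0" for v
  proof -
    define a b c g p q r where abc: "a = v par_a" "b = v par_b" "c = v par_c" "g = v par_g"
      "p = v par_p" "q = v par_q" "r = v par_r"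
    show ?thesis
      unfolding sig_down_def rho_c_def poly_pv hq_def be3_def SE6_exponents abc[symmetric]
        poly_mult poly_minus poly_pCons poly_0 poly_1 by algebra
  qed
  have D2: "sig_down rho_c v * poly (hq v) (v par_r - 1) + (v par_r * (v par_r + 2 - SE6_exponent v 3) * (v par_r + 1 - SE6_exponent v 2)) * (v par_r - 1) * poly (pv be3 v) (v par_r - 2) = 0" for v
  proof -
    define a b c g p q r where abc: "a = v par_a" "b = v par_b" "c = v par_c" "g = v par_g"
      "p = v par_p" "q = v par_q" "r = v par_r"
    show ?thesis
      unfolding sig_down_def rho_c_def poly_pv hq_def be3_def SE6_exponents abc[symmetric]
        poly_mult poly_minus poly_pCons poly_0 poly_1 by algebra
  qed
  have D3: "sig_down rho_c v * poly ([:al_c (v par_a) (v par_b) (v par_c) (v par_g) (v par_p) (v par_q):]) (v par_r) + ((v par_r - 1) * (v par_r + 1 - SE6_exponent v 3) * (v par_r + 1 - SE6_exponent v 2)) * v par_r * poly (pv be2 v) (v par_r - 1)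
      + zc (v par_a) (v par_b) (v par_c) (v par_g) (v par_p) (v par_q) * v par_r * (v par_r - 1) * poly (pv be3 v) (v par_r - 2) = 0" for v
  proof -
    define a b c g p q r where abc: "a = v par_a" "b = v par_b" "c = v par_c" "g = v par_g"
      "p = v par_p" "q = v par_q" "r = v par_r"
    show ?thesis
      unfolding sig_down_def rho_c_def poly_pv al_c_def be2_def be3_def zc_def SE6_exponents abc[symmetric]
        poly_mult poly_minus poly_pCons poly_0 poly_1 by algebra
  qed
  show ?thesis
    unfolding H_c_def[abs_def]
    by (rule lifts_down[where ?h0.0 = "\<lambda>_. 0" and ?h1.0 = "\<lambda>v. [:al_c (v par_a) (v par_b) (v par_c) (v par_g) (v par_p) (v par_q):]" and ?h2.0 = "hq" and u = "\<lambda>v. ((v par_r - 1) * (v par_r + 1 - SE6_exponent v 3) * (v par_r + 1 - SE6_exponent v 2))"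
        and w = "\<lambda>v. (v par_r * (v par_r + 2 - SE6_exponent v 3) * (v par_r + 1 - SE6_exponent v 2))" and ?y2.0 = "\<lambda>v. zc (v par_a) (v par_b) (v par_c) (v par_g) (v par_p) (v par_q)",
        OF pfam_const _ pfam_hq(1) _ _ degree_hq(1) _ _ _ _ D1 D2 D3])
      (rule degree_hq pfam_rho | simp; fail | (unfold za_def zc_def zg_def al_c_def al_g_def)?, (intro pfam_data pfam_hq; simp))+
qed

lemma lifts_g_down: "lifts (\<lambda>v. xi2 (v par_r)) (sig_down rho_g) H_g"
proof -
  have D1: "sig_down rho_g v * poly ([:F_g v:] * hq v) (v par_r) + ((v par_r - 1) * (v par_r + 1 - SE6_exponent v 3) * F_g v) * v par_r * poly (pv be3 v) (v par_r - 1) = 0" for v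
  proof -
    define a b c g p q r where abc: "a = v par_a" "b = v par_b" "c = v par_c" "g = v par_g"
      "p = v par_p" "q = v par_q" "r = v par_r"
    show ?thesis
      unfolding sig_down_def rho_g_def poly_pv F_g_def hq_def be3_def SE6_exponents abc[symmetric]
        poly_mult poly_minus poly_pCons poly_0 poly_1 by algebra
  qed
  have D2: "sig_down rho_g v * poly ([:F_g v:] * hq v) (v par_r - 1) + (v par_r * (v par_r + 2 - SE6_exponent v 3) * F_g v) * (v par_r - 1) * poly (pv be3 v) (v par_r - 2) = 0" for v
  proof -
    define a b c g p q r where abc: "a = v par_a" "b = v par_b" "c = v par_c" "g = v par_g"
      "p = v par_p" "q = v par_q" "r = v par_r"
    show ?thesis
      unfolding sig_down_def rho_g_def poly_pv F_g_def hq_def be3_def SE6_exponents abc[symmetric]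
        poly_mult poly_minus poly_pCons poly_0 poly_1 by algebra
  qed
  have D3: "sig_down rho_g v * poly ([:al_g (v par_a) (v par_b) (v par_c) (v par_g) (v par_p) (v par_q):]) (v par_r) + ((v par_r - 1) * (v par_r + 1 - SE6_exponent v 3) * F_g v) * v par_r * poly (pv be2 v) (v par_r - 1)
      + zg (v par_a) (v par_b) (v par_c) (v par_g) (v par_p) (v par_q) * v par_r * (v par_r - 1) * poly (pv be3 v) (v par_r - 2) = 0" for v
  proof -
    define a b c g p q r where abc: "a = v par_a" "b = v par_b" "c = v par_c" "g = v par_g"
      "p = v par_p" "q = v par_q" "r = v par_r"
    show ?thesis
      unfolding sig_down_def rho_g_def poly_pv F_g_def al_g_def be2_def be3_def zg_def SE6_exponents abc[symmetric]
        poly_mult poly_minus poly_pCons poly_0 poly_1 by algebra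
  qed
  show ?thesis
    unfolding H_g_def[abs_def]
    by (rule lifts_down[where ?h0.0 = "\<lambda>_. 0" and ?h1.0 = "\<lambda>v. [:al_g (v par_a) (v par_b) (v par_c) (v par_g) (v par_p) (v par_q):]" and ?h2.0 = "\<lambda>v. [:F_g v:] * hq v" and u = "\<lambda>v. ((v par_r - 1) * (v par_r + 1 - SE6_exponent v 3) * F_g v)"
        and w = "\<lambda>v. (v par_r * (v par_r + 2 - SE6_exponent v 3) * F_g v)" and ?y2.0 = "\<lambda>v. zg (v par_a) (v par_b) (v par_c) (v par_g) (v par_p) (v par_q)",
        OF pfam_const _ _ _ _ degree_hq(2) _ _ _ _ D1 D2 D3])
      (rule degree_hq pfam_rho | simp; fail | (unfold za_def zc_def zg_def al_c_def al_g_def)?, (intro pfam_data pfam_hq; simp))+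
qed

subsection \<open>Lowering operators for \<open>c\<close> and \<open>g\<close>\<close>

text \<open>The lowering operator is the sum of an operator that
  \<open>xi2\<close> reduces, the reflection of another such operator, and a correction of order \<open>2\<close>.\<close>

lemma lifts_split:
  assumes P0: "lifts (\<lambda>v. xi2 (v par_r)) (sig_down \<rho>) H" and \<rho>: "pfam (\<lambda>c. c) \<rho>"
    and Pp: "pfam op_const Pp" "\<And>v. op_order (Pp v) \<le> 5"
    and N: "\<And>v. eta2 (v par_r - 2) * H v + xi2 (v par_r - 2) * oflip (H (swap v))
      + eta2 (v par_r - 2) * xi2 (v par_r) * Pp v = N v"
  shows "lifts (\<lambda>v. eta2 (v par_r - 2) * xi2 (v par_r)) (\<lambda>v. sig_down \<rho> v * \<rho> (swap v)) N"
proof -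
  obtain P Z where P: "pfam op_const P" "\<And>v. op_order (P v) \<le> 5"
    and XP: "\<And>v. xi2 (v par_r) * P v = op_const (sig_down \<rho> v) * H v + Z v * SE6 v"
    using P0 unfolding lifts_def by blast
  \<comment> \<open>\<open>swap\<close> fixes \<open>r\<close>, so this scalar is symmetric under
    the reflection, and the operator and its reflected partner receive the same factor.\<close>
  define k where "k v = sig_down \<rho> v * \<rho> (swap v)" for v
  define Q where "Q v = op_const (\<rho> (swap v)) * P v + op_const (\<rho> v) * oflip (P (swap v)) + op_const (k v) * Pp v" for v
  define Y where "Y v = op_const (\<rho> (swap v)) * (eta2 (v par_r - 2) * Z v)
      + op_const (\<rho> v) * (xi2 (v par_r - 2) * oflip (Z (swap v)))" for v
  have cc: "op_const x * (op_const y * A) = op_const (x * y) * A" for x y A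
    by (simp only: op_const_simps(2) mult.assoc)
  have k: "op_const (\<rho> (swap v)) * (op_const (sig_down \<rho> v) * A) = op_const (k v) * A"
    "op_const (\<rho> v) * (op_const (sig_down \<rho> (swap v)) * A) = op_const (k v) * A" for v A
    unfolding cc by (simp_all add: k_def sig_down_def mult.commute mult.left_commute)
  have "pfam (\<lambda>c. c) k"
    unfolding k_def[abs_def] sig_down_def by (intro pfam_intros \<rho> pfam_swap ring_emb_id)
  then have "pfam op_const Q"
    unfolding Q_def[abs_def]
    by (intro pfam_add pfam_mult pfam_emb[OF _ ring_emb_op_const] \<rho> pfam_swap pfam_oflip P Pp ring_emb_id ring_emb_op_const)
  moreover have "op_order (Q v) \<le> 5" for v
  proof -
    have "op_order (oflip (P (swap v))) \<le> 5" using op_order_oflip P(2) by (meson order_trans)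
    then have "op_order (op_const (\<rho> (swap v)) * P v) \<le> 0 + 5" "op_order (op_const (\<rho> v) * oflip (P (swap v))) \<le> 0 + 5"
      "op_order (op_const (k v) * Pp v) \<le> 0 + 5"
      using P(2) Pp(2) by (intro op_order_mult_le; simp)+
    then show ?thesis unfolding Q_def by (intro op_order_add_le) simp_all
  qed
  moreover have "eta2 (v par_r - 2) * xi2 (v par_r) * Q v = op_const (k v) * N v + Y v * SE6 v" for v
  proof -
    define B X where "B = eta2 (v par_r - 2)" and "X = xi2 (v par_r - 2)"
    have "eta2 (v par_r) * oflip (P (swap v)) = oflip (xi2 (swap v par_r) * P (swap v))"
      by (simp add: eta2_def oflip_mult)
    then have e: "eta2 (v par_r) * oflip (P (swap v))
        = op_const (sig_down \<rho> (swap v)) * oflip (H (swap v)) + oflip (Z (swap v)) * SE6 v"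
      unfolding XP by (simp add: oflip_add oflip_mult oflip_op_const SE6_flip)
    have "B * xi2 (v par_r) * Q v = op_const (\<rho> (swap v)) * (B * (xi2 (v par_r) * P v))
        + op_const (\<rho> v) * (B * xi2 (v par_r) * oflip (P (swap v))) + op_const (k v) * (B * xi2 (v par_r) * Pp v)"
      unfolding Q_def distrib_left op_const_left_commute[of "B * xi2 (v par_r)"] by (simp only: mult.assoc)
    \<comment> \<open>\<open>eta2\<close> and \<open>xi2\<close> commute up to the shift of
      \<open>r\<close>, so the reflected partner meets the operator that reduces it.\<close>
    also have "B * xi2 (v par_r) * oflip (P (swap v)) = X * (eta2 (v par_r) * oflip (P (swap v)))"
      unfolding B_def X_def xi2_eta2[symmetric] by (simp only: mult.assoc)
    finally have "B * xi2 (v par_r) * Q v = op_const (k v) * (B * H v + X * oflip (H (swap v)) + B * xi2 (v par_r) * Pp v)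
        + Y v * SE6 v"
      unfolding XP e distrib_left op_const_left_commute[of B] op_const_left_commute[of X] k Y_def
        B_def[symmetric] X_def[symmetric] distrib_right
      by (simp only: mult.assoc add_ac)
    then show ?thesis unfolding N[of v, symmetric] B_def X_def .
  qed
  ultimately show ?thesis
    unfolding lifts_def k_def[abs_def] by blast
qed

lemma lifts_uminus: "lifts A \<sigma> M \<Longrightarrow> lifts A (\<lambda>v. - \<sigma> v) M"
proof -
  assume "lifts A \<sigma> M"
  then obtain P Z where P: "pfam op_const P" "\<And>v. op_order (P v) \<le> 5" "\<And>v. A v * P v = op_const (\<sigma> v) * M v + Z v * SE6 v"
    unfolding lifts_def by blast
  have n: "op_const (- c) = - op_const c" for c by (rule op_const_simps(3))
  have "op_order (- P v) = op_order (P v)" for v by (simp add: op_order_def uminus_diffop.rep_eq)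
  then show ?thesis
    unfolding lifts_def using P
    by (intro exI[of _ "\<lambda>v. - P v"] exI[of _ "\<lambda>v. - Z v"]) (auto simp: n intro: pfam_uminus)
qed

text \<open>At the point \<open>x + r\<close> the parameter \<open>r\<close> cancels in the linear
  factors, which makes the identities to be checked smaller.\<close>

lemma poly_ext_shift: "(\<And>x. poly p (x + r) = poly q (x + r)) \<Longrightarrow> p = (q :: complex poly)"
  by (rule complex_poly_ext) (metis diff_add_cancel)

lemma psi_5: "psi s [h0, h1, h2, h3, h4] = lop [[:s, 1:] * [:s + 1, 1:] * [:s + 2, 1:] * [:s + 3, 1:] * h0,
    [:s + 1, 1:] * [:s + 2, 1:] * [:s + 3, 1:] * h1, [:s + 2, 1:] * [:s + 3, 1:] * h2, [:s + 3, 1:] * h3, h4]"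
  by (simp add: psi_def mult.assoc add.assoc del: mult_pCons_left mult_pCons_right)

lemma split_terms:
  shows "eta2 (r - 2) * psi (- r) [0, [:\<alpha>:], h] = lop [0,
      [:1 - r, 1:] * [:2 - r, 1:] * [:3 - r, 1:] * [:\<alpha>:],
      [:2 - r, 1:] * [:3 - r, 1:] * (h - [:2:] * [:\<alpha>:]), [:3 - r, 1:] * ([:\<alpha>:] - [:2:] * shp h), shp (shp h)]"
    and "xi2 (r - 2) * oflip (psi (- r) [0, [:\<alpha>:], [:F:] * ([:c, 1:] * [:d, 1:])]) = lop [0,
      - ([:2 - r, 1:] * [:3 - r, 1:] * [:1 - r, 1:] * [:\<alpha>:]),
      [:2 - r, 1:] * [:3 - r, 1:] * ([:\<alpha>:] + [:F:] * [:c, 1:] * [:d, 1:]),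
      - ([:2 - r, 1:] * [:3 - r, 1:] * [:F:] * [:c + d + 1, 2:]), [:2 - r, 1:] * [:3 - r, 1:] * [:F:]]"
    and "eta2 (r - 2) * xi2 r * lop [p0, p1, p2] = lop [
      [:- r, 1:] * [:1 - r, 1:] * [:2 - r, 1:] * [:3 - r, 1:] * p0,
      [:- r, 1:] * [:1 - r, 1:] * [:2 - r, 1:] * [:3 - r, 1:] * p1 - [:2:] * [:1 - r, 1:] * [:2 - r, 1:] * [:3 - r, 1:] * shp p0,
      [:- r, 1:] * [:1 - r, 1:] * [:2 - r, 1:] * [:3 - r, 1:] * p2 - [:2:] * [:1 - r, 1:] * [:2 - r, 1:] * [:3 - r, 1:] * shp p1
        + [:2 - r, 1:] * [:3 - r, 1:] * shp (shp p0),
      - [:2:] * [:1 - r, 1:] * [:2 - r, 1:] * [:3 - r, 1:] * shp p2 + [:2 - r, 1:] * [:3 - r, 1:] * shp (shp p1),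
      [:2 - r, 1:] * [:3 - r, 1:] * shp (shp p2)]"
proof -
  have "eta2 (r - 2) * psi (- r) [0, [:\<alpha>:], h] = psi (- r) (lmult [1, - 2, 1] [0, [:\<alpha>:], h])"
    using psi_mult[of "[1, - 2, 1]" "[0, [:\<alpha>:], h]" "- r"] by (simp add: eta2_psi)
  also have "lmult [1, - 2, 1] [0, [:\<alpha>:], h] = [0, [:\<alpha>:], h - [:2:] * [:\<alpha>:], [:\<alpha>:] - [:2:] * shp h, shp (shp h)]"
    unfolding lmult.simps ladd.simps list.map list.inject by (intro conjI refl; rule complex_poly_ext; simp)
  finally show "eta2 (r - 2) * psi (- r) [0, [:\<alpha>:], h] = lop [0,
      [:1 - r, 1:] * [:2 - r, 1:] * [:3 - r, 1:] * [:\<alpha>:],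
      [:2 - r, 1:] * [:3 - r, 1:] * (h - [:2:] * [:\<alpha>:]), [:3 - r, 1:] * ([:\<alpha>:] - [:2:] * shp h), shp (shp h)]"
    unfolding psi_5 by (simp add: add.commute del: mult_pCons_left mult_pCons_right)
next
  have xi: "xi2 (r - 2) = thp ([:3 - r, 1:] * [:2 - r, 1:])"
    by (simp add: xi2_def xi_thp flip: thp_mult del: mult_pCons_left mult_pCons_right)
  have m: "lop X * op_d = lop (0 # X)" for X by simp
  have fl: "oflip (psi (- r) [0, [:\<alpha>:], [:F:] * ([:c, 1:] * [:d, 1:])])
      = lop (ladd (0 # map uminus (lmult (flin (1 - r)) [[:\<alpha>:]])) (0 # 0 # lmult [[:F:]] (lmult (flin c) (flin d))))"
    unfolding psi_3 lop_ladd m[symmetric] lop_map_uminus lop_lmult lop_const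
      thp_mult oflip_linear[symmetric]
    by (simp add: thp_mult thp_const oflip_add oflip_mult oflip_mult_d oflip_op_const oflip_d add.commute
        mult.assoc distrib_right del: mult_pCons_left mult_pCons_right)
  show "xi2 (r - 2) * oflip (psi (- r) [0, [:\<alpha>:], [:F:] * ([:c, 1:] * [:d, 1:])]) = lop [0,
      - ([:2 - r, 1:] * [:3 - r, 1:] * [:1 - r, 1:] * [:\<alpha>:]),
      [:2 - r, 1:] * [:3 - r, 1:] * ([:\<alpha>:] + [:F:] * [:c, 1:] * [:d, 1:]),
      - ([:2 - r, 1:] * [:3 - r, 1:] * [:F:] * [:c + d + 1, 2:]), [:2 - r, 1:] * [:3 - r, 1:] * [:F:]]"
    unfolding fl xi lop_map_mult[symmetric]
    apply (rule arg_cong[where f = lop], unfold flin_def lmult.simps ladd.simps list.map list.inject, intro conjI refl;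
      rule complex_poly_ext; unfold poly_eval)
    subgoal by algebra
    subgoal by algebra
    subgoal by algebra
    subgoal by algebra
    subgoal by algebra
    done
next
  show "eta2 (r - 2) * xi2 r * lop [p0, p1, p2] = lop [
      [:- r, 1:] * [:1 - r, 1:] * [:2 - r, 1:] * [:3 - r, 1:] * p0,
      [:- r, 1:] * [:1 - r, 1:] * [:2 - r, 1:] * [:3 - r, 1:] * p1 - [:2:] * [:1 - r, 1:] * [:2 - r, 1:] * [:3 - r, 1:] * shp p0,
      [:- r, 1:] * [:1 - r, 1:] * [:2 - r, 1:] * [:3 - r, 1:] * p2 - [:2:] * [:1 - r, 1:] * [:2 - r, 1:] * [:3 - r, 1:] * shp p1
        + [:2 - r, 1:] * [:3 - r, 1:] * shp (shp p0),
      - [:2:] * [:1 - r, 1:] * [:2 - r, 1:] * [:3 - r, 1:] * shp p2 + [:2 - r, 1:] * [:3 - r, 1:] * shp (shp p1),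
      [:2 - r, 1:] * [:3 - r, 1:] * shp (shp p2)]"
    (is "_ = lop ?R")
  proof -
    have p2: "poly 2 t = (2 :: complex)" for t by simp
    have "eta2 (r - 2) * xi2 r * lop [p0, p1, p2] = lop (?R @ [0, 0])"
      unfolding eta2_xi2 psi_5 lop_lmult[symmetric]
      apply (rule arg_cong[where f = lop], unfold lmult.simps ladd.simps list.map append.simps list.inject, intro conjI refl;
        rule complex_poly_ext; unfold poly_eval p2)
      subgoal by algebra
      subgoal by algebra
      subgoal by algebra
      subgoal by algebra
      subgoal by algebra
      subgoal by algebra
      subgoal by algebra
      done
    then show ?thesis by simp
  qed
qed

text \<open>The product of \<open>eta2\<close> and \<open>xi2\<close> lowers \<open>r\<close> by 4,
  but \<open>N_c\<close> only by 2, so the multiplier is \<open>op_d ^ 2 * N_c\<close>. The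
  correction \<open>lop [0, 0, - 1]\<close> is - \<partial>^2.\<close>

lemma split_c: "eta2 (v par_r - 2) * H_c v + xi2 (v par_r - 2) * oflip (H_c (swap v))
    + eta2 (v par_r - 2) * xi2 (v par_r) * lop [0, 0, - 1] = op_d ^ 2 * N_c v"
proof -
  define a b c g p q r where abc: "a = v par_a" "b = v par_b" "c = v par_c" "g = v par_g"
    "p = v par_p" "q = v par_q" "r = v par_r"
  have 1: "H_c (swap v) = psi (- r) [0, [:al_c b a c g q p:], [:1:] * ([:1 - q - r, 1:] * [:- b - c - q - r, 1:])]"
    by (simp add: H_c_def hq_def abc one_pCons[symmetric] del: mult_pCons_left mult_pCons_right)
  show ?thesis
    unfolding 1 unfolding H_c_def N_c_def psi2_def abc[symmetric] split_terms unfolding psi_3 op_d2_lop lop_ladd[symmetric]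
    apply (rule arg_cong[where f = lop], unfold ladd.simps list.map list.inject, intro conjI refl;
      rule poly_ext_shift[where r = r];
      unfold poly_eval poly_pv nc0_def nc1_def nc2_def al_c_def hq_def abc[symmetric])
    subgoal by algebra
    subgoal by algebra
    subgoal by algebra
    subgoal by algebra
    subgoal by algebra
    done
qed

text \<open>In \<open>split_terms\<close> only the third summand has a coefficient at \<partial>^0,
  which forces the entry \<open>pv ng0 v\<close>; the other two come from comparing higher
  coefficients.\<close>

definition P_g :: "params \<Rightarrow> diffop" where
  "P_g v = lop [pv ng0 v,
     pcompose [:be_g (v par_a) (v par_b) (v par_c) (v par_g) (v par_p) (v par_q),
       - ((2 * v par_b + v par_g) * (2 * v par_c + v par_g)):] [:- v par_r - v par_p, 1:],
     [:- ((2 * v par_a + v par_g) * (v par_b + v par_c + v par_g)):]]"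

lemma split_g: "eta2 (v par_r - 2) * H_g v + xi2 (v par_r - 2) * oflip (H_g (swap v))
    + eta2 (v par_r - 2) * xi2 (v par_r) * P_g v = N_g v"
proof -
  define a b c g p q r where abc: "a = v par_a" "b = v par_b" "c = v par_c" "g = v par_g"
    "p = v par_p" "q = v par_q" "r = v par_r"
  have 1: "H_g (swap v) = psi (- r) [0, [:al_g b a c g q p:],
      [:(2 * a + g) * (b + c + g):] * ([:1 - q - r, 1:] * [:- b - c - q - r, 1:])]"
    by (simp add: H_g_def hq_def F_g_def abc del: mult_pCons_left mult_pCons_right)
  show ?thesis
    unfolding 1 unfolding H_g_def N_g_def P_g_def abc[symmetric] split_terms psi_5 lop_ladd[symmetric]
    apply (rule arg_cong[where f = lop], unfold ladd.simps list.map list.inject, intro conjI refl;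
      rule poly_ext_shift[where r = r];
      unfold poly_eval poly_pcompose poly_pv ng0_def ng1_def ng2_def ng3_def ng4_def al_g_def be_g_def hq_def F_g_def abc[symmetric])
    subgoal by algebra
    subgoal by algebra
    subgoal by algebra
    subgoal by algebra
    subgoal by algebra
    done
qed

lemma lifts_c_split: "lifts (\<lambda>v. eta2 (v par_r - 2) * xi2 (v par_r)) (\<lambda>v. sig_down rho_c v * rho_c (swap v))
    (\<lambda>v. op_d ^ 2 * N_c v)"
proof (rule lifts_split[OF lifts_c_down pfam_rho(1) _ _ split_c])
  show "op_order (lop [0, 0, - 1]) \<le> 5" by (rule lop_order_le) (auto simp: less_Suc_eq numeral_3_eq_3)
qed (rule pfam_const)

text \<open>The minus sign offsets that of \<open>kap_g\<close>, giving the S-value of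
  \<open>g\<close> its positive sign.\<close>

lemma lifts_g_split: "lifts (\<lambda>v. eta2 (v par_r - 2) * xi2 (v par_r)) (\<lambda>v. - (sig_down rho_g v * rho_g (swap v))) N_g"
proof (rule lifts_uminus, rule lifts_split[OF lifts_g_down pfam_rho(2) _ _ split_g])
  show "pfam op_const P_g"
    unfolding P_g_def[abs_def] lop.simps be_g_def
    by (intro pfam_add pfam_mult pfam_const pfam_thp pfam_pv_data pfam_data)
  fix v
  have "degree (pv ng0 v) \<le> 2" by (rule degree_pv, unfold ng0_def, rule degree_quadratic)
  moreover have "degree (pcompose [:x, y:] [:z, 1:]) \<le> 4" for x y z :: complex
    by (rule order_trans[OF degree_pcompose_le]) simp
  ultimately show "op_order (P_g v) \<le> 5"
    unfolding P_g_def by (intro lop_order_le) (auto simp: less_Suc_eq numeral_3_eq_3 intro: order_trans)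
qed

section \<open>Pairing raising and lowering operators\<close>

lemma hom_pair_a: "\<exists>Pu Pd. hom_pair par_a Pu Pd
  (\<lambda>v. sig_a (shift_down par_a v) * sig_down rho_c v * kap_a (v par_a) (v par_b) (v par_c) (v par_g))"
proof -
  obtain Pu Zu where Pu: "pfam op_const Pu" "\<And>v. op_order (Pu v) \<le> 5"
    "\<And>v. op_d ^ 2 * Pu v = op_const (sig_a v) * M_a v + Zu v * SE6 v"
    using lifts_a_up unfolding lifts_def by blast
  obtain Pd Zd where Pd: "pfam op_const Pd" "\<And>v. op_order (Pd v) \<le> 5"
    "\<And>v. xi2 (v par_r) * Pd v = op_const (sig_down rho_c v) * N_a v + Zd v * SE6 v"
    using lifts_a_down unfolding lifts_def by blast
  have "hom_pair par_a Pu Pd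
    (\<lambda>v. sig_a (shift_down par_a v) * sig_down rho_c v * kap_a (v par_a) (v par_b) (v par_c) (v par_g))"
  proof (rule hom_pair_xi[OF Pu Pd])
    fix v
    show "SE6 ((shift_up par_a v)(par_r := v par_r - 2)) * M_a v \<in> left_ideal (SE6 v)"
      using M_a_hom[of v] by (simp add: shift_up_def)
    have e: "(shift_down par_a v)(par_p := shift_down par_a v par_p + 2, par_r := v par_r - 2)
        = v(par_a := v par_a - 1, par_p := v par_p + 2, par_r := v par_r - 2)"
      by (simp add: shift_down_def)
    show "SE6 ((shift_down par_a v)(par_p := shift_down par_a v par_p + 2, par_r := v par_r - 2)) * N_a v
        \<in> left_ideal (SE6 v)"
      unfolding e by (rule N_a_hom)
    show "xi2 (v par_r - 2) * M_a v = M_a (v(par_p := v par_p + 2, par_r := v par_r - 2)) * xi2 (v par_r)"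
      unfolding M_a_def by (rule psi2_xi2[symmetric])
    show "M_a ((shift_down par_a v)(par_p := shift_down par_a v par_p + 2, par_r := v par_r - 2)) * N_a v
        - op_const (kap_a (v par_a) (v par_b) (v par_c) (v par_g)) * (xi2 (v par_r - 2) * op_d ^ 2) \<in> left_ideal (SE6 v)"
      unfolding e by (rule M_a_N_a)
  qed simp_all
  then show ?thesis by blast
qed

lemma M_p_eq: "M_p v = op_d * xi (v par_r)"
proof -
  have "psi (- v par_r + 1) [0, 1] * psi (- v par_r) [1, 0] = M_p v"
    using psi_mult[of "[0, 1]" "[1, 0]" "- v par_r"] by (simp add: M_p_def)
  moreover have "psi (- v par_r) [1, 0] = xi (v par_r)" by (simp add: psi_Cons xi_thp)
  ultimately show ?thesis by (simp add: op_d_psi2(1)[symmetric])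
qed

lemma M_p_hom: "SE6 (v(par_p := v par_p + 1, par_r := v par_r - 2)) * M_p v \<in> left_ideal (SE6 v)"
proof -
  let ?w = "v(par_p := v par_p + 1, par_r := v par_r - 1)"
  have "SE6 (v(par_p := v par_p + 1, par_r := v par_r - 2)) * op_d = op_d * SE6 ?w"
    using SE6_op_d[of ?w] by simp
  then have "SE6 (v(par_p := v par_p + 1, par_r := v par_r - 2)) * M_p v = op_d * (SE6 ?w * xi (v par_r))"
    by (simp add: M_p_eq flip: mult.assoc)
  then show ?thesis
    unfolding SE6_xi[symmetric] by (simp flip: mult.assoc)
qed

lemma hom_pair_p: "\<exists>Pu Pd. hom_pair par_p Pu Pd (\<lambda>v. sig_p (shift_down par_p v) * sig_down rho_p v)"
proof -
  obtain Pu Zu where Pu: "pfam op_const Pu" "\<And>v. op_order (Pu v) \<le> 5"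
    "\<And>v. op_d ^ 2 * Pu v = op_const (sig_p v) * M_p v + Zu v * SE6 v"
    using lifts_p_up unfolding lifts_def by blast
  obtain Pd Zd where Pd: "pfam op_const Pd" "\<And>v. op_order (Pd v) \<le> 5"
    "\<And>v. xi2 (v par_r) * Pd v = op_const (sig_down rho_p v) * M_p v + Zd v * SE6 v"
    using lifts_p_down unfolding lifts_def by blast
  have "hom_pair par_p Pu Pd (\<lambda>v. sig_p (shift_down par_p v) * sig_down rho_p v)"
  proof (rule hom_pair_xi[OF Pu Pd, where \<kappa> = "\<lambda>_. 1"])
    fix v
    show "SE6 ((shift_up par_p v)(par_r := v par_r - 2)) * M_p v \<in> left_ideal (SE6 v)"
      using M_p_hom[of v] by (simp add: shift_up_def)
    have e: "(shift_down par_p v)(par_p := shift_down par_p v par_p + 2, par_r := v par_r - 2)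
        = v(par_p := v par_p + 1, par_r := v par_r - 2)"
      by (auto simp: shift_down_def)
    show "SE6 ((shift_down par_p v)(par_p := shift_down par_p v par_p + 2, par_r := v par_r - 2)) * M_p v
        \<in> left_ideal (SE6 v)"
      unfolding e by (rule M_p_hom)
    show "xi2 (v par_r - 2) * M_p v = M_p (v(par_p := v par_p + 2, par_r := v par_r - 2)) * xi2 (v par_r)"
      unfolding M_p_def using psi_xi2[of "v par_r" 0 1 0] by simp
    \<comment> \<open>An exact equality, with no multiple of \<open>SE6\<close>, which accounts for
      \<kappa> = 1.\<close>
    have "M_p (v(par_p := v par_p + 1, par_r := v par_r - 2)) * M_p v = xi2 (v par_r - 2) * op_d ^ 2"
      unfolding M_p_def xi2_d2 using psi_mult[of "[0, 1, 0]" "[0, 1, 0]" "- v par_r"] by simp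
    then show "M_p ((shift_down par_p v)(par_p := shift_down par_p v par_p + 2, par_r := v par_r - 2)) * M_p v
        - op_const 1 * (xi2 (v par_r - 2) * op_d ^ 2) \<in> left_ideal (SE6 v)"
      unfolding e by (simp add: op_const_simps left_ideal_iff exI[of _ 0])
  qed simp_all
  then show ?thesis by blast
qed

lemma commute_d2:
  fixes d :: "'a::monoid_mult"
  shows "A * d = d * B \<Longrightarrow> B * d = d * C \<Longrightarrow> A * d ^ 2 = d ^ 2 * C"
  by (metis mult.assoc power2_eq_square)

lemma commute_mult:
  fixes d :: "'a::monoid_mult"
  shows "A * d = d * B \<Longrightarrow> A' * d = d * B' \<Longrightarrow> A * A' * d = d * (B * B')"
  by (metis mult.assoc)

lemma hom_pair_c: "\<exists>Pu Pd. hom_pair par_c Pu Pd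
  (\<lambda>v. sig_c (shift_down par_c v) * (sig_down rho_c v * rho_c (swap v)) * kap_c (v par_a) (v par_b) (v par_c) (v par_g))"
proof -
  obtain Pu Zu where Pu: "pfam op_const Pu" "\<And>v. op_order (Pu v) \<le> 5"
    "\<And>v. op_d ^ 2 * Pu v = op_const (sig_c v) * M_c v + Zu v * SE6 v"
    using lifts_c_up unfolding lifts_def by blast
  obtain Pd Zd where Pd: "pfam op_const Pd" "\<And>v. op_order (Pd v) \<le> 5"
    "\<And>v. eta2 (v par_r - 2) * xi2 (v par_r) * Pd v
      = op_const (sig_down rho_c v * rho_c (swap v)) * (op_d ^ 2 * N_c v) + Zd v * SE6 v"
    using lifts_c_split unfolding lifts_def by blast
  have "hom_pair par_c Pu Pd
    (\<lambda>v. sig_c (shift_down par_c v) * (sig_down rho_c v * rho_c (swap v)) * kap_c (v par_a) (v par_b) (v par_c) (v par_g))"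
  proof (rule hom_pair_eta_xi[OF Pu Pd])
    fix v
    define k where "k = kap_c (v par_a) (v par_b) (v par_c) (v par_g)"
    define r where "r = v par_r"
    let ?w = "v(par_c := v par_c - 1, par_p := v par_p + 2, par_q := v par_q + 2, par_r := r - 2)"
    let ?w' = "v(par_c := v par_c - 1, par_p := v par_p + 2, par_q := v par_q + 2, par_r := r - 4)"
    show "SE6 ((shift_up par_c v)(par_r := v par_r - 2)) * M_c v \<in> left_ideal (SE6 v)"
      using M_c_hom[of v] by (simp add: shift_up_def)
    have e: "(shift_down par_c v)(par_p := v par_p + 2, par_q := v par_q + 2, par_r := v par_r - 4) = ?w'"
      by (simp add: shift_down_def r_def)
    have "SE6 ?w' * op_d ^ 2 = op_d ^ 2 * SE6 ?w"
      by (rule commute_d2[where B = "SE6 (?w(par_r := r - 3))"])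
        (use SE6_op_d[of ?w] SE6_op_d[of "?w(par_r := r - 3)"] in simp_all)
    then have "SE6 ?w' * (op_d ^ 2 * N_c v) = op_d ^ 2 * (SE6 ?w * N_c v)"
      by (simp flip: mult.assoc)
    then show "SE6 ((shift_down par_c v)(par_p := v par_p + 2, par_q := v par_q + 2, par_r := v par_r - 4)) * (op_d ^ 2 * N_c v)
        \<in> left_ideal (SE6 v)"
      unfolding e using left_ideal_mult[OF N_c_hom[of v], of "op_d ^ 2"] by (simp add: r_def)
    show "xi2 (v par_r - 2) * M_c v = M_c (v(par_p := v par_p + 2, par_r := v par_r - 2)) * xi2 (v par_r)"
      unfolding M_c_def by (rule psi2_xi2[symmetric])
    show "eta2 (v par_r - 2) * M_c v = M_c (v(par_q := v par_q + 2, par_r := v par_r - 2)) * eta2 (v par_r)"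
      by (rule M_c_eta2[symmetric])
    have "M_c ?w' * op_d ^ 2 = op_d ^ 2 * M_c ?w"
      using op_d2_psi2[of ?w mc0 mc1 mc2] unfolding M_c_def by simp
    \<comment> \<open>\<partial>^2 is moved to the front, since \<open>M_c_N_c\<close> concerns the
      multiplier at \<open>r - 2\<close> and not at \<open>r - 4\<close>.\<close>
    then have 1: "M_c ?w' * (op_d ^ 2 * N_c v) = op_d ^ 2 * (M_c ?w * N_c v)"
      by (simp flip: mult.assoc)
    have 2: "eta2 (r - 4) * xi2 (r - 2) * op_d ^ 2 = op_d ^ 2 * (eta2 (r - 2) * xi2 r)"
      by (rule commute_d2[where B = "eta2 (r - 3) * xi2 (r - 1)"]; rule commute_mult)
        (use eta2_shift[of "r - 3"] eta2_shift[of "r - 2"] xi2_shift[of "r - 1"] xi2_shift[of r] in simp_all)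
    have "op_d ^ 2 * (M_c ?w * N_c v - op_const k * (eta2 (r - 2) * xi2 r)) \<in> left_ideal (SE6 v)"
      unfolding k_def r_def by (rule left_ideal_mult[OF M_c_N_c])
    then show "M_c ((shift_down par_c v)(par_p := v par_p + 2, par_q := v par_q + 2, par_r := v par_r - 4)) * (op_d ^ 2 * N_c v)
        - op_const (kap_c (v par_a) (v par_b) (v par_c) (v par_g)) * (eta2 (v par_r - 4) * xi2 (v par_r - 2) * op_d ^ 2)
        \<in> left_ideal (SE6 v)"
      unfolding e unfolding k_def[symmetric] r_def[symmetric] 1 2 right_diff_distrib op_const_left_commute[of "op_d ^ 2"] .
  qed simp_all
  then show ?thesis by blast
qed

lemma hom_pair_g: "\<exists>Pu Pd. hom_pair par_g Pu Pd
  (\<lambda>v. sig_g (shift_down par_g v) * - (sig_down rho_g v * rho_g (swap v)) * kap_g (v par_a) (v par_b) (v par_c) (v par_g))"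
proof -
  obtain Pu Zu where Pu: "pfam op_const Pu" "\<And>v. op_order (Pu v) \<le> 5"
    "\<And>v. op_d ^ 2 * Pu v = op_const (sig_g v) * M_g v + Zu v * SE6 v"
    using lifts_g_up unfolding lifts_def by blast
  obtain Pd Zd where Pd: "pfam op_const Pd" "\<And>v. op_order (Pd v) \<le> 5"
    "\<And>v. eta2 (v par_r - 2) * xi2 (v par_r) * Pd v
      = op_const (- (sig_down rho_g v * rho_g (swap v))) * N_g v + Zd v * SE6 v"
    using lifts_g_split unfolding lifts_def by blast
  have "hom_pair par_g Pu Pd
    (\<lambda>v. sig_g (shift_down par_g v) * - (sig_down rho_g v * rho_g (swap v)) * kap_g (v par_a) (v par_b) (v par_c) (v par_g))"
  proof (rule hom_pair_eta_xi[OF Pu Pd])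
    fix v
    show "SE6 ((shift_up par_g v)(par_r := v par_r - 2)) * M_g v \<in> left_ideal (SE6 v)"
      using M_g_hom[of v] by (simp add: shift_up_def)
    have e: "(shift_down par_g v)(par_p := v par_p + 2, par_q := v par_q + 2, par_r := v par_r - 4)
        = v(par_g := v par_g - 2, par_p := v par_p + 2, par_q := v par_q + 2, par_r := v par_r - 4)"
      by (simp add: shift_down_def)
    show "SE6 ((shift_down par_g v)(par_p := v par_p + 2, par_q := v par_q + 2, par_r := v par_r - 4)) * N_g v
        \<in> left_ideal (SE6 v)"
      unfolding e by (rule N_g_hom)
    show "xi2 (v par_r - 2) * M_g v = M_g (v(par_p := v par_p + 2, par_r := v par_r - 2)) * xi2 (v par_r)"
      unfolding M_g_def by (rule psi2_xi2[symmetric])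
    show "eta2 (v par_r - 2) * M_g v = M_g (v(par_q := v par_q + 2, par_r := v par_r - 2)) * eta2 (v par_r)"
      by (rule M_g_eta2[symmetric])
    show "M_g ((shift_down par_g v)(par_p := v par_p + 2, par_q := v par_q + 2, par_r := v par_r - 4)) * N_g v
        - op_const (kap_g (v par_a) (v par_b) (v par_c) (v par_g)) * (eta2 (v par_r - 4) * xi2 (v par_r - 2) * op_d ^ 2)
        \<in> left_ideal (SE6 v)"
      unfolding e by (rule M_g_N_g)
  qed simp_all
  then show ?thesis by blast
qed

text \<open>Lowering is \<partial> itself, and raising is the cofactor \<open>R\<close> at the
  shifted parameter. As \<open>R\<close> \<partial> is \<open>SE6\<close> minus its constant part,
  the S-value is minus that constant.\<close>

lemma hom_pair_r: "\<exists>Pu Pd. hom_pair par_r Pu Pd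
  (\<lambda>v. v par_r * (v par_r - 1) * (v par_r - 2) * SE6_exponent v 7 * SE6_exponent v 8 * SE6_exponent v 9)"
proof -
  let ?s = "\<lambda>v::params. - v par_r"
  define T0 where "T0 v = [:?s v, 1:] * [:?s v + 1, 1:] * [:?s v + 2, 1:] * pv be0 v" for v
  define T1 where "T1 v = [:?s v + 1, 1:] * [:?s v + 2, 1:] * pv be1 v" for v
  define T2 where "T2 v = [:?s v + 2, 1:] * pv be2 v" for v
  have pT: "pfam (\<lambda>c. [:c:]) T0" "pfam (\<lambda>c. [:c:]) T1" "pfam (\<lambda>c. [:c:]) T2"
    unfolding T0_def[abs_def] T1_def[abs_def] T2_def[abs_def] by (intro pfam_data pfam_be)+
  \<comment> \<open>Splitting off the value at \<theta> = 0 leaves a multiple of \<theta> =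
    \<open>x \<partial>\<close>, which ends in \<partial>; the value is the constant part of
    \<open>SE6\<close>.\<close>
  obtain g where g: "pfam (\<lambda>c. [:c:]) g" "\<And>v. T0 v = [:poly (T0 v) 0:] + [:- 0, 1:] * g v"
    using pfam_synthetic_div[OF pT(1) pfam_const[of _ 0]] by blast
  define k where "k v = v par_r * (v par_r - 1) * (v par_r - 2) * SE6_exponent v 7 * SE6_exponent v 8 * SE6_exponent v 9" for v
  have k: "poly (T0 v) 0 = - k v" for v
    unfolding T0_def k_def poly_be0 poly_eval by algebra
  define R where "R v = thp (g v) * op_x + lop [T1 v, T2 v, pv be3 v]" for v
  have pR: "pfam op_const R"
    unfolding R_def[abs_def] lop.simps by (intro pfam_add pfam_mult pfam_const pfam_thp g pT pfam_be)
  have S: "SE6 v = op_const (- k v) + R v * op_d" for v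
  proof -
    have "thp (T0 v) = op_const (- k v) + thp (g v * [:0, 1:])"
      by (subst g(2)) (simp only: k thp_add thp_const minus_zero mult.commute)
    also have "thp (g v * [:0, 1:]) = thp (g v) * op_x * op_d"
      unfolding thp_mult by (simp add: thp_linear op_theta_eq op_const_simps mult.assoc)
    finally have T: "thp (T0 v) = op_const (- k v) + thp (g v) * op_x * op_d" .
    have "SE6 v = lop [T0 v, T1 v, T2 v, pv be3 v]"
      by (simp add: SE6_lop_4 T0_def T1_def T2_def del: mult_pCons_left mult_pCons_right)
    also have "\<dots> = op_const (- k v) + R v * op_d"
      unfolding lop.simps(2)[of "T0 v"] T R_def distrib_right by (simp only: add.assoc)
    finally show ?thesis .
  qed
  have d: "op_d \<noteq> 0" using op_order_d by (metis op_order_0 zero_neq_one)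
  \<comment> \<open>From \<partial> \<open>SE6 v\<close> = \<open>SE6\<close> at
    \<open>r - 1\<close> times \<partial>, by cancelling \<partial> on the right: the two operators
    are \<open>C + R \<partial>\<close> and \<open>C + \<partial> R\<close> with the same constant
    \<open>C\<close>.\<close>
  have S': "SE6 (v(par_r := v par_r - 1)) = op_const (- k v) + op_d * R v" for v
  proof -
    have "SE6 (v(par_r := v par_r - 1)) * op_d = (op_const (- k v) + op_d * R v) * op_d"
      unfolding SE6_op_d[symmetric] S[of v] distrib_left distrib_right
      by (simp only: op_const_commute mult.assoc)
    then show ?thesis using d by simp
  qed
  have "hom_pair par_r (\<lambda>v. R (shift_up par_r v)) (\<lambda>_. op_d) k"
    unfolding hom_pair_def
  proof (intro conjI allI impI)
    show "pfam op_const (\<lambda>v. R (shift_up par_r v))" by (rule pfam_shift(1)[OF pR ring_emb_op_const])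
    show "pfam op_const (\<lambda>_. op_d)" by (rule pfam_const)
    fix v
    have oR: "op_order (R w) \<le> 5" for w
    proof (cases "R w = 0")
      case False
      have "R w * op_d = SE6 w - op_const (- k w)" by (simp add: S[of w])
      moreover have "op_order (SE6 w - op_const (- k w)) \<le> 6"
        by (intro op_order_diff_le SE6_order) simp
      ultimately show ?thesis using op_order_mult[OF False d] by simp
    qed simp
    show "op_order (R (shift_up par_r v)) \<le> 5" by (rule oR)
    show "op_order op_d \<le> 5" by simp
    let ?w = "shift_up par_r v"
    have w: "?w(par_r := ?w par_r - 1) = v" by (auto simp: shift_up_def)
    have "SE6 ?w * R ?w = R ?w * (op_const (- k ?w) + op_d * R ?w)"
      by (simp only: S[of ?w] distrib_left distrib_right op_const_commute mult.assoc)
    also have "\<dots> = R ?w * SE6 v" using S'[of ?w] w by simp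
    finally show "SE6 ?w * R ?w \<in> left_ideal (SE6 v)" by simp
    show "SE6 (shift_down par_r v) * op_d \<in> left_ideal (SE6 v)"
      using SE6_op_d[of v] by (metis left_ideal_self shift_down_def shift_step.simps(7))
    have "R v * op_d - op_const (k v) = SE6 v" by (simp add: S[of v] op_const_simps)
    then show "R (shift_up par_r (shift_down par_r v)) * op_d - op_const (k v) \<in> left_ideal (SE6 v)"
      using left_ideal_self[of 1 "SE6 v"] by simp
  qed
  then show ?thesis unfolding k_def[abs_def] by blast
qed

section \<open>The S-values in factored form\<close>

lemma ex_shift_pair:
  "\<exists>Pu Pd. hom_pair e Pu Pd k \<Longrightarrow> pfam (\<lambda>c. c) k \<Longrightarrow> k v0 \<noteq> 0 \<Longrightarrow> \<exists>Pu Pd. shift_pair e Pu Pd k"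
  using shift_pairI by blast

lemma exponents_shift_down:
  "SE6_exponent (shift_down par_a v) 8 = SE6_exponent v 8 + 1" "SE6_exponent (shift_down par_a v) 9 = SE6_exponent v 9 + 2"
  "SE6_exponent (shift_down par_c v) 7 = SE6_exponent v 7 + 2" "SE6_exponent (shift_down par_c v) 8 = SE6_exponent v 8 + 2"
  "SE6_exponent (shift_down par_c v) 9 = SE6_exponent v 9 + 2"
  "SE6_exponent (shift_down par_g v) 8 = SE6_exponent v 8 + 2" "SE6_exponent (shift_down par_g v) 9 = SE6_exponent v 9 + 2"
  "SE6_exponent (shift_down par_p v) 7 = SE6_exponent v 7 + 1" "SE6_exponent (shift_down par_p v) 8 = SE6_exponent v 8 + 1"
  "SE6_exponent (shift_down par_p v) 9 = SE6_exponent v 9 + 1"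
  by (simp_all add: SE6_exponents shift_down_def)

lemma exponents_swap:
  "SE6_exponent (swap v) 2 = SE6_exponent v 5" "SE6_exponent (swap v) 3 = SE6_exponent v 6"
  "SE6_exponent (swap v) 7 = SE6_exponent v 7" "SE6_exponent (swap v) 8 = SE6_exponent v 8"
  "SE6_exponent (swap v) 9 = SE6_exponent v 9"
  by (simp_all add: SE6_exponents)

lemma shift_down_r: "e \<noteq> par_r \<Longrightarrow> shift_down e v par_r = v par_r"
  by (simp add: shift_down_def)

lemma sig_shift_down:
  "sig_a (shift_down par_a v) = v par_r * (v par_r - 1) * SE6_exponent v 8 * SE6_exponent v 9 * (SE6_exponent v 9 + 1)"
  "sig_c (shift_down par_c v) = v par_r * (v par_r - 1) * SE6_exponent v 7 * (SE6_exponent v 7 + 1)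
     * SE6_exponent v 8 * (SE6_exponent v 8 + 1) * SE6_exponent v 9 * (SE6_exponent v 9 + 1)"
  "sig_g (shift_down par_g v) = v par_r * (v par_r - 1)
     * SE6_exponent v 8 * (SE6_exponent v 8 + 1) * SE6_exponent v 9 * (SE6_exponent v 9 + 1)"
  "sig_p (shift_down par_p v) = v par_r * (v par_r - 1) * SE6_exponent v 7 * SE6_exponent v 8 * SE6_exponent v 9"
  unfolding sig_a_def sig_c_def sig_g_def sig_p_def exponents_shift_down
  by (simp_all add: shift_down_r, algebra+)

lemma rho_factors:
  "rho_c v = - ((SE6_exponent v 2 - v par_r - 1) * (SE6_exponent v 3 - v par_r - 1) * (SE6_exponent v 3 - v par_r - 2))"
  "rho_g v = (SE6_exponent v 3 - 1 - v par_r) * (SE6_exponent v 3 - 2 - v par_r)"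
  "rho_p v = - (v par_p * (SE6_exponent v 2 - v par_r - 1) * (SE6_exponent v 3 - v par_r - 1))"
  unfolding rho_c_def rho_g_def rho_p_def by algebra+

lemmas S_value_factors = sig_shift_down sig_down_def rho_factors kap_a_def kap_c_def kap_g_def
  exponents_swap swap_simps power2_eq_square mult_minus_left mult_minus_right minus_minus

lemma shift_pair_a: "\<exists>Pu Pd. shift_pair par_a Pu Pd (\<lambda>v.
    - (v par_r^2 * (v par_r - 1)^2 * v par_a * (2 * v par_a + v par_g) * (SE6_exponent v 2 - v par_r - 1) * (v par_a + v par_b + v par_c + v par_g + 1)
      * (2 * v par_a + 2 * v par_b + 2 * v par_c + v par_g + 2) * (SE6_exponent v 3 - v par_r - 1) * (SE6_exponent v 3 - v par_r - 2) * SE6_exponent v 8 * SE6_exponent v 9 * (SE6_exponent v 9 + 1)))"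
proof -
  have e: "(\<lambda>v. sig_a (shift_down par_a v) * sig_down rho_c v * kap_a (v par_a) (v par_b) (v par_c) (v par_g))
    = (\<lambda>v. - (v par_r^2 * (v par_r - 1)^2 * v par_a * (2 * v par_a + v par_g) * (SE6_exponent v 2 - v par_r - 1) * (v par_a + v par_b + v par_c + v par_g + 1)
      * (2 * v par_a + 2 * v par_b + 2 * v par_c + v par_g + 2) * (SE6_exponent v 3 - v par_r - 1) * (SE6_exponent v 3 - v par_r - 2) * SE6_exponent v 8 * SE6_exponent v 9 * (SE6_exponent v 9 + 1)))"
    unfolding S_value_factors by (simp only: mult_ac)
  show ?thesis
    \<comment> \<open>When all seven parameters equal 3 no factor vanishes, so the S-value is a
      nonzero polynomial, as generic nonvanishing of the operators requires.\<close>
    by (rule ex_shift_pair[OF hom_pair_a[unfolded e], of "\<lambda>_. 3"])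
      ((intro pfam_data; simp)+, simp add: SE6_exponents)
qed

lemma shift_pair_c: "\<exists>Pu Pd. shift_pair par_c Pu Pd (\<lambda>v.
    v par_r^2 * (v par_r - 1)^2 * v par_c * (2 * v par_c + v par_g) * (SE6_exponent v 2 - v par_r - 1) * (SE6_exponent v 5 - v par_r - 1)
      * (v par_a + v par_b + v par_c + v par_g + 1) * (2 * v par_a + 2 * v par_b + 2 * v par_c + v par_g + 2)
      * (SE6_exponent v 3 - v par_r - 1) * (SE6_exponent v 3 - v par_r - 2) * (SE6_exponent v 6 - v par_r - 1) * (SE6_exponent v 6 - v par_r - 2)
      * SE6_exponent v 7 * (SE6_exponent v 7 + 1) * SE6_exponent v 8 * (SE6_exponent v 8 + 1) * SE6_exponent v 9 * (SE6_exponent v 9 + 1))"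
proof -
  have e: "(\<lambda>v. sig_c (shift_down par_c v) * (sig_down rho_c v * rho_c (swap v)) * kap_c (v par_a) (v par_b) (v par_c) (v par_g))
    = (\<lambda>v. v par_r^2 * (v par_r - 1)^2 * v par_c * (2 * v par_c + v par_g) * (SE6_exponent v 2 - v par_r - 1) * (SE6_exponent v 5 - v par_r - 1)
      * (v par_a + v par_b + v par_c + v par_g + 1) * (2 * v par_a + 2 * v par_b + 2 * v par_c + v par_g + 2)
      * (SE6_exponent v 3 - v par_r - 1) * (SE6_exponent v 3 - v par_r - 2) * (SE6_exponent v 6 - v par_r - 1) * (SE6_exponent v 6 - v par_r - 2)
      * SE6_exponent v 7 * (SE6_exponent v 7 + 1) * SE6_exponent v 8 * (SE6_exponent v 8 + 1) * SE6_exponent v 9 * (SE6_exponent v 9 + 1))"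
    unfolding S_value_factors by (simp only: mult_ac)
  show ?thesis
    by (rule ex_shift_pair[OF hom_pair_c[unfolded e], of "\<lambda>_. 3"])
      ((intro pfam_data; simp)+, simp add: SE6_exponents)
qed

lemma shift_pair_g: "\<exists>Pu Pd. shift_pair par_g Pu Pd (\<lambda>v.
    v par_r^2 * (v par_r - 1)^2 * (v par_g - 1) * (2 * v par_a + v par_g) * (2 * v par_b + v par_g) * (2 * v par_c + v par_g)
      * (v par_a + v par_b + v par_c + v par_g) * (v par_a + v par_b + v par_c + v par_g + 1) * (2 * v par_a + 2 * v par_b + 2 * v par_c + v par_g + 2)
      * (SE6_exponent v 3 - 1 - v par_r) * (SE6_exponent v 3 - 2 - v par_r) * (SE6_exponent v 6 - 1 - v par_r) * (SE6_exponent v 6 - 2 - v par_r)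
      * SE6_exponent v 8 * (SE6_exponent v 8 + 1) * SE6_exponent v 9 * (SE6_exponent v 9 + 1))"
proof -
  have e: "(\<lambda>v. sig_g (shift_down par_g v) * - (sig_down rho_g v * rho_g (swap v)) * kap_g (v par_a) (v par_b) (v par_c) (v par_g))
    = (\<lambda>v. v par_r^2 * (v par_r - 1)^2 * (v par_g - 1) * (2 * v par_a + v par_g) * (2 * v par_b + v par_g) * (2 * v par_c + v par_g)
      * (v par_a + v par_b + v par_c + v par_g) * (v par_a + v par_b + v par_c + v par_g + 1) * (2 * v par_a + 2 * v par_b + 2 * v par_c + v par_g + 2)
      * (SE6_exponent v 3 - 1 - v par_r) * (SE6_exponent v 3 - 2 - v par_r) * (SE6_exponent v 6 - 1 - v par_r) * (SE6_exponent v 6 - 2 - v par_r)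
      * SE6_exponent v 8 * (SE6_exponent v 8 + 1) * SE6_exponent v 9 * (SE6_exponent v 9 + 1))"
    unfolding S_value_factors by (simp only: mult_ac)
  show ?thesis
    by (rule ex_shift_pair[OF hom_pair_g[unfolded e], of "\<lambda>_. 3"])
      ((intro pfam_data; simp)+, simp add: SE6_exponents)
qed

lemma shift_pair_p: "\<exists>Pu Pd. shift_pair par_p Pu Pd (\<lambda>v.
    - (v par_r^2 * (v par_r - 1)^2 * v par_p * (SE6_exponent v 2 - v par_r - 1) * (SE6_exponent v 3 - v par_r - 1) * SE6_exponent v 7 * SE6_exponent v 8 * SE6_exponent v 9))"
proof -
  have e: "(\<lambda>v. sig_p (shift_down par_p v) * sig_down rho_p v)
    = (\<lambda>v. - (v par_r^2 * (v par_r - 1)^2 * v par_p * (SE6_exponent v 2 - v par_r - 1) * (SE6_exponent v 3 - v par_r - 1) * SE6_exponent v 7 * SE6_exponent v 8 * SE6_exponent v 9))"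
    unfolding S_value_factors by (simp only: mult_ac)
  show ?thesis
    by (rule ex_shift_pair[OF hom_pair_p[unfolded e], of "\<lambda>_. 3"])
      ((intro pfam_data; simp)+, simp add: SE6_exponents)
qed

lemma shift_pair_b: "\<exists>Pu Pd. shift_pair par_b Pu Pd (\<lambda>v.
    - (v par_r^2 * (v par_r - 1)^2 * v par_b * (2 * v par_b + v par_g) * (SE6_exponent v 5 - v par_r - 1) * (v par_a + v par_b + v par_c + v par_g + 1)
      * (2 * v par_a + 2 * v par_b + 2 * v par_c + v par_g + 2) * (SE6_exponent v 6 - v par_r - 1) * (SE6_exponent v 6 - v par_r - 2) * SE6_exponent v 8 * SE6_exponent v 9 * (SE6_exponent v 9 + 1)))"
proof -
  have e: "(\<lambda>v. (\<lambda>v. sig_a (shift_down par_a v) * sig_down rho_c v * kap_a (v par_a) (v par_b) (v par_c) (v par_g)) (swap v))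
    = (\<lambda>v. - (v par_r^2 * (v par_r - 1)^2 * v par_b * (2 * v par_b + v par_g) * (SE6_exponent v 5 - v par_r - 1) * (v par_a + v par_b + v par_c + v par_g + 1)
      * (2 * v par_a + 2 * v par_b + 2 * v par_c + v par_g + 2) * (SE6_exponent v 6 - v par_r - 1) * (SE6_exponent v 6 - v par_r - 2) * SE6_exponent v 8 * SE6_exponent v 9 * (SE6_exponent v 9 + 1)))"
    unfolding S_value_factors by (simp only: mult_ac add_ac)
  obtain Pu Pd where "hom_pair par_a Pu Pd (\<lambda>v. sig_a (shift_down par_a v) * sig_down rho_c v * kap_a (v par_a) (v par_b) (v par_c) (v par_g))"
    using hom_pair_a by blast
  from hom_pair_swap[OF this, of par_b] 
  have h: "\<exists>Pu Pd. hom_pair par_b Pu Pd (\<lambda>v. - (v par_r^2 * (v par_r - 1)^2 * v par_b * (2 * v par_b + v par_g) * (SE6_exponent v 5 - v par_r - 1) * (v par_a + v par_b + v par_c + v par_g + 1)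
      * (2 * v par_a + 2 * v par_b + 2 * v par_c + v par_g + 2) * (SE6_exponent v 6 - v par_r - 1) * (SE6_exponent v 6 - v par_r - 2) * SE6_exponent v 8 * SE6_exponent v 9 * (SE6_exponent v 9 + 1)))"
    unfolding e using swap_shift by blast
  show ?thesis
    by (rule ex_shift_pair[OF h, of "\<lambda>_. 3"]) ((intro pfam_data; simp)+, simp add: SE6_exponents)
qed

lemma shift_pair_q: "\<exists>Pu Pd. shift_pair par_q Pu Pd (\<lambda>v.
    - (v par_r^2 * (v par_r - 1)^2 * v par_q * (SE6_exponent v 5 - v par_r - 1) * (SE6_exponent v 6 - v par_r - 1) * SE6_exponent v 7 * SE6_exponent v 8 * SE6_exponent v 9))"
proof -
  have e: "(\<lambda>v. (\<lambda>v. sig_p (shift_down par_p v) * sig_down rho_p v) (swap v))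
    = (\<lambda>v. - (v par_r^2 * (v par_r - 1)^2 * v par_q * (SE6_exponent v 5 - v par_r - 1) * (SE6_exponent v 6 - v par_r - 1) * SE6_exponent v 7 * SE6_exponent v 8 * SE6_exponent v 9))"
    unfolding S_value_factors by (simp only: mult_ac add_ac)
  obtain Pu Pd where "hom_pair par_p Pu Pd (\<lambda>v. sig_p (shift_down par_p v) * sig_down rho_p v)"
    using hom_pair_p by blast
  from hom_pair_swap[OF this, of par_q] 
  have h: "\<exists>Pu Pd. hom_pair par_q Pu Pd (\<lambda>v. - (v par_r^2 * (v par_r - 1)^2 * v par_q * (SE6_exponent v 5 - v par_r - 1) * (SE6_exponent v 6 - v par_r - 1) * SE6_exponent v 7 * SE6_exponent v 8 * SE6_exponent v 9))"
    unfolding e using swap_shift by blast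
  show ?thesis
    by (rule ex_shift_pair[OF h, of "\<lambda>_. 3"]) ((intro pfam_data; simp)+, simp add: SE6_exponents)
qed

lemma shift_pair_r: "\<exists>Pu Pd. shift_pair par_r Pu Pd (\<lambda>v.
    v par_r * (v par_r - 1) * (v par_r - 2) * SE6_exponent v 7 * SE6_exponent v 8 * SE6_exponent v 9)"
  by (rule ex_shift_pair[OF hom_pair_r, of "\<lambda>_. 3"]) ((intro pfam_data; simp)+, simp add: SE6_exponents)

theorem proposition5p9:
  shows "\<exists>Pup Pdown :: param \<Rightarrow> params \<Rightarrow> diffop.
    (\<forall>\<epsilon>. shift_operator_family (shift_up \<epsilon>) (Pup \<epsilon>) \<and>
         shift_operator_family (shift_down \<epsilon>) (Pdown \<epsilon>)) \<and>
    (\<forall>v a b c g p q r e2 e3 e5 e6 e7 e8 e9.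
       a = v par_a \<and> b = v par_b \<and> c = v par_c \<and> g = v par_g \<and>
       p = v par_p \<and> q = v par_q \<and> r = v par_r \<and>
       e2 = SE6_exponent v 2 \<and> e3 = SE6_exponent v 3 \<and> e5 = SE6_exponent v 5 \<and>
       e6 = SE6_exponent v 6 \<and> e7 = SE6_exponent v 7 \<and> e8 = SE6_exponent v 8 \<and>
       e9 = SE6_exponent v 9 \<longrightarrow>
       is_S_value_down par_a (Pup par_a) (Pdown par_a) v
         (- (r^2 * (r - 1)^2 * a * (2 * a + g) * (e2 - r - 1) * (a + b + c + g + 1)
             * (2 * a + 2 * b + 2 * c + g + 2) * (e3 - r - 1) * (e3 - r - 2)
             * e8 * e9 * (e9 + 1))) \<and>
       is_S_value_down par_b (Pup par_b) (Pdown par_b) v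
         (- (r^2 * (r - 1)^2 * b * (2 * b + g) * (e5 - r - 1) * (a + b + c + g + 1)
             * (2 * a + 2 * b + 2 * c + g + 2) * (e6 - r - 1) * (e6 - r - 2)
             * e8 * e9 * (e9 + 1))) \<and>
       is_S_value_down par_c (Pup par_c) (Pdown par_c) v
         (r^2 * (r - 1)^2 * c * (2 * c + g) * (e2 - r - 1) * (e5 - r - 1)
             * (a + b + c + g + 1) * (2 * a + 2 * b + 2 * c + g + 2)
             * (e3 - r - 1) * (e3 - r - 2) * (e6 - r - 1) * (e6 - r - 2)
             * e7 * (e7 + 1) * e8 * (e8 + 1) * e9 * (e9 + 1)) \<and>
       is_S_value_down par_g (Pup par_g) (Pdown par_g) v
         (r^2 * (r - 1)^2 * (g - 1) * (2 * a + g) * (2 * b + g) * (2 * c + g)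
             * (a + b + c + g) * (a + b + c + g + 1) * (2 * a + 2 * b + 2 * c + g + 2)
             * (e3 - 1 - r) * (e3 - 2 - r) * (e6 - 1 - r) * (e6 - 2 - r)
             * e8 * (e8 + 1) * e9 * (e9 + 1)) \<and>
       is_S_value_down par_p (Pup par_p) (Pdown par_p) v
         (- (r^2 * (r - 1)^2 * p * (e2 - r - 1) * (e3 - r - 1) * e7 * e8 * e9)) \<and>
       is_S_value_down par_q (Pup par_q) (Pdown par_q) v
         (- (r^2 * (r - 1)^2 * q * (e5 - r - 1) * (e6 - r - 1) * e7 * e8 * e9)) \<and>
       is_S_value_down par_r (Pup par_r) (Pdown par_r) v
         (r * (r - 1) * (r - 2) * e7 * e8 * e9))"
proof -
  obtain Ua Da where a: "shift_pair par_a Ua Da (\<lambda>v.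
    - (v par_r^2 * (v par_r - 1)^2 * v par_a * (2 * v par_a + v par_g) * (SE6_exponent v 2 - v par_r - 1) * (v par_a + v par_b + v par_c + v par_g + 1)
      * (2 * v par_a + 2 * v par_b + 2 * v par_c + v par_g + 2) * (SE6_exponent v 3 - v par_r - 1) * (SE6_exponent v 3 - v par_r - 2) * SE6_exponent v 8 * SE6_exponent v 9 * (SE6_exponent v 9 + 1)))"
    using shift_pair_a by blast
  obtain Ub Db where b: "shift_pair par_b Ub Db (\<lambda>v.
    - (v par_r^2 * (v par_r - 1)^2 * v par_b * (2 * v par_b + v par_g) * (SE6_exponent v 5 - v par_r - 1) * (v par_a + v par_b + v par_c + v par_g + 1)
      * (2 * v par_a + 2 * v par_b + 2 * v par_c + v par_g + 2) * (SE6_exponent v 6 - v par_r - 1) * (SE6_exponent v 6 - v par_r - 2) * SE6_exponent v 8 * SE6_exponent v 9 * (SE6_exponent v 9 + 1)))"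
    using shift_pair_b by blast
  obtain Uc Dc where c: "shift_pair par_c Uc Dc (\<lambda>v.
    v par_r^2 * (v par_r - 1)^2 * v par_c * (2 * v par_c + v par_g) * (SE6_exponent v 2 - v par_r - 1) * (SE6_exponent v 5 - v par_r - 1)
      * (v par_a + v par_b + v par_c + v par_g + 1) * (2 * v par_a + 2 * v par_b + 2 * v par_c + v par_g + 2)
      * (SE6_exponent v 3 - v par_r - 1) * (SE6_exponent v 3 - v par_r - 2) * (SE6_exponent v 6 - v par_r - 1) * (SE6_exponent v 6 - v par_r - 2)
      * SE6_exponent v 7 * (SE6_exponent v 7 + 1) * SE6_exponent v 8 * (SE6_exponent v 8 + 1) * SE6_exponent v 9 * (SE6_exponent v 9 + 1))"
    using shift_pair_c by blast
  obtain Ug Dg where g: "shift_pair par_g Ug Dg (\<lambda>v.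
    v par_r^2 * (v par_r - 1)^2 * (v par_g - 1) * (2 * v par_a + v par_g) * (2 * v par_b + v par_g) * (2 * v par_c + v par_g)
      * (v par_a + v par_b + v par_c + v par_g) * (v par_a + v par_b + v par_c + v par_g + 1) * (2 * v par_a + 2 * v par_b + 2 * v par_c + v par_g + 2)
      * (SE6_exponent v 3 - 1 - v par_r) * (SE6_exponent v 3 - 2 - v par_r) * (SE6_exponent v 6 - 1 - v par_r) * (SE6_exponent v 6 - 2 - v par_r)
      * SE6_exponent v 8 * (SE6_exponent v 8 + 1) * SE6_exponent v 9 * (SE6_exponent v 9 + 1))"
    using shift_pair_g by blast
  obtain Up Dp where p: "shift_pair par_p Up Dp (\<lambda>v.
    - (v par_r^2 * (v par_r - 1)^2 * v par_p * (SE6_exponent v 2 - v par_r - 1) * (SE6_exponent v 3 - v par_r - 1) * SE6_exponent v 7 * SE6_exponent v 8 * SE6_exponent v 9))"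
    using shift_pair_p by blast
  obtain Uq Dq where q: "shift_pair par_q Uq Dq (\<lambda>v.
    - (v par_r^2 * (v par_r - 1)^2 * v par_q * (SE6_exponent v 5 - v par_r - 1) * (SE6_exponent v 6 - v par_r - 1) * SE6_exponent v 7 * SE6_exponent v 8 * SE6_exponent v 9))"
    using shift_pair_q by blast
  obtain Ur Dr where r: "shift_pair par_r Ur Dr (\<lambda>v.
    v par_r * (v par_r - 1) * (v par_r - 2) * SE6_exponent v 7 * SE6_exponent v 8 * SE6_exponent v 9)"
    using shift_pair_r by blast
  let ?U = "\<lambda>e. case e of par_a \<Rightarrow> Ua | par_b \<Rightarrow> Ub | par_c \<Rightarrow> Uc | par_g \<Rightarrow> Ug | par_p \<Rightarrow> Up | par_q \<Rightarrow> Uq | par_r \<Rightarrow> Ur"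
  let ?D = "\<lambda>e. case e of par_a \<Rightarrow> Da | par_b \<Rightarrow> Db | par_c \<Rightarrow> Dc | par_g \<Rightarrow> Dg | par_p \<Rightarrow> Dp | par_q \<Rightarrow> Dq | par_r \<Rightarrow> Dr"
  note sp = a b c g p q r
  show ?thesis
  proof (rule exI[of _ ?U], rule exI[of _ ?D], intro conjI allI impI; (elim conjE)?)
    fix e
    show "shift_operator_family (shift_up e) (?U e)" "shift_operator_family (shift_down e) (?D e)"
      using sp unfolding shift_pair_def by (cases e; simp)+
  qed (use sp in \<open>unfold shift_pair_def, simp_all only: param.case\<close>)
qed

end
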